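(* Let $0<\alpha<1$, $1<p<\frac1\alpha$ and $\frac1q=\frac1p-\alpha$. Let $w\in A_{p,q}^+$ and let $u$ be a measurable function on $\mathbb{R}$. Then the following statements are equivalent. (a) There exists $f\in L^p(w^p)$ such that $u=W_\alpha f$ (almost everywhere). (b) $u\in L^q(w^q)$ and the limit $\lim_{\varepsilon\to0^+}(D_{\rm right})^\alpha_\varepsilon u$ exists in the norm of $L^p(w^p)$. (c) $u\in L^q(w^q)$ and $\sup_{\varepsilon>0}\|(D_{\rm right})^\alpha_\varepsilon u\|_{L^p(w^p)}<+\infty$.
   Context: A weight is a measurable function $w$ on $\mathbb{R}$ with $0<w<\infty$, and $L^r(w^r)=L^r(\mathbb{R},w(x)^r\,dx)$. For $1<p,q<\infty$, $w\in A_{p,q}^+$ means that there is a constant $C>0$ such that $$\Big(\frac1h\int_{a-h}^a w^q\Big)^{1/q}\Big(\frac1h\int_a^{a+h}w^{-p'}\Big)^{1/p'}\le C\quad\text{for all }a\in\mathbb{R},\ h>0,$$ where $p'=p/(p-1)$. The fractional integral is $W_\alpha f(x)=\frac{1}{\Gamma(\alpha)}\int_x^\infty\frac{f(t)}{(t-x)^{1-\alpha}}\,dt$. For $\varepsilon>0$ the truncated fractional derivative from the right is $$(D_{\rm right})^\alpha_\varepsilon u(x)=\frac{1}{\Gamma(-\alpha)}\int_{x+\varepsilon}^\infty\frac{u(t)-u(x)}{(t-x)^{1+\alpha}}\,dt.$$ *)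

theory Defs
  imports "HOL-Analysis.Analysis"
begin

definition weight :: "(real \<Rightarrow> real) \<Rightarrow> bool" where
  "weight w \<longleftrightarrow> w \<in> borel_measurable lebesgue \<and> (\<forall>x. 0 < w x)"

text \<open>The measure \<open>w(x)\<^sup>r dx\<close> on the real line.\<close>

definition wmeasure :: "real \<Rightarrow> (real \<Rightarrow> real) \<Rightarrow> real measure" where
  "wmeasure r w = density lebesgue (\<lambda>x. ennreal (w x powr r))"

text \<open>The space \<open>L\<^sup>r(w\<^sup>r)\<close>, as a set of functions rather than of almost-everywhere classes, and its
  norm. The norm is only meaningful on members of the space (a divergent Bochner integral is \<open>0\<close>).\<close>

definition wLp :: "real \<Rightarrow> (real \<Rightarrow> real) \<Rightarrow> (real \<Rightarrow> real) set" where
  "wLp r w = {f \<in> borel_measurable lebesgue. integrable (wmeasure r w) (\<lambda>x. \<bar>f x\<bar> powr r)}"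

definition wLp_norm :: "real \<Rightarrow> (real \<Rightarrow> real) \<Rightarrow> (real \<Rightarrow> real) \<Rightarrow> real" where
  "wLp_norm r w f = (LINT x|wmeasure r w. \<bar>f x\<bar> powr r) powr (1 / r)"

definition conj_exp :: "real \<Rightarrow> real" where
  "conj_exp p = p / (p - 1)"

text \<open>Both factors of the one-sided condition are positive elements of \<open>[0,\<infinity>]\<close>, so the bound by a finite
  constant forces both integrals to be finite; this is what the two integrability conjuncts record.\<close>

definition A_plus :: "real \<Rightarrow> real \<Rightarrow> (real \<Rightarrow> real) \<Rightarrow> bool" where
  "A_plus p q w \<longleftrightarrow>
     (\<exists>C>0. \<forall>a. \<forall>h>0.
        set_integrable lebesgue {a - h..a} (\<lambda>x. w x powr q) \<and>
        set_integrable lebesgue {a..a + h} (\<lambda>x. w x powr (- conj_exp p)) \<and>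
        (1 / h * (LINT x:{a - h..a}|lebesgue. w x powr q)) powr (1 / q) *
        (1 / h * (LINT x:{a..a + h}|lebesgue. w x powr (- conj_exp p))) powr (1 / conj_exp p) \<le> C)"

definition frac_integral :: "real \<Rightarrow> (real \<Rightarrow> real) \<Rightarrow> real \<Rightarrow> real" where
  "frac_integral \<alpha> f x =
     1 / Gamma \<alpha> * (LINT t:{x<..}|lebesgue. f t / (t - x) powr (1 - \<alpha>))"

text \<open>Convergence of the integral defining \<open>W\<^sub>\<alpha> f(x)\<close>.\<close>

definition frac_integral_exists :: "real \<Rightarrow> (real \<Rightarrow> real) \<Rightarrow> real \<Rightarrow> bool" where
  "frac_integral_exists \<alpha> f x \<longleftrightarrow>
     set_integrable lebesgue {x<..} (\<lambda>t. f t / (t - x) powr (1 - \<alpha>))"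

text \<open>For \<open>w \<in> A\<^sub>p\<^sub>,\<^sub>q\<^sup>+\<close>, \<open>1/q = 1/p - \<alpha>\<close> and \<open>u \<in> L\<^sup>q(w\<^sup>q)\<close> this integral converges absolutely for
  every \<open>x\<close> and \<open>\<epsilon> > 0\<close>, by Hoelder's inequality on the dyadic pieces
  \<open>(x + 2\<^sup>k\<epsilon>, x + 2\<^sup>k\<^sup>+\<^sup>1\<epsilon>)\<close>.\<close>

definition trunc_frac_deriv :: "real \<Rightarrow> real \<Rightarrow> (real \<Rightarrow> real) \<Rightarrow> real \<Rightarrow> real" where
  "trunc_frac_deriv \<alpha> \<epsilon> u x =
     1 / Gamma (- \<alpha>) * (LINT t:{x + \<epsilon><..}|lebesgue. (u t - u x) / (t - x) powr (1 + \<alpha>))"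

text \<open>Norm convergence in \<open>L\<^sup>r(w\<^sup>r)\<close> as \<open>\<epsilon> \<rightarrow> 0\<^sup>+\<close>.\<close>

definition wLp_tendsto ::
  "real \<Rightarrow> (real \<Rightarrow> real) \<Rightarrow> (real \<Rightarrow> real \<Rightarrow> real) \<Rightarrow> (real \<Rightarrow> real) \<Rightarrow> bool" where
  "wLp_tendsto r w F g \<longleftrightarrow>
     g \<in> wLp r w \<and> (\<forall>\<^sub>F \<epsilon> in at_right 0. F \<epsilon> \<in> wLp r w) \<and>
     ((\<lambda>\<epsilon>. wLp_norm r w (\<lambda>x. F \<epsilon> x - g x)) \<longlongrightarrow> 0) (at_right 0)"

end

theory Submission
  imports Defs
begin

text \<open>Put \<open>\<nu> = w\<^sup>q dx\<close> and \<open>\<sigma> = w\<^sup>-\<^sup>r dx\<close> with \<open>r = p/(p - 1)\<close>.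

  The bound \<open>W\<^sub>\<alpha> : L\<^sup>p(w\<^sup>p) \<rightarrow> L\<^sup>q(w\<^sup>q)\<close>: the kernel of \<open>W\<^sub>\<alpha>\<close> is dominated by two dyadic kernels which join the
  left half of a dyadic interval to its right half, so the condition on \<open>w\<close> applies to each term. The
  resulting bilinear dyadic sum is split by Hoelder's inequality with an exponent \<open>s\<close> strictly between
  \<open>p\<close> and \<open>q\<close>; each factor is a Carleson embedding with the power \<open>s/p > 1\<close> of a measure, for which
  the packing condition holds because \<open>\<sigma>\<close> gives a fixed proportion of an interval to its left half
  (and \<open>\<nu>\<close> to its right half).

  Convolution with a decreasing integrable kernel is dominated by a superposition of the averages of
  \<open>f\<close> over \<open>[x + d, x + 2 d]\<close>. Because of the gap these are bounded on \<open>L\<^sup>p(w\<^sup>p)\<close> and \<open>L\<^sup>q(w\<^sup>q)\<close>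
  uniformly in \<open>d\<close>. The truncated derivative of \<open>W\<^sub>\<alpha> f\<close> is the convolution \<open>K\<^sub>\<epsilon> f\<close> of \<open>f\<close> with the dilates of an
  integrable kernel that has a decreasing majorant, so it is bounded in, and converges in,
  \<open>L\<^sup>p(w\<^sup>p)\<close> to a nonzero multiple \<open>c f\<close>.

  Conversely, let \<open>D\<^sub>\<epsilon> u\<close> converge to \<open>g\<close>. Since \<open>K\<^sub>\<delta> D\<^sub>\<epsilon> u = K\<^sub>\<epsilon> D\<^sub>\<delta> u\<close>, letting \<open>\<epsilon> \<rightarrow> 0\<close> gives
  \<open>K\<^sub>\<delta> g = c D\<^sub>\<delta> u\<close>, that is, all truncated derivatives of \<open>z = W\<^sub>\<alpha> g - c u\<close> vanish. Then \<open>z(x)\<close> is a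
  multiple of a tail integral of \<open>z\<close> at every scale, and hence \<open>0\<close>, because \<open>\<nu>\<close> of \<open>[x, x + d]\<close> is
  unbounded in \<open>d\<close>. If the \<open>D\<^sub>\<epsilon> u\<close> are only bounded, the same identity is obtained for the
  limit of almost minimal elements of the convex sets of those \<open>g\<close> that satisfy it up to an error
  tending to \<open>0\<close>.\<close>

section \<open>Embedding theorems for sums over binary trees\<close>

text \<open>The condition compares \<open>\<nu>\<close> to the left of a point with
  \<open>\<sigma>\<close> to its right and yields growth in one direction only; for w(x) = e^x
  neither measure is doubling. This shapes every estimate. In the dyadic sums
  \<open>\<sigma>\<close> measures right halves only and \<open>\<nu>\<close> left halves only,
  because packing fails for the halves that may carry almost all the mass. Averages of f are taken
  at a distance from x, so that the weight and f live on opposite sides of some point; no one-sided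
  maximal function is used.

  In the converse, u is known to lie in L^q(w^q) only, while the limit of the truncated derivatives
  lives in L^p(w^p). The exchange of \<delta> and \<epsilon> lets the approximate identity act on a
  fixed function of L^q(w^q), and the limits found in the two spaces are identified along a
  subsequence that converges almost everywhere in both senses.\<close>

lemma nn_integral_Hoelder:
  fixes f g :: "'a \<Rightarrow> real"
  assumes [measurable]: "f \<in> borel_measurable M" "g \<in> borel_measurable M"
    and nonneg: "\<And>x. 0 \<le> f x" "\<And>x. 0 \<le> g x"
    and p: "1 < p" "1 < p'" "1 / p + 1 / p' = 1"
    and a: "(\<integral>\<^sup>+x. ennreal (f x powr p) \<partial>M) \<le> ennreal a" "0 \<le> a"
    and b: "(\<integral>\<^sup>+x. ennreal (g x powr p') \<partial>M) \<le> ennreal b" "0 \<le> b"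
  shows "(\<integral>\<^sup>+x. ennreal (f x * g x) \<partial>M) \<le> ennreal (a powr (1 / p) * b powr (1 / p'))"
proof (cases "a = 0 \<or> b = 0")
  case True
  have "AE x in M. f x * g x = 0"
  proof (cases "a = 0")
    case True
    then have "(\<integral>\<^sup>+x. ennreal (f x powr p) \<partial>M) = 0" using a by simp
    then have "AE x in M. ennreal (f x powr p) = 0" by (subst (asm) nn_integral_0_iff_AE) auto
    then show ?thesis by eventually_elim (use nonneg in auto)
  next
    case False
    then have "(\<integral>\<^sup>+x. ennreal (g x powr p') \<partial>M) = 0" using b \<open>a = 0 \<or> b = 0\<close> by simp
    then have "AE x in M. ennreal (g x powr p') = 0" by (subst (asm) nn_integral_0_iff_AE) auto
    then show ?thesis by eventually_elim (use nonneg in auto)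
  qed
  then have "(\<integral>\<^sup>+x. ennreal (f x * g x) \<partial>M) = (\<integral>\<^sup>+x. 0 \<partial>M)"
    by (intro nn_integral_cong_AE) auto
  then show ?thesis by simp
next
  case False
  then have pos: "a > 0" "b > 0" using a b by auto
  \<comment> \<open>Normalising by upper bounds rather than by the norms makes Young's inequality
    integrate to A B (1/p + 1/p') = A B. Division by A and B is why a = 0 or b = 0 is treated
    apart.\<close>
  define A where "A = a powr (1 / p)"
  define B where "B = b powr (1 / p')"
  have AB: "A > 0" "B > 0" "A powr p = a" "B powr p' = b"
    using pos p by (auto simp: A_def B_def powr_powr)
  have pt: "f x * g x \<le> A * B / (p * a) * (f x powr p) + A * B / (p' * b) * (g x powr p')" for x
  proof -
    have "(f x / A) * (g x / B) \<le> (f x / A) powr p / p + (g x / B) powr p' / p'"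
      by (rule Youngs_inequality) (use p nonneg AB in auto)
    also have "\<dots> = f x powr p / (p * a) + g x powr p' / (p' * b)"
      using AB nonneg by (simp add: powr_divide field_simps)
    finally have "A * B * ((f x / A) * (g x / B)) \<le> A * B * (f x powr p / (p * a) + g x powr p' / (p' * b))"
      using AB by (intro mult_left_mono) auto
    then show ?thesis using AB by (simp add: algebra_simps)
  qed
  have "(\<integral>\<^sup>+x. ennreal (f x * g x) \<partial>M) \<le>
      (\<integral>\<^sup>+x. ennreal (A * B / (p * a)) * ennreal (f x powr p) + ennreal (A * B / (p' * b)) * ennreal (g x powr p') \<partial>M)"
    using pt AB pos p by (intro nn_integral_mono) (auto simp flip: ennreal_mult'' ennreal_plus intro!: ennreal_leI)
  also have "\<dots> = ennreal (A * B / (p * a)) * (\<integral>\<^sup>+x. ennreal (f x powr p) \<partial>M)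
       + ennreal (A * B / (p' * b)) * (\<integral>\<^sup>+x. ennreal (g x powr p') \<partial>M)"
    by (simp add: nn_integral_add nn_integral_cmult)
  also have "\<dots> \<le> ennreal (A * B / (p * a)) * ennreal a + ennreal (A * B / (p' * b)) * ennreal b"
    by (intro add_mono mult_left_mono a b) auto
  also have "\<dots> = ennreal (A * B / (p * a) * a + A * B / (p' * b) * b)"
    using AB pos p by (simp flip: ennreal_mult'' ennreal_plus)
  also have "A * B / (p * a) * a + A * B / (p' * b) * b = A * B * (1 / p + 1 / p')"
    using pos p by (simp add: field_simps)
  finally show ?thesis using p by (simp add: A_def B_def)
qed

section \<open>Superadditivity of powers and sums over binary trees\<close>

lemma powr_superadditive:
  fixes x y :: real
  assumes "0 \<le> x" "0 \<le> y" "1 \<le> \<theta>"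
  shows "x powr \<theta> + y powr \<theta> \<le> (x + y) powr \<theta>"
proof -
  have *: "z * (x + y) powr (\<theta> - 1) \<ge> z powr \<theta>" if "0 \<le> z" "z \<le> x + y" for z
  proof (cases "z = 0")
    case False
    have "z powr \<theta> = z * z powr (\<theta> - 1)" using False that by (simp add: powr_mult_base)
    also have "\<dots> \<le> z * (x + y) powr (\<theta> - 1)"
      using that assms by (intro mult_left_mono powr_mono2) auto
    finally show ?thesis .
  qed (use assms in auto)
  have "x powr \<theta> + y powr \<theta> \<le> (x + y) * (x + y) powr (\<theta> - 1)"
    using *[of x] *[of y] assms by (simp add: algebra_simps)
  also have "\<dots> = (x + y) powr \<theta>"
    using assms by (cases "x + y = 0") (auto simp: powr_mult_base)
  finally show ?thesis .
qed

text \<open>If a is at least c b, then a + b is at least (1 + c) b, and writing (a + b)^\<theta> as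
  a (a + b)^(\<theta> - 1) + b (a + b)^(\<theta> - 1) yields a factor larger than 1 on the part b.
  This surplus is what bounds sums over arbitrarily many generations of a tree.\<close>

lemma powr_superadditive_gap:
  fixes a b :: real
  assumes "0 \<le> a" "0 \<le> b" "c * b \<le> a" "0 < c" "1 < \<theta>"
  shows "a powr \<theta> + (1 + c) powr (\<theta> - 1) * b powr \<theta> \<le> (a + b) powr \<theta>"
proof (cases "a + b = 0")
  case True
  then have "a = 0" "b = 0" using assms by auto
  then show ?thesis by simp
next
  case False
  have s: "(a + b) powr \<theta> = a * (a + b) powr (\<theta> - 1) + b * (a + b) powr (\<theta> - 1)"
    using False assms by (simp add: powr_mult_base flip: distrib_right)
  have "a powr \<theta> \<le> a * (a + b) powr (\<theta> - 1)"
  proof (cases "a = 0")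
    case False
    have "a powr \<theta> = a * a powr (\<theta> - 1)" using False assms by (simp add: powr_mult_base)
    also have "\<dots> \<le> a * (a + b) powr (\<theta> - 1)"
      using assms by (intro mult_left_mono powr_mono2) auto
    finally show ?thesis .
  qed auto
  moreover have "(1 + c) powr (\<theta> - 1) * b powr \<theta> \<le> b * (a + b) powr (\<theta> - 1)"
  proof (cases "b = 0")
    case False
    have "(1 + c) powr (\<theta> - 1) * b powr \<theta> = b * ((1 + c) * b) powr (\<theta> - 1)"
      using False assms by (simp add: powr_mult powr_mult_base)
    also have "\<dots> \<le> b * (a + b) powr (\<theta> - 1)"
      using assms by (intro mult_left_mono powr_mono2) (auto simp: algebra_simps)
    finally show ?thesis .
  qed auto
  ultimately show ?thesis using s by linarith
qed

text \<open>Recursion on the depth n keeps all sums finite, so bounds uniform in n take the place of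
  convergence, and one definition serves real and extended values. The estimates below are
  inductions on n that split off the root.\<close>

primrec tree_sum :: "('q \<Rightarrow> 'q) \<Rightarrow> ('q \<Rightarrow> 'q) \<Rightarrow> ('q \<Rightarrow> 'b::comm_monoid_add) \<Rightarrow> nat \<Rightarrow> 'q \<Rightarrow> 'b" where
  "tree_sum c1 c2 F 0 Q = 0"
| "tree_sum c1 c2 F (Suc n) Q = F Q + tree_sum c1 c2 F n (c1 Q) + tree_sum c1 c2 F n (c2 Q)"

lemma tree_sum_swap: "tree_sum c1 c2 F n Q = tree_sum c2 c1 F n Q"
  by (induction n arbitrary: Q) (auto simp: algebra_simps)

lemma tree_sum_mono:
  fixes F G :: "'q \<Rightarrow> 'b::ordered_comm_monoid_add"
  assumes "\<And>Q. F Q \<le> G Q"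
  shows "tree_sum c1 c2 F n Q \<le> tree_sum c1 c2 G n Q"
  by (induction n arbitrary: Q) (auto intro!: add_mono assms)

lemma tree_sum_nonneg:
  fixes F :: "'q \<Rightarrow> 'b::ordered_comm_monoid_add"
  assumes "\<And>Q. 0 \<le> F Q"
  shows "0 \<le> tree_sum c1 c2 F n Q"
  by (induction n arbitrary: Q) (auto intro!: add_nonneg_nonneg assms)

lemma tree_sum_add: "tree_sum c1 c2 (\<lambda>Q. F Q + G Q) n Q = tree_sum c1 c2 F n Q + tree_sum c1 c2 G n Q"
  by (induction n arbitrary: Q) (auto simp: algebra_simps)

lemma tree_sum_cmult: "tree_sum c1 c2 (\<lambda>Q. a * F Q) n Q = a * tree_sum c1 c2 F n Q"
  for F :: "'q \<Rightarrow> 'b::semiring_0"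
  by (induction n arbitrary: Q) (auto simp: algebra_simps)

lemma tree_sum_ennreal:
  assumes "\<And>Q. 0 \<le> F Q"
  shows "tree_sum c1 c2 (\<lambda>Q. ennreal (F Q)) n Q = ennreal (tree_sum c1 c2 F n Q)"
  by (induction n arbitrary: Q) (auto simp: assms tree_sum_nonneg)

lemma borel_measurable_tree_sum[measurable]:
  fixes F :: "'q \<Rightarrow> 'a \<Rightarrow> ennreal"
  assumes [measurable]: "\<And>Q. F Q \<in> borel_measurable M"
  shows "(\<lambda>x. tree_sum c1 c2 (\<lambda>Q. F Q x) n Q) \<in> borel_measurable M"
  by (induction n arbitrary: Q) auto

lemma nn_integral_tree_sum:
  assumes [measurable]: "\<And>Q. F Q \<in> borel_measurable M"
  shows "(\<integral>\<^sup>+x. tree_sum c1 c2 (\<lambda>Q. F Q x) n Q \<partial>M) = tree_sum c1 c2 (\<lambda>Q. \<integral>\<^sup>+x. F Q x \<partial>M) n Q"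
  by (induction n arbitrary: Q) (auto simp: nn_integral_add)

text \<open>The Carleson packing condition for s^\<theta>. With k = (1 + c)^(\<theta> - 1) and a, b
  the powers at the two children, the induction closes because b + (a + b)/(k - 1) = (a + k b)/(k -
  1), and a + k b is at most the power at Q. Summing over the \<open>c1\<close> children instead
  would fail: all the mass may sit on one branch of them.\<close>

lemma tree_sum_powr_le:
  fixes s :: "'q \<Rightarrow> real"
  assumes add: "\<And>Q. s Q = s (c1 Q) + s (c2 Q)" and nonneg: "\<And>Q. 0 \<le> s Q"
    and grow: "\<And>Q. c * s (c2 Q) \<le> s (c1 Q)" and c: "0 < c" and \<theta>: "1 < \<theta>"
  shows "tree_sum c1 c2 (\<lambda>Q. s (c2 Q) powr \<theta>) n Q \<le> 1 / ((1 + c) powr (\<theta> - 1) - 1) * s Q powr \<theta>"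
proof (induction n arbitrary: Q)
  case 0
  have "1 < (1 + c) powr (\<theta> - 1)" using c \<theta> by (simp add: gr_one_powr)
  then show ?case by simp
next
  case (Suc n)
  define k where "k = (1 + c) powr (\<theta> - 1)"
  have k: "k > 1" using c \<theta> by (simp add: k_def gr_one_powr)
  define a b where "a = s (c1 Q) powr \<theta>" and "b = s (c2 Q) powr \<theta>"
  have "a + k * b \<le> s Q powr \<theta>"
    unfolding a_def b_def k_def add[of Q]
    by (rule powr_superadditive_gap) (use nonneg grow c \<theta> in auto)
  then have "(a + k * b) / (k - 1) \<le> s Q powr \<theta> / (k - 1)"
    using k by (intro divide_right_mono) auto
  moreover have "b + 1 / (k - 1) * a + 1 / (k - 1) * b = (a + k * b) / (k - 1)"
  proof -
    define i where "i = 1 / (k - 1)"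
    have "i * k = 1 + i" using k by (simp add: i_def field_simps)
    then have "b + i * a + i * b = i * (a + k * b)" by (simp add: algebra_simps)
    then show ?thesis by (simp add: i_def)
  qed
  moreover have "tree_sum c1 c2 (\<lambda>Q. s (c2 Q) powr \<theta>) (Suc n) Q \<le> b + 1 / (k - 1) * a + 1 / (k - 1) * b"
    using Suc[of "c1 Q"] Suc[of "c2 Q"] by (simp add: a_def b_def k_def)
  ultimately show ?case unfolding k_def by simp
qed

text \<open>A stopping argument. Below a node \<open>c2 Q\<close> with s < m the whole subtree is
  bounded by packing, and s^\<theta> there is at most m^\<theta>; this accounts for the constant,
  plus 1 for the node itself. Otherwise the induction continues with m^\<theta>, which is
  superadditive over the two children because \<theta> > 1.\<close>

lemma tree_sum_weak_type:
  fixes s m :: "'q \<Rightarrow> real"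
  assumes add: "\<And>Q. s Q = s (c1 Q) + s (c2 Q)" and nonneg: "\<And>Q. 0 \<le> s Q"
    and grow: "\<And>Q. c * s (c2 Q) \<le> s (c1 Q)" and c: "0 < c" and \<theta>: "1 < \<theta>"
    and madd: "\<And>Q. m Q = m (c1 Q) + m (c2 Q)" and mnonneg: "\<And>Q. 0 \<le> m Q"
  shows "tree_sum c1 c2 (\<lambda>Q. if s (c2 Q) < m (c2 Q) then s (c2 Q) powr \<theta> else 0) n Q
    \<le> (1 + 1 / ((1 + c) powr (\<theta> - 1) - 1)) * m Q powr \<theta>" (is "tree_sum c1 c2 ?F n Q \<le> _")
proof (induction n arbitrary: Q)
  have k: "1 < (1 + c) powr (\<theta> - 1)" using c \<theta> by (simp add: gr_one_powr)
  define C where "C = 1 / ((1 + c) powr (\<theta> - 1) - 1)"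
  have C: "C > 0" using k by (simp add: C_def)
  {
    case 0
    show ?case using C by (simp add: C_def)
  next
    case (Suc n)
    have IH: "tree_sum c1 c2 ?F n R \<le> (1 + C) * m R powr \<theta>" for R using Suc by (simp add: C_def)
    have sup: "(1 + C) * (m (c1 Q) powr \<theta> + m (c2 Q) powr \<theta>) \<le> (1 + C) * m Q powr \<theta>"
      unfolding madd[of Q] using C \<theta> mnonneg by (intro mult_left_mono powr_superadditive) auto
    have "?F Q + tree_sum c1 c2 ?F n (c2 Q) \<le> (1 + C) * m (c2 Q) powr \<theta>"
    proof (cases "s (c2 Q) < m (c2 Q)")
      case True
      have le: "s (c2 Q) powr \<theta> \<le> m (c2 Q) powr \<theta>"
        using True nonneg \<theta> by (intro powr_mono2) auto
      have "tree_sum c1 c2 ?F n (c2 Q) \<le> tree_sum c1 c2 (\<lambda>Q. s (c2 Q) powr \<theta>) n (c2 Q)"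
        by (rule tree_sum_mono) auto
      also have "\<dots> \<le> C * s (c2 Q) powr \<theta>"
        unfolding C_def by (rule tree_sum_powr_le) (fact add nonneg grow c \<theta>)+
      also have "\<dots> \<le> C * m (c2 Q) powr \<theta>" using C le by (intro mult_left_mono) auto
      finally show ?thesis using True le by (simp add: algebra_simps)
    next
      case False
      then show ?thesis using IH[of "c2 Q"] by simp
    qed
    moreover have "tree_sum c1 c2 ?F (Suc n) Q = tree_sum c1 c2 ?F n (c1 Q) + (?F Q + tree_sum c1 c2 ?F n (c2 Q))"
      by (simp only: tree_sum.simps ac_simps)
    ultimately show ?case using IH[of "c1 Q"] sup unfolding C_def[symmetric] distrib_left by linarith
  }
qed

lemma nn_integral_powr_layer:
  fixes y :: real
  assumes "0 < s" "0 \<le> y"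
  shows "(\<integral>\<^sup>+l. ennreal (s * l powr (s - 1)) * indicator {0<..<y} l \<partial>lborel) = ennreal (y powr s)"
proof -
  have "((\<lambda>l. s * l powr (s - 1)) has_integral s * (y powr (s - 1 + 1) / (s - 1 + 1))) {0..y}"
    using assms by (intro has_integral_mult_right has_integral_powr_from_0) auto
  then have "((\<lambda>l. s * l powr (s - 1)) has_integral y powr s) {0..y}" using assms by simp
  then have "((\<lambda>l. if l \<in> {0..y} then s * l powr (s - 1) else 0) has_integral y powr s) UNIV"
    by (simp only: has_integral_restrict_UNIV)
  then have "(\<integral>\<^sup>+l. ennreal (if l \<in> {0..y} then s * l powr (s - 1) else 0) \<partial>lborel) = ennreal (y powr s)"
    by (intro nn_integral_has_integral_lborel) (use assms in auto)
  also have "(\<integral>\<^sup>+l. ennreal (if l \<in> {0..y} then s * l powr (s - 1) else 0) \<partial>lborel) =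
    (\<integral>\<^sup>+l. ennreal (s * l powr (s - 1)) * indicator {0<..<y} l \<partial>lborel)"
  proof (rule nn_integral_cong_AE)
    show "AE l in lborel. ennreal (if l \<in> {0..y} then s * l powr (s - 1) else 0) = ennreal (s * l powr (s - 1)) * indicator {0<..<y} l"
      using AE_lborel_singleton[of 0] AE_lborel_singleton[of y]
      by eventually_elim (auto simp: indicator_def)
  qed
  finally show ?thesis .
qed

text \<open>Carleson embedding in the style of Marcinkiewicz interpolation. Each term is S^\<theta>
  times the s-th power of an average, with \<theta> = s/p; the layer-cake formula reduces it to
  level sets of the averages. At level t only the part of \<phi> above t/2 matters, the weak-type
  bound applies to that part, and integration in t restores the L^p norm. The bound is uniform in
  the depth and in the root.\<close>

lemma tree_sum_strong_type:
  fixes M :: "'a measure" and I :: "'q \<Rightarrow> 'a set" and \<phi> :: "'a \<Rightarrow> real"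
  assumes sf: "sigma_finite_measure M"
    and meas[measurable]: "\<And>Q. I Q \<in> sets M" "\<phi> \<in> borel_measurable M"
    and fin: "\<And>Q. emeasure M (I Q) < \<infinity>"
    and split: "\<And>Q. I Q = I (c1 Q) \<union> I (c2 Q)" "\<And>Q. I (c1 Q) \<inter> I (c2 Q) = {}"
    and grow: "\<And>Q. c * measure M (I (c2 Q)) \<le> measure M (I (c1 Q))" and c: "0 < c"
    and p: "1 < p" "p < s"
    and \<phi>: "\<And>x. 0 \<le> \<phi> x" "(\<integral>\<^sup>+x. ennreal (\<phi> x powr p) \<partial>M) \<le> 1"
  shows "tree_sum c1 c2 (\<lambda>Q. measure M (I (c2 Q)) powr (s / p - s) * (LINT x:I (c2 Q)|M. \<phi> x) powr s) n Q
    \<le> (1 + 1 / ((1 + c) powr (s / p - 1) - 1)) * s * 2 powr s / (p - 1)"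
proof -
  interpret sigma_finite_measure M by (rule sf)
  interpret P: pair_sigma_finite lborel M ..
  define \<theta> where "\<theta> = s / p"
  define B where "B = 1 + 1 / ((1 + c) powr (s / p - 1) - 1)"
  define S where "S Q = measure M (I Q)" for Q
  define m0 where "m0 Q = (LINT x:I Q|M. \<phi> x)" for Q
  define h where "h l x = \<phi> x * indicator {x. l < \<phi> x} x" for l x
  define m where "m l Q = (LINT x:I Q|M. h l x)" for l Q
  have \<theta>: "1 < \<theta>" "\<theta> * p = s" using p by (auto simp: \<theta>_def)
  have "1 < (1 + c) powr (s / p - 1)" using c \<theta> by (simp add: gr_one_powr \<theta>_def)
  then have B: "B > 0" by (simp add: B_def add_pos_pos)
  have h_meas[measurable]: "(\<lambda>x. h l x) \<in> borel_measurable M" for l unfolding h_def by measurable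
  have h0: "0 \<le> h l x" "h l x \<le> \<phi> x" "\<phi> x \<le> h l x + \<bar>l\<bar>" for l x
    using \<phi>(1)[of x] by (auto simp: h_def indicator_def)
  have pint: "integrable M (\<lambda>x. \<phi> x powr p)"
    using \<phi>(2) by (intro integrableI_bounded) (auto simp: le_less_trans[OF _ ennreal_one_less_top])
  have pint1: "(LINT x|M. \<phi> x powr p) \<le> 1"
  proof -
    have "ennreal (LINT x|M. \<phi> x powr p) \<le> 1" using \<phi>(2) by (subst nn_integral_eq_integral[OF pint, symmetric]) auto
    then show ?thesis by (simp add: ennreal_le_1)
  qed
  have le1p: "y \<le> 1 + y powr p" if "0 \<le> y" for y :: real
  proof (cases "y \<le> 1")
    case True then show ?thesis by (simp add: add_increasing2)
  next
    case False
    then have "y powr 1 \<le> y powr p" using p by (intro powr_mono) auto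
    then show ?thesis using False by simp
  qed
  have one: "integrable M (indicator (I Q) :: 'a \<Rightarrow> real)" for Q using fin[of Q] by (intro integrable_real_indicator) (auto simp: less_top)
  have int0: "set_integrable M (I Q) \<phi>" for Q
    unfolding set_integrable_def
  proof (rule Bochner_Integration.integrable_bound[where f="\<lambda>x. indicator (I Q) x + \<phi> x powr p"])
    show "AE x in M. norm (indicator (I Q) x *\<^sub>R \<phi> x) \<le> norm (indicator (I Q) x + \<phi> x powr p)"
      using le1p \<phi>(1) by (auto simp: indicator_def)
  qed (use one pint in auto)
  have int: "set_integrable M (I Q) (h l)" for Q l
    by (rule set_integrable_bound[OF int0[of Q]]) (use h0 \<phi>(1) in \<open>auto simp: set_borel_measurable_def\<close>)
  have m_nonneg: "0 \<le> m l Q" for l Q unfolding m_def set_lebesgue_integral_def using h0 by (intro integral_nonneg_AE) auto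
  have m0_nonneg: "0 \<le> m0 Q" for Q unfolding m0_def set_lebesgue_integral_def using \<phi>(1) by (intro integral_nonneg_AE) auto
  have madd: "m l Q = m l (c1 Q) + m l (c2 Q)" for l Q
    unfolding m_def by (subst split(1)) (rule set_integral_Un[OF split(2) int int])
  have Sadd: "S Q = S (c1 Q) + S (c2 Q)" for Q
    unfolding S_def using fin[of "c1 Q"] fin[of "c2 Q"]
    by (subst split(1)) (rule measure_Union, auto simp: split(2))
  \<comment> \<open>Replacing \<phi> by its part above l changes the integral over
    \<open>I Q\<close> by at most l \<open>S Q\<close>, so an average above 2 l forces the average
    of the truncated function above l.\<close>
  have m0_m: "m0 Q \<le> l * S Q + m l Q" if "0 < l" for l Q
  proof -
    have "m0 Q \<le> (LINT x|M. l * indicator (I Q) x + indicator (I Q) x *\<^sub>R h l x)"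
      unfolding m0_def set_lebesgue_integral_def
      by (intro integral_mono int0[unfolded set_integrable_def] Bochner_Integration.integrable_add integrable_mult_right one int[unfolded set_integrable_def])
         (use h0(3)[of _ l] that in \<open>auto simp: indicator_def algebra_simps\<close>)
    also have "\<dots> = l * S Q + m l Q"
      unfolding m_def set_lebesgue_integral_def S_def
      using one int[unfolded set_integrable_def] fin[of Q] by (subst Bochner_Integration.integral_add) auto
    finally show ?thesis .
  qed
  \<comment> \<open>On {\<phi> > l} one has \<phi> <= l^(1 - p) \<phi>^p. This bound later trades
    the surplus power m^(\<theta> - 1) for a power of l, leaving m to the first power, to which
    Fubini's theorem applies.\<close>
  have ml: "m l Q \<le> l powr (1 - p)" if "0 < l" for l Q
  proof -
    have "m l Q \<le> (LINT x|M. l powr (1 - p) * \<phi> x powr p)"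
      unfolding m_def set_lebesgue_integral_def
    proof (intro integral_mono int[unfolded set_integrable_def] integrable_mult_right pint)
      fix x
      have "\<phi> x \<le> l powr (1 - p) * \<phi> x powr p" if "l < \<phi> x"
      proof -
        have "\<phi> x = \<phi> x powr (1 - p) * \<phi> x powr p" using that \<open>0 < l\<close> by (simp flip: powr_add)
        also have "\<dots> \<le> l powr (1 - p) * \<phi> x powr p"
          using that \<open>0 < l\<close> p by (intro mult_right_mono powr_mono2') auto
        finally show ?thesis .
      qed
      then show "indicator (I Q) x *\<^sub>R h l x \<le> l powr (1 - p) * \<phi> x powr p"
        by (auto simp: h_def indicator_def)
    qed
    also have "\<dots> \<le> l powr (1 - p)" using pint1 by (simp add: mult_left_le)
    finally show ?thesis .
  qed
  have weak: "tree_sum c1 c2 (\<lambda>Q. if 2 * l * S (c2 Q) < m0 (c2 Q) then S (c2 Q) powr \<theta> else 0) n Q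
     \<le> B * (l powr (p - 1 - s) * m l Q)" if l: "0 < l" for l
  proof -
    have "tree_sum c1 c2 (\<lambda>Q. if 2 * l * S (c2 Q) < m0 (c2 Q) then S (c2 Q) powr \<theta> else 0) n Q
      \<le> tree_sum c1 c2 (\<lambda>Q. if S (c2 Q) < m l (c2 Q) / l then S (c2 Q) powr \<theta> else 0) n Q"
    proof (rule tree_sum_mono)
      fix Q
      have "S (c2 Q) < m l (c2 Q) / l" if "2 * l * S (c2 Q) < m0 (c2 Q)"
        using that m0_m[OF l, of "c2 Q"] l by (simp add: field_simps)
      then show "(if 2 * l * S (c2 Q) < m0 (c2 Q) then S (c2 Q) powr \<theta> else 0) \<le> (if S (c2 Q) < m l (c2 Q) / l then S (c2 Q) powr \<theta> else 0)"
        by auto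
    qed
    also have "\<dots> \<le> B * (m l Q / l) powr \<theta>"
      unfolding B_def \<theta>_def[symmetric]
    proof (rule tree_sum_weak_type[where m="\<lambda>Q. m l Q / l"])
      show "m l Q / l = m l (c1 Q) / l + m l (c2 Q) / l" for Q
        by (subst madd) (rule add_divide_distrib)
      show "S Q = S (c1 Q) + S (c2 Q)" for Q by (rule Sadd)
    qed (use grow c \<theta>(1) l m_nonneg in \<open>auto simp: S_def\<close>)
    also have "(m l Q / l) powr \<theta> \<le> l powr (p - 1 - s) * m l Q"
    proof (cases "m l Q = 0")
      case False
      then have mp: "m l Q > 0" using m_nonneg[of l Q] by simp
      have "(m l Q / l) powr \<theta> = l powr (- \<theta>) * (m l Q powr (\<theta> - 1) * m l Q)"
        using mp l by (simp add: powr_divide powr_minus powr_diff field_simps)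
      also have "\<dots> \<le> l powr (- \<theta>) * ((l powr (1 - p)) powr (\<theta> - 1) * m l Q)"
        using mp l ml[OF l, of Q] \<theta> by (intro mult_left_mono mult_right_mono powr_mono2) auto
      also have "\<dots> = l powr (- \<theta> + (1 - p) * (\<theta> - 1)) * m l Q"
        by (simp only: powr_powr powr_add mult.assoc)
      also have "- \<theta> + (1 - p) * (\<theta> - 1) = p - 1 - s" using \<theta>(2) by (simp add: algebra_simps)
      finally show ?thesis .
    qed auto
    finally show ?thesis using B by simp
  qed
  define X where "X Q = S (c2 Q) powr (s / p - s) * m0 (c2 Q) powr s" for Q
  \<comment> \<open>X is S^\<theta> (m0/S)^s, and (m0/S)^s is the integral of s t^(s - 1) over 0 < t
    < m0/S. The condition is written t S < m0 to avoid dividing by S = 0.\<close>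
  define F where "F Q t = ennreal (s * t powr (s - 1)) * ennreal (if t * S (c2 Q) < m0 (c2 Q) then S (c2 Q) powr \<theta> else 0) * indicator {0<..} t" for Q t
  have X: "(\<integral>\<^sup>+t. F Q t \<partial>lborel) = ennreal (X Q)" for Q
  proof (cases "S (c2 Q) = 0")
    case True
    then have "AE x in M. x \<notin> I (c2 Q)"
      using fin[of "c2 Q"] by (intro AE_not_in) (auto simp: S_def null_sets_def emeasure_eq_ennreal_measure less_top)
    then have "m0 (c2 Q) = (LINT x|M. 0)" unfolding m0_def set_lebesgue_integral_def
      by (intro integral_cong_AE) (auto simp: indicator_def)
    then show ?thesis using True by (simp add: F_def X_def)
  next
    case False
    then have Sp: "S (c2 Q) > 0" by (simp add: S_def less_le)
    have "(\<integral>\<^sup>+t. F Q t \<partial>lborel) = (\<integral>\<^sup>+t. ennreal (S (c2 Q) powr \<theta>) * (ennreal (s * t powr (s - 1)) * indicator {0<..<m0 (c2 Q) / S (c2 Q)} t) \<partial>lborel)"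
      by (rule nn_integral_cong) (use Sp in \<open>auto simp: F_def indicator_def field_simps\<close>)
    also have "\<dots> = ennreal (S (c2 Q) powr \<theta>) * ennreal ((m0 (c2 Q) / S (c2 Q)) powr s)"
      using p Sp m0_nonneg by (subst nn_integral_cmult) (auto simp: nn_integral_powr_layer)
    also have "\<dots> = ennreal (S (c2 Q) powr \<theta> * (m0 (c2 Q) / S (c2 Q)) powr s)" by (simp add: ennreal_mult'')
    also have "S (c2 Q) powr \<theta> * (m0 (c2 Q) / S (c2 Q)) powr s = X Q"
      using Sp m0_nonneg[of "c2 Q"] by (simp add: X_def powr_divide powr_diff \<theta>_def)
    finally show ?thesis .
  qed
  have F_meas[measurable]: "F Q \<in> borel_measurable lborel" for Q unfolding F_def by measurable
  have "ennreal (tree_sum c1 c2 X n Q) = tree_sum c1 c2 (\<lambda>Q. \<integral>\<^sup>+t. F Q t \<partial>lborel) n Q"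
    unfolding X by (rule tree_sum_ennreal[symmetric]) (simp add: X_def)
  also have "\<dots> = (\<integral>\<^sup>+t. tree_sum c1 c2 (\<lambda>Q. F Q t) n Q \<partial>lborel)"
    by (rule nn_integral_tree_sum[symmetric]) simp
  also have "\<dots> \<le> (\<integral>\<^sup>+t. ennreal (s * B * 2 powr (s + 1 - p)) * (ennreal (t powr (p - 2)) * indicator {0<..} t * (\<integral>\<^sup>+x. ennreal (\<phi> x) * indicator {x. t < 2 * \<phi> x} x \<partial>M)) \<partial>lborel)"
  proof (rule nn_integral_mono)
    fix t :: real
    show "tree_sum c1 c2 (\<lambda>Q. F Q t) n Q \<le> ennreal (s * B * 2 powr (s + 1 - p)) * (ennreal (t powr (p - 2)) * indicator {0<..} t * (\<integral>\<^sup>+x. ennreal (\<phi> x) * indicator {x. t < 2 * \<phi> x} x \<partial>M))"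
    proof (cases "0 < t")
      case False
      then have "tree_sum c1 c2 (\<lambda>Q. F Q t) n Q = tree_sum c1 c2 (\<lambda>Q. ennreal 0) n Q"
        by (simp add: F_def)
      also have "\<dots> = ennreal (tree_sum c1 c2 (\<lambda>Q. 0) n Q)" by (rule tree_sum_ennreal) simp
      also have "tree_sum c1 c2 (\<lambda>Q. 0::real) n Q = 0" by (induction n arbitrary: Q) auto
      finally show ?thesis by simp
    next
      case True
      have "tree_sum c1 c2 (\<lambda>Q. F Q t) n Q = ennreal (s * t powr (s - 1)) *
         tree_sum c1 c2 (\<lambda>Q. ennreal (if t * S (c2 Q) < m0 (c2 Q) then S (c2 Q) powr \<theta> else 0)) n Q"
        using True unfolding F_def by (simp add: tree_sum_cmult)
      also have "\<dots> = ennreal (s * t powr (s - 1)) * ennreal (tree_sum c1 c2 (\<lambda>Q. if t * S (c2 Q) < m0 (c2 Q) then S (c2 Q) powr \<theta> else 0) n Q)"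
        by (subst tree_sum_ennreal) auto
      also have "\<dots> \<le> ennreal (s * t powr (s - 1)) * ennreal (B * ((t / 2) powr (p - 1 - s) * m (t / 2) Q))"
        using weak[of "t / 2"] True by (intro mult_left_mono ennreal_leI) auto
      also have "\<dots> = ennreal (s * B * 2 powr (s + 1 - p) * t powr (p - 2)) * ennreal (m (t / 2) Q)"
      proof -
        have "t powr (s - 1) * (t / 2) powr (p - 1 - s) = 2 powr (s + 1 - p) * t powr (p - 2)"
        proof -
          have "(t / 2) powr (p - 1 - s) = t powr (p - 1 - s) * 2 powr (s + 1 - p)"
          proof -
            have "(t / 2) powr e = t powr e * 2 powr (- e)" for e
              using True by (simp add: powr_divide powr_minus_divide)
            moreover have "- (p - 1 - s) = s + 1 - p" by simp
            ultimately show ?thesis by metis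
          qed
          moreover have "t powr (s - 1) * t powr (p - 1 - s) = t powr (p - 2)"
            by (simp flip: powr_add)
          ultimately show ?thesis by simp
        qed
        then have "(t powr (s - 1) * (t / 2) powr (p - 1 - s)) * (s * B * m (t / 2) Q) = (2 powr (s + 1 - p) * t powr (p - 2)) * (s * B * m (t / 2) Q)"
          by simp
        then have "s * t powr (s - 1) * (B * ((t / 2) powr (p - 1 - s) * m (t / 2) Q)) = s * B * 2 powr (s + 1 - p) * t powr (p - 2) * m (t / 2) Q"
          by (simp only: ac_simps)
        then show ?thesis using p B m_nonneg True by (simp flip: ennreal_mult'')
      qed
      also have "ennreal (m (t / 2) Q) \<le> (\<integral>\<^sup>+x. ennreal (\<phi> x) * indicator {x. t < 2 * \<phi> x} x \<partial>M)"
      proof -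
        have "ennreal (m (t / 2) Q) = (\<integral>\<^sup>+x. ennreal (indicator (I Q) x *\<^sub>R h (t / 2) x) \<partial>M)"
          unfolding m_def set_lebesgue_integral_def
          by (rule nn_integral_eq_integral[symmetric]) (use int[unfolded set_integrable_def] h0 in auto)
        also have "\<dots> \<le> (\<integral>\<^sup>+x. ennreal (\<phi> x) * indicator {x. t < 2 * \<phi> x} x \<partial>M)"
          by (intro nn_integral_mono) (auto simp: h_def indicator_def)
        finally show ?thesis .
      qed
      finally show ?thesis using True p B by (simp add: ennreal_mult'' mult.assoc mult_left_mono)
    qed
  qed
  also have "\<dots> = ennreal (s * B * 2 powr (s + 1 - p)) * (\<integral>\<^sup>+t. (\<integral>\<^sup>+x. ennreal (t powr (p - 2)) * indicator {0<..} t * (ennreal (\<phi> x) * indicator {x. t < 2 * \<phi> x} x) \<partial>M) \<partial>lborel)"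
    by (simp add: nn_integral_cmult)
  also have "(\<integral>\<^sup>+t. (\<integral>\<^sup>+x. ennreal (t powr (p - 2)) * indicator {0<..} t * (ennreal (\<phi> x) * indicator {x. t < 2 * \<phi> x} x) \<partial>M) \<partial>lborel)
     = (\<integral>\<^sup>+x. (\<integral>\<^sup>+t. ennreal (t powr (p - 2)) * indicator {0<..} t * (ennreal (\<phi> x) * indicator {x. t < 2 * \<phi> x} x) \<partial>lborel) \<partial>M)"
    by (rule P.Fubini'[symmetric]) measurable
  also have "\<dots> = (\<integral>\<^sup>+x. ennreal (2 powr (p - 1) / (p - 1)) * ennreal (\<phi> x powr p) \<partial>M)"
  proof (rule nn_integral_cong)
    \<comment> \<open>The exponent p - 2 exceeds -1 because p > 1, so the integral over 0 < t < 2
      \<phi>(x) converges at 0; it supplies the factor 1/(p - 1).\<close>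
    fix x
    have "(\<integral>\<^sup>+t. ennreal (t powr (p - 2)) * indicator {0<..} t * (ennreal (\<phi> x) * indicator {x. t < 2 * \<phi> x} x) \<partial>lborel)
      = (\<integral>\<^sup>+t. ennreal (\<phi> x / (p - 1)) * (ennreal ((p - 1) * t powr (p - 1 - 1)) * indicator {0<..<2 * \<phi> x} t) \<partial>lborel)"
      by (rule nn_integral_cong) (use p \<phi>(1) in \<open>auto simp: indicator_def simp flip: ennreal_mult''\<close>)
    also have "\<dots> = ennreal (\<phi> x / (p - 1)) * ennreal ((2 * \<phi> x) powr (p - 1))"
      using p \<phi>(1)[of x] by (subst nn_integral_cmult, simp, subst nn_integral_powr_layer) auto
    also have "\<dots> = ennreal (\<phi> x / (p - 1) * (2 * \<phi> x) powr (p - 1))" by (rule ennreal_mult''[symmetric]) simp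
    also have "\<phi> x / (p - 1) * (2 * \<phi> x) powr (p - 1) = 2 powr (p - 1) / (p - 1) * \<phi> x powr p"
      using \<phi>(1)[of x] p by (cases "\<phi> x = 0") (auto simp: powr_mult powr_diff)
    also have "ennreal \<dots> = ennreal (2 powr (p - 1) / (p - 1)) * ennreal (\<phi> x powr p)" by (rule ennreal_mult'') simp
    finally show "(\<integral>\<^sup>+t. ennreal (t powr (p - 2)) * indicator {0<..} t * (ennreal (\<phi> x) * indicator {x. t < 2 * \<phi> x} x) \<partial>lborel) = ennreal (2 powr (p - 1) / (p - 1)) * ennreal (\<phi> x powr p)" .
  qed
  also have "\<dots> \<le> ennreal (2 powr (p - 1) / (p - 1)) * 1"
    by (subst nn_integral_cmult, simp) (rule mult_left_mono[OF \<phi>(2)], simp)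
  finally have "ennreal (tree_sum c1 c2 X n Q) \<le> ennreal (s * B * 2 powr (s + 1 - p)) * ennreal (2 powr (p - 1) / (p - 1))"
    by (simp add: mult_left_mono)
  also have "\<dots> = ennreal (s * B * 2 powr (s + 1 - p) * (2 powr (p - 1) / (p - 1)))"
    using p by (intro ennreal_mult''[symmetric]) auto
  also have "s * B * 2 powr (s + 1 - p) * (2 powr (p - 1) / (p - 1)) = B * s * 2 powr s / (p - 1)"
  proof -
    have "2 powr (s + 1 - p) * 2 powr (p - 1) = (2::real) powr s" by (simp flip: powr_add)
    then show ?thesis by (simp add: field_simps)
  qed
  finally have "tree_sum c1 c2 X n Q \<le> B * s * 2 powr s / (p - 1)"
    using B p by (subst (asm) ennreal_le_iff) auto
  then show ?thesis unfolding X_def S_def m0_def B_def .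
qed

section \<open>One-sided weights and dyadic intervals\<close>

text \<open>The condition with the averages multiplied out: 1/q + 1/p' = 1 - \<alpha>, hence the
  factor h^(1 - \<alpha>). Here w is Borel and positive everywhere; the passage from a Lebesgue
  measurable weight is made only at the end, so all integrals are over
  \<open>lborel\<close>.\<close>

locale one_sided_weight =
  fixes \<alpha> p q p' :: real and w :: "real \<Rightarrow> real" and C :: real
  assumes \<alpha>: "0 < \<alpha>" "\<alpha> < 1"
    and p: "1 < p" and pq: "1 / q = 1 / p - \<alpha>" and q0: "0 < q" and p': "1 / p + 1 / p' = 1"
    and w_meas[measurable]: "w \<in> borel_measurable borel" and w_pos: "\<And>x. 0 < w x"
    and C_pos: "0 < C"
    and finite_left: "\<And>a b. emeasure (density lborel (\<lambda>x. ennreal (w x powr q))) {a..b} < \<infinity>"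
    and finite_right: "\<And>a b. emeasure (density lborel (\<lambda>x. ennreal (w x powr (- p')))) {a..b} < \<infinity>"
    and A_plus: "\<And>a h. 0 < h \<Longrightarrow>
      measure (density lborel (\<lambda>x. ennreal (w x powr q))) {a - h..a} powr (1 / q) *
      measure (density lborel (\<lambda>x. ennreal (w x powr (- p')))) {a..a + h} powr (1 / p') \<le> C * h powr (1 - \<alpha>)"
begin

definition \<nu> :: "real measure" where "\<nu> = density lborel (\<lambda>x. ennreal (w x powr q))"
definition \<sigma> :: "real measure" where "\<sigma> = density lborel (\<lambda>x. ennreal (w x powr (- p')))"

lemma sets_\<nu>[simp, measurable_cong]: "sets \<nu> = sets borel" by (simp add: \<nu>_def)
lemma sets_\<sigma>[simp, measurable_cong]: "sets \<sigma> = sets borel" by (simp add: \<sigma>_def)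

lemma p_less_q: "p < q"
proof -
  have "1 / q < 1 / p" using pq \<alpha> by simp
  then show ?thesis using p q0 by (simp add: field_simps)
qed

lemma q1: "1 < q" using p_less_q p by simp

lemma p'1: "1 < p'"
proof -
  have i: "1 / p' = 1 - 1 / p" using p' by simp
  then have "0 < 1 / p'" "1 / p' < 1" using p by auto
  then have "0 < p'" by (simp add: zero_less_divide_iff)
  then show ?thesis using \<open>1 / p' < 1\<close> by (simp add: field_simps)
qed

lemma inv_sum: "1 / q + 1 / p' = 1 - \<alpha>" using pq p' by simp

lemma emeasure_\<nu>: "A \<in> sets borel \<Longrightarrow> emeasure \<nu> A = (\<integral>\<^sup>+x. ennreal (w x powr q) * indicator A x \<partial>lborel)"
  unfolding \<nu>_def by (subst emeasure_density) auto

lemma emeasure_\<sigma>: "A \<in> sets borel \<Longrightarrow> emeasure \<sigma> A = (\<integral>\<^sup>+x. ennreal (w x powr (- p')) * indicator A x \<partial>lborel)"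
  unfolding \<sigma>_def by (subst emeasure_density) auto

lemma finite_\<nu>: "A \<subseteq> {a..b} \<Longrightarrow> A \<in> sets borel \<Longrightarrow> emeasure \<nu> A < \<infinity>"
  using finite_left[of a b] emeasure_mono[of A "{a..b}" \<nu>] by (auto simp: \<nu>_def intro: le_less_trans)

lemma finite_\<sigma>: "A \<subseteq> {a..b} \<Longrightarrow> A \<in> sets borel \<Longrightarrow> emeasure \<sigma> A < \<infinity>"
  using finite_right[of a b] emeasure_mono[of A "{a..b}" \<sigma>] by (auto simp: \<sigma>_def intro: le_less_trans)

lemma sigma_finite_\<nu>: "sigma_finite_measure \<nu>"
  unfolding \<nu>_def by (subst sigma_finite_measure.sigma_finite_iff_density_finite[OF sigma_finite_lborel]) auto
  
lemma sigma_finite_\<sigma>: "sigma_finite_measure \<sigma>"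
  unfolding \<sigma>_def by (subst sigma_finite_measure.sigma_finite_iff_density_finite[OF sigma_finite_lborel]) auto

lemma emeasure_eq_\<nu>: "A \<subseteq> {a..b} \<Longrightarrow> A \<in> sets borel \<Longrightarrow> emeasure \<nu> A = ennreal (measure \<nu> A)"
  using finite_\<nu>[of A a b] by (intro emeasure_eq_ennreal_measure) auto

lemma emeasure_eq_\<sigma>: "A \<subseteq> {a..b} \<Longrightarrow> A \<in> sets borel \<Longrightarrow> emeasure \<sigma> A = ennreal (measure \<sigma> A)"
  using finite_\<sigma>[of A a b] by (intro emeasure_eq_ennreal_measure) auto

lemma measure_\<nu>_mono: "A \<subseteq> B \<Longrightarrow> B \<subseteq> {a..b} \<Longrightarrow> A \<in> sets borel \<Longrightarrow> B \<in> sets borel \<Longrightarrow> measure \<nu> A \<le> measure \<nu> B"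
  using finite_\<nu>[of B a b] by (intro measure_mono_fmeasurable) (auto simp: fmeasurable_def)

lemma measure_\<sigma>_mono: "A \<subseteq> B \<Longrightarrow> B \<subseteq> {a..b} \<Longrightarrow> A \<in> sets borel \<Longrightarrow> B \<in> sets borel \<Longrightarrow> measure \<sigma> A \<le> measure \<sigma> B"
  using finite_\<sigma>[of B a b] by (intro measure_mono_fmeasurable) (auto simp: fmeasurable_def)

lemma A_plus_halfopen:
  assumes "0 < h"
  shows "measure \<nu> {a - h..<a} powr (1 / q) * measure \<sigma> {a..<a + h} powr (1 / p') \<le> C * h powr (1 - \<alpha>)"
proof -
  have "measure \<nu> {a - h..<a} powr (1 / q) * measure \<sigma> {a..<a + h} powr (1 / p')
     \<le> measure \<nu> {a - h..a} powr (1 / q) * measure \<sigma> {a..a + h} powr (1 / p')"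
    using q1 p'1
    by (intro mult_mono powr_mono2 measure_\<nu>_mono[of _ _ "a - h" a] measure_\<sigma>_mono[of _ _ a "a + h"]) auto
  then show ?thesis using A_plus[OF assms, of a] by (simp add: \<nu>_def \<sigma>_def)
qed

text \<open>A reverse of the condition, on a single interval: Hoelder's inequality for 1 =
  w^(1/\<beta>) w^(-1/\<beta>) with \<beta> = 1 - \<alpha>. The exponents q \<beta> = 1 + q/p' and
  p' \<beta> = 1 + p'/q are conjugate and exceed 1.\<close>

lemma length_le_\<nu>_\<sigma>:
  assumes "a < b"
  shows "(b - a) powr (1 - \<alpha>) \<le> measure \<nu> {a..<b} powr (1 / q) * measure \<sigma> {a..<b} powr (1 / p')"
proof -
  have sub: "{a..<b} \<subseteq> {a..b}" by auto
  define \<beta> where "\<beta> = 1 - \<alpha>"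
  have \<beta>: "0 < \<beta>" using \<alpha> by (simp add: \<beta>_def)
  have \<beta>': "\<beta> = 1 / q + 1 / p'" using inv_sum by (simp add: \<beta>_def)
  have P: "q * \<beta> = 1 + q / p'" "p' * \<beta> = 1 + p' / q" using q1 p'1 by (auto simp: \<beta>' field_simps)
  have "(\<integral>\<^sup>+x. ennreal (w x powr (1 / \<beta>) * indicator {a..<b} x * (w x powr (- 1 / \<beta>) * indicator {a..<b} x)) \<partial>lborel)
     \<le> ennreal (measure \<nu> {a..<b} powr (1 / (q * \<beta>)) * measure \<sigma> {a..<b} powr (1 / (p' * \<beta>)))"
  proof (rule nn_integral_Hoelder)
    show "1 < q * \<beta>" "1 < p' * \<beta>" using P q1 p'1 by (auto simp: add_pos_pos)
    have "1 / (q * \<beta>) + 1 / (p' * \<beta>) = (1 / q + 1 / p') / \<beta>"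
      using q1 p'1 \<beta> by (simp add: field_simps)
    then show "1 / (q * \<beta>) + 1 / (p' * \<beta>) = 1" using \<beta> \<beta>' by simp
    have "(\<integral>\<^sup>+x. ennreal ((w x powr (1 / \<beta>) * indicator {a..<b} x) powr (q * \<beta>)) \<partial>lborel) = emeasure \<nu> {a..<b}"
      using \<beta> q1 by (subst emeasure_\<nu>, simp) (intro nn_integral_cong, auto simp: indicator_def powr_powr)
    then show "(\<integral>\<^sup>+x. ennreal ((w x powr (1 / \<beta>) * indicator {a..<b} x) powr (q * \<beta>)) \<partial>lborel) \<le> ennreal (measure \<nu> {a..<b})"
      using emeasure_eq_\<nu>[OF sub] by simp
    have "(\<integral>\<^sup>+x. ennreal ((w x powr (- 1 / \<beta>) * indicator {a..<b} x) powr (p' * \<beta>)) \<partial>lborel) = emeasure \<sigma> {a..<b}"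
      using \<beta> p'1 by (subst emeasure_\<sigma>, simp) (intro nn_integral_cong, auto simp: indicator_def powr_powr)
    then show "(\<integral>\<^sup>+x. ennreal ((w x powr (- 1 / \<beta>) * indicator {a..<b} x) powr (p' * \<beta>)) \<partial>lborel) \<le> ennreal (measure \<sigma> {a..<b})"
      using emeasure_eq_\<sigma>[OF sub] by simp
  qed auto
  also have "(\<integral>\<^sup>+x. ennreal (w x powr (1 / \<beta>) * indicator {a..<b} x * (w x powr (- 1 / \<beta>) * indicator {a..<b} x)) \<partial>lborel)
     = (\<integral>\<^sup>+x. indicator {a..<b} x \<partial>lborel)"
  proof (rule nn_integral_cong)
    fix x
    have "w x powr (1 / \<beta>) * w x powr (- 1 / \<beta>) = 1" using w_pos[of x] by (simp flip: powr_add)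
    then show "ennreal (w x powr (1 / \<beta>) * indicator {a..<b} x * (w x powr (- 1 / \<beta>) * indicator {a..<b} x)) = indicator {a..<b} x"
      by (auto simp: indicator_def)
  qed
  also have "\<dots> = ennreal (b - a)" using assms by simp
  finally have "b - a \<le> measure \<nu> {a..<b} powr (1 / (q * \<beta>)) * measure \<sigma> {a..<b} powr (1 / (p' * \<beta>))"
    by (subst (asm) ennreal_le_iff) auto
  then have "(b - a) powr \<beta> \<le> (measure \<nu> {a..<b} powr (1 / (q * \<beta>)) * measure \<sigma> {a..<b} powr (1 / (p' * \<beta>))) powr \<beta>"
    using assms \<beta> by (intro powr_mono2) auto
  also have "\<dots> = measure \<nu> {a..<b} powr (1 / q) * measure \<sigma> {a..<b} powr (1 / p')"
    using \<beta> by (simp add: powr_mult powr_powr)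
  finally show ?thesis by (simp add: \<beta>_def)
qed

lemma measure_pos:
  assumes "a < b"
  shows "0 < measure \<nu> {a..<b}" "0 < measure \<sigma> {a..<b}"
proof -
  have "0 < (b - a) powr (1 - \<alpha>)" using assms by simp
  then have "0 < measure \<nu> {a..<b} powr (1 / q) * measure \<sigma> {a..<b} powr (1 / p')"
    using length_le_\<nu>_\<sigma>[OF assms] by linarith
  then show "0 < measure \<nu> {a..<b}" "0 < measure \<sigma> {a..<b}"
    by (auto simp: less_le)
qed

text \<open>When the condition at a is combined with the reverse inequality on the left interval,
  the \<open>\<nu>\<close> mass of that interval cancels, being positive by
  \<open>measure_pos\<close>. What remains compares two neighbouring \<open>\<sigma>\<close>
  masses.\<close>

lemma \<sigma>_growth:
  assumes "0 < h"
  shows "C powr (- p') * measure \<sigma> {a..<a + h} \<le> measure \<sigma> {a - h..<a}"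
proof -
  have "measure \<nu> {a - h..<a} powr (1 / q) * measure \<sigma> {a..<a + h} powr (1 / p')
     \<le> measure \<nu> {a - h..<a} powr (1 / q) * (C * measure \<sigma> {a - h..<a} powr (1 / p'))"
  proof -
    have "h powr (1 - \<alpha>) \<le> measure \<nu> {a - h..<a} powr (1 / q) * measure \<sigma> {a - h..<a} powr (1 / p')"
      using length_le_\<nu>_\<sigma>[of "a - h" a] assms by simp
    from mult_left_mono[OF this, of C] A_plus_halfopen[OF assms, of a] C_pos show ?thesis
      by (subst mult.left_commute) linarith
  qed
  then have "measure \<sigma> {a..<a + h} powr (1 / p') \<le> C * measure \<sigma> {a - h..<a} powr (1 / p')"
    using measure_pos(1)[of "a - h" a] assms by simp
  then have "(measure \<sigma> {a..<a + h} powr (1 / p')) powr p' \<le> (C * measure \<sigma> {a - h..<a} powr (1 / p')) powr p'"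
    using p'1 by (intro powr_mono2) auto
  then have "measure \<sigma> {a..<a + h} \<le> C powr p' * measure \<sigma> {a - h..<a}"
    using p'1 C_pos by (simp add: powr_powr powr_mult)
  then show ?thesis using C_pos by (simp add: powr_minus field_simps)
qed

text \<open>The mirror image: the reverse inequality is used on the right interval, whose
  \<open>\<sigma>\<close> mass cancels.\<close>

lemma \<nu>_growth:
  assumes "0 < h"
  shows "C powr (- q) * measure \<nu> {a - h..<a} \<le> measure \<nu> {a..<a + h}"
proof -
  have "measure \<sigma> {a..<a + h} powr (1 / p') * measure \<nu> {a - h..<a} powr (1 / q)
     \<le> measure \<sigma> {a..<a + h} powr (1 / p') * (C * measure \<nu> {a..<a + h} powr (1 / q))"
  proof -
    have "h powr (1 - \<alpha>) \<le> measure \<nu> {a..<a + h} powr (1 / q) * measure \<sigma> {a..<a + h} powr (1 / p')"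
      using length_le_\<nu>_\<sigma>[of a "a + h"] assms by simp
    from mult_left_mono[OF this, of C] A_plus_halfopen[OF assms, of a] C_pos
    have "measure \<nu> {a - h..<a} powr (1 / q) * measure \<sigma> {a..<a + h} powr (1 / p')
      \<le> C * (measure \<nu> {a..<a + h} powr (1 / q) * measure \<sigma> {a..<a + h} powr (1 / p'))" by linarith
    then show ?thesis by (simp only: ac_simps)
  qed
  then have "measure \<nu> {a - h..<a} powr (1 / q) \<le> C * measure \<nu> {a..<a + h} powr (1 / q)"
    using measure_pos(2)[of a "a + h"] assms by simp
  then have "(measure \<nu> {a - h..<a} powr (1 / q)) powr q \<le> (C * measure \<nu> {a..<a + h} powr (1 / q)) powr q"
    using q1 by (intro powr_mono2) auto
  then have "measure \<nu> {a - h..<a} \<le> C powr q * measure \<nu> {a..<a + h}"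
    using q1 C_pos by (simp add: powr_powr powr_mult)
  then show ?thesis using C_pos by (simp add: powr_minus field_simps)
qed

end

section \<open>Dyadic trees of intervals and their kernels\<close>

definition node_set :: "real \<times> real \<Rightarrow> real set" where
  "node_set Q = {fst Q..<fst Q + snd Q}"

definition left_half :: "real \<times> real \<Rightarrow> real \<times> real" where
  "left_half Q = (fst Q, snd Q / 2)"

definition right_half :: "real \<times> real \<Rightarrow> real \<times> real" where
  "right_half Q = (fst Q + snd Q / 2, snd Q / 2)"

lemma node_set_measurable[measurable]: "node_set Q \<in> sets borel"
  by (simp add: node_set_def)

text \<open>Half-open intervals keep the halves disjoint, and a node of nonpositive length has an
  empty set, so the identities hold for every pair (left endpoint, length).\<close>

lemma node_set_split:
  "node_set Q = node_set (left_half Q) \<union> node_set (right_half Q)"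
  "node_set (left_half Q) \<inter> node_set (right_half Q) = {}"
  by (auto simp: node_set_def left_half_def right_half_def)

lemma node_set_split':
  "node_set Q = node_set (right_half Q) \<union> node_set (left_half Q)"
  "node_set (right_half Q) \<inter> node_set (left_half Q) = {}"
  by (subst Un_commute, rule node_set_split(1)) (subst Int_commute, rule node_set_split(2))

text \<open>A dyadic substitute for (t - x)^(\<alpha> - 1) on x < t. Each term is a product of a
  function of x and a function of t, whose supports are adjacent in the order that the condition on
  w demands.\<close>

definition tree_kernel :: "real \<Rightarrow> nat \<Rightarrow> real \<times> real \<Rightarrow> real \<Rightarrow> real \<Rightarrow> ennreal" where
  "tree_kernel \<alpha> n Q x t = tree_sum left_half right_half (\<lambda>Q. ennreal (snd Q powr (\<alpha> - 1)) *
     (indicator (node_set (left_half Q)) x * indicator (node_set (right_half Q)) t)) n Q"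

lemma tree_kernel_simps:
  "tree_kernel \<alpha> 0 Q x t = 0"
  "tree_kernel \<alpha> (Suc n) Q x t = ennreal (snd Q powr (\<alpha> - 1)) *
     (indicator (node_set (left_half Q)) x * indicator (node_set (right_half Q)) t)
     + tree_kernel \<alpha> n (left_half Q) x t + tree_kernel \<alpha> n (right_half Q) x t"
  by (simp_all add: tree_kernel_def)

lemma tree_kernel_mono_Suc: "tree_kernel \<alpha> n Q x t \<le> tree_kernel \<alpha> (Suc n) Q x t"
proof (induction n arbitrary: Q)
  case (Suc n)
  show ?case by (subst (1 2) tree_kernel_simps(2)) (intro add_mono order_refl Suc)
qed (simp add: tree_kernel_simps)

lemma tree_kernel_mono: "m \<le> n \<Longrightarrow> tree_kernel \<alpha> m Q x t \<le> tree_kernel \<alpha> n Q x t"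
  by (rule lift_Suc_mono_le[where f="\<lambda>n. tree_kernel \<alpha> n Q x t"]) (rule tree_kernel_mono_Suc)

lemma tree_kernel_measurable[measurable]:
  "(\<lambda>(x, t). tree_kernel \<alpha> n Q x t) \<in> borel_measurable (borel \<Otimes>\<^sub>M borel)"
  unfolding tree_kernel_def split_beta' by measurable

text \<open>Descend to the node that separates x and t; as x < t, it has x on its left and t on its
  right. Its length is at most that of Q, and the exponent \<alpha> - 1 is negative. Lengths halve
  while staying above t - x, so separation occurs after a number of steps bounded by j.\<close>

lemma tree_kernel_lower:
  assumes "x \<in> node_set Q" "t \<in> node_set Q" "x < t" "\<alpha> < 1"
  shows "\<exists>n. ennreal (snd Q powr (\<alpha> - 1)) \<le> tree_kernel \<alpha> n Q x t"
proof -
  obtain j where "snd Q / (t - x) < 2 ^ j" using real_arch_pow[of 2] by auto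
  then have "snd Q < 2 ^ j * (t - x)" using assms by (simp add: field_simps)
  then show ?thesis using assms
  proof (induction j arbitrary: Q)
    case 0
    then show ?case by (auto simp: node_set_def)
  next
    case (Suc j)
    have l: "snd Q > 0" using Suc.prems by (auto simp: node_set_def)
    consider (sep) "x \<in> node_set (left_half Q)" "t \<in> node_set (right_half Q)"
      | (l) "x \<in> node_set (left_half Q)" "t \<in> node_set (left_half Q)"
      | (r) "x \<in> node_set (right_half Q)" "t \<in> node_set (right_half Q)"
      using Suc.prems by (cases "x < fst Q + snd Q / 2"; cases "t < fst Q + snd Q / 2")
        (auto simp: node_set_def left_half_def right_half_def)
    then show ?case
    proof cases
      case sep
      then show ?thesis by (intro exI[of _ 1]) (simp add: tree_kernel_simps)
    next
      case l
      have "\<exists>n. ennreal (snd (left_half Q) powr (\<alpha> - 1)) \<le> tree_kernel \<alpha> n (left_half Q) x t"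
        by (rule Suc.IH) (use l Suc.prems in \<open>auto simp: left_half_def\<close>)
      then obtain n where n: "ennreal (snd (left_half Q) powr (\<alpha> - 1)) \<le> tree_kernel \<alpha> n (left_half Q) x t" by blast
      have "snd Q powr (\<alpha> - 1) \<le> snd (left_half Q) powr (\<alpha> - 1)"
        using \<open>snd Q > 0\<close> Suc.prems by (intro powr_mono2') (auto simp: left_half_def)
      then have "ennreal (snd Q powr (\<alpha> - 1)) \<le> tree_kernel \<alpha> n (left_half Q) x t"
        using n ennreal_leI order_trans by blast
      also have "\<dots> \<le> tree_kernel \<alpha> (Suc n) Q x t" by (simp add: tree_kernel_simps add_increasing add_increasing2)
      finally show ?thesis by blast
    next
      case r
      have "\<exists>n. ennreal (snd (right_half Q) powr (\<alpha> - 1)) \<le> tree_kernel \<alpha> n (right_half Q) x t"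
        by (rule Suc.IH) (use r Suc.prems in \<open>auto simp: right_half_def\<close>)
      then obtain n where n: "ennreal (snd (right_half Q) powr (\<alpha> - 1)) \<le> tree_kernel \<alpha> n (right_half Q) x t" by blast
      have "snd Q powr (\<alpha> - 1) \<le> snd (right_half Q) powr (\<alpha> - 1)"
        using \<open>snd Q > 0\<close> Suc.prems by (intro powr_mono2') (auto simp: right_half_def)
      then have "ennreal (snd Q powr (\<alpha> - 1)) \<le> tree_kernel \<alpha> n (right_half Q) x t"
        using n ennreal_leI order_trans by blast
      also have "\<dots> \<le> tree_kernel \<alpha> (Suc n) Q x t" by (simp add: tree_kernel_simps add_increasing)
      finally show ?thesis by blast
    qed
  qed
qed

text \<open>The j-th node of generation k heads a subtree of the tree of the root; the leading one
  of the k binary digits of j decides which half to enter.\<close>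

lemma tree_kernel_descend:
  assumes "j < 2 ^ k"
  shows "tree_kernel \<alpha> n (a + real j * (l / 2 ^ k), l / 2 ^ k) x t \<le> tree_kernel \<alpha> (n + k) (a, l) x t"
  using assms
proof (induction k arbitrary: a l j)
  case 0
  then have "j = 0" by simp
  then show ?case by (simp only: of_nat_0 mult_zero_left add_0_right power_0 div_by_1 order_refl)
next
  case (Suc k)
  show ?case
  proof (cases "j < 2 ^ k")
    case True
    have "tree_kernel \<alpha> n (a + real j * ((l / 2) / 2 ^ k), (l / 2) / 2 ^ k) x t \<le> tree_kernel \<alpha> (n + k) (left_half (a, l)) x t"
      using Suc.IH[OF True, of a "l / 2"] by (simp add: left_half_def)
    also have "\<dots> \<le> tree_kernel \<alpha> (n + Suc k) (a, l) x t" by (simp add: tree_kernel_simps add_increasing add_increasing2)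
    finally show ?thesis by (simp only: divide_divide_eq_left power_Suc)
  next
    case False
    then have j: "j - 2 ^ k < 2 ^ k" "real (j - 2 ^ k) = real j - 2 ^ k" using Suc.prems by (auto simp: of_nat_diff)
    have "tree_kernel \<alpha> n (a + l / 2 + real (j - 2 ^ k) * ((l / 2) / 2 ^ k), (l / 2) / 2 ^ k) x t \<le> tree_kernel \<alpha> (n + k) (right_half (a, l)) x t"
      using Suc.IH[OF j(1), of "a + l / 2" "l / 2"] by (simp add: right_half_def)
    also have "\<dots> \<le> tree_kernel \<alpha> (n + Suc k) (a, l) x t" by (simp add: tree_kernel_simps add_increasing)
    also have "a + l / 2 + real (j - 2 ^ k) * ((l / 2) / 2 ^ k) = a + real j * (l / 2 ^ Suc k)"
    proof -
      define r where "r = real (j - 2 ^ k)"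
      have r: "real j = r + 2 ^ k" using j(2) by (simp add: r_def)
      show ?thesis unfolding r_def[symmetric] r by (simp add: field_simps)
    qed
    finally show ?thesis by (simp only: divide_divide_eq_left power_Suc)
  qed
qed

lemma node_at_level:
  fixes x a l :: real
  assumes "a \<le> x" "x < a + l" "0 < l"
  obtains j where "j < 2 ^ k" "x \<in> node_set (a + real j * (l / 2 ^ k), l / 2 ^ k)"
proof
  define d where "d = l / 2 ^ k"
  define j where "j = nat \<lfloor>(x - a) / d\<rfloor>"
  have d: "d > 0" "l = d * 2 ^ k" using assms by (auto simp: d_def)
  have j: "real j \<le> (x - a) / d" "(x - a) / d < real j + 1"
    using assms d by (auto simp: j_def)
  have "(x - a) / d < 2 ^ k" using assms d by (simp add: field_simps)
  then have "real j < 2 ^ k" using j by linarith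
  then show "j < 2 ^ k" by simp
  show "x \<in> node_set (a + real j * (l / 2 ^ k), l / 2 ^ k)"
    unfolding d_def[symmetric] using j d by (auto simp: node_set_def field_simps)
qed

text \<open>The endpoints of level \<open>k\<close> of the two trees differ by at least a third of the length of the
  intervals of that level, since \<open>2\<^sup>k\<close> is not divisible by \<open>3\<close>. Hence two close points lie in a
  common interval of one of the two trees.\<close>

lemma tree_kernel_two_grids:
  assumes "- M \<le> x" "x < t" "t < M" "\<alpha> < 1"
  shows "\<exists>n. ennreal ((6 * (t - x)) powr (\<alpha> - 1)) \<le>
    tree_kernel \<alpha> n (- 2 * M, 6 * M) x t + tree_kernel \<alpha> n (- 4 * M, 6 * M) x t"
proof -
  have M: "M > 0" using assms by simp
  \<comment> \<open>The roots [-2M, 4M) and [-4M, 2M) both contain [-M, M) and are shifted against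
    each other by 2M, a third of their length 6M.\<close>
  define L where "L k = 6 * M / 2 ^ k" for k :: nat
  have "\<exists>k. L k \<le> 3 * (t - x)"
  proof -
    obtain k where "6 * M / (3 * (t - x)) < 2 ^ k" using real_arch_pow[of 2] by auto
    then have "L k \<le> 3 * (t - x)" using assms by (simp add: L_def field_simps)
    then show ?thesis ..
  qed
  \<comment> \<open>The generation k just before \<open>k1\<close> has 3 (t - x) < L k <= 6 (t - x):
    the upper bound produces the constant 6 of the claim, the lower bound makes t - x shorter than a
    third of an interval.\<close>
  define k1 where "k1 = (LEAST k. L k \<le> 3 * (t - x))"
  have k1: "L k1 \<le> 3 * (t - x)" unfolding k1_def by (rule LeastI_ex) fact
  have "k1 \<noteq> 0" using k1 assms by (intro notI) (simp add: L_def)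
  then obtain k where k: "k1 = Suc k" using not0_implies_Suc by blast
  have Lk: "L k > 3 * (t - x)" using not_less_Least[of k "\<lambda>k. L k \<le> 3 * (t - x)"] k by (auto simp: k1_def)
  have "L k1 = L k / 2" by (simp add: k L_def)
  then have Lk2: "L k \<le> 6 * (t - x)" using k1 by linarith
  have Lpos: "L k > 0" using M by (simp add: L_def)
  obtain i where i: "i < 2 ^ k" "x \<in> node_set (- 2 * M + real i * L k, L k)"
    using node_at_level[of "- 2 * M" x "6 * M" k] assms M unfolding L_def by auto
  obtain j where j: "j < 2 ^ k" "x \<in> node_set (- 4 * M + real j * L k, L k)"
    using node_at_level[of "- 4 * M" x "6 * M" k] assms M unfolding L_def by auto
  have pow: "(6 * (t - x)) powr (\<alpha> - 1) \<le> L k powr (\<alpha> - 1)"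
    using Lk2 Lpos assms by (intro powr_mono2') auto
  have found: ?thesis if *: "t \<in> node_set (a + real m * L k, L k)" "x \<in> node_set (a + real m * L k, L k)" "m < 2 ^ k" "a = - 2 * M \<or> a = - 4 * M" for a m
  proof -
    obtain n where n: "ennreal (L k powr (\<alpha> - 1)) \<le> tree_kernel \<alpha> n (a + real m * L k, L k) x t"
      using tree_kernel_lower[OF *(2,1) assms(2,4)] by auto
    also have "\<dots> \<le> tree_kernel \<alpha> (n + k) (a, 6 * M) x t"
      unfolding L_def by (rule tree_kernel_descend) (rule *(3))
    finally have "ennreal ((6 * (t - x)) powr (\<alpha> - 1)) \<le> tree_kernel \<alpha> (n + k) (a, 6 * M) x t"
      using pow ennreal_leI order_trans by blast
    then have "ennreal ((6 * (t - x)) powr (\<alpha> - 1)) \<le> tree_kernel \<alpha> (n + k) (- 2 * M, 6 * M) x t + tree_kernel \<alpha> (n + k) (- 4 * M, 6 * M) x t"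
      using *(4) by (auto intro: add_increasing add_increasing2)
    then show ?thesis by blast
  qed
  show ?thesis
  proof (cases "t \<in> node_set (- 2 * M + real i * L k, L k) \<or> t \<in> node_set (- 4 * M + real j * L k, L k)")
    case True
    then show ?thesis using found i j by blast
  next
    case False
    \<comment> \<open>Now t lies beyond both intervals containing x. Their right endpoints e and e'
      are in (x, t], hence closer than L k / 3, although their difference is L k / 3 times an
      integer congruent to 2^k modulo 3.\<close>
    define e where "e = - 2 * M + (real i + 1) * L k"
    define e' where "e' = - 4 * M + (real j + 1) * L k"
    have "x < e" "e \<le> t" "x < e'" "e' \<le> t"
      using False i(2) j(2) assms(2) by (auto simp: node_set_def e_def e'_def algebra_simps)
    then have "\<bar>e - e'\<bar> < L k / 3" using Lk by argo
    moreover have "e - e' = L k / 3 * (real_of_int (2 ^ k + 3 * (int i - int j)))"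
    proof -
      have "2 * M = L k / 3 * 2 ^ k" by (simp add: L_def)
      then show ?thesis by (simp add: e_def e'_def algebra_simps)
    qed
    ultimately have "L k / 3 * \<bar>real_of_int (2 ^ k + 3 * (int i - int j))\<bar> < L k / 3 * 1"
      using Lpos by (simp add: abs_mult)
    then have "\<bar>real_of_int (2 ^ k + 3 * (int i - int j))\<bar> < 1" using Lpos by (simp only: mult_less_cancel_left_pos)
    then have "2 ^ k + 3 * (int i - int j) = 0" by linarith
    then have "(2::int) ^ k = 3 * (int j - int i)" by (simp add: algebra_simps)
    then have "(3::int) dvd 2 ^ k" by simp
    moreover have "\<not> (3::int) dvd 2 ^ n" for n
    proof (induction n)
      case (Suc n)
      then show ?case unfolding power_Suc by presburger
    qed simp
    ultimately show ?thesis by simp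
  qed
qed

lemma nn_integral_SUP_nested:
  fixes F :: "nat \<Rightarrow> 'a \<Rightarrow> 'b \<Rightarrow> ennreal"
  assumes "sigma_finite_measure N"
    and [measurable]: "\<And>n. (\<lambda>(x, y). F n x y) \<in> borel_measurable (M \<Otimes>\<^sub>M N)"
    and inc: "\<And>x y. incseq (\<lambda>n. F n x y)"
  shows "(\<integral>\<^sup>+x. \<integral>\<^sup>+y. (SUP n. F n x y) \<partial>N \<partial>M) = (SUP n. \<integral>\<^sup>+x. \<integral>\<^sup>+y. F n x y \<partial>N \<partial>M)"
proof -
  interpret sigma_finite_measure N by fact
  have inc': "incseq (\<lambda>n. F n x)" for x
    using inc by (auto simp: incseq_def le_fun_def)
  have "(\<integral>\<^sup>+x. \<integral>\<^sup>+y. (SUP n. F n x y) \<partial>N \<partial>M) = (\<integral>\<^sup>+x. (SUP n. \<integral>\<^sup>+y. F n x y \<partial>N) \<partial>M)"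
    by (intro nn_integral_cong nn_integral_monotone_convergence_SUP inc') measurable
  also have "\<dots> = (SUP n. \<integral>\<^sup>+x. \<integral>\<^sup>+y. F n x y \<partial>N \<partial>M)"
    using inc by (intro nn_integral_monotone_convergence_SUP)
      (auto simp: incseq_def le_fun_def intro!: nn_integral_mono)
  finally show ?thesis .
qed

section \<open>The dyadic bilinear form\<close>

context one_sided_weight
begin

lemma powr_relations: "p' * p - p' = p" "s / p - s = - s / p'"
proof -
  have "p + p' = p' * p" using p' p p'1 by (simp add: field_simps)
  then show "p' * p - p' = p" by linarith
  have "s / p + s / p' = s * (1 / p + 1 / p')" by (simp add: distrib_left)
  then show "s / p - s = - s / p'" unfolding p' by simp
qed

text \<open>At one node the condition bounds |Q|^(\<alpha> - 1) by C times \<open>\<nu>\<close> of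
  the left half to the power -1/q times \<open>\<sigma>\<close> of the right half to the power
  -1/p'. Young's inequality with exponents s, s' separates the two factors, and each sum is an
  instance of \<open>tree_sum_strong_type\<close>, for \<open>\<nu>\<close> with the halves
  exchanged. K depends neither on n nor on Q.\<close>

lemma tree_form_bound:
  "\<exists>K\<ge>0. \<forall>n Q f g. f \<in> borel_measurable borel \<longrightarrow> g \<in> borel_measurable borel \<longrightarrow>
     (\<forall>x. 0 \<le> f x) \<longrightarrow> (\<forall>x. 0 \<le> g x) \<longrightarrow>
     (\<integral>\<^sup>+x. ennreal (f x powr p * w x powr p) \<partial>lborel) \<le> 1 \<longrightarrow>
     (\<integral>\<^sup>+x. ennreal (g x powr (q / (q - 1)) * w x powr (- (q / (q - 1)))) \<partial>lborel) \<le> 1 \<longrightarrow>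
     (\<integral>\<^sup>+x. \<integral>\<^sup>+t. tree_kernel \<alpha> n Q x t * ennreal (f t * g x) \<partial>lborel \<partial>lborel) \<le> ennreal K"
proof -
  define q' where "q' = q / (q - 1)"
  \<comment> \<open>Any s strictly between p and q serves: s > p is the gap required for the
    embedding of L^p(\<sigma>), and s < q means s' > q', the gap for L^q'(\<nu>).\<close>
  define s where "s = (p + q) / 2"
  define s' where "s' = s / (s - 1)"
  have s: "p < s" "s < q" "1 < s" using p_less_q p by (auto simp: s_def)
  have q': "1 < q'" "1 / q + 1 / q' = 1" "q' * q - q = q'" using q1 by (auto simp: q'_def field_simps)
  have s': "1 < s'" "1 / s + 1 / s' = 1" using s by (auto simp: s'_def field_simps)
  have q's': "q' < s'" unfolding q'_def s'_def using s q1 by (simp add: field_simps)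
  define c1 where "c1 = C powr (- p')"
  define c2 where "c2 = C powr (- q)"
  have c: "c1 > 0" "c2 > 0" using C_pos by (auto simp: c1_def c2_def)
  define K1 where "K1 = (1 + 1 / ((1 + c1) powr (s / p - 1) - 1)) * s * 2 powr s / (p - 1)"
  define K2 where "K2 = (1 + 1 / ((1 + c2) powr (s' / q' - 1) - 1)) * s' * 2 powr s' / (q' - 1)"
  have "1 < (1 + c1) powr (s / p - 1)" using c s p by (intro gr_one_powr) auto
  then have K1: "K1 \<ge> 0" using s p by (auto simp: K1_def intro!: mult_nonneg_nonneg divide_nonneg_nonneg add_nonneg_nonneg)
  have "1 < (1 + c2) powr (s' / q' - 1)" using c q's' q' by (intro gr_one_powr) auto
  then have K2: "K2 \<ge> 0" using s' q' by (auto simp: K2_def intro!: mult_nonneg_nonneg divide_nonneg_nonneg add_nonneg_nonneg)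
  define K where "K = C * (K1 / s + K2 / s')"
  have K0: "K \<ge> 0" using K1 K2 C_pos s s' by (auto simp: K_def)
  have fin\<sigma>: "emeasure \<sigma> (node_set Q) < \<infinity>" for Q
    by (rule finite_\<sigma>[of _ "fst Q" "fst Q + snd Q"]) (auto simp: node_set_def)
  have fin\<nu>: "emeasure \<nu> (node_set Q) < \<infinity>" for Q
    by (rule finite_\<nu>[of _ "fst Q" "fst Q + snd Q"]) (auto simp: node_set_def)
  have grow\<sigma>: "c1 * measure \<sigma> (node_set (right_half Q)) \<le> measure \<sigma> (node_set (left_half Q))" for Q
  proof (cases "snd Q > 0")
    case True
    then show ?thesis using \<sigma>_growth[of "snd Q / 2" "fst Q + snd Q / 2"]
      by (simp add: c1_def node_set_def left_half_def right_half_def)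
  qed (simp add: node_set_def left_half_def right_half_def)
  have grow\<nu>: "c2 * measure \<nu> (node_set (left_half Q)) \<le> measure \<nu> (node_set (right_half Q))" for Q
  proof (cases "snd Q > 0")
    case True
    then show ?thesis using \<nu>_growth[of "snd Q / 2" "fst Q + snd Q / 2"]
      by (simp add: c2_def node_set_def left_half_def right_half_def)
  qed (simp add: node_set_def left_half_def right_half_def)
  have main: "(\<integral>\<^sup>+x. \<integral>\<^sup>+t. tree_kernel \<alpha> n Q x t * ennreal (f t * g x) \<partial>lborel \<partial>lborel) \<le> ennreal K"
    if [measurable]: "f \<in> borel_measurable borel" "g \<in> borel_measurable borel" and nonneg: "\<And>x. 0 \<le> f x" "\<And>x. 0 \<le> g x"
      and f1: "(\<integral>\<^sup>+x. ennreal (f x powr p * w x powr p) \<partial>lborel) \<le> 1"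
      and g1: "(\<integral>\<^sup>+x. ennreal (g x powr q' * w x powr (- q')) \<partial>lborel) \<le> 1" for n Q f g
  proof -
    \<comment> \<open>Densities for the two measures: \<phi> d\<sigma> = f dx and \<gamma> d\<nu> =
      g dx. The integral of \<phi>^p for \<open>\<sigma>\<close> is that of (f w)^p, since p' p - p'
      = p, and likewise that of \<gamma>^q' for \<open>\<nu>\<close> is that of (g/w)^q'.\<close>
    define \<phi> where "\<phi> t = f t * w t powr p'" for t
    define \<gamma> where "\<gamma> t = g t * w t powr (- q)" for t
    have [measurable]: "\<phi> \<in> borel_measurable borel" "\<gamma> \<in> borel_measurable borel" unfolding \<phi>_def[abs_def] \<gamma>_def[abs_def] by measurable
    have \<phi>0: "0 \<le> \<phi> t" and \<gamma>0: "0 \<le> \<gamma> t" for t using nonneg by (auto simp: \<phi>_def \<gamma>_def)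
    have \<phi>1: "(\<integral>\<^sup>+x. ennreal (\<phi> x powr p) \<partial>\<sigma>) \<le> 1"
    proof -
      have "(\<integral>\<^sup>+x. ennreal (\<phi> x powr p) \<partial>\<sigma>) = (\<integral>\<^sup>+x. ennreal (f x powr p * w x powr p) \<partial>lborel)"
        unfolding \<sigma>_def
      proof (subst nn_integral_density; (measurable)?; intro nn_integral_cong)
        fix x
        have "w x powr (- p') * (f x * w x powr p') powr p = f x powr p * w x powr (- p' + p' * p)"
          using nonneg[of x] unfolding powr_add by (simp add: powr_mult powr_powr mult.left_commute)
        then show "ennreal (w x powr - p') * ennreal (\<phi> x powr p) = ennreal (f x powr p * w x powr p)"
          using powr_relations(1) by (simp add: \<phi>_def algebra_simps flip: ennreal_mult'')
      qed
      then show ?thesis using f1 by simp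
    qed
    have \<gamma>1: "(\<integral>\<^sup>+x. ennreal (\<gamma> x powr q') \<partial>\<nu>) \<le> 1"
    proof -
      have "(\<integral>\<^sup>+x. ennreal (\<gamma> x powr q') \<partial>\<nu>) = (\<integral>\<^sup>+x. ennreal (g x powr q' * w x powr (- q')) \<partial>lborel)"
        unfolding \<nu>_def
      proof (subst nn_integral_density; (measurable)?; intro nn_integral_cong)
        fix x
        have "w x powr q * (g x * w x powr (- q)) powr q' = g x powr q' * w x powr (q + (- q) * q')"
          using nonneg[of x] unfolding powr_add by (simp add: powr_mult powr_powr mult.left_commute)
        moreover have "q + (- q) * q' = - q'" using q'(3) by (simp add: algebra_simps)
        ultimately show "ennreal (w x powr q) * ennreal (\<gamma> x powr q') = ennreal (g x powr q' * w x powr (- q'))"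
          by (simp add: \<gamma>_def flip: ennreal_mult'')
      qed
      then show ?thesis using g1 by simp
    qed
    have le1p: "y \<le> 1 + y powr r" if "0 \<le> y" "1 < r" for y r :: real
    proof (cases "y \<le> 1")
      case True then show ?thesis by (simp add: add_increasing2)
    next
      case False
      then have "y powr 1 \<le> y powr r" using that by (intro powr_mono) auto
      then show ?thesis using False by simp
    qed
    define mf where "mf R = (LINT x:node_set R|\<sigma>. \<phi> x)" for R
    define mg where "mg R = (LINT x:node_set R|\<nu>. \<gamma> x)" for R
    have mf: "ennreal (mf R) = (\<integral>\<^sup>+t. ennreal (f t) * indicator (node_set R) t \<partial>lborel)" for R
    proof -
      have "(\<integral>\<^sup>+x. ennreal (indicator (node_set R) x * \<phi> x) \<partial>\<sigma>) \<le> (\<integral>\<^sup>+x. indicator (node_set R) x + ennreal (\<phi> x powr p) \<partial>\<sigma>)"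
      proof (rule nn_integral_mono)
        fix x
        have "ennreal (\<phi> x) \<le> ennreal (1 + \<phi> x powr p)" by (intro ennreal_leI le1p \<phi>0 p)
        then show "ennreal (indicator (node_set R) x * \<phi> x) \<le> indicator (node_set R) x + ennreal (\<phi> x powr p)"
          by (auto simp: indicator_def)
      qed
      also have "\<dots> \<le> emeasure \<sigma> (node_set R) + 1" using \<phi>1 by (subst nn_integral_add) (auto intro: add_mono)
      also have "\<dots> < \<infinity>" using fin\<sigma>[of R] by simp
      finally have fin: "(\<integral>\<^sup>+x. ennreal (indicator (node_set R) x * \<phi> x) \<partial>\<sigma>) < \<infinity>" .
      have "mf R = enn2real (\<integral>\<^sup>+x. ennreal (indicator (node_set R) x * \<phi> x) \<partial>\<sigma>)"
        unfolding mf_def set_lebesgue_integral_def using \<phi>0 by (subst integral_eq_nn_integral) auto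
      then have "ennreal (mf R) = (\<integral>\<^sup>+x. ennreal (indicator (node_set R) x * \<phi> x) \<partial>\<sigma>)" using fin by simp
      also have "\<dots> = (\<integral>\<^sup>+t. ennreal (f t) * indicator (node_set R) t \<partial>lborel)"
        unfolding \<sigma>_def
      proof (subst nn_integral_density; (measurable)?; intro nn_integral_cong)
        fix x
        have "w x powr (- p') * (f x * w x powr p') = f x"
          using w_pos[of x] by (simp add: powr_minus)
        then show "ennreal (w x powr - p') * ennreal (indicator (node_set R) x * \<phi> x) = ennreal (f x) * indicator (node_set R) x"
          using nonneg[of x] by (auto simp: \<phi>_def indicator_def simp flip: ennreal_mult'')
      qed
      finally show ?thesis .
    qed
    have mg: "ennreal (mg R) = (\<integral>\<^sup>+t. ennreal (g t) * indicator (node_set R) t \<partial>lborel)" for R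
    proof -
      have "(\<integral>\<^sup>+x. ennreal (indicator (node_set R) x * \<gamma> x) \<partial>\<nu>) \<le> (\<integral>\<^sup>+x. indicator (node_set R) x + ennreal (\<gamma> x powr q') \<partial>\<nu>)"
      proof (rule nn_integral_mono)
        fix x
        have "ennreal (\<gamma> x) \<le> ennreal (1 + \<gamma> x powr q')" by (intro ennreal_leI le1p \<gamma>0 q')
        then show "ennreal (indicator (node_set R) x * \<gamma> x) \<le> indicator (node_set R) x + ennreal (\<gamma> x powr q')"
          by (auto simp: indicator_def)
      qed
      also have "\<dots> \<le> emeasure \<nu> (node_set R) + 1" using \<gamma>1 by (subst nn_integral_add) (auto intro: add_mono)
      also have "\<dots> < \<infinity>" using fin\<nu>[of R] by simp
      finally have fin: "(\<integral>\<^sup>+x. ennreal (indicator (node_set R) x * \<gamma> x) \<partial>\<nu>) < \<infinity>" .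
      have "mg R = enn2real (\<integral>\<^sup>+x. ennreal (indicator (node_set R) x * \<gamma> x) \<partial>\<nu>)"
        unfolding mg_def set_lebesgue_integral_def using \<gamma>0 by (subst integral_eq_nn_integral) auto
      then have "ennreal (mg R) = (\<integral>\<^sup>+x. ennreal (indicator (node_set R) x * \<gamma> x) \<partial>\<nu>)" using fin by simp
      also have "\<dots> = (\<integral>\<^sup>+t. ennreal (g t) * indicator (node_set R) t \<partial>lborel)"
        unfolding \<nu>_def
      proof (subst nn_integral_density; (measurable)?; intro nn_integral_cong)
        fix x
        have "w x powr q * (g x * w x powr (- q)) = g x"
          using w_pos[of x] by (simp add: powr_minus)
        then show "ennreal (w x powr q) * ennreal (indicator (node_set R) x * \<gamma> x) = ennreal (g x) * indicator (node_set R) x"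
          using nonneg[of x] by (auto simp: \<gamma>_def indicator_def simp flip: ennreal_mult'')
      qed
      finally show ?thesis .
    qed
    have mf0: "0 \<le> mf R" and mg0: "0 \<le> mg R" for R
      unfolding mf_def mg_def set_lebesgue_integral_def using \<phi>0 \<gamma>0 by (auto intro!: integral_nonneg_AE)
    define X where "X R = measure \<sigma> (node_set (right_half R)) powr (s / p - s) * mf (right_half R) powr s" for R
    define Y where "Y R = measure \<nu> (node_set (left_half R)) powr (s' / q' - s') * mg (left_half R) powr s'" for R
    have X: "tree_sum left_half right_half X n Q \<le> K1"
      unfolding X_def mf_def K1_def
      by (rule tree_sum_strong_type[OF sigma_finite_\<sigma> _ _ fin\<sigma> node_set_split grow\<sigma> c(1) p s(1) \<phi>0 \<phi>1]) auto
    have "tree_sum right_half left_half Y n Q \<le> K2"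
      unfolding Y_def mg_def K2_def
      by (rule tree_sum_strong_type[OF sigma_finite_\<nu> _ _ fin\<nu> node_set_split' grow\<nu> c(2) q'(1) q's' \<gamma>0 \<gamma>1]) auto
    then have Y: "tree_sum left_half right_half Y n Q \<le> K2" by (subst tree_sum_swap)
    have node: "snd R powr (\<alpha> - 1) * (mf (right_half R) * mg (left_half R)) \<le> C * (X R / s + Y R / s')" for R
    proof (cases "snd R > 0")
      case False
      then have "mf (right_half R) = 0" by (simp add: mf_def node_set_def right_half_def set_lebesgue_integral_def)
      then show ?thesis using C_pos s s' by (auto simp: X_def Y_def)
    next
      case True
      define l where "l = snd R"
      define S where "S = measure \<sigma> (node_set (right_half R))"
      define N where "N = measure \<nu> (node_set (left_half R))"
      \<comment> \<open>The powers of u and v with exponents s and s' are exactly the summands X and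
        Y, since s/p - s = -s/p' and s'/q' - s' = -s'/q.\<close>
      define u where "u = S powr (- (1 / p')) * mf (right_half R)"
      define v where "v = N powr (- (1 / q)) * mg (left_half R)"
      have l: "l > 0" using True by (simp add: l_def)
      have "node_set (right_half R) = {fst R + l / 2..<fst R + l}"
        "node_set (left_half R) = {fst R..<fst R + l / 2}"
        by (auto simp: node_set_def right_half_def left_half_def l_def)
      then have SN: "S > 0" "N > 0"
        using measure_pos(2)[of "fst R + l / 2" "fst R + l"] measure_pos(1)[of "fst R" "fst R + l / 2"] l
        by (simp_all add: S_def N_def)
      have uv: "0 \<le> u" "0 \<le> v" using mf0 mg0 by (auto simp: u_def v_def)
      have "N powr (1 / q) * S powr (1 / p') \<le> C * (l / 2) powr (1 - \<alpha>)"
        using A_plus_halfopen[of "l / 2" "fst R + l / 2"] l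
        by (simp add: S_def N_def node_set_def right_half_def left_half_def l_def)
      also have "\<dots> \<le> C * l powr (1 - \<alpha>)" using l C_pos \<alpha> by (intro mult_left_mono powr_mono2) auto
      finally have "l powr (\<alpha> - 1) * (N powr (1 / q) * S powr (1 / p')) \<le> l powr (\<alpha> - 1) * (C * l powr (1 - \<alpha>))"
        by (intro mult_left_mono) auto
      also have "\<dots> = C" using l by (simp flip: powr_add)
      finally have co: "l powr (\<alpha> - 1) * (N powr (1 / q) * S powr (1 / p')) \<le> C" .
      have "l powr (\<alpha> - 1) * (mf (right_half R) * mg (left_half R))
        = l powr (\<alpha> - 1) * (N powr (1 / q) * S powr (1 / p')) * (u * v)"
        using SN by (simp add: u_def v_def powr_minus field_simps)
      also have "\<dots> \<le> C * (u * v)" using co uv by (intro mult_right_mono) auto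
      also have "\<dots> \<le> C * (u powr s / s + v powr s' / s')"
        using C_pos uv s s' by (intro mult_left_mono Youngs_inequality) auto
      also have "u powr s = X R"
        using mf0 powr_relations(2)[of s] by (simp add: u_def X_def S_def powr_mult powr_powr)
      also have "v powr s' = Y R"
      proof -
        have "s' / q + s' / q' = s' * (1 / q + 1 / q')" by (simp add: distrib_left)
        then have "s' / q' - s' = - s' / q" unfolding q'(2) by simp
        then show ?thesis using mg0 by (simp add: v_def Y_def N_def powr_mult powr_powr)
      qed
      finally show ?thesis by (simp add: l_def)
    qed
    have XY0: "0 \<le> X R" "0 \<le> Y R" for R by (auto simp: X_def Y_def)
    have "(\<integral>\<^sup>+x. \<integral>\<^sup>+t. tree_kernel \<alpha> n Q x t * ennreal (f t * g x) \<partial>lborel \<partial>lborel)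
      = (\<integral>\<^sup>+x. \<integral>\<^sup>+t. tree_sum left_half right_half (\<lambda>Q. ennreal (f t * g x) * (ennreal (snd Q powr (\<alpha> - 1)) *
           (indicator (node_set (left_half Q)) x * indicator (node_set (right_half Q)) t))) n Q \<partial>lborel \<partial>lborel)"
      unfolding tree_kernel_def tree_sum_cmult by (simp add: mult.commute)
    also have "\<dots> = (\<integral>\<^sup>+x. tree_sum left_half right_half (\<lambda>Q. \<integral>\<^sup>+t. ennreal (f t * g x) * (ennreal (snd Q powr (\<alpha> - 1)) *
           (indicator (node_set (left_half Q)) x * indicator (node_set (right_half Q)) t)) \<partial>lborel) n Q \<partial>lborel)"
      by (intro nn_integral_cong nn_integral_tree_sum) measurable
    also have "\<dots> = tree_sum left_half right_half (\<lambda>Q. \<integral>\<^sup>+x. \<integral>\<^sup>+t. ennreal (f t * g x) * (ennreal (snd Q powr (\<alpha> - 1)) *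
           (indicator (node_set (left_half Q)) x * indicator (node_set (right_half Q)) t)) \<partial>lborel \<partial>lborel) n Q"
      by (intro nn_integral_tree_sum) measurable
    also have "\<dots> \<le> tree_sum left_half right_half (\<lambda>R. ennreal (C * (X R / s + Y R / s'))) n Q"
    proof (rule tree_sum_mono)
      fix R
      have "(\<integral>\<^sup>+x. \<integral>\<^sup>+t. ennreal (f t * g x) * (ennreal (snd R powr (\<alpha> - 1)) *
           (indicator (node_set (left_half R)) x * indicator (node_set (right_half R)) t)) \<partial>lborel \<partial>lborel)
        = (\<integral>\<^sup>+x. \<integral>\<^sup>+t. (ennreal (snd R powr (\<alpha> - 1)) * (ennreal (g x) * indicator (node_set (left_half R)) x)) * (ennreal (f t) * indicator (node_set (right_half R)) t) \<partial>lborel \<partial>lborel)"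
        using nonneg by (simp add: ennreal_mult' ac_simps)
      also have "\<dots> = ennreal (snd R powr (\<alpha> - 1)) * (ennreal (mf (right_half R)) * ennreal (mg (left_half R)))"
        unfolding mf mg by (simp add: nn_integral_cmult nn_integral_multc del: mult.assoc) (simp only: ac_simps)
      also have "\<dots> = ennreal (snd R powr (\<alpha> - 1) * (mf (right_half R) * mg (left_half R)))"
        using mf0 mg0 by (simp flip: ennreal_mult'')
      also have "\<dots> \<le> ennreal (C * (X R / s + Y R / s'))" by (intro ennreal_leI node)
      finally show "(\<integral>\<^sup>+x. \<integral>\<^sup>+t. ennreal (f t * g x) * (ennreal (snd R powr (\<alpha> - 1)) *
           (indicator (node_set (left_half R)) x * indicator (node_set (right_half R)) t)) \<partial>lborel \<partial>lborel)
         \<le> ennreal (C * (X R / s + Y R / s'))" .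
    qed
    also have "\<dots> = ennreal (tree_sum left_half right_half (\<lambda>R. C * (X R / s + Y R / s')) n Q)"
      by (rule tree_sum_ennreal) (use C_pos XY0 s s' in auto)
    also have "tree_sum left_half right_half (\<lambda>R. C * (X R / s + Y R / s')) n Q
      = C * (1 / s * tree_sum left_half right_half X n Q + 1 / s' * tree_sum left_half right_half Y n Q)"
      by (simp only: tree_sum_cmult[symmetric] tree_sum_add[symmetric]) simp
    also have "\<dots> \<le> K" unfolding K_def using X Y C_pos s s'
      by (intro mult_left_mono add_mono) (auto simp: field_simps)
    finally show ?thesis by (simp add: ennreal_leI)
  qed
  show ?thesis
    by (rule exI[of _ K]) (use K0 main[unfolded q'_def] in blast)
qed

end

section \<open>The weighted Hardy--Littlewood--Sobolev inequality\<close>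

definition frac_kernel :: "real \<Rightarrow> real \<Rightarrow> real" where
  "frac_kernel \<alpha> s = (if 0 < s then s powr (\<alpha> - 1) else 0)"

lemma frac_kernel_nonneg: "0 \<le> frac_kernel \<alpha> s" by (simp add: frac_kernel_def)

lemma frac_kernel_measurable[measurable]: "frac_kernel \<alpha> \<in> borel_measurable borel"
  unfolding frac_kernel_def[abs_def] by measurable

context one_sided_weight
begin

text \<open>On [-M, M) the kernel is at most c times the supremum over the depth of the sum of two
  dyadic kernels, with c = 6^(1 - \<alpha>) compensating the factor 6. The dyadic bound is the same
  for all roots and depths, so monotone convergence removes the depth and the restriction to a
  bounded interval.\<close>

lemma bilinear_bound:
  "\<exists>K\<ge>0. \<forall>f g. f \<in> borel_measurable borel \<longrightarrow> g \<in> borel_measurable borel \<longrightarrow>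
     (\<forall>x. 0 \<le> f x) \<longrightarrow> (\<forall>x. 0 \<le> g x) \<longrightarrow>
     (\<integral>\<^sup>+x. ennreal (f x powr p * w x powr p) \<partial>lborel) \<le> 1 \<longrightarrow>
     (\<integral>\<^sup>+x. ennreal (g x powr (q / (q - 1)) * w x powr (- (q / (q - 1)))) \<partial>lborel) \<le> 1 \<longrightarrow>
     (\<integral>\<^sup>+x. \<integral>\<^sup>+t. ennreal (frac_kernel \<alpha> (t - x)) * ennreal (f t * g x) \<partial>lborel \<partial>lborel) \<le> ennreal K"
proof -
  from tree_form_bound obtain K where K: "K \<ge> 0" "\<forall>n Q f g. f \<in> borel_measurable borel \<longrightarrow> g \<in> borel_measurable borel \<longrightarrow>
     (\<forall>x. 0 \<le> f x) \<longrightarrow> (\<forall>x. 0 \<le> g x) \<longrightarrow>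
     (\<integral>\<^sup>+x. ennreal (f x powr p * w x powr p) \<partial>lborel) \<le> 1 \<longrightarrow>
     (\<integral>\<^sup>+x. ennreal (g x powr (q / (q - 1)) * w x powr (- (q / (q - 1)))) \<partial>lborel) \<le> 1 \<longrightarrow>
     (\<integral>\<^sup>+x. \<integral>\<^sup>+t. tree_kernel \<alpha> n Q x t * ennreal (f t * g x) \<partial>lborel \<partial>lborel) \<le> ennreal K" by blast
  define c where "c = (6::real) powr (1 - \<alpha>)"
  have c: "c > 0" by (simp add: c_def)
  define K' where "K' = c * (K + K)"
  have main: "(\<integral>\<^sup>+x. \<integral>\<^sup>+t. ennreal (frac_kernel \<alpha> (t - x)) * ennreal (f t * g x) \<partial>lborel \<partial>lborel) \<le> ennreal K'"
    if [measurable]: "f \<in> borel_measurable borel" "g \<in> borel_measurable borel" and nonneg: "\<And>x. 0 \<le> f x" "\<And>x. 0 \<le> g x"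
      and f1: "(\<integral>\<^sup>+x. ennreal (f x powr p * w x powr p) \<partial>lborel) \<le> 1"
      and g1: "(\<integral>\<^sup>+x. ennreal (g x powr (q / (q - 1)) * w x powr (- (q / (q - 1)))) \<partial>lborel) \<le> 1" for f g
  proof -
    define J where "J m = {- real (Suc m)..<real (Suc m)}" for m
    have [measurable]: "J m \<in> sets borel" for m by (simp add: J_def)
    define P where "P m x t = ennreal (f t * g x) * (indicator (J m) x * indicator (J m) t)" for m x t
    have [measurable]: "(\<lambda>(x, t). P m x t) \<in> borel_measurable (lborel \<Otimes>\<^sub>M lborel)" for m
      unfolding P_def split_beta' by measurable
    have bound: "(\<integral>\<^sup>+x. \<integral>\<^sup>+t. ennreal (frac_kernel \<alpha> (t - x)) * P m x t \<partial>lborel \<partial>lborel) \<le> ennreal K'" for m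
    proof -
      define M where "M = real (Suc m)"
      define k where "k n x t = tree_kernel \<alpha> n (- 2 * M, 6 * M) x t + tree_kernel \<alpha> n (- 4 * M, 6 * M) x t" for n x t
      have [measurable]: "(\<lambda>(x, t). k n x t) \<in> borel_measurable (lborel \<Otimes>\<^sub>M lborel)" for n
      proof -
        have [measurable]: "(\<lambda>(x, t). tree_kernel \<alpha> n Q x t) \<in> borel_measurable (lborel \<Otimes>\<^sub>M lborel)" for Q
          using tree_kernel_measurable by (simp cong: measurable_cong_sets sets_pair_measure_cong)
        show ?thesis unfolding k_def split_beta' by measurable
      qed
      have inc: "incseq (\<lambda>n. ennreal c * (k n x t * P m x t))" for x t
        unfolding k_def incseq_def
        by (intro allI impI mult_left_mono mult_right_mono add_mono tree_kernel_mono) auto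
      have "ennreal (frac_kernel \<alpha> (t - x)) * P m x t \<le> (SUP n. ennreal c * (k n x t * P m x t))" for x t
      proof (cases "x < t \<and> x \<in> J m \<and> t \<in> J m")
        case False
        then have "ennreal (frac_kernel \<alpha> (t - x)) * P m x t = 0"
          by (auto simp: frac_kernel_def P_def)
        then show ?thesis by (simp only: zero_le)
      next
        case True
        then have "\<exists>n. ennreal ((6 * (t - x)) powr (\<alpha> - 1)) \<le> k n x t"
          unfolding k_def using \<alpha> by (intro tree_kernel_two_grids) (auto simp: J_def M_def)
        then obtain n where n: "ennreal ((6 * (t - x)) powr (\<alpha> - 1)) \<le> k n x t" ..
        have "frac_kernel \<alpha> (t - x) = c * (6 * (t - x)) powr (\<alpha> - 1)"
        proof -
          have "c * 6 powr (\<alpha> - 1) = 1" unfolding c_def by (simp flip: powr_add)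
          moreover have "(6 * (t - x)) powr (\<alpha> - 1) = 6 powr (\<alpha> - 1) * (t - x) powr (\<alpha> - 1)"
            using True by (intro powr_mult)
          ultimately show ?thesis using True by (simp add: frac_kernel_def flip: mult.assoc)
        qed
        then have "ennreal (frac_kernel \<alpha> (t - x)) * P m x t = ennreal c * (ennreal ((6 * (t - x)) powr (\<alpha> - 1)) * P m x t)"
          using c by (simp add: ennreal_mult mult.assoc)
        also have "\<dots> \<le> ennreal c * (k n x t * P m x t)" using n by (intro mult_left_mono mult_right_mono) auto
        also have "\<dots> \<le> (SUP n. ennreal c * (k n x t * P m x t))" by (rule SUP_upper) simp
        finally show ?thesis .
      qed
      then have "(\<integral>\<^sup>+x. \<integral>\<^sup>+t. ennreal (frac_kernel \<alpha> (t - x)) * P m x t \<partial>lborel \<partial>lborel)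
        \<le> (\<integral>\<^sup>+x. \<integral>\<^sup>+t. (SUP n. ennreal c * (k n x t * P m x t)) \<partial>lborel \<partial>lborel)"
        by (intro nn_integral_mono)
      also have "\<dots> = (SUP n. \<integral>\<^sup>+x. \<integral>\<^sup>+t. ennreal c * (k n x t * P m x t) \<partial>lborel \<partial>lborel)"
        by (rule nn_integral_SUP_nested[OF sigma_finite_lborel _ inc]) measurable
      also have "\<dots> \<le> ennreal K'"
      proof (rule SUP_least)
        fix n
        have tk: "(\<integral>\<^sup>+x. \<integral>\<^sup>+t. tree_kernel \<alpha> n Q x t * ennreal (f t * g x) \<partial>lborel \<partial>lborel) \<le> ennreal K" for Q
          using K(2) nonneg f1 g1 that(1,2) by blast
        have [measurable]: "(\<lambda>(x, t). tree_kernel \<alpha> n Q x t) \<in> borel_measurable (lborel \<Otimes>\<^sub>M lborel)" for Q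
          using tree_kernel_measurable by (simp cong: measurable_cong_sets sets_pair_measure_cong)
        have [measurable]: "(\<lambda>t. tree_kernel \<alpha> n Q x t) \<in> borel_measurable lborel" for Q x
          by measurable
        have "(\<integral>\<^sup>+x. \<integral>\<^sup>+t. ennreal c * (k n x t * P m x t) \<partial>lborel \<partial>lborel)
          \<le> (\<integral>\<^sup>+x. \<integral>\<^sup>+t. ennreal c * (tree_kernel \<alpha> n (- 2 * M, 6 * M) x t * ennreal (f t * g x) + tree_kernel \<alpha> n (- 4 * M, 6 * M) x t * ennreal (f t * g x)) \<partial>lborel \<partial>lborel)"
          by (intro nn_integral_mono mult_left_mono) (auto simp: k_def P_def indicator_def algebra_simps)
        also have "\<dots> = ennreal c * ((\<integral>\<^sup>+x. \<integral>\<^sup>+t. tree_kernel \<alpha> n (- 2 * M, 6 * M) x t * ennreal (f t * g x) \<partial>lborel \<partial>lborel)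
           + (\<integral>\<^sup>+x. \<integral>\<^sup>+t. tree_kernel \<alpha> n (- 4 * M, 6 * M) x t * ennreal (f t * g x) \<partial>lborel \<partial>lborel))"
          by (simp add: nn_integral_cmult nn_integral_add)
        also have "\<dots> \<le> ennreal c * (ennreal K + ennreal K)" by (intro mult_left_mono add_mono tk) auto
        also have "\<dots> = ennreal K'" using K(1) c by (simp add: K'_def flip: ennreal_plus ennreal_mult'')
        finally show "(\<integral>\<^sup>+x. \<integral>\<^sup>+t. ennreal c * (k n x t * P m x t) \<partial>lborel \<partial>lborel) \<le> ennreal K'" .
      qed
      finally show ?thesis .
    qed
    have inc: "incseq (\<lambda>m. ennreal (frac_kernel \<alpha> (t - x)) * P m x t)" for x t
      unfolding incseq_def P_def by (intro allI impI mult_left_mono) (auto simp: J_def indicator_def)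
    have "ennreal (frac_kernel \<alpha> (t - x)) * ennreal (f t * g x) \<le> (SUP m. ennreal (frac_kernel \<alpha> (t - x)) * P m x t)" for x t
    proof -
      obtain m where "\<bar>x\<bar> + \<bar>t\<bar> < real m" using reals_Archimedean2 by blast
      then have "x \<in> J m" "t \<in> J m" by (auto simp: J_def)
      then have "ennreal (frac_kernel \<alpha> (t - x)) * ennreal (f t * g x) = ennreal (frac_kernel \<alpha> (t - x)) * P m x t"
        by (simp add: P_def)
      also have "\<dots> \<le> (SUP m. ennreal (frac_kernel \<alpha> (t - x)) * P m x t)" by (rule SUP_upper) simp
      finally show ?thesis .
    qed
    then have "(\<integral>\<^sup>+x. \<integral>\<^sup>+t. ennreal (frac_kernel \<alpha> (t - x)) * ennreal (f t * g x) \<partial>lborel \<partial>lborel)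
      \<le> (\<integral>\<^sup>+x. \<integral>\<^sup>+t. (SUP m. ennreal (frac_kernel \<alpha> (t - x)) * P m x t) \<partial>lborel \<partial>lborel)"
      by (intro nn_integral_mono)
    also have "\<dots> = (SUP m. \<integral>\<^sup>+x. \<integral>\<^sup>+t. ennreal (frac_kernel \<alpha> (t - x)) * P m x t \<partial>lborel \<partial>lborel)"
      by (rule nn_integral_SUP_nested[OF sigma_finite_lborel _ inc]) measurable
    also have "\<dots> \<le> ennreal K'" by (intro SUP_least bound)
    finally show ?thesis .
  qed
  have "K' \<ge> 0" using K(1) c by (simp add: K'_def)
  then show ?thesis using main by blast
qed

text \<open>Duality. Truncating the values at n and the domain to [-n, n] makes the q-th power
  integral finite, so that it can be divided out; the resulting bound K^q is uniform in n. The
  supremum in the statement also detects points where the potential is infinite, at which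
  \<open>enn2real\<close> of the untruncated value would be 0.\<close>

lemma frac_integral_bound:
  "\<exists>K. \<forall>f. f \<in> borel_measurable borel \<longrightarrow> (\<forall>x. 0 \<le> f x) \<longrightarrow>
     (\<integral>\<^sup>+x. ennreal (f x powr p * w x powr p) \<partial>lborel) \<le> 1 \<longrightarrow>
     (\<integral>\<^sup>+x. (SUP n::nat. ennreal (enn2real (min (\<integral>\<^sup>+t. ennreal (frac_kernel \<alpha> (t - x)) * ennreal (f t) \<partial>lborel) (of_nat n)) powr q * w x powr q
        * indicator {- real n..real n} x)) \<partial>lborel) \<le> ennreal K"
proof -
  from bilinear_bound obtain K where K: "K \<ge> 0" "\<forall>f g. f \<in> borel_measurable borel \<longrightarrow> g \<in> borel_measurable borel \<longrightarrow>
     (\<forall>x. 0 \<le> f x) \<longrightarrow> (\<forall>x. 0 \<le> g x) \<longrightarrow>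
     (\<integral>\<^sup>+x. ennreal (f x powr p * w x powr p) \<partial>lborel) \<le> 1 \<longrightarrow>
     (\<integral>\<^sup>+x. ennreal (g x powr (q / (q - 1)) * w x powr (- (q / (q - 1)))) \<partial>lborel) \<le> 1 \<longrightarrow>
     (\<integral>\<^sup>+x. \<integral>\<^sup>+t. ennreal (frac_kernel \<alpha> (t - x)) * ennreal (f t * g x) \<partial>lborel \<partial>lborel) \<le> ennreal K" by blast
  define q' where "q' = q / (q - 1)"
  have q': "1 < q'" "1 - 1 / q' = 1 / q" "(q - 1) * q' = q" using q1 by (auto simp: q'_def field_simps)
  have "q' * q - q' = (q - 1) * q'" by (simp add: algebra_simps)
  with q' have q': "1 < q'" "1 - 1 / q' = 1 / q" "q' * q - q' = q" "(q - 1) * q' = q" by simp_all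
  have main: "(\<integral>\<^sup>+x. (SUP n::nat. ennreal (enn2real (min (T x) (of_nat n)) powr q * w x powr q * indicator {- real n..real n} x)) \<partial>lborel) \<le> ennreal (K powr q)"
    if [measurable]: "f \<in> borel_measurable borel" and nonneg: "\<And>x. 0 \<le> f x"
      and f1: "(\<integral>\<^sup>+x. ennreal (f x powr p * w x powr p) \<partial>lborel) \<le> 1"
      and T: "T = (\<lambda>x. \<integral>\<^sup>+t. ennreal (frac_kernel \<alpha> (t - x)) * ennreal (f t) \<partial>lborel)" for f T
  proof -
    have [measurable]: "T \<in> borel_measurable borel" unfolding T by measurable
    define R where "R n x = enn2real (min (T x) (of_nat n))" for n :: nat and x
    have [measurable]: "R n \<in> borel_measurable borel" for n unfolding R_def[abs_def] by measurable
    have R: "ennreal (R n x) = min (T x) (of_nat n)" "0 \<le> R n x" "R n x \<le> real n" for n x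
    proof -
      have fin: "min (T x) (of_nat n) < \<infinity>" by (metis ennreal_of_nat_neq_top infinity_ennreal_def min.strict_coboundedI2 top.not_eq_extremum)
      then show "ennreal (R n x) = min (T x) (of_nat n)" by (simp add: R_def)
      then have "ennreal (R n x) \<le> ennreal (real n)" by (simp add: ennreal_of_nat_eq_real_of_nat)
      then show "R n x \<le> real n" by simp
      show "0 \<le> R n x" by (simp add: R_def)
    qed
    have Rmono: "R m x \<le> R n x" if "m \<le> n" for m n x
    proof -
      have "ennreal (R m x) \<le> ennreal (R n x)" unfolding R using that by (intro min.mono) auto
      then show ?thesis using R(2) by (simp)
    qed
    define h where "h n x = R n x powr q * w x powr q * indicator {- real n..real n} x" for n x
    have [measurable]: "h n \<in> borel_measurable borel" for n unfolding h_def[abs_def] by measurable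
    have h0: "0 \<le> h n x" for n x by (simp add: h_def)
    have hmono: "h m x \<le> h n x" if "m \<le> n" for m n x
      unfolding h_def using that Rmono[OF that, of x] R(2) q1
      by (intro mult_mono powr_mono2) (auto simp: indicator_def less_imp_le[OF w_pos])
    have bound: "(\<integral>\<^sup>+x. ennreal (h n x) \<partial>lborel) \<le> ennreal (K powr q)" for n
    proof -
      have "(\<integral>\<^sup>+x. ennreal (h n x) \<partial>lborel) \<le> (\<integral>\<^sup>+x. ennreal (real n powr q) * (ennreal (w x powr q) * indicator {- real n..real n} x) \<partial>lborel)"
      proof (rule nn_integral_mono)
        fix x
        have "h n x \<le> real n powr q * (w x powr q * indicator {- real n..real n} x)"
          using R[of n x] q1 by (auto simp: h_def indicator_def intro!: mult_right_mono powr_mono2)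
        then show "ennreal (h n x) \<le> ennreal (real n powr q) * (ennreal (w x powr q) * indicator {- real n..real n} x)"
          by (auto simp: indicator_def ennreal_leI ennreal_neg simp flip: ennreal_mult'')
      qed
      also have "\<dots> = ennreal (real n powr q) * emeasure \<nu> {- real n..real n}"
        by (simp add: emeasure_\<nu> nn_integral_cmult)
      also have "\<dots> < \<infinity>" using finite_\<nu>[of "{- real n..real n}" "- real n" "real n"] by (simp add: ennreal_mult_less_top)
      finally have fin: "(\<integral>\<^sup>+x. ennreal (h n x) \<partial>lborel) < \<infinity>" .
      define A where "A = enn2real (\<integral>\<^sup>+x. ennreal (h n x) \<partial>lborel)"
      have A: "(\<integral>\<^sup>+x. ennreal (h n x) \<partial>lborel) = ennreal A" "0 \<le> A" using fin by (auto simp: A_def)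
      show ?thesis
      proof (cases "A = 0")
        case True
        then show ?thesis using A by simp
      next
        case False
        then have Ap: "A > 0" using A by simp
        \<comment> \<open>The extremal function of Hoelder's inequality: its dual norm is 1, and its
          pairing with \<open>R n\<close> is A^(1 - 1/q') = A^(1/q).\<close>
        define g where "g x = A powr (- 1 / q') * (R n x powr (q - 1) * w x powr q * indicator {- real n..real n} x)" for x
        have [measurable]: "g \<in> borel_measurable borel" unfolding g_def[abs_def] by measurable
        have g0: "0 \<le> g x" for x by (simp add: g_def)
        have "(\<integral>\<^sup>+x. ennreal (g x powr q' * w x powr (- q')) \<partial>lborel) = (\<integral>\<^sup>+x. ennreal (1 / A) * ennreal (h n x) \<partial>lborel)"
        proof (rule nn_integral_cong)
          fix x
          have "(w x powr q) powr q' * w x powr (- q') = w x powr q"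
            using q'(3) by (simp add: powr_powr mult.commute flip: powr_add)
          moreover have "(R n x powr (q - 1)) powr q' = R n x powr q" using q'(4) by (simp add: powr_powr)
          moreover have "(A powr (- 1 / q')) powr q' = 1 / A"
          proof -
            have "(A powr (- 1 / q')) powr q' = A powr (- 1)" unfolding powr_powr using q'(1) by simp
            then show ?thesis using Ap by (simp add: powr_minus_divide)
          qed
          ultimately have "g x powr q' * w x powr (- q') = 1 / A * h n x"
            by (cases "x \<in> {- real n..real n}") (auto simp: g_def h_def powr_mult)
          then show "ennreal (g x powr q' * w x powr (- q')) = ennreal (1 / A) * ennreal (h n x)"
            using h0 by (simp only: ennreal_mult'')
        qed
        also have "\<dots> = ennreal (1 / A) * ennreal A" using A by (simp add: nn_integral_cmult)
        also have "\<dots> = 1" using Ap by (simp flip: ennreal_mult'')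
        finally have g1: "(\<integral>\<^sup>+x. ennreal (g x powr q' * w x powr (- q')) \<partial>lborel) = 1" .
        have "(\<integral>\<^sup>+x. \<integral>\<^sup>+t. ennreal (frac_kernel \<alpha> (t - x)) * ennreal (f t * g x) \<partial>lborel \<partial>lborel) \<le> ennreal K"
        proof -
          have g1': "(\<integral>\<^sup>+x. ennreal (g x powr (q / (q - 1)) * w x powr (- (q / (q - 1)))) \<partial>lborel) \<le> 1" using g1 unfolding q'_def by simp
          have "g \<in> borel_measurable borel" by measurable
          then show ?thesis using K(2) that(1) nonneg g0 f1 g1' by blast
        qed
        moreover have "ennreal (A powr (1 / q)) \<le> (\<integral>\<^sup>+x. \<integral>\<^sup>+t. ennreal (frac_kernel \<alpha> (t - x)) * ennreal (f t * g x) \<partial>lborel \<partial>lborel)"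
        proof -
          have "A powr (- 1 / q') * A = A powr (1 - 1 / q')" using Ap by (simp add: powr_diff powr_minus field_simps)
          then have "ennreal (A powr (1 / q)) = ennreal (A powr (- 1 / q')) * ennreal A"
            using q'(2) A by (simp flip: ennreal_mult'')
          also have "\<dots> = (\<integral>\<^sup>+x. ennreal (A powr (- 1 / q')) * ennreal (h n x) \<partial>lborel)"
            using A by (simp add: nn_integral_cmult)
          also have "\<dots> \<le> (\<integral>\<^sup>+x. ennreal (g x) * T x \<partial>lborel)"
          proof (rule nn_integral_mono)
            fix x
            have "R n x powr q = R n x powr (q - 1) * R n x"
              using R(2)[of n x] by (cases "R n x = 0") (auto simp: powr_diff)
            then have "A powr (- 1 / q') * h n x = g x * R n x" by (simp add: g_def h_def)
            then have "ennreal (A powr (- 1 / q')) * ennreal (h n x) = ennreal (g x) * ennreal (R n x)"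
              using h0 g0 R(2) by (simp flip: ennreal_mult'')
            also have "\<dots> \<le> ennreal (g x) * T x" unfolding R by (intro mult_left_mono) auto
            finally show "ennreal (A powr (- 1 / q')) * ennreal (h n x) \<le> ennreal (g x) * T x" .
          qed
          also have "\<dots> = (\<integral>\<^sup>+x. \<integral>\<^sup>+t. ennreal (frac_kernel \<alpha> (t - x)) * ennreal (f t * g x) \<partial>lborel \<partial>lborel)"
            unfolding T using nonneg g0
            by (intro nn_integral_cong) (auto simp: nn_integral_cmult[symmetric] ennreal_mult ac_simps)
          finally show ?thesis .
        qed
        ultimately have "ennreal (A powr (1 / q)) \<le> ennreal K" by (rule order_trans[rotated])
        then have "A powr (1 / q) \<le> K" using K by simp
        then have "(A powr (1 / q)) powr q \<le> K powr q" using q1 by (intro powr_mono2) auto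
        then show ?thesis using A q1 by (simp add: powr_powr ennreal_leI)
      qed
    qed
    have "(\<integral>\<^sup>+x. (SUP n. ennreal (h n x)) \<partial>lborel) = (SUP n. \<integral>\<^sup>+x. ennreal (h n x) \<partial>lborel)"
      by (rule nn_integral_monotone_convergence_SUP) (auto simp: incseq_def le_fun_def hmono ennreal_leI)
    also have "\<dots> \<le> ennreal (K powr q)" by (intro SUP_least bound)
    finally show ?thesis unfolding h_def R_def .
  qed
  then show ?thesis by blast
qed

text \<open>Homogeneity reduces to normalised f. The supremum H of the truncated integrands has
  finite integral, hence is finite almost everywhere, and at such points the potential is finite and
  its weighted q-th power is at most H.\<close>

theorem frac_integral_Lq:
  assumes [measurable]: "f \<in> borel_measurable borel"
    and fin: "(\<integral>\<^sup>+x. ennreal (\<bar>f x\<bar> powr p * w x powr p) \<partial>lborel) < \<infinity>"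
  defines "T \<equiv> (\<lambda>x. \<integral>\<^sup>+s. ennreal (frac_kernel \<alpha> s * \<bar>f (x + s)\<bar>) \<partial>lborel)"
  shows "AE x in lborel. T x < \<infinity>"
    and "(\<integral>\<^sup>+x. ennreal (enn2real (T x) powr q * w x powr q) \<partial>lborel) < \<infinity>"
proof -
  from frac_integral_bound obtain K where K: "\<forall>f. f \<in> borel_measurable borel \<longrightarrow> (\<forall>x. 0 \<le> f x) \<longrightarrow>
     (\<integral>\<^sup>+x. ennreal (f x powr p * w x powr p) \<partial>lborel) \<le> 1 \<longrightarrow>
     (\<integral>\<^sup>+x. (SUP n::nat. ennreal (enn2real (min (\<integral>\<^sup>+t. ennreal (frac_kernel \<alpha> (t - x)) * ennreal (f t) \<partial>lborel) (of_nat n)) powr q * w x powr q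
        * indicator {- real n..real n} x)) \<partial>lborel) \<le> ennreal K" by blast
  define b where "b = enn2real (\<integral>\<^sup>+x. ennreal (\<bar>f x\<bar> powr p * w x powr p) \<partial>lborel)"
  have b: "(\<integral>\<^sup>+x. ennreal (\<bar>f x\<bar> powr p * w x powr p) \<partial>lborel) = ennreal b" "b \<ge> 0" using fin by (auto simp: b_def)
  \<comment> \<open>With b + 1 in place of b the normalisation covers b = 0 as well.\<close>
  define c where "c = (b + 1) powr (- 1 / p)"
  have "c powr p = (b + 1) powr (- 1)" unfolding c_def powr_powr using p by simp
  then have c: "c > 0" "c powr p = 1 / (b + 1)" using b by (auto simp: c_def powr_minus_divide)
  define f' where "f' x = c * \<bar>f x\<bar>" for x
  define T' where "T' x = (\<integral>\<^sup>+t. ennreal (frac_kernel \<alpha> (t - x)) * ennreal (f' t) \<partial>lborel)" for x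
  have [measurable]: "f' \<in> borel_measurable borel" unfolding f'_def[abs_def] by measurable
  have [measurable]: "T' \<in> borel_measurable borel" unfolding T'_def[abs_def] by measurable
  have f'0: "\<forall>x. 0 \<le> f' x" using c by (simp add: f'_def)
  have "(\<integral>\<^sup>+x. ennreal (f' x powr p * w x powr p) \<partial>lborel) = (\<integral>\<^sup>+x. ennreal (1 / (b + 1)) * ennreal (\<bar>f x\<bar> powr p * w x powr p) \<partial>lborel)"
    by (intro nn_integral_cong) (use c in \<open>auto simp: f'_def powr_mult simp flip: ennreal_mult''\<close>)
  also have "\<dots> = ennreal (1 / (b + 1)) * ennreal b" using b by (simp add: nn_integral_cmult)
  also have "\<dots> \<le> 1" using b by (simp add: divide_le_eq flip: ennreal_mult'')
  finally have f'1: "(\<integral>\<^sup>+x. ennreal (f' x powr p * w x powr p) \<partial>lborel) \<le> 1" .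
  define H where "H x = (SUP n::nat. ennreal (enn2real (min (T' x) (of_nat n)) powr q * w x powr q * indicator {- real n..real n} x))" for x
  have [measurable]: "H \<in> borel_measurable borel" unfolding H_def[abs_def] by measurable
  have f'm: "f' \<in> borel_measurable borel" by measurable
  have "(\<integral>\<^sup>+x. H x \<partial>lborel) \<le> ennreal K"
    unfolding H_def T'_def using K f'm f'0 f'1 by blast
  then have Hfin: "(\<integral>\<^sup>+x. H x \<partial>lborel) < \<infinity>" by (rule le_less_trans) simp
  then have "AE x in lborel. H x \<noteq> \<infinity>" by (intro nn_integral_noteq_infinite) auto
  have T'T: "T' x = ennreal c * T x" for x
  proof -
    have "T' x = (\<integral>\<^sup>+s. ennreal (frac_kernel \<alpha> (x + s - x)) * ennreal (f' (x + s)) \<partial>lborel)"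
      unfolding T'_def by (subst nn_integral_real_affine[where c=1 and t=x]) auto
    also have "\<dots> = (\<integral>\<^sup>+s. ennreal c * ennreal (frac_kernel \<alpha> s * \<bar>f (x + s)\<bar>) \<partial>lborel)"
      by (intro nn_integral_cong) (use c in \<open>auto simp: f'_def frac_kernel_nonneg ac_simps simp flip: ennreal_mult''\<close>)
    finally show ?thesis by (simp add: nn_integral_cmult T_def)
  qed
  have T'fin: "T' x < \<infinity>" if H: "H x \<noteq> \<infinity>" for x
  proof (rule ccontr)
    assume "\<not> T' x < \<infinity>"
    then have T': "T' x = \<infinity>" by (metis infinity_ennreal_def top.not_eq_extremum)
    obtain B where B: "H x = ennreal B" "0 \<le> B" using H by (cases "H x") auto
    \<comment> \<open>If \<open>T' x\<close> were infinite, the n-th truncation would contribute n^q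
      w^q >= n w^q > B + 1, beyond the finite value B of \<open>H x\<close>.\<close>
    obtain n :: nat where n: "n > \<bar>x\<bar> + (B + 1) / (w x powr q) + 1" using reals_Archimedean2 by blast
    have wq: "w x powr q > 0" using w_pos[of x] by simp
    have "0 \<le> (B + 1) / (w x powr q)" using B wq by simp
    then have "real n > 1" "\<bar>x\<bar> < real n" using n by linarith+
    then have n1: "real n > 1" "x \<in> {- real n..real n}" by auto
    have "real n * w x powr q > B + 1"
    proof -
      have "(B + 1) / (w x powr q) < real n" using n by linarith
      then show ?thesis using wq by (simp add: field_simps)
    qed
    moreover have "real n * w x powr q \<le> real n powr q * w x powr q"
      using n1 q1 wq powr_mono[of 1 q "real n"] by (intro mult_right_mono) auto
    moreover have "ennreal (real n powr q * w x powr q) \<le> H x"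
    proof -
      have "ennreal (real n powr q * w x powr q) = ennreal (enn2real (min (T' x) (of_nat n)) powr q * w x powr q * indicator {- real n..real n} x)"
        using T' n1 by (simp add: ennreal_of_nat_eq_real_of_nat)
      also have "\<dots> \<le> H x" unfolding H_def by (rule SUP_upper) simp
      finally show ?thesis .
    qed
    ultimately show False using B by simp
  qed
  have Hge: "ennreal (enn2real (T' x) powr q * w x powr q) \<le> H x" if H: "H x \<noteq> \<infinity>" for x
  proof -
    obtain n :: nat where n: "n > \<bar>x\<bar> + enn2real (T' x)" using reals_Archimedean2 by blast
    have "T' x = ennreal (enn2real (T' x))" using T'fin[OF H] by simp
    also have "\<dots> \<le> of_nat n" using n by (subst ennreal_of_nat_eq_real_of_nat) (intro ennreal_leI, linarith)
    finally have "min (T' x) (of_nat n) = T' x" by (simp add: min_absorb1)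
    moreover have "x \<in> {- real n..real n}"
    proof -
      have "0 \<le> enn2real (T' x)" by simp
      then have "\<bar>x\<bar> < real n" using n by linarith
      then show ?thesis by auto
    qed
    ultimately have "ennreal (enn2real (T' x) powr q * w x powr q) = ennreal (enn2real (min (T' x) (of_nat n)) powr q * w x powr q * indicator {- real n..real n} x)"
      by simp
    also have "\<dots> \<le> H x" unfolding H_def by (rule SUP_upper) simp
    finally show ?thesis .
  qed
  show "AE x in lborel. T x < \<infinity>"
    using \<open>AE x in lborel. H x \<noteq> \<infinity>\<close>
  proof eventually_elim
    case (elim x)
    then have "ennreal c * T x < \<infinity>" using T'fin T'T by simp
    then show ?case using c by (auto simp: ennreal_mult_less_top)
  qed
  have "(\<integral>\<^sup>+x. ennreal (enn2real (T x) powr q * w x powr q) \<partial>lborel) \<le> (\<integral>\<^sup>+x. ennreal (c powr (- q)) * H x \<partial>lborel)"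
  proof (rule nn_integral_mono_AE)
    show "AE x in lborel. ennreal (enn2real (T x) powr q * w x powr q) \<le> ennreal (c powr (- q)) * H x"
      using \<open>AE x in lborel. H x \<noteq> \<infinity>\<close>
    proof eventually_elim
      case (elim x)
      have "enn2real (T' x) = c * enn2real (T x)" using c by (simp add: T'T enn2real_mult)
      then have "enn2real (T x) powr q * w x powr q = c powr (- q) * (enn2real (T' x) powr q * w x powr q)"
        using c by (simp add: powr_mult powr_minus)
      then have "ennreal (enn2real (T x) powr q * w x powr q) = ennreal (c powr (- q)) * ennreal (enn2real (T' x) powr q * w x powr q)"
        by (simp only: ennreal_mult'' mult_nonneg_nonneg powr_ge_zero)
      also have "\<dots> \<le> ennreal (c powr (- q)) * H x" by (intro mult_left_mono Hge elim) auto
      finally show ?case .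
    qed
  qed
  also have "\<dots> = ennreal (c powr (- q)) * (\<integral>\<^sup>+x. H x \<partial>lborel)" by (simp add: nn_integral_cmult)
  also have "\<dots> < \<infinity>" using Hfin by (simp add: ennreal_mult_less_top)
  finally show "(\<integral>\<^sup>+x. ennreal (enn2real (T x) powr q * w x powr q) \<partial>lborel) < \<infinity>" .
qed

end

section \<open>Convolution with decreasing kernels\<close>

text \<open>An infinite base has its own clause because \<open>enn2real\<close> sends \<infinity> to
  0, which would turn divergent integrals into vanishing ones.\<close>

definition ennpowr :: "ennreal \<Rightarrow> real \<Rightarrow> ennreal" where
  "ennpowr x r = (if x = \<infinity> then \<infinity> else ennreal (enn2real x powr r))"

lemma ennpowr_ennreal[simp]: "0 \<le> x \<Longrightarrow> ennpowr (ennreal x) r = ennreal (x powr r)"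
  by (simp add: ennpowr_def)

lemma ennpowr_mono: "x \<le> y \<Longrightarrow> 0 \<le> r \<Longrightarrow> ennpowr x r \<le> ennpowr y r"
  by (cases x; cases y) (auto simp: ennpowr_def top_unique intro!: ennreal_leI powr_mono2)

lemma ennpowr_measurable[measurable]:
  assumes [measurable]: "f \<in> borel_measurable M"
  shows "(\<lambda>x. ennpowr (f x) r) \<in> borel_measurable M"
  unfolding ennpowr_def by measurable

text \<open>Jensen's inequality for the measure m dx, of mass at most B, by Hoelder's inequality for
  m^(1/r) G and m^(1/r'). If the right side is finite, then G is finite almost everywhere on {m > 0}
  and may be replaced by its \<open>enn2real\<close> there.\<close>

lemma ennpowr_Jensen:
  fixes m :: "'a \<Rightarrow> real" and G :: "'a \<Rightarrow> ennreal"
  assumes [measurable]: "m \<in> borel_measurable M" "G \<in> borel_measurable M"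
    and m: "\<And>x. 0 \<le> m x" "(\<integral>\<^sup>+x. ennreal (m x) \<partial>M) \<le> ennreal B" "0 < B" and r: "1 < r"
  shows "ennpowr (\<integral>\<^sup>+x. ennreal (m x) * G x \<partial>M) r \<le>
    ennreal (B powr (r - 1)) * (\<integral>\<^sup>+x. ennreal (m x) * ennpowr (G x) r \<partial>M)"
proof (cases "(\<integral>\<^sup>+x. ennreal (m x) * ennpowr (G x) r \<partial>M) = \<infinity>")
  case True
  then show ?thesis using m by (simp add: ennreal_mult_top)
next
  case False
  then obtain A where A: "(\<integral>\<^sup>+x. ennreal (m x) * ennpowr (G x) r \<partial>M) = ennreal A" "0 \<le> A"
    by (cases "\<integral>\<^sup>+x. ennreal (m x) * ennpowr (G x) r \<partial>M") auto
  define r' where "r' = r / (r - 1)"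
  have r': "1 < r'" "1 / r + 1 / r' = 1" "r / r' = r - 1" using r by (auto simp: r'_def field_simps)
  define g where "g x = enn2real (G x)" for x
  have [measurable]: "g \<in> borel_measurable M" unfolding g_def[abs_def] by measurable
  have "AE x in M. ennreal (m x) * ennpowr (G x) r \<noteq> \<infinity>"
    using False by (intro nn_integral_noteq_infinite) auto
  then have ae: "AE x in M. ennreal (m x) * G x = ennreal (m x * g x) \<and> ennreal (m x) * ennpowr (G x) r = ennreal (m x * g x powr r)"
  proof eventually_elim
    case (elim x)
    show ?case
    proof (cases "m x = 0")
      case False
      then have "G x \<noteq> \<infinity>" using elim m(1)[of x] by (auto simp: ennpowr_def ennreal_mult_eq_top_iff)
      then show ?thesis using m(1)[of x] by (cases "G x") (auto simp: g_def ennreal_mult)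
    qed auto
  qed
  have "(\<integral>\<^sup>+x. ennreal (m x powr (1 / r) * g x * m x powr (1 / r')) \<partial>M) \<le> ennreal (A powr (1 / r) * B powr (1 / r'))"
  proof (rule nn_integral_Hoelder[OF _ _ _ _ r r'(1,2)])
    have "(\<integral>\<^sup>+x. ennreal ((m x powr (1 / r) * g x) powr r) \<partial>M) = ennreal A"
      unfolding A(1)[symmetric]
    proof (rule nn_integral_cong_AE)
      show "AE x in M. ennreal ((m x powr (1 / r) * g x) powr r) = ennreal (m x) * ennpowr (G x) r"
        using ae by eventually_elim (use r m(1) in \<open>simp add: powr_mult powr_powr g_def\<close>)
    qed
    then show "(\<integral>\<^sup>+x. ennreal ((m x powr (1 / r) * g x) powr r) \<partial>M) \<le> ennreal A" by simp
    show "(\<integral>\<^sup>+x. ennreal ((m x powr (1 / r')) powr r') \<partial>M) \<le> ennreal B"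
      using m r'(1) by (simp add: powr_powr)
  qed (use A m in \<open>auto simp: g_def\<close>)
  also have "(\<integral>\<^sup>+x. ennreal (m x powr (1 / r) * g x * m x powr (1 / r')) \<partial>M) = (\<integral>\<^sup>+x. ennreal (m x) * G x \<partial>M)"
  proof (rule nn_integral_cong_AE)
    show "AE x in M. ennreal (m x powr (1 / r) * g x * m x powr (1 / r')) = ennreal (m x) * G x"
      using ae
    proof eventually_elim
      case (elim x)
      have "m x powr (1 / r) * m x powr (1 / r') = m x" using m(1)[of x] r'(2) by (simp flip: powr_add)
      then have "m x powr (1 / r) * g x * m x powr (1 / r') = m x * g x" by (simp only: ac_simps)
      then show ?case using elim by (simp only:)
    qed
  qed
  finally have "ennpowr (\<integral>\<^sup>+x. ennreal (m x) * G x \<partial>M) r \<le> ennpowr (ennreal (A powr (1 / r) * B powr (1 / r'))) r"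
    using r by (intro ennpowr_mono) auto
  also have "\<dots> = ennreal ((A powr (1 / r) * B powr (1 / r')) powr r)" by simp
  also have "(A powr (1 / r) * B powr (1 / r')) powr r = B powr (r - 1) * A"
    using A(2) m(3) r r'(3) by (simp add: powr_mult powr_powr)
  also have "ennreal \<dots> = ennreal (B powr (r - 1)) * ennreal A" using A by (simp add: ennreal_mult)
  finally show ?thesis using A by simp
qed

section \<open>Weighted norms, one-sided convolutions and averages at a distance\<close>

lemma pred_interval_measurable[measurable]:
  fixes f g h :: "'a \<Rightarrow> real"
  assumes [measurable]: "f \<in> borel_measurable M" "g \<in> borel_measurable M" "h \<in> borel_measurable M"
  shows "Measurable.pred M (\<lambda>x. h x \<in> {f x<..g x})" "Measurable.pred M (\<lambda>x. h x \<in> {f x..<g x})"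
  unfolding greaterThanAtMost_iff atLeastLessThan_iff by measurable

text \<open>This is the r-th power of a norm. Without the root it is a plain integral, suited to
  Fubini's theorem and monotone limits; the price is homogeneity of degree r and the constant 2^r in
  \<open>wnorm_add\<close>.\<close>

definition wnorm :: "real \<Rightarrow> (real \<Rightarrow> real) \<Rightarrow> (real \<Rightarrow> real) \<Rightarrow> ennreal" where
  "wnorm r v f = (\<integral>\<^sup>+x. ennreal (\<bar>f x\<bar> powr r * v x powr r) \<partial>lborel)"

text \<open>Functions are sampled at x + s, so a kernel supported in s > 0 looks to the right of x.
  Finiteness of this extended value is the integrability behind \<open>conv\<close>.\<close>

definition abs_conv :: "(real \<Rightarrow> real) \<Rightarrow> (real \<Rightarrow> real) \<Rightarrow> real \<Rightarrow> ennreal" where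
  "abs_conv k f x = (\<integral>\<^sup>+s. ennreal (\<bar>k s\<bar> * \<bar>f (x + s)\<bar>) \<partial>lborel)"

definition conv :: "(real \<Rightarrow> real) \<Rightarrow> (real \<Rightarrow> real) \<Rightarrow> real \<Rightarrow> real" where
  "conv k f x = (LINT s|lborel. k s * f (x + s))"

lemma abs_conv_measurable[measurable]:
  assumes [measurable]: "k \<in> borel_measurable borel" "f \<in> borel_measurable borel"
  shows "abs_conv k f \<in> borel_measurable borel"
  unfolding abs_conv_def[abs_def] by measurable

lemma conv_measurable[measurable]:
  assumes [measurable]: "k \<in> borel_measurable borel" "f \<in> borel_measurable borel"
  shows "conv k f \<in> borel_measurable borel"
  unfolding conv_def[abs_def] by measurable

lemma abs_conv_integrable:
  assumes [measurable]: "k \<in> borel_measurable borel" "f \<in> borel_measurable borel"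
    and "abs_conv k f x < \<infinity>"
  shows "integrable lborel (\<lambda>s. k s * f (x + s))"
  using assms(3) unfolding abs_conv_def by (intro integrableI_bounded) (auto simp: abs_mult)

text \<open>A divergent Bochner integral is 0, so the comparison persists at points of
  divergence.\<close>

lemma abs_conv_le: "ennreal \<bar>conv k f x\<bar> \<le> abs_conv k f x"
proof (cases "integrable lborel (\<lambda>s. k s * f (x + s))")
  case True
  have "ennreal \<bar>conv k f x\<bar> \<le> (\<integral>\<^sup>+s. ennreal \<bar>k s * f (x + s)\<bar> \<partial>lborel)"
    unfolding conv_def using True by (rule integral_norm_bound_ennreal[of lborel "\<lambda>s. k s * f (x + s)", simplified])
  then show ?thesis by (simp add: abs_conv_def abs_mult)
qed (simp add: conv_def not_integrable_integral_eq)

lemma wnorm_finite_AE: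
  assumes [measurable]: "F \<in> borel_measurable borel" "v \<in> borel_measurable borel"
    and "\<And>x. 0 < v x" "(\<integral>\<^sup>+x. ennpowr (F x) r * ennreal (v x powr r) \<partial>lborel) < \<infinity>"
  shows "AE x in lborel. F x < \<infinity>"
proof -
  have "AE x in lborel. ennpowr (F x) r * ennreal (v x powr r) \<noteq> \<infinity>"
    using assms(4) by (intro nn_integral_noteq_infinite) auto
  then show ?thesis
  proof eventually_elim
    case (elim x)
    have "v x powr r > 0" using assms(3)[of x] by simp
    then show ?case using elim by (auto simp: ennpowr_def ennreal_mult_eq_top_iff top.not_eq_extremum split: if_splits)
  qed
qed

text \<open>A one-sided A_r condition for v^r, tested against functions: X bounds the integral of
  |f| over [a, a + d), and the mass of v^r on the adjacent left interval is paired with X^r. As a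
  locale it lets one proof serve both (p, w) and (q, w).\<close>

locale average_weight =
  fixes r :: real and v :: "real \<Rightarrow> real" and D :: real
  assumes r: "1 < r" and v_meas[measurable]: "v \<in> borel_measurable borel" and v_pos: "\<And>x. 0 < v x"
    and D_pos: "0 < D"
    and v_fin: "\<And>a b. (\<integral>\<^sup>+x. ennreal (v x powr r) * indicator {a..<b} x \<partial>lborel) < \<infinity>"
    and average: "\<And>a d f B. 0 < d \<Longrightarrow> f \<in> borel_measurable borel \<Longrightarrow> 0 \<le> B \<Longrightarrow>
      (\<integral>\<^sup>+x. ennreal (\<bar>f x\<bar> powr r * v x powr r) * indicator {a..<a + d} x \<partial>lborel) \<le> ennreal B \<Longrightarrow>
      \<exists>X\<ge>0. (\<integral>\<^sup>+x. ennreal \<bar>f x\<bar> * indicator {a..<a + d} x \<partial>lborel) \<le> ennreal X \<and>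
        (\<integral>\<^sup>+x. ennreal (v x powr r) * indicator {a - d..<a} x \<partial>lborel) * ennreal (X powr r) \<le> ennreal ((D * d) powr r * B)"
begin

definition gap_average :: "real \<Rightarrow> (real \<Rightarrow> real) \<Rightarrow> real \<Rightarrow> ennreal" where
  "gap_average d f x = ennreal (1 / d) * (\<integral>\<^sup>+s. ennreal \<bar>f (x + s)\<bar> * indicator {d<..2 * d} s \<partial>lborel)"

lemma gap_average_measurable[measurable]:
  assumes [measurable]: "f \<in> borel_measurable borel"
  shows "(\<lambda>(d, x). gap_average d f x) \<in> borel_measurable (borel \<Otimes>\<^sub>M borel)"
  unfolding gap_average_def split_beta' by measurable

text \<open>If x lies in [y - d, y), the interval of averaging lies in [y, y + 2d), separated from x
  by y, and the locale condition applies with length 2d. Integrating over all y instead of choosing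
  a partition counts each x with weight d and each point of f with weight 2d, which is the source of
  the leading factor 2.\<close>

lemma gap_average_bound:
  assumes [measurable]: "f \<in> borel_measurable borel" and d: "0 < d" and fin: "wnorm r v f < \<infinity>"
  shows "(\<integral>\<^sup>+x. ennpowr (gap_average d f x) r * ennreal (v x powr r) \<partial>lborel) \<le> ennreal (2 * (2 * D) powr r) * wnorm r v f"
proof -
  define h where "h x = ennpowr (gap_average d f x) r * ennreal (v x powr r)" for x
  have [measurable]: "h \<in> borel_measurable borel"
    unfolding h_def[abs_def] gap_average_def by measurable
  define b where "b y = (\<integral>\<^sup>+x. ennreal (\<bar>f x\<bar> powr r * v x powr r) * indicator {y..<y + 2 * d} x \<partial>lborel)" for y
  have local: "(\<integral>\<^sup>+x. h x * indicator {y - d..<y} x \<partial>lborel) \<le> ennreal ((2 * D) powr r) * b y" for y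
  proof -
    have "b y \<le> wnorm r v f" unfolding b_def wnorm_def by (intro nn_integral_mono) (auto simp: indicator_def)
    then have "b y < \<infinity>" using fin by (rule le_less_trans)
    then obtain B where B: "b y = ennreal B" "0 \<le> B" by (cases "b y") auto
    obtain X where X: "X \<ge> 0" "(\<integral>\<^sup>+x. ennreal \<bar>f x\<bar> * indicator {y..<y + 2 * d} x \<partial>lborel) \<le> ennreal X"
      "(\<integral>\<^sup>+x. ennreal (v x powr r) * indicator {y - 2 * d..<y} x \<partial>lborel) * ennreal (X powr r) \<le> ennreal ((D * (2 * d)) powr r * B)"
      using average[of "2 * d" f B y] d B by (auto simp: b_def)
    have g: "gap_average d f x \<le> ennreal (X / d)" if "x \<in> {y - d..<y}" for x
    proof -
      have "(\<integral>\<^sup>+s. ennreal \<bar>f (x + s)\<bar> * indicator {d<..2 * d} s \<partial>lborel) \<le> (\<integral>\<^sup>+s. ennreal \<bar>f (x + 1 * s)\<bar> * indicator {y..<y + 2 * d} (x + 1 * s) \<partial>lborel)"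
        by (intro nn_integral_mono) (use that in \<open>auto simp: indicator_def\<close>)
      also have "\<dots> = (\<integral>\<^sup>+t. ennreal \<bar>f t\<bar> * indicator {y..<y + 2 * d} t \<partial>lborel)"
        by (subst nn_integral_real_affine[where c=1 and t=x and f="\<lambda>t. ennreal \<bar>f t\<bar> * indicator {y..<y + 2 * d} t"]) auto
      also have "\<dots> \<le> ennreal X" by (rule X(2))
      finally have "gap_average d f x \<le> ennreal (1 / d) * ennreal X"
        unfolding gap_average_def by (intro mult_left_mono) auto
      also have "\<dots> = ennreal (X / d)" using X d by (simp flip: ennreal_mult)
      finally show ?thesis .
    qed
    have "(\<integral>\<^sup>+x. h x * indicator {y - d..<y} x \<partial>lborel) \<le> (\<integral>\<^sup>+x. ennreal ((X / d) powr r) * (ennreal (v x powr r) * indicator {y - 2 * d..<y} x) \<partial>lborel)"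
    proof (rule nn_integral_mono)
      fix x
      show "h x * indicator {y - d..<y} x \<le> ennreal ((X / d) powr r) * (ennreal (v x powr r) * indicator {y - 2 * d..<y} x)"
      proof (cases "x \<in> {y - d..<y}")
        case True
        have "ennpowr (gap_average d f x) r \<le> ennpowr (ennreal (X / d)) r"
          using g[OF True] r by (intro ennpowr_mono) auto
        also have "\<dots> = ennreal ((X / d) powr r)" using X d by simp
        finally have "h x \<le> ennreal ((X / d) powr r) * ennreal (v x powr r)" unfolding h_def by (intro mult_right_mono) auto
        then show ?thesis using True d by (auto simp: indicator_def)
      qed auto
    qed
    also have "\<dots> = ennreal ((X / d) powr r) * (\<integral>\<^sup>+x. ennreal (v x powr r) * indicator {y - 2 * d..<y} x \<partial>lborel)"
      by (rule nn_integral_cmult) measurable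
    also have "\<dots> = ennreal (1 / d powr r) * ((\<integral>\<^sup>+x. ennreal (v x powr r) * indicator {y - 2 * d..<y} x \<partial>lborel) * ennreal (X powr r))"
    proof -
      have "ennreal ((X / d) powr r) = ennreal (1 / d powr r) * ennreal (X powr r)"
        using X d by (simp add: powr_divide flip: ennreal_mult)
      then show ?thesis by (simp only: ac_simps)
    qed
    also have "\<dots> \<le> ennreal (1 / d powr r) * ennreal ((D * (2 * d)) powr r * B)"
      by (intro mult_left_mono X(3)) auto
    also have "\<dots> = ennreal ((2 * D) powr r * B)"
      using d B D_pos by (simp add: powr_mult flip: ennreal_mult)
    also have "\<dots> = ennreal ((2 * D) powr r) * b y" using B by (simp add: ennreal_mult)
    finally show ?thesis .
  qed
  have ind: "indicator {y - d..<y} x = (indicator {x<..x + d} y :: ennreal)" for x y by (auto simp: indicator_def)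
  have "ennreal d * (\<integral>\<^sup>+x. h x \<partial>lborel) = (\<integral>\<^sup>+x. h x * (\<integral>\<^sup>+y. indicator {x<..x + d} y \<partial>lborel) \<partial>lborel)"
    using d by (simp add: mult.commute[of _ "ennreal d"] nn_integral_cmult)
  also have "\<dots> = (\<integral>\<^sup>+x. \<integral>\<^sup>+y. h x * indicator {y - d..<y} x \<partial>lborel \<partial>lborel)"
    by (simp add: ind nn_integral_cmult)
  also have "\<dots> = (\<integral>\<^sup>+y. \<integral>\<^sup>+x. h x * indicator {y - d..<y} x \<partial>lborel \<partial>lborel)"
    by (rule lborel_pair.Fubini') measurable
  also have "\<dots> \<le> (\<integral>\<^sup>+y. ennreal ((2 * D) powr r) * b y \<partial>lborel)" by (intro nn_integral_mono local)
  also have "\<dots> = ennreal ((2 * D) powr r) * (\<integral>\<^sup>+y. \<integral>\<^sup>+x. ennreal (\<bar>f x\<bar> powr r * v x powr r) * indicator {y..<y + 2 * d} x \<partial>lborel \<partial>lborel)"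
    unfolding b_def by (rule nn_integral_cmult) measurable
  also have "(\<integral>\<^sup>+y. \<integral>\<^sup>+x. ennreal (\<bar>f x\<bar> powr r * v x powr r) * indicator {y..<y + 2 * d} x \<partial>lborel \<partial>lborel)
    = (\<integral>\<^sup>+x. \<integral>\<^sup>+y. ennreal (\<bar>f x\<bar> powr r * v x powr r) * indicator {y..<y + 2 * d} x \<partial>lborel \<partial>lborel)"
    by (rule lborel_pair.Fubini') measurable
  also have "\<dots> = (\<integral>\<^sup>+x. ennreal (\<bar>f x\<bar> powr r * v x powr r) * ennreal (2 * d) \<partial>lborel)"
  proof (rule nn_integral_cong)
    fix x
    have ind2: "indicator {y..<y + 2 * d} x = (indicator {x - 2 * d<..x} y :: ennreal)" for y by (auto simp: indicator_def)
    show "(\<integral>\<^sup>+y. ennreal (\<bar>f x\<bar> powr r * v x powr r) * indicator {y..<y + 2 * d} x \<partial>lborel) = ennreal (\<bar>f x\<bar> powr r * v x powr r) * ennreal (2 * d)"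
      unfolding ind2 using d by (subst nn_integral_cmult) auto
  qed
  also have "\<dots> = wnorm r v f * ennreal (2 * d)" unfolding wnorm_def by (rule nn_integral_multc) measurable
  finally have "ennreal d * (\<integral>\<^sup>+x. h x \<partial>lborel) \<le> ennreal ((2 * D) powr r) * (wnorm r v f * ennreal (2 * d))" .
  then have "ennreal (1 / d) * (ennreal d * (\<integral>\<^sup>+x. h x \<partial>lborel)) \<le> ennreal (1 / d) * (ennreal ((2 * D) powr r) * (wnorm r v f * ennreal (2 * d)))"
    by (intro mult_left_mono) auto
  also have "ennreal (1 / d) * (ennreal d * (\<integral>\<^sup>+x. h x \<partial>lborel)) = (\<integral>\<^sup>+x. h x \<partial>lborel)"
    using d by (simp flip: mult.assoc ennreal_mult)
  also have "ennreal (1 / d) * (ennreal ((2 * D) powr r) * (wnorm r v f * ennreal (2 * d))) = ennreal (1 / d * (2 * D) powr r * (2 * d)) * wnorm r v f"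
    using d by (simp add: ennreal_mult ac_simps del: times_divide_eq_left times_divide_eq_right)
  also have "1 / d * (2 * D) powr r * (2 * d) = 2 * (2 * D) powr r" using d by simp
  finally show ?thesis by (simp add: h_def)
qed

text \<open>m is the density of a superposition of gap averages dominating k. Jensen's inequality
  for m plays the part of Minkowski's inequality: B^(r - 1) comes from Jensen and one more B from
  the final integration over d.\<close>

lemma conv_bound:
  assumes [measurable]: "f \<in> borel_measurable borel" "k \<in> borel_measurable borel" "m \<in> borel_measurable borel"
    and fin: "wnorm r v f < \<infinity>"
    and m0: "\<And>d. 0 \<le> m d" "\<And>d. d \<le> 0 \<Longrightarrow> m d = 0"
    and m: "\<And>s. ennreal \<bar>k s\<bar> \<le> (\<integral>\<^sup>+d. ennreal (m d / d) * indicator {d<..2 * d} s \<partial>lborel)"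
    and B: "(\<integral>\<^sup>+d. ennreal (m d) \<partial>lborel) \<le> ennreal B" "0 < B"
  shows "abs_conv k f x \<le> (\<integral>\<^sup>+d. ennreal (m d) * gap_average d f x \<partial>lborel)"
    and "(\<integral>\<^sup>+x. ennpowr (abs_conv k f x) r * ennreal (v x powr r) \<partial>lborel) \<le> ennreal (2 * (2 * D * B) powr r) * wnorm r v f"
proof -
  have pt: "abs_conv k f x \<le> (\<integral>\<^sup>+d. ennreal (m d) * gap_average d f x \<partial>lborel)" for x
  proof -
    have "abs_conv k f x \<le> (\<integral>\<^sup>+s. (\<integral>\<^sup>+d. ennreal (m d / d) * indicator {d<..2 * d} s \<partial>lborel) * ennreal \<bar>f (x + s)\<bar> \<partial>lborel)"
      unfolding abs_conv_def using m by (intro nn_integral_mono) (auto simp: ennreal_mult intro!: mult_right_mono)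
    also have "\<dots> = (\<integral>\<^sup>+s. \<integral>\<^sup>+d. ennreal (m d / d) * indicator {d<..2 * d} s * ennreal \<bar>f (x + s)\<bar> \<partial>lborel \<partial>lborel)"
      by (intro nn_integral_cong nn_integral_multc[symmetric]) measurable
    also have "\<dots> = (\<integral>\<^sup>+d. \<integral>\<^sup>+s. ennreal (m d / d) * indicator {d<..2 * d} s * ennreal \<bar>f (x + s)\<bar> \<partial>lborel \<partial>lborel)"
      by (rule lborel_pair.Fubini') measurable
    also have "\<dots> = (\<integral>\<^sup>+d. ennreal (m d) * gap_average d f x \<partial>lborel)"
    proof (rule nn_integral_cong)
      fix d
      show "(\<integral>\<^sup>+s. ennreal (m d / d) * indicator {d<..2 * d} s * ennreal \<bar>f (x + s)\<bar> \<partial>lborel) = ennreal (m d) * gap_average d f x"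
      proof (cases "d > 0")
        case True
        have "(\<integral>\<^sup>+s. ennreal (m d / d) * indicator {d<..2 * d} s * ennreal \<bar>f (x + s)\<bar> \<partial>lborel)
          = ennreal (m d / d) * (\<integral>\<^sup>+s. ennreal \<bar>f (x + s)\<bar> * indicator {d<..2 * d} s \<partial>lborel)"
          by (subst nn_integral_cmult[symmetric]) (auto simp: ac_simps)
        also have "\<dots> = ennreal (m d) * ennreal (1 / d) * (\<integral>\<^sup>+s. ennreal \<bar>f (x + s)\<bar> * indicator {d<..2 * d} s \<partial>lborel)"
          using True m0 by (simp flip: ennreal_mult)
        finally show ?thesis by (simp add: gap_average_def mult.assoc)
      next
        case False
        then show ?thesis using m0(2)[of d] by simp
      qed
    qed
    finally show ?thesis .
  qed
  then show "abs_conv k f x \<le> (\<integral>\<^sup>+d. ennreal (m d) * gap_average d f x \<partial>lborel)" .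
  have "(\<integral>\<^sup>+x. ennpowr (abs_conv k f x) r * ennreal (v x powr r) \<partial>lborel)
    \<le> (\<integral>\<^sup>+x. (ennreal (B powr (r - 1)) * (\<integral>\<^sup>+d. ennreal (m d) * ennpowr (gap_average d f x) r \<partial>lborel)) * ennreal (v x powr r) \<partial>lborel)"
  proof (intro nn_integral_mono mult_right_mono)
    fix x
    have [measurable]: "(\<lambda>d. gap_average d f x) \<in> borel_measurable borel"
      unfolding gap_average_def by measurable
    have "ennpowr (abs_conv k f x) r \<le> ennpowr (\<integral>\<^sup>+d. ennreal (m d) * gap_average d f x \<partial>lborel) r"
      using r by (intro ennpowr_mono pt) auto
    also have "\<dots> \<le> ennreal (B powr (r - 1)) * (\<integral>\<^sup>+d. ennreal (m d) * ennpowr (gap_average d f x) r \<partial>lborel)"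
      by (rule ennpowr_Jensen) (use m0 B r in auto)
    finally show "ennpowr (abs_conv k f x) r \<le> ennreal (B powr (r - 1)) * (\<integral>\<^sup>+d. ennreal (m d) * ennpowr (gap_average d f x) r \<partial>lborel)" .
  qed auto
  also have "\<dots> = ennreal (B powr (r - 1)) * (\<integral>\<^sup>+x. \<integral>\<^sup>+d. ennreal (m d) * (ennpowr (gap_average d f x) r * ennreal (v x powr r)) \<partial>lborel \<partial>lborel)"
    by (simp add: nn_integral_cmult nn_integral_multc[symmetric] gap_average_def mult.assoc)
  also have "(\<integral>\<^sup>+x. \<integral>\<^sup>+d. ennreal (m d) * (ennpowr (gap_average d f x) r * ennreal (v x powr r)) \<partial>lborel \<partial>lborel)
     = (\<integral>\<^sup>+d. \<integral>\<^sup>+x. ennreal (m d) * (ennpowr (gap_average d f x) r * ennreal (v x powr r)) \<partial>lborel \<partial>lborel)"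
    unfolding gap_average_def by (rule lborel_pair.Fubini') measurable
  also have "\<dots> = (\<integral>\<^sup>+d. ennreal (m d) * (\<integral>\<^sup>+x. ennpowr (gap_average d f x) r * ennreal (v x powr r) \<partial>lborel) \<partial>lborel)"
    unfolding gap_average_def by (intro nn_integral_cong nn_integral_cmult) measurable
  also have "\<dots> \<le> (\<integral>\<^sup>+d. ennreal (m d) * (ennreal (2 * (2 * D) powr r) * wnorm r v f) \<partial>lborel)"
  proof (rule nn_integral_mono)
    fix d
    show "ennreal (m d) * (\<integral>\<^sup>+x. ennpowr (gap_average d f x) r * ennreal (v x powr r) \<partial>lborel) \<le> ennreal (m d) * (ennreal (2 * (2 * D) powr r) * wnorm r v f)"
    proof (cases "d > 0")
      case True
      then show ?thesis by (intro mult_left_mono gap_average_bound fin) auto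
    next
      case False
      then show ?thesis using m0(2)[of d] by simp
    qed
  qed
  also have "\<dots> = (\<integral>\<^sup>+d. ennreal (m d) \<partial>lborel) * (ennreal (2 * (2 * D) powr r) * wnorm r v f)"
    by (rule nn_integral_multc) measurable
  also have "\<dots> \<le> ennreal B * (ennreal (2 * (2 * D) powr r) * wnorm r v f)" by (intro mult_right_mono B) auto
  finally have "(\<integral>\<^sup>+x. ennpowr (abs_conv k f x) r * ennreal (v x powr r) \<partial>lborel) \<le>
     ennreal (B powr (r - 1)) * (ennreal B * (ennreal (2 * (2 * D) powr r) * wnorm r v f))" by (simp add: mult_left_mono)
  also have "\<dots> = ennreal (B powr (r - 1) * B * (2 * (2 * D) powr r)) * wnorm r v f"
    using B D_pos by (simp add: ennreal_mult mult.assoc)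
  also have "B powr (r - 1) * B * (2 * (2 * D) powr r) = 2 * (2 * D * B) powr r"
  proof -
    have "B powr (r - 1) * B = B powr r" using B by (simp add: powr_diff)
    then show ?thesis using B D_pos by (simp add: powr_mult)
  qed
  finally show "(\<integral>\<^sup>+x. ennpowr (abs_conv k f x) r * ennreal (v x powr r) \<partial>lborel) \<le> ennreal (2 * (2 * D * B) powr r) * wnorm r v f" .
qed

end

section \<open>The averaging condition for the exponents p and q\<close>

lemma nn_integral_power_mean:
  fixes F :: "real \<Rightarrow> real"
  assumes [measurable]: "F \<in> borel_measurable borel" and F: "\<And>x. 0 \<le> F x"
    and st: "0 < s" "s < t" and d: "0 < d" and U: "0 \<le> U"
    and le: "(\<integral>\<^sup>+x. ennreal (F x powr t) * indicator {a..<a + d} x \<partial>lborel) \<le> ennreal U"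
  shows "(\<integral>\<^sup>+x. ennreal (F x powr s) * indicator {a..<a + d} x \<partial>lborel) \<le> ennreal (U powr (s / t) * d powr (1 - s / t))"
proof -
  define P where "P = t / s"
  define P' where "P' = P / (P - 1)"
  have P: "1 < P" "1 < P'" "1 / P + 1 / P' = 1" using st by (auto simp: P_def P'_def field_simps)
  have "(\<integral>\<^sup>+x. ennreal ((F x powr s * indicator {a..<a + d} x) * indicator {a..<a + d} x) \<partial>lborel)
    \<le> ennreal (U powr (1 / P) * d powr (1 / P'))"
  proof (rule nn_integral_Hoelder[OF _ _ _ _ P])
    have "(\<integral>\<^sup>+x. ennreal ((F x powr s * indicator {a..<a + d} x) powr P) \<partial>lborel) = (\<integral>\<^sup>+x. ennreal (F x powr t) * indicator {a..<a + d} x \<partial>lborel)"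
      by (intro nn_integral_cong) (use st P in \<open>auto simp: indicator_def powr_powr P_def\<close>)
    then show "(\<integral>\<^sup>+x. ennreal ((F x powr s * indicator {a..<a + d} x) powr P) \<partial>lborel) \<le> ennreal U" using le by simp
    have "(\<integral>\<^sup>+x. ennreal (indicator {a..<a + d} x powr P') \<partial>lborel) = (\<integral>\<^sup>+x. indicator {a..<a + d} x \<partial>lborel)"
      by (intro nn_integral_cong) (auto simp: indicator_def)
    then show "(\<integral>\<^sup>+x. ennreal (indicator {a..<a + d} x powr P') \<partial>lborel) \<le> ennreal d" using d by simp
  qed (use d U in auto)
  also have "(\<integral>\<^sup>+x. ennreal ((F x powr s * indicator {a..<a + d} x) * indicator {a..<a + d} x) \<partial>lborel)
     = (\<integral>\<^sup>+x. ennreal (F x powr s) * indicator {a..<a + d} x \<partial>lborel)"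
    by (intro nn_integral_cong) (auto simp: indicator_def)
  also have "1 / P = s / t" by (simp add: P_def)
  also have "1 / P' = 1 - s / t" using P(3) by (simp add: P_def)
  finally show ?thesis .
qed

context one_sided_weight
begin

text \<open>Since p < q, the mean of w^p is controlled by that of w^q; with Hoelder's inequality for
  |f| w and 1/w, the condition for (p, q) gives the one for p with the same constant C. The powers
  of d add up because p/q = 1 - p \<alpha>.\<close>

lemma average_weight_p: "average_weight p w C"
proof
  show "(\<integral>\<^sup>+x. ennreal (w x powr p) * indicator {a..<b} x \<partial>lborel) < \<infinity>" for a b
  proof (cases "a < b")
    case True
    have "(\<integral>\<^sup>+x. ennreal (w x powr q) * indicator {a..<a + (b - a)} x \<partial>lborel) \<le> ennreal (measure \<nu> {a..<b})"
    proof -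
      have "{a..<b} \<subseteq> {a..b}" by auto
      then show ?thesis using emeasure_eq_\<nu>[of "{a..<b}" a b] by (simp add: emeasure_\<nu>)
    qed
    then have "(\<integral>\<^sup>+x. ennreal (w x powr p) * indicator {a..<a + (b - a)} x \<partial>lborel) \<le> ennreal (measure \<nu> {a..<b} powr (p / q) * (b - a) powr (1 - p / q))"
      using True p p_less_q by (intro nn_integral_power_mean) (auto simp: less_imp_le[OF w_pos])
    then show ?thesis by (auto intro: le_less_trans)
  qed auto
  fix a d :: real and f :: "real \<Rightarrow> real" and B :: real
  assume d: "0 < d" and [measurable]: "f \<in> borel_measurable borel" and B: "0 \<le> B"
    and fB: "(\<integral>\<^sup>+x. ennreal (\<bar>f x\<bar> powr p * w x powr p) * indicator {a..<a + d} x \<partial>lborel) \<le> ennreal B"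
  define iw where "iw x = w x powr (- 1)" for x
  have [measurable]: "iw \<in> borel_measurable borel" unfolding iw_def[abs_def] by measurable
  have iw: "iw x powr s = w x powr (- s)" "w x * iw x = 1" "0 \<le> iw x" for x s
  proof -
    show "iw x powr s = w x powr (- s)" unfolding iw_def powr_powr by simp
    show "w x * iw x = 1" unfolding iw_def using w_pos[of x] by (simp add: powr_minus)
  qed (simp add: iw_def)
  define S where "S = measure \<sigma> {a..<a + d}"
  define N where "N = measure \<nu> {a - d..<a}"
  have sub: "{a..<a + d} \<subseteq> {a..a + d}" "{a - d..<a} \<subseteq> {a - d..a}" by auto
  have S: "(\<integral>\<^sup>+x. ennreal (w x powr (- p')) * indicator {a..<a + d} x \<partial>lborel) = ennreal S"
    using emeasure_eq_\<sigma>[OF sub(1)] by (simp add: emeasure_\<sigma> S_def)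
  have N: "(\<integral>\<^sup>+x. ennreal (w x powr q) * indicator {a - d..<a} x \<partial>lborel) = ennreal N"
    using emeasure_eq_\<nu>[OF sub(2)] by (simp add: emeasure_\<nu> N_def)
  have SN: "0 \<le> S" "0 \<le> N" by (auto simp: S_def N_def)
  have NS: "N powr (1 / q) * S powr (1 / p') \<le> C * d powr (1 - \<alpha>)"
    unfolding N_def S_def by (rule A_plus_halfopen[OF d])
  define X where "X = B powr (1 / p) * S powr (1 / p')"
  have "(\<integral>\<^sup>+x. ennreal ((\<bar>f x\<bar> * w x * indicator {a..<a + d} x) * (iw x * indicator {a..<a + d} x)) \<partial>lborel) \<le> ennreal X"
    unfolding X_def
  proof (rule nn_integral_Hoelder[OF _ _ _ _ p p'1 p'])
    have "(\<integral>\<^sup>+x. ennreal ((\<bar>f x\<bar> * w x * indicator {a..<a + d} x) powr p) \<partial>lborel)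
      = (\<integral>\<^sup>+x. ennreal (\<bar>f x\<bar> powr p * w x powr p) * indicator {a..<a + d} x \<partial>lborel)"
      by (intro nn_integral_cong) (use p in \<open>auto simp: indicator_def powr_mult less_imp_le[OF w_pos]\<close>)
    then show "(\<integral>\<^sup>+x. ennreal ((\<bar>f x\<bar> * w x * indicator {a..<a + d} x) powr p) \<partial>lborel) \<le> ennreal B" using fB by simp
    have "(\<integral>\<^sup>+x. ennreal ((iw x * indicator {a..<a + d} x) powr p') \<partial>lborel)
      = (\<integral>\<^sup>+x. ennreal (w x powr (- p')) * indicator {a..<a + d} x \<partial>lborel)"
      by (intro nn_integral_cong) (use p'1 in \<open>auto simp: indicator_def iw(1)\<close>)
    then show "(\<integral>\<^sup>+x. ennreal ((iw x * indicator {a..<a + d} x) powr p') \<partial>lborel) \<le> ennreal S" using S by simp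
  qed (use B SN in \<open>auto simp: less_imp_le[OF w_pos] iw(3)\<close>)
  also have "(\<integral>\<^sup>+x. ennreal ((\<bar>f x\<bar> * w x * indicator {a..<a + d} x) * (iw x * indicator {a..<a + d} x)) \<partial>lborel)
    = (\<integral>\<^sup>+x. ennreal \<bar>f x\<bar> * indicator {a..<a + d} x \<partial>lborel)"
  proof (rule nn_integral_cong)
    fix x
    show "ennreal ((\<bar>f x\<bar> * w x * indicator {a..<a + d} x) * (iw x * indicator {a..<a + d} x)) = ennreal \<bar>f x\<bar> * indicator {a..<a + d} x"
      by (auto simp: indicator_def mult.assoc iw(2))
  qed
  finally have X: "(\<integral>\<^sup>+x. ennreal \<bar>f x\<bar> * indicator {a..<a + d} x \<partial>lborel) \<le> ennreal X" .
  have V: "(\<integral>\<^sup>+x. ennreal (w x powr p) * indicator {a - d..<a} x \<partial>lborel) \<le> ennreal (N powr (p / q) * d powr (1 - p / q))"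
  proof -
    have "(\<integral>\<^sup>+x. ennreal (w x powr p) * indicator {a - d..<(a - d) + d} x \<partial>lborel) \<le> ennreal (N powr (p / q) * d powr (1 - p / q))"
      using p p_less_q d SN N by (intro nn_integral_power_mean) (auto simp: less_imp_le[OF w_pos])
    then show ?thesis by simp
  qed
  have "N powr (p / q) * d powr (1 - p / q) * X powr p \<le> (C * d) powr p * B"
  proof -
    have "N powr (p / q) * d powr (1 - p / q) * X powr p = (N powr (1 / q) * S powr (1 / p')) powr p * d powr (1 - p / q) * B"
      using p B by (simp add: X_def powr_mult powr_powr)
    also have "\<dots> \<le> (C * d powr (1 - \<alpha>)) powr p * d powr (1 - p / q) * B"
      using NS p B by (intro mult_right_mono powr_mono2) auto
    also have "\<dots> = C powr p * (d powr ((1 - \<alpha>) * p) * d powr (1 - p / q)) * B"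
      using C_pos by (simp add: powr_mult powr_powr)
    also have "d powr ((1 - \<alpha>) * p) * d powr (1 - p / q) = d powr p"
    proof -
      have "p * (1 / q) = p * (1 / p - \<alpha>)" using pq by simp
      then have "p / q = 1 - p * \<alpha>" using p by (simp add: right_diff_distrib)
      then have "(1 - \<alpha>) * p + (1 - p / q) = p" by (simp add: algebra_simps)
      then show ?thesis by (simp only: powr_add[symmetric])
    qed
    also have "C powr p * d powr p = (C * d) powr p" using C_pos d by (simp add: powr_mult)
    finally show ?thesis .
  qed
  then have "(\<integral>\<^sup>+x. ennreal (w x powr p) * indicator {a - d..<a} x \<partial>lborel) * ennreal (X powr p) \<le> ennreal ((C * d) powr p * B)"
    using mult_right_mono[OF V, of "ennreal (X powr p)"] by (simp add: ennreal_leI order_trans flip: ennreal_mult'')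
  moreover have "X \<ge> 0" by (simp add: X_def)
  ultimately show "\<exists>X\<ge>0. (\<integral>\<^sup>+x. ennreal \<bar>f x\<bar> * indicator {a..<a + d} x \<partial>lborel) \<le> ennreal X \<and>
        (\<integral>\<^sup>+x. ennreal (w x powr p) * indicator {a - d..<a} x \<partial>lborel) * ennreal (X powr p) \<le> ennreal ((C * d) powr p * B)"
    using X by blast
qed (fact p w_meas w_pos C_pos)+

text \<open>Here the weight power is already w^q and the dual exponent has to change: q' < p', so
  the mean of w^(-q') is controlled by that of w^(-p').\<close>

lemma average_weight_q: "average_weight q w C"
proof
  show "(\<integral>\<^sup>+x. ennreal (w x powr q) * indicator {a..<b} x \<partial>lborel) < \<infinity>" for a b
  proof -
    have "{a..<b} \<subseteq> {a..b}" by auto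
    then show ?thesis using finite_\<nu>[of "{a..<b}" a b] by (simp add: emeasure_\<nu>)
  qed
  fix a d :: real and f :: "real \<Rightarrow> real" and B :: real
  assume d: "0 < d" and [measurable]: "f \<in> borel_measurable borel" and B: "0 \<le> B"
    and fB: "(\<integral>\<^sup>+x. ennreal (\<bar>f x\<bar> powr q * w x powr q) * indicator {a..<a + d} x \<partial>lborel) \<le> ennreal B"
  define q' where "q' = q / (q - 1)"
  have q': "1 < q'" "1 / q + 1 / q' = 1" using q1 by (auto simp: q'_def field_simps)
  have "1 / p' = 1 / q' - \<alpha>" using q'(2) inv_sum by simp
  then have "1 / p' < 1 / q'" using \<alpha> by simp
  then have q'p': "q' < p'" using q' p'1 by (simp add: field_simps)
  define iw where "iw x = w x powr (- 1)" for x
  have [measurable]: "iw \<in> borel_measurable borel" unfolding iw_def[abs_def] by measurable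
  have iw: "iw x powr s = w x powr (- s)" "w x * iw x = 1" "0 \<le> iw x" for x s
  proof -
    show "iw x powr s = w x powr (- s)" unfolding iw_def powr_powr by simp
    show "w x * iw x = 1" unfolding iw_def using w_pos[of x] by (simp add: powr_minus)
  qed (simp add: iw_def)
  define S where "S = measure \<sigma> {a..<a + d}"
  define N where "N = measure \<nu> {a - d..<a}"
  have sub: "{a..<a + d} \<subseteq> {a..a + d}" "{a - d..<a} \<subseteq> {a - d..a}" by auto
  have S: "(\<integral>\<^sup>+x. ennreal ((iw x) powr p') * indicator {a..<a + d} x \<partial>lborel) = ennreal S"
    using emeasure_eq_\<sigma>[OF sub(1)] by (simp add: emeasure_\<sigma> S_def iw(1))
  have N: "(\<integral>\<^sup>+x. ennreal (w x powr q) * indicator {a - d..<a} x \<partial>lborel) = ennreal N"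
    using emeasure_eq_\<nu>[OF sub(2)] by (simp add: emeasure_\<nu> N_def)
  have SN: "0 \<le> S" "0 \<le> N" by (auto simp: S_def N_def)
  have NS: "N powr (1 / q) * S powr (1 / p') \<le> C * d powr (1 - \<alpha>)"
    unfolding N_def S_def by (rule A_plus_halfopen[OF d])
  define S' where "S' = S powr (q' / p') * d powr (1 - q' / p')"
  have S': "(\<integral>\<^sup>+x. ennreal ((iw x) powr q') * indicator {a..<a + d} x \<partial>lborel) \<le> ennreal S'"
    unfolding S'_def using q' q'p' d SN S iw(3) by (intro nn_integral_power_mean) auto
  define X where "X = B powr (1 / q) * S' powr (1 / q')"
  have "(\<integral>\<^sup>+x. ennreal ((\<bar>f x\<bar> * w x * indicator {a..<a + d} x) * (iw x * indicator {a..<a + d} x)) \<partial>lborel) \<le> ennreal X"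
    unfolding X_def
  proof (rule nn_integral_Hoelder[OF _ _ _ _ q1 q'])
    have "(\<integral>\<^sup>+x. ennreal ((\<bar>f x\<bar> * w x * indicator {a..<a + d} x) powr q) \<partial>lborel)
      = (\<integral>\<^sup>+x. ennreal (\<bar>f x\<bar> powr q * w x powr q) * indicator {a..<a + d} x \<partial>lborel)"
      by (intro nn_integral_cong) (use q1 in \<open>auto simp: indicator_def powr_mult less_imp_le[OF w_pos]\<close>)
    then show "(\<integral>\<^sup>+x. ennreal ((\<bar>f x\<bar> * w x * indicator {a..<a + d} x) powr q) \<partial>lborel) \<le> ennreal B" using fB by simp
    have "(\<integral>\<^sup>+x. ennreal ((iw x * indicator {a..<a + d} x) powr q') \<partial>lborel)
      = (\<integral>\<^sup>+x. ennreal ((iw x) powr q') * indicator {a..<a + d} x \<partial>lborel)"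
      by (intro nn_integral_cong) (use q'(1) in \<open>auto simp: indicator_def\<close>)
    then show "(\<integral>\<^sup>+x. ennreal ((iw x * indicator {a..<a + d} x) powr q') \<partial>lborel) \<le> ennreal S'" using S' by simp
  qed (use B SN in \<open>auto simp: less_imp_le[OF w_pos] S'_def iw(3)\<close>)
  also have "(\<integral>\<^sup>+x. ennreal ((\<bar>f x\<bar> * w x * indicator {a..<a + d} x) * (iw x * indicator {a..<a + d} x)) \<partial>lborel)
    = (\<integral>\<^sup>+x. ennreal \<bar>f x\<bar> * indicator {a..<a + d} x \<partial>lborel)"
  proof (rule nn_integral_cong)
    fix x
    show "ennreal ((\<bar>f x\<bar> * w x * indicator {a..<a + d} x) * (iw x * indicator {a..<a + d} x)) = ennreal \<bar>f x\<bar> * indicator {a..<a + d} x"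
      by (auto simp: indicator_def mult.assoc iw(2))
  qed
  finally have X: "(\<integral>\<^sup>+x. ennreal \<bar>f x\<bar> * indicator {a..<a + d} x \<partial>lborel) \<le> ennreal X" .
  have "N * X powr q \<le> (C * d) powr q * B"
  proof -
    have S'e: "S' powr (1 / q') = S powr (1 / p') * d powr (1 / q' - 1 / p')"
    proof -
      have "(1 - q' / p') * (1 / q') = 1 / q' - 1 / p'" using q'(1) by (simp add: diff_divide_distrib)
      then show ?thesis using q'(1) by (simp add: S'_def powr_mult powr_powr)
    qed
    have "N * X powr q = (N powr (1 / q) * S powr (1 / p')) powr q * d powr ((1 / q' - 1 / p') * q) * B"
      using q1 B SN by (simp add: X_def S'e powr_mult powr_powr)
    also have "\<dots> \<le> (C * d powr (1 - \<alpha>)) powr q * d powr ((1 / q' - 1 / p') * q) * B"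
      using NS q1 B by (intro mult_right_mono powr_mono2) auto
    also have "\<dots> = C powr q * (d powr ((1 - \<alpha>) * q) * d powr ((1 / q' - 1 / p') * q)) * B"
      using C_pos by (simp add: powr_mult powr_powr)
    also have "d powr ((1 - \<alpha>) * q) * d powr ((1 / q' - 1 / p') * q) = d powr q"
    proof -
      have "(1 - \<alpha>) * q + (1 / q' - 1 / p') * q = ((1 - \<alpha>) + (1 / q' - 1 / p')) * q" by (simp only: distrib_right)
      also have "(1 - \<alpha>) + (1 / q' - 1 / p') = 1" using inv_sum q'(2) by linarith
      finally show ?thesis by (simp add: powr_add[symmetric])
    qed
    also have "C powr q * d powr q = (C * d) powr q" using C_pos d by (simp add: powr_mult)
    finally show ?thesis .
  qed
  then have "(\<integral>\<^sup>+x. ennreal (w x powr q) * indicator {a - d..<a} x \<partial>lborel) * ennreal (X powr q) \<le> ennreal ((C * d) powr q * B)"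
    unfolding N using SN by (simp add: ennreal_leI flip: ennreal_mult'')
  moreover have "X \<ge> 0" by (simp add: X_def)
  ultimately show "\<exists>X\<ge>0. (\<integral>\<^sup>+x. ennreal \<bar>f x\<bar> * indicator {a..<a + d} x \<partial>lborel) \<le> ennreal X \<and>
        (\<integral>\<^sup>+x. ennreal (w x powr q) * indicator {a - d..<a} x \<partial>lborel) * ennreal (X powr q) \<le> ennreal ((C * d) powr q * B)"
    using X by blast
qed (fact q1 w_meas w_pos C_pos)+

end

text \<open>For decreasing \<mu>, the value \<mu>(s) is at most the integral of 2 \<mu>(d)/d over
  s/2 <= d < s, and for these d the point s lies in (d, 2d]. So m = 2 \<mu> is an admissible
  density, of mass at most 2B.\<close>

lemma (in average_weight) conv_bound_decreasing:
  assumes [measurable]: "f \<in> borel_measurable borel" "k \<in> borel_measurable borel" "\<mu> \<in> borel_measurable borel"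
    and fin: "wnorm r v f < \<infinity>"
    and \<mu>: "\<And>s. 0 \<le> \<mu> s" "\<And>s. s \<le> 0 \<Longrightarrow> \<mu> s = 0" "\<And>s t. 0 < s \<Longrightarrow> s \<le> t \<Longrightarrow> \<mu> t \<le> \<mu> s"
    and k: "\<And>s. \<bar>k s\<bar> \<le> \<mu> s"
    and B: "(\<integral>\<^sup>+s. ennreal (\<mu> s) \<partial>lborel) \<le> ennreal B" "0 < B"
  shows "(\<integral>\<^sup>+x. ennpowr (abs_conv k f x) r * ennreal (v x powr r) \<partial>lborel) \<le> ennreal (2 * (4 * D * B) powr r) * wnorm r v f"
proof -
  have maj: "ennreal \<bar>k s\<bar> \<le> (\<integral>\<^sup>+d. ennreal (2 * \<mu> d / d) * indicator {d<..2 * d} s \<partial>lborel)" for s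
  proof (cases "s > 0")
    case False
    then show ?thesis using k[of s] \<mu>(2)[of s] by simp
  next
    case True
    have "ennreal (\<mu> s) = ennreal (2 * \<mu> s / s) * ennreal (s - s / 2)"
      using True \<mu>(1)[of s] by (simp flip: ennreal_mult)
    also have "\<dots> = (\<integral>\<^sup>+d. ennreal (2 * \<mu> s / s) * indicator {s / 2..<s} d \<partial>lborel)"
      using True by (subst nn_integral_cmult) auto
    also have "\<dots> \<le> (\<integral>\<^sup>+d. ennreal (2 * \<mu> d / d) * indicator {d<..2 * d} s \<partial>lborel)"
    proof (rule nn_integral_mono)
      fix d
      have "2 * \<mu> s / s \<le> 2 * \<mu> d / d" if "s / 2 \<le> d" "d < s"
        using that True \<mu>(1)[of s] \<mu>(1)[of d] \<mu>(3)[of d s] by (intro frac_le) auto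
      then show "ennreal (2 * \<mu> s / s) * indicator {s / 2..<s} d \<le> ennreal (2 * \<mu> d / d) * indicator {d<..2 * d} s"
        by (auto simp: indicator_def ennreal_leI)
    qed
    finally have "ennreal (\<mu> s) \<le> (\<integral>\<^sup>+d. ennreal (2 * \<mu> d / d) * indicator {d<..2 * d} s \<partial>lborel)" .
    then show ?thesis using ennreal_leI[OF k[of s]] by (rule order_trans[rotated])
  qed
  have "(\<integral>\<^sup>+d. ennreal (2 * \<mu> d) \<partial>lborel) = 2 * (\<integral>\<^sup>+s. ennreal (\<mu> s) \<partial>lborel)"
    using \<mu> by (simp add: ennreal_mult nn_integral_cmult)
  also have "\<dots> \<le> 2 * ennreal B" by (intro mult_left_mono B) auto
  also have "\<dots> = ennreal (2 * B)" using B by (simp add: ennreal_mult)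
  finally have B2: "(\<integral>\<^sup>+d. ennreal (2 * \<mu> d) \<partial>lborel) \<le> ennreal (2 * B)" .
  have "(\<integral>\<^sup>+x. ennpowr (abs_conv k f x) r * ennreal (v x powr r) \<partial>lborel) \<le> ennreal (2 * (2 * D * (2 * B)) powr r) * wnorm r v f"
    by (rule conv_bound(2)[of _ _ "\<lambda>d. 2 * \<mu> d"]) (use fin \<mu> maj B2 B in auto)
  moreover have "2 * D * (2 * B) = 4 * D * B" by simp
  ultimately show ?thesis by (simp only:)
qed

section \<open>Iterated convolutions\<close>

lemma lborel_Fubini:
  fixes g :: "real \<Rightarrow> real \<Rightarrow> real"
  assumes [measurable]: "(\<lambda>(x, y). g x y) \<in> borel_measurable (borel \<Otimes>\<^sub>M borel)"
    and fin: "(\<integral>\<^sup>+x. \<integral>\<^sup>+y. ennreal \<bar>g x y\<bar> \<partial>lborel \<partial>lborel) < \<infinity>"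
  shows "(LINT x|lborel. LINT y|lborel. g x y) = (LINT y|lborel. LINT x|lborel. g x y)"
proof -
  have [measurable]: "case_prod g \<in> borel_measurable (lborel \<Otimes>\<^sub>M lborel)"
    using assms(1) by (simp cong: measurable_cong_sets sets_pair_measure_cong)
  have "(\<integral>\<^sup>+z. ennreal \<bar>case_prod g z\<bar> \<partial>(lborel \<Otimes>\<^sub>M lborel)) = (\<integral>\<^sup>+x. \<integral>\<^sup>+y. ennreal \<bar>g x y\<bar> \<partial>lborel \<partial>lborel)"
    by (subst lborel.nn_integral_fst[symmetric]) auto
  then have "integrable (lborel \<Otimes>\<^sub>M lborel) (case_prod g)"
    using fin by (intro integrableI_bounded) auto
  then show ?thesis by (rule lborel_pair.Fubini_integral[symmetric])
qed

context
  fixes k1 k2 f :: "real \<Rightarrow> real" and x :: real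
  assumes [measurable]: "k1 \<in> borel_measurable borel" "k2 \<in> borel_measurable borel" "f \<in> borel_measurable borel"
    and fin: "(\<integral>\<^sup>+t. ennreal \<bar>k1 t\<bar> * abs_conv k2 f (x + t) \<partial>lborel) < \<infinity>"
begin

text \<open>Fubini's theorem after the substitution of s - t for s in the inner integral. The
  convergence hypothesis concerns a single x because the applications have it only almost
  everywhere.\<close>

lemma conv_conv: "conv k1 (conv k2 f) x = conv (\<lambda>s. LINT t|lborel. k1 t * k2 (s - t)) f x"
proof -
  have "conv k1 (conv k2 f) x = (LINT t|lborel. LINT s|lborel. k1 t * k2 (s - t) * f (x + s))"
    unfolding conv_def
  proof (rule Bochner_Integration.integral_cong)
    fix t
    have "(LINT s|lborel. k1 t * k2 (s - t) * f (x + s)) = (LINT s|lborel. k1 t * (k2 s * f (x + t + s)))"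
      by (subst lborel_integral_real_affine[where c=1 and t=t]) (auto simp: ac_simps)
    then show "k1 t * (LINT s|lborel. k2 s * f (x + t + s)) = (LINT s|lborel. k1 t * k2 (s - t) * f (x + s))" by simp
  qed simp
  also have "\<dots> = (LINT s|lborel. LINT t|lborel. k1 t * k2 (s - t) * f (x + s))"
  proof (rule lborel_Fubini)
    have "(\<integral>\<^sup>+t. \<integral>\<^sup>+s. ennreal \<bar>k1 t * k2 (s - t) * f (x + s)\<bar> \<partial>lborel \<partial>lborel) = (\<integral>\<^sup>+t. ennreal \<bar>k1 t\<bar> * abs_conv k2 f (x + t) \<partial>lborel)"
    proof (rule nn_integral_cong)
      fix t
      have "(\<integral>\<^sup>+s. ennreal \<bar>k1 t * k2 (s - t) * f (x + s)\<bar> \<partial>lborel) = (\<integral>\<^sup>+s. ennreal \<bar>k1 t\<bar> * ennreal (\<bar>k2 s\<bar> * \<bar>f (x + t + s)\<bar>) \<partial>lborel)"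
        by (subst nn_integral_real_affine[where c=1 and t=t]) (auto simp: abs_mult ac_simps simp flip: ennreal_mult)
      then show "(\<integral>\<^sup>+s. ennreal \<bar>k1 t * k2 (s - t) * f (x + s)\<bar> \<partial>lborel) = ennreal \<bar>k1 t\<bar> * abs_conv k2 f (x + t)"
        by (simp add: abs_conv_def nn_integral_cmult)
    qed
    then show "(\<integral>\<^sup>+t. \<integral>\<^sup>+s. ennreal \<bar>k1 t * k2 (s - t) * f (x + s)\<bar> \<partial>lborel \<partial>lborel) < \<infinity>" using fin by simp
  qed measurable
  finally show ?thesis unfolding conv_def by simp
qed

lemma conv_commute: "conv k1 (conv k2 f) x = conv k2 (conv k1 f) x"
proof -
  have "conv k1 (conv k2 f) x = (LINT t|lborel. LINT s|lborel. k1 t * (k2 s * f (x + t + s)))"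
    unfolding conv_def by simp
  also have "\<dots> = (LINT s|lborel. LINT t|lborel. k1 t * (k2 s * f (x + t + s)))"
  proof (rule lborel_Fubini)
    have "(\<integral>\<^sup>+t. \<integral>\<^sup>+s. ennreal \<bar>k1 t * (k2 s * f (x + t + s))\<bar> \<partial>lborel \<partial>lborel) = (\<integral>\<^sup>+t. ennreal \<bar>k1 t\<bar> * abs_conv k2 f (x + t) \<partial>lborel)"
      unfolding abs_conv_def
      by (subst nn_integral_cmult[symmetric]) (auto simp: abs_mult ennreal_mult)
    then show "(\<integral>\<^sup>+t. \<integral>\<^sup>+s. ennreal \<bar>k1 t * (k2 s * f (x + t + s))\<bar> \<partial>lborel \<partial>lborel) < \<infinity>" using fin by simp
  qed measurable
  also have "\<dots> = (LINT s|lborel. LINT t|lborel. k2 s * (k1 t * f (x + s + t)))" by (simp add: ac_simps)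
  finally show ?thesis unfolding conv_def by simp
qed

end

section \<open>Kernels of Marchaud type\<close>

definition trunc_kernel :: "real \<Rightarrow> real \<Rightarrow> real \<Rightarrow> real" where
  "trunc_kernel \<alpha> \<epsilon> t = (if \<epsilon> < t then t powr (- 1 - \<alpha>) else 0)"

text \<open>The closed form of the convolution of \<open>trunc_kernel\<close> with
  \<open>frac_kernel\<close>, as computed in \<open>nn_integral_trunc_frac_kernel\<close>.\<close>

definition frac_trunc_kernel :: "real \<Rightarrow> real \<Rightarrow> real \<Rightarrow> real" where
  "frac_trunc_kernel \<alpha> \<epsilon> s = (if \<epsilon> < s then \<epsilon> powr (- \<alpha>) * (s - \<epsilon>) powr \<alpha> / (\<alpha> * s) else 0)"

text \<open>The kernel of \<open>marchaud_diff\<close> composed with convolution by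
  \<open>frac_kernel\<close>; the coefficient \<epsilon>^(-\<alpha>)/\<alpha> is the integral of
  \<open>trunc_kernel\<close>.\<close>

definition marchaud_kernel :: "real \<Rightarrow> real \<Rightarrow> real \<Rightarrow> real" where
  "marchaud_kernel \<alpha> \<epsilon> s = \<epsilon> powr (- \<alpha>) / \<alpha> * frac_kernel \<alpha> s - frac_trunc_kernel \<alpha> \<epsilon> s"

lemma kernel_measurable[measurable]:
  "trunc_kernel \<alpha> \<epsilon> \<in> borel_measurable borel"
  "frac_trunc_kernel \<alpha> \<epsilon> \<in> borel_measurable borel"
  "marchaud_kernel \<alpha> \<epsilon> \<in> borel_measurable borel"
  unfolding trunc_kernel_def[abs_def] frac_trunc_kernel_def[abs_def] marchaud_kernel_def[abs_def]
  by measurable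

lemma trunc_kernel_nonneg: "0 \<le> trunc_kernel \<alpha> \<epsilon> t" by (simp add: trunc_kernel_def)

lemma nn_integral_powr_tail:
  fixes a e :: real
  assumes "e < - 1" "0 < a"
  shows "(\<integral>\<^sup>+t. ennreal (t powr e) * indicator {a<..} t \<partial>lborel) = ennreal (- (a powr (e + 1)) / (e + 1))"
proof -
  have "((\<lambda>t. if t \<in> {a..} then t powr e else 0) has_integral - (a powr (e + 1)) / (e + 1)) UNIV"
    using has_integral_powr_to_inf[OF assms] by (simp only: has_integral_restrict_UNIV)
  then have "(\<integral>\<^sup>+t. ennreal (if t \<in> {a..} then t powr e else 0) \<partial>lborel) = ennreal (- (a powr (e + 1)) / (e + 1))"
    by (intro nn_integral_has_integral_lborel) auto
  also have "(\<integral>\<^sup>+t. ennreal (if t \<in> {a..} then t powr e else 0) \<partial>lborel) = (\<integral>\<^sup>+t. ennreal (t powr e) * indicator {a<..} t \<partial>lborel)"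
  proof (rule nn_integral_cong_AE)
    show "AE t in lborel. ennreal (if t \<in> {a..} then t powr e else 0) = ennreal (t powr e) * indicator {a<..} t"
      using AE_lborel_singleton[of a] by eventually_elim (auto simp: indicator_def)
  qed
  finally show ?thesis .
qed

context
  fixes \<alpha> :: real
  assumes \<alpha>: "0 < \<alpha>" "\<alpha> < 1"
begin

lemma nn_integral_trunc_kernel:
  assumes "0 < \<epsilon>"
  shows "(\<integral>\<^sup>+t. ennreal (trunc_kernel \<alpha> \<epsilon> t) \<partial>lborel) = ennreal (\<epsilon> powr (- \<alpha>) / \<alpha>)"
proof -
  have "(\<integral>\<^sup>+t. ennreal (trunc_kernel \<alpha> \<epsilon> t) \<partial>lborel) = (\<integral>\<^sup>+t. ennreal (t powr (- 1 - \<alpha>)) * indicator {\<epsilon><..} t \<partial>lborel)"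
    by (intro nn_integral_cong) (auto simp: trunc_kernel_def indicator_def)
  also have "\<dots> = ennreal (\<epsilon> powr (- \<alpha>) / \<alpha>)"
    using \<alpha> assms by (subst nn_integral_powr_tail) auto
  finally show ?thesis .
qed

lemma trunc_kernel_integrable:
  assumes "0 < \<epsilon>"
  shows "integrable lborel (trunc_kernel \<alpha> \<epsilon>)" "(LINT t|lborel. trunc_kernel \<alpha> \<epsilon> t) = \<epsilon> powr (- \<alpha>) / \<alpha>"
proof -
  show "integrable lborel (trunc_kernel \<alpha> \<epsilon>)"
    using nn_integral_trunc_kernel[OF assms] by (intro integrableI_bounded) (auto simp: trunc_kernel_nonneg)
  have "(LINT t|lborel. trunc_kernel \<alpha> \<epsilon> t) = enn2real (\<integral>\<^sup>+t. ennreal (trunc_kernel \<alpha> \<epsilon> t) \<partial>lborel)"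
    by (rule integral_eq_nn_integral) (auto simp: trunc_kernel_nonneg)
  then show "(LINT t|lborel. trunc_kernel \<alpha> \<epsilon> t) = \<epsilon> powr (- \<alpha>) / \<alpha>"
    using nn_integral_trunc_kernel[OF assms] \<alpha> by simp
qed

text \<open>The antiderivative of \<open>t powr (- 1 - \<alpha>) * (s - t) powr (\<alpha> - 1)\<close> is
  \<open>- ((s - t) / t) powr \<alpha> / (\<alpha> * s)\<close>.\<close>

lemma nn_integral_trunc_frac_kernel:
  assumes \<epsilon>: "0 < \<epsilon>"
  shows "(\<integral>\<^sup>+t. ennreal (trunc_kernel \<alpha> \<epsilon> t * frac_kernel \<alpha> (s - t)) \<partial>lborel) = ennreal (frac_trunc_kernel \<alpha> \<epsilon> s)"
proof (cases "\<epsilon> < s")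
  case False
  then have "trunc_kernel \<alpha> \<epsilon> t * frac_kernel \<alpha> (s - t) = 0" for t by (auto simp: trunc_kernel_def frac_kernel_def)
  then show ?thesis using False by (simp only: frac_trunc_kernel_def) simp
next
  case True
  define F where "F t = - (((s - t) / t) powr \<alpha>) / (\<alpha> * s)" for t
  define f where "f t = t powr (- 1 - \<alpha>) * (s - t) powr (\<alpha> - 1)" for t
  have [measurable]: "f \<in> borel_measurable borel" unfolding f_def[abs_def] by measurable
  have "(f has_integral (F s - F \<epsilon>)) {\<epsilon>..s}"
  proof (rule fundamental_theorem_of_calculus_interior)
    show "\<epsilon> \<le> s" using True by simp
    show "continuous_on {\<epsilon>..s} F"
      unfolding F_def using \<epsilon> \<alpha> True by (intro continuous_intros continuous_on_powr') auto
    fix t assume t: "t \<in> {\<epsilon><..<s}"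
    then have tp: "0 < t" "0 < (s - t) / t" using \<epsilon> by auto
    have "DERIV (\<lambda>t. (s - t) / t) t :> - s / t\<^sup>2"
      using tp by (auto intro!: derivative_eq_intros simp: power2_eq_square field_simps)
    from DERIV_fun_powr[OF this tp(2), of \<alpha>]
    have "DERIV (\<lambda>t. ((s - t) / t) powr \<alpha>) t :> \<alpha> * ((s - t) / t) powr (\<alpha> - 1) * (- s / t\<^sup>2)" by simp
    from DERIV_cmult[OF this, of "- 1 / (\<alpha> * s)"]
    have "DERIV F t :> (- 1 / (\<alpha> * s)) * (\<alpha> * ((s - t) / t) powr (\<alpha> - 1) * (- s / t\<^sup>2))"
      by (simp add: F_def[abs_def])
    also have "(- 1 / (\<alpha> * s)) * (\<alpha> * ((s - t) / t) powr (\<alpha> - 1) * (- s / t\<^sup>2)) = ((s - t) / t) powr (\<alpha> - 1) / t\<^sup>2"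
      using \<alpha> \<epsilon> True by (simp add: field_simps)
    also have "\<dots> = f t"
    proof -
      have "((s - t) / t) powr (\<alpha> - 1) = (s - t) powr (\<alpha> - 1) * t powr (- (\<alpha> - 1))"
        unfolding powr_minus_divide[of t "\<alpha> - 1"] using tp t by (simp add: powr_divide)
      moreover have "1 / t\<^sup>2 = t powr (- 2)" using tp by (simp add: powr_minus_divide)
      ultimately have "((s - t) / t) powr (\<alpha> - 1) / t\<^sup>2 = (s - t) powr (\<alpha> - 1) * (t powr (- (\<alpha> - 1)) * t powr (- 2))"
        by (metis mult.assoc mult.right_neutral times_divide_eq_right)
      also have "t powr (- (\<alpha> - 1)) * t powr (- 2) = t powr (- 1 - \<alpha>)"
        unfolding powr_add[symmetric] by (simp add: algebra_simps)
      finally show ?thesis by (simp add: f_def)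
    qed
    finally show "(F has_vector_derivative f t) (at t)"
      by (simp add: has_real_derivative_iff_has_vector_derivative)
  qed
  then have "((\<lambda>t. if t \<in> {\<epsilon>..s} then f t else 0) has_integral (F s - F \<epsilon>)) UNIV"
    by (simp only: has_integral_restrict_UNIV)
  then have "(\<integral>\<^sup>+t. ennreal (if t \<in> {\<epsilon>..s} then f t else 0) \<partial>lborel) = ennreal (F s - F \<epsilon>)"
    by (intro nn_integral_has_integral_lborel) (auto simp: f_def)
  moreover have "(\<integral>\<^sup>+t. ennreal (if t \<in> {\<epsilon>..s} then f t else 0) \<partial>lborel) = (\<integral>\<^sup>+t. ennreal (trunc_kernel \<alpha> \<epsilon> t * frac_kernel \<alpha> (s - t)) \<partial>lborel)"
  proof (rule nn_integral_cong_AE)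
    show "AE t in lborel. ennreal (if t \<in> {\<epsilon>..s} then f t else 0) = ennreal (trunc_kernel \<alpha> \<epsilon> t * frac_kernel \<alpha> (s - t))"
      using AE_lborel_singleton[of \<epsilon>] AE_lborel_singleton[of s]
      by eventually_elim (auto simp: trunc_kernel_def frac_kernel_def f_def)
  qed
  moreover have "F s - F \<epsilon> = frac_trunc_kernel \<alpha> \<epsilon> s"
    using True \<epsilon> \<alpha> by (simp add: F_def frac_trunc_kernel_def powr_divide powr_minus_divide)
  ultimately show ?thesis by simp
qed

text \<open>Boundedness in s makes the product with the integrable \<open>trunc_kernel\<close>
  integrable in \<open>trunc_frac_trunc_commute\<close>.\<close>

lemma frac_trunc_kernel_bounds:
  assumes \<epsilon>: "0 < \<epsilon>"
  shows "0 \<le> frac_trunc_kernel \<alpha> \<epsilon> s" "frac_trunc_kernel \<alpha> \<epsilon> s \<le> 1 / (\<alpha> * \<epsilon>)"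
proof -
  show "0 \<le> frac_trunc_kernel \<alpha> \<epsilon> s" using \<epsilon> \<alpha> by (auto simp: frac_trunc_kernel_def)
  show "frac_trunc_kernel \<alpha> \<epsilon> s \<le> 1 / (\<alpha> * \<epsilon>)"
  proof (cases "\<epsilon> < s")
    case True
    have "(s - \<epsilon>) powr \<alpha> / s \<le> s powr \<alpha> / s" using True \<epsilon> \<alpha> by (intro divide_right_mono powr_mono2) auto
    also have "\<dots> = s powr (\<alpha> - 1)" using True \<epsilon> by (simp add: powr_diff)
    also have "\<dots> \<le> \<epsilon> powr (\<alpha> - 1)" using True \<epsilon> \<alpha> by (intro powr_mono2') auto
    finally have "\<epsilon> powr (- \<alpha>) / \<alpha> * ((s - \<epsilon>) powr \<alpha> / s) \<le> \<epsilon> powr (- \<alpha>) / \<alpha> * \<epsilon> powr (\<alpha> - 1)"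
      using \<alpha> by (intro mult_left_mono) auto
    also have "\<dots> = 1 / (\<alpha> * \<epsilon>)"
    proof -
      have "\<epsilon> powr (- \<alpha>) * \<epsilon> powr (\<alpha> - 1) = \<epsilon> powr (- 1)" by (simp flip: powr_add)
      then have "\<epsilon> powr (- \<alpha>) * \<epsilon> powr (\<alpha> - 1) = 1 / \<epsilon>" using \<epsilon> by (simp only: powr_minus_divide) simp
      moreover have "\<epsilon> powr (- \<alpha>) / \<alpha> * \<epsilon> powr (\<alpha> - 1) = (\<epsilon> powr (- \<alpha>) * \<epsilon> powr (\<alpha> - 1)) / \<alpha>" by simp
      ultimately show ?thesis using \<epsilon> \<alpha> by simp
    qed
    finally show ?thesis using True by (simp add: frac_trunc_kernel_def)
  qed (use \<alpha> \<epsilon> in \<open>auto simp: frac_trunc_kernel_def\<close>)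
qed

lemma trunc_frac_kernel_integral:
  assumes \<epsilon>: "0 < \<epsilon>"
  shows "integrable lborel (\<lambda>t. trunc_kernel \<alpha> \<epsilon> t * frac_kernel \<alpha> (s - t))"
    "(LINT t|lborel. trunc_kernel \<alpha> \<epsilon> t * frac_kernel \<alpha> (s - t)) = frac_trunc_kernel \<alpha> \<epsilon> s"
    "integrable lborel (\<lambda>t. frac_kernel \<alpha> t * trunc_kernel \<alpha> \<epsilon> (s - t))"
    "(LINT t|lborel. frac_kernel \<alpha> t * trunc_kernel \<alpha> \<epsilon> (s - t)) = frac_trunc_kernel \<alpha> \<epsilon> s"
proof -
  have nn: "0 \<le> trunc_kernel \<alpha> \<epsilon> t * frac_kernel \<alpha> (s - t)" for t
    by (simp add: trunc_kernel_nonneg frac_kernel_nonneg)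
  show 1: "integrable lborel (\<lambda>t. trunc_kernel \<alpha> \<epsilon> t * frac_kernel \<alpha> (s - t))"
    using nn_integral_trunc_frac_kernel[OF \<epsilon>, of s] nn by (intro integrableI_bounded) auto
  have "(LINT t|lborel. trunc_kernel \<alpha> \<epsilon> t * frac_kernel \<alpha> (s - t)) = enn2real (\<integral>\<^sup>+t. ennreal (trunc_kernel \<alpha> \<epsilon> t * frac_kernel \<alpha> (s - t)) \<partial>lborel)"
    using nn by (intro integral_eq_nn_integral) auto
  then show 2: "(LINT t|lborel. trunc_kernel \<alpha> \<epsilon> t * frac_kernel \<alpha> (s - t)) = frac_trunc_kernel \<alpha> \<epsilon> s"
    using nn_integral_trunc_frac_kernel[OF \<epsilon>, of s] frac_trunc_kernel_bounds[OF \<epsilon>] by simp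
  have eq: "(\<lambda>t. frac_kernel \<alpha> t * trunc_kernel \<alpha> \<epsilon> (s - t)) = (\<lambda>t. (\<lambda>t. trunc_kernel \<alpha> \<epsilon> t * frac_kernel \<alpha> (s - t)) (s + (- 1) * t))"
    by (simp add: mult.commute)
  show "integrable lborel (\<lambda>t. frac_kernel \<alpha> t * trunc_kernel \<alpha> \<epsilon> (s - t))"
    unfolding eq by (rule lborel_integrable_real_affine[OF 1]) simp
  show "(LINT t|lborel. frac_kernel \<alpha> t * trunc_kernel \<alpha> \<epsilon> (s - t)) = frac_trunc_kernel \<alpha> \<epsilon> s"
    unfolding eq 2[symmetric]
    by (subst (2) lborel_integral_real_affine[where c="- 1" and t=s]) auto
qed

text \<open>With \<open>R t = frac_kernel \<alpha> (- t)\<close>, convolution kernels become values of \<^term>\<open>conv\<close>, so that the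
  commutativity of convolution is an instance of \<open>conv_commute\<close>.\<close>

lemma trunc_frac_trunc_commute:
  assumes \<epsilon>: "0 < \<epsilon>" and \<delta>: "0 < \<delta>"
  shows "integrable lborel (\<lambda>t. frac_trunc_kernel \<alpha> \<delta> t * trunc_kernel \<alpha> \<epsilon> (s - t))"
    "(LINT t|lborel. frac_trunc_kernel \<alpha> \<delta> t * trunc_kernel \<alpha> \<epsilon> (s - t)) =
     (LINT t|lborel. frac_trunc_kernel \<alpha> \<epsilon> t * trunc_kernel \<alpha> \<delta> (s - t))"
proof -
  define R where "R t = frac_kernel \<alpha> (- t)" for t
  have [measurable]: "R \<in> borel_measurable borel" unfolding R_def[abs_def] by measurable
  have c: "conv (trunc_kernel \<alpha> \<delta>) R x = frac_trunc_kernel \<alpha> \<delta> (- x)" if "0 < \<delta>" for x \<delta>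
  proof -
    have "conv (trunc_kernel \<alpha> \<delta>) R x = (LINT t|lborel. trunc_kernel \<alpha> \<delta> t * frac_kernel \<alpha> (- x - t))"
      by (simp add: conv_def R_def)
    then show ?thesis using trunc_frac_kernel_integral(2)[OF that] by simp
  qed
  have ac: "abs_conv (trunc_kernel \<alpha> \<delta>) R x = ennreal (frac_trunc_kernel \<alpha> \<delta> (- x))" if "0 < \<delta>" for x \<delta>
  proof -
    have "abs_conv (trunc_kernel \<alpha> \<delta>) R x = (\<integral>\<^sup>+t. ennreal (trunc_kernel \<alpha> \<delta> t * frac_kernel \<alpha> (- x - t)) \<partial>lborel)"
      by (simp add: abs_conv_def R_def trunc_kernel_nonneg frac_kernel_nonneg)
    then show ?thesis using nn_integral_trunc_frac_kernel[OF that] by simp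
  qed
  have int: "integrable lborel (\<lambda>t. trunc_kernel \<alpha> \<epsilon> t * frac_trunc_kernel \<alpha> \<delta> (s - t))" if \<epsilon>: "0 < \<epsilon>" and \<delta>: "0 < \<delta>" for \<epsilon> \<delta>
  proof (rule Bochner_Integration.integrable_bound[OF integrable_mult_left[OF trunc_kernel_integrable(1)[OF \<epsilon>], of "1 / (\<alpha> * \<delta>)"]])
    have "\<bar>trunc_kernel \<alpha> \<epsilon> t * frac_trunc_kernel \<alpha> \<delta> (s - t)\<bar> \<le> \<bar>trunc_kernel \<alpha> \<epsilon> t * (1 / (\<alpha> * \<delta>))\<bar>" for t
      unfolding abs_mult using frac_trunc_kernel_bounds[OF \<delta>, of "s - t"] mult_pos_pos[OF \<alpha>(1) \<delta>]
      by (intro mult_left_mono) (auto simp del: zero_less_mult_iff)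
    then show "AE t in lborel. norm (trunc_kernel \<alpha> \<epsilon> t * frac_trunc_kernel \<alpha> \<delta> (s - t)) \<le> norm (trunc_kernel \<alpha> \<epsilon> t * (1 / (\<alpha> * \<delta>)))"
      by simp
  qed measurable
  have eq: "(\<lambda>t. frac_trunc_kernel \<alpha> \<delta> t * trunc_kernel \<alpha> \<epsilon> (s - t)) = (\<lambda>t. (\<lambda>t. trunc_kernel \<alpha> \<epsilon> t * frac_trunc_kernel \<alpha> \<delta> (s - t)) (s + (- 1) * t))" for \<epsilon> \<delta>
    by (simp add: mult.commute)
  show "integrable lborel (\<lambda>t. frac_trunc_kernel \<alpha> \<delta> t * trunc_kernel \<alpha> \<epsilon> (s - t))"
    unfolding eq by (rule lborel_integrable_real_affine[OF int[OF \<epsilon> \<delta>]]) simp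
  have e: "(LINT t|lborel. frac_trunc_kernel \<alpha> \<delta> t * trunc_kernel \<alpha> \<epsilon> (s - t)) = conv (trunc_kernel \<alpha> \<epsilon>) (conv (trunc_kernel \<alpha> \<delta>) R) (- s)"
    if "0 < \<delta>" for \<epsilon> \<delta>
  proof -
    have "conv (trunc_kernel \<alpha> \<epsilon>) (conv (trunc_kernel \<alpha> \<delta>) R) (- s) = (LINT t|lborel. trunc_kernel \<alpha> \<epsilon> t * frac_trunc_kernel \<alpha> \<delta> (s - t))"
      by (subst conv_def) (simp add: c[OF that])
    also have "\<dots> = (LINT t|lborel. frac_trunc_kernel \<alpha> \<delta> t * trunc_kernel \<alpha> \<epsilon> (s - t))"
      unfolding eq by (subst lborel_integral_real_affine[where c="- 1" and t=s]) auto
    finally show ?thesis by simp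
  qed
  show "(LINT t|lborel. frac_trunc_kernel \<alpha> \<delta> t * trunc_kernel \<alpha> \<epsilon> (s - t)) =
     (LINT t|lborel. frac_trunc_kernel \<alpha> \<epsilon> t * trunc_kernel \<alpha> \<delta> (s - t))"
    unfolding e[OF \<delta>] e[OF \<epsilon>]
  proof (rule conv_commute)
    have "(\<integral>\<^sup>+t. ennreal \<bar>trunc_kernel \<alpha> \<epsilon> t\<bar> * abs_conv (trunc_kernel \<alpha> \<delta>) R (- s + t) \<partial>lborel)
      = (\<integral>\<^sup>+t. ennreal (norm (trunc_kernel \<alpha> \<epsilon> t * frac_trunc_kernel \<alpha> \<delta> (s - t))) \<partial>lborel)"
      using frac_trunc_kernel_bounds(1)[OF \<delta>]
      by (intro nn_integral_cong) (simp add: ac[OF \<delta>] abs_mult ennreal_mult)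
    also have "\<dots> < \<infinity>" using int[OF \<epsilon> \<delta>] by (simp add: integrable_iff_bounded)
    finally show "(\<integral>\<^sup>+t. ennreal \<bar>trunc_kernel \<alpha> \<epsilon> t\<bar> * abs_conv (trunc_kernel \<alpha> \<delta>) R (- s + t) \<partial>lborel) < \<infinity>" .
  qed measurable
qed

text \<open>Formally, let \<tau>_\<epsilon> be \<epsilon>^(-\<alpha>)/\<alpha> times the point mass
  at 0 minus \<open>trunc_kernel\<close>. The Marchaud kernel is \<tau>_\<epsilon> convolved with
  \<open>frac_kernel\<close>, so \<tau>_\<epsilon> convolved with the kernel for \<delta> is
  symmetric in \<epsilon> and \<delta>. Rearranged so that no point mass occurs, this symmetry is
  the identity.\<close>

lemma marchaud_trunc_identity:
  assumes \<epsilon>: "0 < \<epsilon>" and \<delta>: "0 < \<delta>"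
  shows "(LINT t|lborel. marchaud_kernel \<alpha> \<delta> t * trunc_kernel \<alpha> \<epsilon> (s - t)) + \<delta> powr (- \<alpha>) / \<alpha> * marchaud_kernel \<alpha> \<epsilon> s =
    (LINT t|lborel. marchaud_kernel \<alpha> \<epsilon> t * trunc_kernel \<alpha> \<delta> (s - t)) + \<epsilon> powr (- \<alpha>) / \<alpha> * marchaud_kernel \<alpha> \<delta> s"
proof -
  have *: "(LINT t|lborel. marchaud_kernel \<alpha> \<delta> t * trunc_kernel \<alpha> \<epsilon> (s - t)) =
    \<delta> powr (- \<alpha>) / \<alpha> * frac_trunc_kernel \<alpha> \<epsilon> s - (LINT t|lborel. frac_trunc_kernel \<alpha> \<delta> t * trunc_kernel \<alpha> \<epsilon> (s - t))"
    if \<epsilon>: "0 < \<epsilon>" and \<delta>: "0 < \<delta>" for \<epsilon> \<delta>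
  proof -
    have "(LINT t|lborel. marchaud_kernel \<alpha> \<delta> t * trunc_kernel \<alpha> \<epsilon> (s - t)) =
      (LINT t|lborel. \<delta> powr (- \<alpha>) / \<alpha> * (frac_kernel \<alpha> t * trunc_kernel \<alpha> \<epsilon> (s - t)) - frac_trunc_kernel \<alpha> \<delta> t * trunc_kernel \<alpha> \<epsilon> (s - t))"
      by (simp add: marchaud_kernel_def left_diff_distrib mult.assoc)
    also have "\<dots> = \<delta> powr (- \<alpha>) / \<alpha> * frac_trunc_kernel \<alpha> \<epsilon> s - (LINT t|lborel. frac_trunc_kernel \<alpha> \<delta> t * trunc_kernel \<alpha> \<epsilon> (s - t))"
      using trunc_frac_kernel_integral(3,4)[OF \<epsilon>, of s] trunc_frac_trunc_commute(1)[OF \<epsilon> \<delta>, of s]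
      by (subst Bochner_Integration.integral_diff) auto
    finally show ?thesis .
  qed
  show ?thesis unfolding *[OF \<epsilon> \<delta>] *[OF \<delta> \<epsilon>] trunc_frac_trunc_commute(2)[OF \<epsilon> \<delta>, of s]
    by (simp add: marchaud_kernel_def algebra_simps)
qed

text \<open>On (0, \<epsilon>] this is the kernel itself. Beyond \<epsilon> it comes from s^\<alpha>
  - (s - \<epsilon>)^\<alpha> <= \<epsilon> s^(\<alpha> - 1), a gain of decay that makes the tail
  integrable. The two branches agree at \<epsilon>, so the function is decreasing on (0,
  \<infinity>).\<close>

definition marchaud_majorant :: "real \<Rightarrow> real \<Rightarrow> real" where
  "marchaud_majorant \<epsilon> s = (if s \<le> 0 then 0 else if s \<le> \<epsilon> then \<epsilon> powr (- \<alpha>) / \<alpha> * s powr (\<alpha> - 1)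
     else \<epsilon> powr (1 - \<alpha>) / \<alpha> * s powr (\<alpha> - 2))"

lemma marchaud_majorant_measurable[measurable]: "marchaud_majorant \<epsilon> \<in> borel_measurable borel"
  unfolding marchaud_majorant_def[abs_def] by measurable

lemma marchaud_kernel_bounds:
  assumes \<epsilon>: "0 < \<epsilon>"
  shows "0 \<le> marchaud_kernel \<alpha> \<epsilon> s" "marchaud_kernel \<alpha> \<epsilon> s \<le> marchaud_majorant \<epsilon> s"
proof -
  have "0 \<le> marchaud_kernel \<alpha> \<epsilon> s \<and> marchaud_kernel \<alpha> \<epsilon> s \<le> marchaud_majorant \<epsilon> s"
  proof (cases "\<epsilon> < s")
    case False
    then show ?thesis using \<alpha>
      by (auto simp: marchaud_kernel_def marchaud_majorant_def frac_trunc_kernel_def frac_kernel_def)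
  next
    case True
    then have s: "0 < s" using \<epsilon> by simp
    have eq: "marchaud_kernel \<alpha> \<epsilon> s = \<epsilon> powr (- \<alpha>) / \<alpha> * ((s powr \<alpha> - (s - \<epsilon>) powr \<alpha>) / s)"
      using True s by (simp add: marchaud_kernel_def frac_kernel_def frac_trunc_kernel_def powr_diff diff_divide_distrib right_diff_distrib)
    have "(s - \<epsilon>) powr \<alpha> \<le> s powr \<alpha>" using True \<epsilon> \<alpha> by (intro powr_mono2) auto
    then have "0 \<le> marchaud_kernel \<alpha> \<epsilon> s" unfolding eq using s \<alpha> by simp
    moreover have "marchaud_kernel \<alpha> \<epsilon> s \<le> marchaud_majorant \<epsilon> s"
    proof -
      \<comment> \<open>A number in [0, 1] does not decrease when raised to a power \<alpha> < 1;
        multiplication by s^\<alpha> turns this into the bound for the difference of powers.\<close>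
      have "1 - \<epsilon> / s \<le> (1 - \<epsilon> / s) powr \<alpha>"
        using powr_mono'[of \<alpha> 1 "1 - \<epsilon> / s"] True \<epsilon> s \<alpha> by simp
      then have "s powr \<alpha> * (1 - \<epsilon> / s) \<le> s powr \<alpha> * (1 - \<epsilon> / s) powr \<alpha>" by (intro mult_left_mono) auto
      also have "\<dots> = (s * (1 - \<epsilon> / s)) powr \<alpha>" using True \<epsilon> s by (simp add: powr_mult)
      also have "s * (1 - \<epsilon> / s) = s - \<epsilon>" using s by (simp add: field_simps)
      finally have "s powr \<alpha> - (s - \<epsilon>) powr \<alpha> \<le> s powr \<alpha> * (\<epsilon> / s)" by (simp add: algebra_simps)
      then have "\<epsilon> powr (- \<alpha>) / \<alpha> * ((s powr \<alpha> - (s - \<epsilon>) powr \<alpha>) / s) \<le> \<epsilon> powr (- \<alpha>) / \<alpha> * (s powr \<alpha> * (\<epsilon> / s) / s)"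
        using s \<alpha> by (intro mult_left_mono divide_right_mono) auto
      also have "\<dots> = (\<epsilon> powr (- \<alpha>) * \<epsilon>) / \<alpha> * (s powr \<alpha> / (s * s))" by simp
      also have "\<epsilon> powr (- \<alpha>) * \<epsilon> = \<epsilon> powr (1 - \<alpha>)" using \<epsilon> by (simp add: powr_diff powr_minus_divide)
      also have "s powr \<alpha> / (s * s) = s powr (\<alpha> - 2)" using s by (simp add: powr_diff power2_eq_square)
      finally show ?thesis unfolding eq using True s by (simp add: marchaud_majorant_def)
    qed
    ultimately show ?thesis by simp
  qed
  then show "0 \<le> marchaud_kernel \<alpha> \<epsilon> s" "marchaud_kernel \<alpha> \<epsilon> s \<le> marchaud_majorant \<epsilon> s" by auto
qed

lemma marchaud_majorant_props:
  assumes \<epsilon>: "0 < \<epsilon>"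
  shows "0 \<le> marchaud_majorant \<epsilon> s" "s \<le> 0 \<Longrightarrow> marchaud_majorant \<epsilon> s = 0"
    "0 < s \<Longrightarrow> s \<le> t \<Longrightarrow> marchaud_majorant \<epsilon> t \<le> marchaud_majorant \<epsilon> s"
proof -
  show "0 \<le> marchaud_majorant \<epsilon> s" "s \<le> 0 \<Longrightarrow> marchaud_majorant \<epsilon> s = 0"
    using \<alpha> \<epsilon> by (auto simp: marchaud_majorant_def)
  assume st: "0 < s" "s \<le> t"
  consider "t \<le> \<epsilon>" | "\<epsilon> < s" | "s \<le> \<epsilon>" "\<epsilon> < t" by linarith
  then show "marchaud_majorant \<epsilon> t \<le> marchaud_majorant \<epsilon> s"
  proof cases
    case 1
    then show ?thesis using st \<alpha> unfolding marchaud_majorant_def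
      by (auto intro!: mult_left_mono powr_mono2' divide_right_mono)
  next
    case 2
    then show ?thesis using st \<alpha> unfolding marchaud_majorant_def
      by (auto intro!: mult_left_mono powr_mono2' divide_right_mono)
  next
    case 3
    have "\<epsilon> powr (1 - \<alpha>) / \<alpha> * t powr (\<alpha> - 2) \<le> \<epsilon> powr (1 - \<alpha>) / \<alpha> * \<epsilon> powr (\<alpha> - 2)"
      using 3 \<epsilon> \<alpha> by (intro mult_left_mono powr_mono2') auto
    also have "\<dots> = \<epsilon> powr (- \<alpha>) / \<alpha> * \<epsilon> powr (\<alpha> - 1)" by (simp flip: powr_add)
    also have "\<dots> \<le> \<epsilon> powr (- \<alpha>) / \<alpha> * s powr (\<alpha> - 1)"
      using 3 st \<alpha> by (intro mult_left_mono powr_mono2') auto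
    finally show ?thesis using 3 st \<epsilon> by (simp add: marchaud_majorant_def)
  qed
qed

text \<open>The integral of \<open>marchaud_majorant \<epsilon>\<close>, the same for every
  \<epsilon> by dilation: 1/\<alpha>^2 from (0, \<epsilon>] and 1/(\<alpha> (1 - \<alpha>)) from the
  tail. This is why the convolution bounds are uniform in \<epsilon>.\<close>

definition marchaud_mass :: real where "marchaud_mass = 1 / \<alpha>\<^sup>2 + 1 / (\<alpha> * (1 - \<alpha>))"

lemma marchaud_mass_pos: "0 < marchaud_mass"
  using \<alpha> by (auto simp: marchaud_mass_def intro!: add_pos_pos divide_pos_pos mult_pos_pos)

lemma nn_integral_marchaud_majorant:
  assumes \<epsilon>: "0 < \<epsilon>"
  shows "(\<integral>\<^sup>+s. ennreal (marchaud_majorant \<epsilon> s) \<partial>lborel) \<le> ennreal marchaud_mass"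
proof -
  have "(\<integral>\<^sup>+s. ennreal (marchaud_majorant \<epsilon> s) \<partial>lborel) =
    (\<integral>\<^sup>+s. ennreal (\<epsilon> powr (- \<alpha>) / \<alpha>\<^sup>2) * (ennreal (\<alpha> * s powr (\<alpha> - 1)) * indicator {0<..<\<epsilon>} s)
       + ennreal (\<epsilon> powr (1 - \<alpha>) / \<alpha>) * (ennreal (s powr (\<alpha> - 2)) * indicator {\<epsilon><..} s) \<partial>lborel)"
  proof (rule nn_integral_cong_AE)
    show "AE s in lborel. ennreal (marchaud_majorant \<epsilon> s) = ennreal (\<epsilon> powr (- \<alpha>) / \<alpha>\<^sup>2) * (ennreal (\<alpha> * s powr (\<alpha> - 1)) * indicator {0<..<\<epsilon>} s)
       + ennreal (\<epsilon> powr (1 - \<alpha>) / \<alpha>) * (ennreal (s powr (\<alpha> - 2)) * indicator {\<epsilon><..} s)"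
      using AE_lborel_singleton[of \<epsilon>]
    proof eventually_elim
      case (elim s)
      then show ?case using \<alpha> \<epsilon>
        by (auto simp: marchaud_majorant_def indicator_def power2_eq_square simp flip: ennreal_mult'')
    qed
  qed
  also have "\<dots> = ennreal (\<epsilon> powr (- \<alpha>) / \<alpha>\<^sup>2) * ennreal (\<epsilon> powr \<alpha>) + ennreal (\<epsilon> powr (1 - \<alpha>) / \<alpha>) * ennreal (- (\<epsilon> powr (\<alpha> - 2 + 1)) / (\<alpha> - 2 + 1))"
  proof -
    have "(\<integral>\<^sup>+s. ennreal (\<alpha> * s powr (\<alpha> - 1)) * indicator {0<..<\<epsilon>} s \<partial>lborel) = ennreal (\<epsilon> powr \<alpha>)"
      using \<alpha> \<epsilon> by (intro nn_integral_powr_layer) auto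
    moreover have "(\<integral>\<^sup>+s. ennreal (s powr (\<alpha> - 2)) * indicator {\<epsilon><..} s \<partial>lborel) = ennreal (- (\<epsilon> powr (\<alpha> - 2 + 1)) / (\<alpha> - 2 + 1))"
      using \<alpha> \<epsilon> by (intro nn_integral_powr_tail) auto
    ultimately show ?thesis by (subst nn_integral_add) (auto simp: nn_integral_cmult)
  qed
  also have "\<dots> = ennreal (\<epsilon> powr (- \<alpha>) / \<alpha>\<^sup>2 * \<epsilon> powr \<alpha> + \<epsilon> powr (1 - \<alpha>) / \<alpha> * (- (\<epsilon> powr (\<alpha> - 2 + 1)) / (\<alpha> - 2 + 1)))"
  proof -
    have sum: "ennreal a * ennreal b + ennreal c * ennreal d = ennreal (a * b + c * d)"
      if "0 \<le> a" "0 \<le> b" "0 \<le> c" "0 \<le> d" for a b c d :: real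
      using that by (simp add: ennreal_mult)
    have "0 \<le> - (\<epsilon> powr (\<alpha> - 2 + 1)) / (\<alpha> - 2 + 1)" using \<alpha> by (intro divide_nonpos_neg) auto
    then show ?thesis using \<alpha> by (intro sum) auto
  qed
  also have "\<epsilon> powr (- \<alpha>) / \<alpha>\<^sup>2 * \<epsilon> powr \<alpha> + \<epsilon> powr (1 - \<alpha>) / \<alpha> * (- (\<epsilon> powr (\<alpha> - 2 + 1)) / (\<alpha> - 2 + 1)) = marchaud_mass"
  proof -
    have "\<epsilon> powr (- \<alpha>) * \<epsilon> powr \<alpha> = 1" "\<epsilon> powr (1 - \<alpha>) * \<epsilon> powr (\<alpha> - 2 + 1) = 1"
      using \<epsilon> by (simp_all flip: powr_add)
    moreover have "\<epsilon> powr (1 - \<alpha>) / \<alpha> * (- (\<epsilon> powr (\<alpha> - 2 + 1)) / (\<alpha> - 2 + 1)) = (\<epsilon> powr (1 - \<alpha>) * \<epsilon> powr (\<alpha> - 2 + 1)) / (\<alpha> * (1 - \<alpha>))"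
    proof -
      have "- x / (\<alpha> - 2 + 1) = x / (1 - \<alpha>)" for x using \<alpha> by (simp add: field_simps)
      then show ?thesis by simp
    qed
    ultimately show ?thesis by (simp add: marchaud_mass_def)
  qed
  finally show ?thesis by simp
qed

lemma marchaud_kernel_scaling:
  assumes \<epsilon>: "0 < \<epsilon>"
  shows "marchaud_kernel \<alpha> \<epsilon> (\<epsilon> * s) = marchaud_kernel \<alpha> 1 s / \<epsilon>"
proof (cases "s > 0")
  case False
  then show ?thesis using \<epsilon> mult_nonneg_nonpos[of \<epsilon> s] mult_le_0_iff[of \<epsilon> s]
    by (auto simp: marchaud_kernel_def frac_kernel_def frac_trunc_kernel_def not_less zero_less_mult_iff mult_less_cancel_left1)
next
  case True
  have 1: "\<epsilon> powr (- \<alpha>) / \<alpha> * frac_kernel \<alpha> (\<epsilon> * s) = 1 / \<alpha> * frac_kernel \<alpha> s / \<epsilon>"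
    using True \<epsilon> by (simp add: frac_kernel_def powr_mult powr_minus_divide powr_diff)
  have "frac_trunc_kernel \<alpha> \<epsilon> (\<epsilon> * s) = frac_trunc_kernel \<alpha> 1 s / \<epsilon>"
  proof (cases "1 < s")
    case s1: True
    have "\<epsilon> * s - \<epsilon> = \<epsilon> * (s - 1)" by (simp add: algebra_simps)
    then have "(\<epsilon> * s - \<epsilon>) powr \<alpha> = \<epsilon> powr \<alpha> * (s - 1) powr \<alpha>" using \<epsilon> s1 by (simp only: powr_mult)
    then show ?thesis using s1 \<epsilon> by (simp add: frac_trunc_kernel_def powr_minus_divide)
  next
    case s1: False
    then show ?thesis using \<epsilon> by (simp add: frac_trunc_kernel_def mult_less_cancel_left1)
  qed
  then show ?thesis using 1 by (simp add: marchaud_kernel_def diff_divide_distrib)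
qed

lemma marchaud_kernel_integrable:
  assumes \<epsilon>: "0 < \<epsilon>"
  shows "integrable lborel (marchaud_kernel \<alpha> \<epsilon>)"
proof (rule integrableI_bounded)
  have "(\<integral>\<^sup>+s. ennreal (norm (marchaud_kernel \<alpha> \<epsilon> s)) \<partial>lborel) \<le> (\<integral>\<^sup>+s. ennreal (marchaud_majorant \<epsilon> s) \<partial>lborel)"
    using marchaud_kernel_bounds[OF \<epsilon>] by (intro nn_integral_mono ennreal_leI) auto
  also have "\<dots> \<le> ennreal marchaud_mass" by (rule nn_integral_marchaud_majorant[OF \<epsilon>])
  finally show "(\<integral>\<^sup>+s. ennreal (norm (marchaud_kernel \<alpha> \<epsilon> s)) \<partial>lborel) < \<infinity>" by (auto intro: le_less_trans)
qed measurable

definition marchaud_const :: real where "marchaud_const = (LINT s|lborel. marchaud_kernel \<alpha> 1 s)"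

text \<open>A nonnegative kernel with vanishing integral would vanish almost everywhere, but on (0,
  1) the kernel for 1 equals s^(\<alpha> - 1)/\<alpha>. Positivity later allows division by the
  constant.\<close>

lemma marchaud_const_pos: "0 < marchaud_const"
proof -
  have "0 \<le> marchaud_const" unfolding marchaud_const_def by (intro integral_nonneg_AE) (simp add: marchaud_kernel_bounds)
  moreover have "marchaud_const \<noteq> 0"
  proof
    assume "marchaud_const = 0"
    then have "AE s in lborel. marchaud_kernel \<alpha> 1 s = 0"
      using integral_nonneg_eq_0_iff_AE[OF marchaud_kernel_integrable[of 1]] marchaud_kernel_bounds(1)[of 1]
      by (simp add: marchaud_const_def)
    moreover have "marchaud_kernel \<alpha> 1 s \<noteq> 0" if "s \<in> {0<..<1}" for s
      using that \<alpha> by (auto simp: marchaud_kernel_def frac_kernel_def frac_trunc_kernel_def)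
    ultimately have "AE s in lborel. s \<notin> {0<..<1::real}" by (auto elim: eventually_mono)
    then have "emeasure lborel {0<..<1::real} = 0" by (subst (asm) AE_iff_measurable[of "{0<..<1}"]) auto
    then show False by simp
  qed
  ultimately show ?thesis by simp
qed

end

section \<open>Truncated derivatives of fractional integrals\<close>

lemma wnorm_mono_AE:
  assumes "AE x in lborel. \<bar>f x\<bar> \<le> \<bar>g x\<bar>" "0 \<le> r"
  shows "wnorm r v f \<le> wnorm r v g"
  unfolding wnorm_def
proof (rule nn_integral_mono_AE)
  show "AE x in lborel. ennreal (\<bar>f x\<bar> powr r * v x powr r) \<le> ennreal (\<bar>g x\<bar> powr r * v x powr r)"
    using assms(1) by eventually_elim (use assms(2) in \<open>auto intro!: ennreal_leI mult_right_mono powr_mono2\<close>)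
qed

lemma wnorm_cong_AE: "AE x in lborel. f x = g x \<Longrightarrow> wnorm r v f = wnorm r v g"
  unfolding wnorm_def by (intro nn_integral_cong_AE) auto

lemma wnorm_cmult:
  assumes [measurable]: "f \<in> borel_measurable borel" "v \<in> borel_measurable borel"
  shows "wnorm r v (\<lambda>x. c * f x) = ennreal (\<bar>c\<bar> powr r) * wnorm r v f"
proof -
  have "wnorm r v (\<lambda>x. c * f x) = (\<integral>\<^sup>+x. ennreal (\<bar>c\<bar> powr r) * ennreal (\<bar>f x\<bar> powr r * v x powr r) \<partial>lborel)"
    unfolding wnorm_def by (intro nn_integral_cong) (simp add: abs_mult powr_mult mult.assoc flip: ennreal_mult)
  then show ?thesis unfolding wnorm_def by (simp add: nn_integral_cmult)
qed

lemma abs_add_powr_le: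
  fixes a b :: real
  assumes "0 \<le> r"
  shows "\<bar>a + b\<bar> powr r \<le> 2 powr r * (\<bar>a\<bar> powr r + \<bar>b\<bar> powr r)"
proof -
  have "\<bar>a + b\<bar> powr r \<le> (2 * max \<bar>a\<bar> \<bar>b\<bar>) powr r" using assms by (intro powr_mono2) auto
  also have "\<dots> = 2 powr r * max \<bar>a\<bar> \<bar>b\<bar> powr r" by (simp add: powr_mult)
  also have "\<dots> \<le> 2 powr r * (\<bar>a\<bar> powr r + \<bar>b\<bar> powr r)" by (intro mult_left_mono) (auto simp: max_def)
  finally show ?thesis .
qed

lemma wnorm_add:
  assumes [measurable]: "f \<in> borel_measurable borel" "g \<in> borel_measurable borel" "v \<in> borel_measurable borel" and r: "0 \<le> r"
  shows "wnorm r v (\<lambda>x. f x + g x) \<le> ennreal (2 powr r) * (wnorm r v f + wnorm r v g)"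
proof -
  have "wnorm r v (\<lambda>x. f x + g x) \<le> (\<integral>\<^sup>+x. ennreal (2 powr r) * (ennreal (\<bar>f x\<bar> powr r * v x powr r) + ennreal (\<bar>g x\<bar> powr r * v x powr r)) \<partial>lborel)"
    unfolding wnorm_def
  proof (rule nn_integral_mono)
    fix x
    have "\<bar>f x + g x\<bar> powr r * v x powr r \<le> 2 powr r * (\<bar>f x\<bar> powr r + \<bar>g x\<bar> powr r) * v x powr r"
      using r by (intro mult_right_mono abs_add_powr_le) auto
    also have "\<dots> = 2 powr r * (\<bar>f x\<bar> powr r * v x powr r + \<bar>g x\<bar> powr r * v x powr r)" by (simp add: algebra_simps)
    finally show "ennreal (\<bar>f x + g x\<bar> powr r * v x powr r) \<le> ennreal (2 powr r) * (ennreal (\<bar>f x\<bar> powr r * v x powr r) + ennreal (\<bar>g x\<bar> powr r * v x powr r))"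
      by (simp add: ennreal_leI flip: ennreal_mult ennreal_plus)
  qed
  also have "\<dots> = ennreal (2 powr r) * (wnorm r v f + wnorm r v g)"
    unfolding wnorm_def by (simp add: nn_integral_cmult nn_integral_add)
  finally show ?thesis .
qed

lemma wnorm_add_finite:
  assumes "f \<in> borel_measurable borel" "g \<in> borel_measurable borel" "v \<in> borel_measurable borel" "0 \<le> r"
    and "wnorm r v f < \<infinity>" "wnorm r v g < \<infinity>"
  shows "wnorm r v (\<lambda>x. f x + g x) < \<infinity>"
  by (rule le_less_trans[OF wnorm_add[OF assms(1-4)]]) (use assms(5,6) in \<open>simp add: ennreal_mult_less_top\<close>)

lemma wnorm_cmult_finite:
  assumes "f \<in> borel_measurable borel" "v \<in> borel_measurable borel" "wnorm r v f < \<infinity>"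
  shows "wnorm r v (\<lambda>x. c * f x) < \<infinity>"
  using assms by (simp add: wnorm_cmult ennreal_mult_less_top)

lemma wnorm_diff_finite:
  assumes [measurable]: "f \<in> borel_measurable borel" "g \<in> borel_measurable borel" "v \<in> borel_measurable borel"
    and "0 \<le> r" "wnorm r v f < \<infinity>" "wnorm r v g < \<infinity>"
  shows "wnorm r v (\<lambda>x. f x - g x) < \<infinity>"
  using wnorm_add_finite[of f "\<lambda>x. (- 1) * g x" v r] wnorm_cmult_finite[of g v r "- 1"] assms by simp

lemma wnorm_conv_le:
  assumes "0 \<le> r"
  shows "wnorm r v (conv k f) \<le> (\<integral>\<^sup>+x. ennpowr (abs_conv k f x) r * ennreal (v x powr r) \<partial>lborel)"
  unfolding wnorm_def
proof (rule nn_integral_mono)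
  fix x
  have "ennreal (\<bar>conv k f x\<bar> powr r) \<le> ennpowr (abs_conv k f x) r"
    using ennpowr_mono[OF abs_conv_le[of k f x] assms] by simp
  then show "ennreal (\<bar>conv k f x\<bar> powr r * v x powr r) \<le> ennpowr (abs_conv k f x) r * ennreal (v x powr r)"
    by (simp add: ennreal_mult mult_right_mono)
qed

lemma wnorm_enn2real_le:
  "wnorm r v (\<lambda>x. enn2real (F x)) \<le> (\<integral>\<^sup>+x. ennpowr (F x) r * ennreal (v x powr r) \<partial>lborel)"
  unfolding wnorm_def
proof (rule nn_integral_mono)
  fix x
  have "ennreal (\<bar>enn2real (F x)\<bar> powr r) \<le> ennpowr (F x) r"
    by (cases "F x") (auto simp: ennpowr_def)
  then show "ennreal (\<bar>enn2real (F x)\<bar> powr r * v x powr r) \<le> ennpowr (F x) r * ennreal (v x powr r)"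
    by (simp add: ennreal_mult mult_right_mono)
qed

text \<open>The bounds for \<open>abs_conv\<close> concern real functions, while an inner
  \<open>abs_conv\<close> is extended-valued. A function finite almost everywhere may be replaced by
  its \<open>enn2real\<close>, so that the bounds can be iterated.\<close>

lemma nn_integral_abs_conv_enn2real:
  assumes [measurable]: "F \<in> borel_measurable borel" and fin: "AE x in lborel. F x < \<infinity>"
  shows "(\<integral>\<^sup>+t. ennreal \<bar>k t\<bar> * F (x + t) \<partial>lborel) = abs_conv k (\<lambda>y. enn2real (F y)) x"
proof -
  have "AE t in lborel. F (x + 1 * t) < \<infinity>"
    by (rule AE_borel_affine[of 1 "\<lambda>y. F y < \<infinity>" x]) (use fin in auto)
  then show ?thesis unfolding abs_conv_def
    by (intro nn_integral_cong_AE) (auto elim!: eventually_mono simp: ennreal_mult)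
qed

lemma abs_conv_conv_le:
  assumes [measurable]: "k1 \<in> borel_measurable borel" "k2 \<in> borel_measurable borel" "f \<in> borel_measurable borel"
  shows "abs_conv (\<lambda>s. LINT t|lborel. k1 t * k2 (s - t)) f x \<le> (\<integral>\<^sup>+t. ennreal \<bar>k1 t\<bar> * abs_conv k2 f (x + t) \<partial>lborel)"
proof -
  have "abs_conv (\<lambda>s. LINT t|lborel. k1 t * k2 (s - t)) f x \<le> (\<integral>\<^sup>+s. \<integral>\<^sup>+t. ennreal \<bar>k1 t * k2 (s - t) * f (x + s)\<bar> \<partial>lborel \<partial>lborel)"
    unfolding abs_conv_def
  proof (rule nn_integral_mono)
    fix s
    have "ennreal \<bar>LINT t|lborel. k1 t * k2 (s - t)\<bar> \<le> (\<integral>\<^sup>+t. ennreal \<bar>k1 t * k2 (s - t)\<bar> \<partial>lborel)"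
    proof (cases "integrable lborel (\<lambda>t. k1 t * k2 (s - t))")
      case True
      then show ?thesis by (rule integral_norm_bound_ennreal[of lborel "\<lambda>t. k1 t * k2 (s - t)", simplified])
    qed (simp add: not_integrable_integral_eq)
    then have "ennreal \<bar>LINT t|lborel. k1 t * k2 (s - t)\<bar> * ennreal \<bar>f (x + s)\<bar> \<le> (\<integral>\<^sup>+t. ennreal \<bar>k1 t * k2 (s - t)\<bar> \<partial>lborel) * ennreal \<bar>f (x + s)\<bar>"
      by (rule mult_right_mono) simp
    also have "\<dots> = (\<integral>\<^sup>+t. ennreal \<bar>k1 t * k2 (s - t) * f (x + s)\<bar> \<partial>lborel)"
      by (subst nn_integral_multc[symmetric]) (auto simp: abs_mult ennreal_mult)
    finally show "ennreal (\<bar>LINT t|lborel. k1 t * k2 (s - t)\<bar> * \<bar>f (x + s)\<bar>) \<le> (\<integral>\<^sup>+t. ennreal \<bar>k1 t * k2 (s - t) * f (x + s)\<bar> \<partial>lborel)"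
      by (simp add: ennreal_mult)
  qed
  also have "\<dots> = (\<integral>\<^sup>+t. \<integral>\<^sup>+s. ennreal \<bar>k1 t * k2 (s - t) * f (x + s)\<bar> \<partial>lborel \<partial>lborel)"
    by (rule lborel_pair.Fubini') measurable
  also have "\<dots> = (\<integral>\<^sup>+t. ennreal \<bar>k1 t\<bar> * abs_conv k2 f (x + t) \<partial>lborel)"
  proof (rule nn_integral_cong)
    fix t
    have "(\<integral>\<^sup>+s. ennreal \<bar>k1 t * k2 (s - t) * f (x + s)\<bar> \<partial>lborel) = (\<integral>\<^sup>+s. ennreal \<bar>k1 t\<bar> * ennreal (\<bar>k2 s\<bar> * \<bar>f (x + t + s)\<bar>) \<partial>lborel)"
      by (subst nn_integral_real_affine[where c=1 and t=t]) (auto simp: abs_mult ac_simps simp flip: ennreal_mult)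
    then show "(\<integral>\<^sup>+s. ennreal \<bar>k1 t * k2 (s - t) * f (x + s)\<bar> \<partial>lborel) = ennreal \<bar>k1 t\<bar> * abs_conv k2 f (x + t)"
      by (simp add: abs_conv_def nn_integral_cmult)
  qed
  finally show ?thesis .
qed

text \<open>Wherever the tail integral converges this is -Gamma(-\<alpha>) times the truncated
  derivative: the contribution of u(x) is integrated out in closed form, which leaves a multiple of
  u minus a convolution.\<close>

definition marchaud_diff :: "real \<Rightarrow> real \<Rightarrow> (real \<Rightarrow> real) \<Rightarrow> real \<Rightarrow> real" where
  "marchaud_diff \<alpha> \<epsilon> u x = \<epsilon> powr (- \<alpha>) / \<alpha> * u x - conv (trunc_kernel \<alpha> \<epsilon>) u x"

lemma marchaud_diff_measurable[measurable]:
  assumes [measurable]: "u \<in> borel_measurable borel"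
  shows "marchaud_diff \<alpha> \<epsilon> u \<in> borel_measurable borel"
  unfolding marchaud_diff_def[abs_def] by measurable

section \<open>Truncated derivatives in a weighted space\<close>

context average_weight
begin

lemma abs_conv_trunc_finite:
  assumes [measurable]: "f \<in> borel_measurable borel" and fin: "wnorm r v f < \<infinity>"
    and \<alpha>: "0 < \<alpha>" "\<alpha> < 1" and \<epsilon>: "0 < \<epsilon>"
  shows "(\<integral>\<^sup>+x. ennpowr (abs_conv (trunc_kernel \<alpha> \<epsilon>) f x) r * ennreal (v x powr r) \<partial>lborel) < \<infinity>"
proof -
  \<comment> \<open>\<open>trunc_kernel\<close> vanishes on (0, \<epsilon>] and hence is not
    decreasing on s > 0; its decreasing majorant is constant there.\<close>
  define \<mu> where "\<mu> t = (if t \<le> 0 then 0 else max t \<epsilon> powr (- 1 - \<alpha>))" for t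
  have [measurable]: "\<mu> \<in> borel_measurable borel" unfolding \<mu>_def[abs_def] by measurable
  have "(\<integral>\<^sup>+t. ennreal (\<mu> t) \<partial>lborel) \<le> (\<integral>\<^sup>+t. ennreal (\<epsilon> powr (- 1 - \<alpha>)) * indicator {0..\<epsilon>} t + ennreal (trunc_kernel \<alpha> \<epsilon> t) \<partial>lborel)"
    by (intro nn_integral_mono) (auto simp: \<mu>_def indicator_def trunc_kernel_def max_def)
  also have "\<dots> = ennreal (\<epsilon> powr (- 1 - \<alpha>)) * ennreal \<epsilon> + ennreal (\<epsilon> powr (- \<alpha>) / \<alpha>)"
    using \<epsilon> by (subst nn_integral_add) (auto simp: nn_integral_cmult nn_integral_trunc_kernel[OF \<alpha> \<epsilon>])
  also have "\<dots> = ennreal (\<epsilon> powr (- 1 - \<alpha>) * \<epsilon> + \<epsilon> powr (- \<alpha>) / \<alpha>)" using \<epsilon> \<alpha> by (simp add: ennreal_mult)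
  finally have B: "(\<integral>\<^sup>+t. ennreal (\<mu> t) \<partial>lborel) \<le> ennreal (\<epsilon> powr (- 1 - \<alpha>) * \<epsilon> + \<epsilon> powr (- \<alpha>) / \<alpha>)" .
  have "(\<integral>\<^sup>+x. ennpowr (abs_conv (trunc_kernel \<alpha> \<epsilon>) f x) r * ennreal (v x powr r) \<partial>lborel)
    \<le> ennreal (2 * (4 * D * (\<epsilon> powr (- 1 - \<alpha>) * \<epsilon> + \<epsilon> powr (- \<alpha>) / \<alpha>)) powr r) * wnorm r v f"
  proof (rule conv_bound_decreasing[of _ _ \<mu>, OF _ _ _ fin _ _ _ _ B])
    show "\<mu> t \<le> \<mu> s" if "0 < s" "s \<le> t" for s t
      using that \<epsilon> \<alpha> by (auto simp: \<mu>_def intro!: powr_mono2')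
    show "\<bar>trunc_kernel \<alpha> \<epsilon> s\<bar> \<le> \<mu> s" for s using \<epsilon> by (auto simp: trunc_kernel_def \<mu>_def)
  qed (use \<epsilon> \<alpha> in \<open>auto simp: \<mu>_def intro!: add_pos_pos\<close>)
  also have "\<dots> < \<infinity>" using fin by (simp add: ennreal_mult_less_top)
  finally show ?thesis .
qed

lemma abs_conv_marchaud_bound:
  assumes [measurable]: "f \<in> borel_measurable borel" and fin: "wnorm r v f < \<infinity>"
    and \<alpha>: "0 < \<alpha>" "\<alpha> < 1" and \<epsilon>: "0 < \<epsilon>"
  shows "(\<integral>\<^sup>+x. ennpowr (abs_conv (marchaud_kernel \<alpha> \<epsilon>) f x) r * ennreal (v x powr r) \<partial>lborel)
    \<le> ennreal (2 * (4 * D * marchaud_mass \<alpha>) powr r) * wnorm r v f"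
proof (rule conv_bound_decreasing[of _ _ "marchaud_majorant \<alpha> \<epsilon>", OF _ _ _ fin _ _ _ _ nn_integral_marchaud_majorant[OF \<alpha> \<epsilon>]])
  show "\<bar>marchaud_kernel \<alpha> \<epsilon> s\<bar> \<le> marchaud_majorant \<alpha> \<epsilon> s" for s
    using marchaud_kernel_bounds[OF \<alpha> \<epsilon>, of s] by simp
qed (auto simp: marchaud_majorant_props[OF \<alpha> \<epsilon>] marchaud_mass_pos[OF \<alpha>] marchaud_majorant_measurable[OF \<alpha>])

lemma abs_conv_marchaud_finite:
  assumes "f \<in> borel_measurable borel" and fin: "wnorm r v f < \<infinity>"
    and "0 < \<alpha>" "\<alpha> < 1" "0 < \<epsilon>"
  shows "(\<integral>\<^sup>+x. ennpowr (abs_conv (marchaud_kernel \<alpha> \<epsilon>) f x) r * ennreal (v x powr r) \<partial>lborel) < \<infinity>"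
  by (rule le_less_trans[OF abs_conv_marchaud_bound[OF assms]]) (use fin in \<open>simp add: ennreal_mult_less_top\<close>)

lemma wnorm_conv_marchaud:
  assumes "f \<in> borel_measurable borel" "wnorm r v f < \<infinity>" "0 < \<alpha>" "\<alpha> < 1" "0 < \<epsilon>"
  shows "wnorm r v (conv (marchaud_kernel \<alpha> \<epsilon>) f) \<le> ennreal (2 * (4 * D * marchaud_mass \<alpha>) powr r) * wnorm r v f"
  using wnorm_conv_le[of r v] abs_conv_marchaud_bound[OF assms] r by (meson less_imp_le order_trans zero_less_one)

lemma abs_conv_AE_finite:
  assumes [measurable]: "k \<in> borel_measurable borel" "f \<in> borel_measurable borel"
    and "(\<integral>\<^sup>+x. ennpowr (abs_conv k f x) r * ennreal (v x powr r) \<partial>lborel) < \<infinity>"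
  shows "AE x in lborel. abs_conv k f x < \<infinity>"
  by (rule wnorm_finite_AE[OF _ v_meas v_pos assms(3)]) measurable

text \<open>The inner absolute convolution lies in the weighted space by the bound for k2, so the
  outer one is finite almost everywhere by the bound for k1. This supplies the hypothesis of
  \<open>conv_conv\<close>.\<close>

lemma abs_conv_abs_conv_AE_finite:
  assumes [measurable]: "k1 \<in> borel_measurable borel" "k2 \<in> borel_measurable borel" "f \<in> borel_measurable borel"
    and k2: "(\<integral>\<^sup>+x. ennpowr (abs_conv k2 f x) r * ennreal (v x powr r) \<partial>lborel) < \<infinity>"
    and k1: "\<And>F. F \<in> borel_measurable borel \<Longrightarrow> wnorm r v F < \<infinity> \<Longrightarrow>
      (\<integral>\<^sup>+x. ennpowr (abs_conv k1 F x) r * ennreal (v x powr r) \<partial>lborel) < \<infinity>"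
  shows "AE x in lborel. (\<integral>\<^sup>+t. ennreal \<bar>k1 t\<bar> * abs_conv k2 f (x + t) \<partial>lborel) < \<infinity>"
proof -
  have "wnorm r v (\<lambda>x. enn2real (abs_conv k2 f x)) < \<infinity>"
    using wnorm_enn2real_le k2 by (rule le_less_trans)
  then have "AE x in lborel. abs_conv k1 (\<lambda>x. enn2real (abs_conv k2 f x)) x < \<infinity>"
    by (intro abs_conv_AE_finite k1) measurable
  then show ?thesis
    by (subst nn_integral_abs_conv_enn2real[OF _ abs_conv_AE_finite[OF _ _ k2]]) auto
qed

lemma wnorm_marchaud_diff_finite:
  assumes [measurable]: "u \<in> borel_measurable borel" and fin: "wnorm r v u < \<infinity>"
    and \<alpha>: "0 < \<alpha>" "\<alpha> < 1" and \<epsilon>: "0 < \<epsilon>"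
  shows "wnorm r v (marchaud_diff \<alpha> \<epsilon> u) < \<infinity>"
  unfolding marchaud_diff_def[abs_def]
proof (rule wnorm_diff_finite)
  show "wnorm r v (conv (trunc_kernel \<alpha> \<epsilon>) u) < \<infinity>"
    by (rule le_less_trans[OF wnorm_conv_le abs_conv_trunc_finite[OF _ fin \<alpha> \<epsilon>]]) (use r in auto)
  show "wnorm r v (\<lambda>x. \<epsilon> powr - \<alpha> / \<alpha> * u x) < \<infinity>"
    by (rule wnorm_cmult_finite[OF _ v_meas fin]) simp
qed (use r in auto)

text \<open>Both sides expand into convolutions of u with \<open>marchaud_kernel\<close> and with
  the composed kernels Q, and \<open>marchaud_trunc_identity\<close> equates them. The exceptional
  set collects the points where one of four absolute integrals diverges.\<close>

lemma marchaud_diff_commute: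
  assumes [measurable]: "u \<in> borel_measurable borel" and fin: "wnorm r v u < \<infinity>"
    and \<alpha>: "0 < \<alpha>" "\<alpha> < 1" and \<epsilon>: "0 < \<epsilon>" and \<delta>: "0 < \<delta>"
  shows "AE x in lborel. conv (marchaud_kernel \<alpha> \<delta>) (marchaud_diff \<alpha> \<epsilon> u) x = conv (marchaud_kernel \<alpha> \<epsilon>) (marchaud_diff \<alpha> \<delta> u) x"
proof -
  have a: "AE x in lborel. abs_conv (marchaud_kernel \<alpha> \<epsilon>) u x < \<infinity>" if "0 < \<epsilon>" for \<epsilon>
    by (rule abs_conv_AE_finite[OF _ _ abs_conv_marchaud_finite[OF _ fin \<alpha> that]]) auto
  have b: "AE x in lborel. (\<integral>\<^sup>+t. ennreal \<bar>marchaud_kernel \<alpha> \<delta> t\<bar> * abs_conv (trunc_kernel \<alpha> \<epsilon>) u (x + t) \<partial>lborel) < \<infinity>"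
    if "0 < \<epsilon>" "0 < \<delta>" for \<epsilon> \<delta>
    by (rule abs_conv_abs_conv_AE_finite[OF _ _ _ abs_conv_trunc_finite[OF _ fin \<alpha> that(1)]])
      (use abs_conv_marchaud_finite[OF _ _ \<alpha> that(2)] in auto)
  define Q where "Q \<delta> \<epsilon> s = (LINT t|lborel. marchaud_kernel \<alpha> \<delta> t * trunc_kernel \<alpha> \<epsilon> (s - t))" for \<delta> \<epsilon> s
  have [measurable]: "Q \<delta> \<epsilon> \<in> borel_measurable borel" for \<delta> \<epsilon> unfolding Q_def[abs_def] by measurable
  have *: "conv (marchaud_kernel \<alpha> \<delta>) (marchaud_diff \<alpha> \<epsilon> u) x = \<epsilon> powr (- \<alpha>) / \<alpha> * conv (marchaud_kernel \<alpha> \<delta>) u x - conv (Q \<delta> \<epsilon>) u x \<and>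
      integrable lborel (\<lambda>s. Q \<delta> \<epsilon> s * u (x + s))"
    if fa: "abs_conv (marchaud_kernel \<alpha> \<delta>) u x < \<infinity>"
      and fb: "(\<integral>\<^sup>+t. ennreal \<bar>marchaud_kernel \<alpha> \<delta> t\<bar> * abs_conv (trunc_kernel \<alpha> \<epsilon>) u (x + t) \<partial>lborel) < \<infinity>" for x \<epsilon> \<delta>
  proof
    have i1: "integrable lborel (\<lambda>s. marchaud_kernel \<alpha> \<delta> s * u (x + s))"
      by (rule abs_conv_integrable[OF _ _ fa]) auto
    have "abs_conv (marchaud_kernel \<alpha> \<delta>) (conv (trunc_kernel \<alpha> \<epsilon>) u) x \<le> (\<integral>\<^sup>+t. ennreal \<bar>marchaud_kernel \<alpha> \<delta> t\<bar> * abs_conv (trunc_kernel \<alpha> \<epsilon>) u (x + t) \<partial>lborel)"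
      unfolding abs_conv_def[of "marchaud_kernel \<alpha> \<delta>"]
      by (intro nn_integral_mono) (auto simp: ennreal_mult intro!: mult_left_mono abs_conv_le)
    then have lt: "abs_conv (marchaud_kernel \<alpha> \<delta>) (conv (trunc_kernel \<alpha> \<epsilon>) u) x < \<infinity>"
      using fb by (rule le_less_trans)
    have i2: "integrable lborel (\<lambda>s. marchaud_kernel \<alpha> \<delta> s * conv (trunc_kernel \<alpha> \<epsilon>) u (x + s))"
      by (rule abs_conv_integrable[OF _ _ lt]) auto
    have "conv (marchaud_kernel \<alpha> \<delta>) (marchaud_diff \<alpha> \<epsilon> u) x = (LINT s|lborel. \<epsilon> powr (- \<alpha>) / \<alpha> * (marchaud_kernel \<alpha> \<delta> s * u (x + s)) - marchaud_kernel \<alpha> \<delta> s * conv (trunc_kernel \<alpha> \<epsilon>) u (x + s))"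
      unfolding conv_def[of "marchaud_kernel \<alpha> \<delta>"] marchaud_diff_def
      by (rule Bochner_Integration.integral_cong) (auto simp: algebra_simps)
    also have "\<dots> = \<epsilon> powr (- \<alpha>) / \<alpha> * conv (marchaud_kernel \<alpha> \<delta>) u x - conv (marchaud_kernel \<alpha> \<delta>) (conv (trunc_kernel \<alpha> \<epsilon>) u) x"
      using i1 i2 by (subst Bochner_Integration.integral_diff) (auto simp: conv_def[of "marchaud_kernel \<alpha> \<delta>"])
    also have "conv (marchaud_kernel \<alpha> \<delta>) (conv (trunc_kernel \<alpha> \<epsilon>) u) x = conv (Q \<delta> \<epsilon>) u x"
      unfolding Q_def[abs_def] by (rule conv_conv[OF _ _ _ fb]) auto
    finally show "conv (marchaud_kernel \<alpha> \<delta>) (marchaud_diff \<alpha> \<epsilon> u) x = \<epsilon> powr (- \<alpha>) / \<alpha> * conv (marchaud_kernel \<alpha> \<delta>) u x - conv (Q \<delta> \<epsilon>) u x" .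
    have "abs_conv (Q \<delta> \<epsilon>) u x < \<infinity>"
      unfolding Q_def[abs_def] by (rule le_less_trans[OF abs_conv_conv_le fb]) auto
    then show "integrable lborel (\<lambda>s. Q \<delta> \<epsilon> s * u (x + s))" by (intro abs_conv_integrable) auto
  qed
  show ?thesis using a[OF \<epsilon>] a[OF \<delta>] b[OF \<epsilon> \<delta>] b[OF \<delta> \<epsilon>]
  proof eventually_elim
    case (elim x)
    note 1 = *[OF elim(2,3)] and 2 = *[OF elim(1,4)]
    have i1: "integrable lborel (\<lambda>s. marchaud_kernel \<alpha> \<delta> s * u (x + s))"
      by (rule abs_conv_integrable[OF _ _ elim(2)]) auto
    have i2: "integrable lborel (\<lambda>s. marchaud_kernel \<alpha> \<epsilon> s * u (x + s))"
      by (rule abs_conv_integrable[OF _ _ elim(1)]) auto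
    have sum: "conv k1 u x + c * conv k2 u x = (LINT s|lborel. (k1 s + c * k2 s) * u (x + s))"
      if "integrable lborel (\<lambda>s. k1 s * u (x + s))" "integrable lborel (\<lambda>s. k2 s * u (x + s))" for k1 k2 c
    proof -
      have "(LINT s|lborel. (k1 s + c * k2 s) * u (x + s)) = (LINT s|lborel. k1 s * u (x + s) + c * (k2 s * u (x + s)))"
        by (simp add: algebra_simps)
      then show ?thesis using that by (simp add: conv_def)
    qed
    have "conv (Q \<delta> \<epsilon>) u x + \<delta> powr (- \<alpha>) / \<alpha> * conv (marchaud_kernel \<alpha> \<epsilon>) u x
       = conv (Q \<epsilon> \<delta>) u x + \<epsilon> powr (- \<alpha>) / \<alpha> * conv (marchaud_kernel \<alpha> \<delta>) u x"
      unfolding sum[OF conjunct2[OF 1] i2] sum[OF conjunct2[OF 2] i1] Q_def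
      using marchaud_trunc_identity[OF \<alpha> \<epsilon> \<delta>] by (simp only:)
    then show ?case using 1 2 by linarith
  qed
qed

end

section \<open>Truncated derivatives of potentials, and functions whose truncated derivatives
  vanish\<close>

context one_sided_weight
begin

sublocale Wp: average_weight p w C by (rule average_weight_p)
sublocale Wq: average_weight q w C by (rule average_weight_q)

text \<open>For the last claim, the absolute potential of f lies in L^q(w^q), so its convolution
  with \<open>trunc_kernel\<close> converges almost everywhere. At such points the kernels may be
  composed, and \<open>trunc_kernel\<close> composed with \<open>frac_kernel\<close> is
  \<open>frac_trunc_kernel\<close>.\<close>

lemma frac_integral_props:
  assumes [measurable]: "f \<in> borel_measurable borel" and fin: "wnorm p w f < \<infinity>"
  shows "AE x in lborel. abs_conv (frac_kernel \<alpha>) f x < \<infinity>"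
    and "wnorm q w (conv (frac_kernel \<alpha>) f) < \<infinity>"
    and "0 < \<delta> \<Longrightarrow> AE x in lborel. marchaud_diff \<alpha> \<delta> (conv (frac_kernel \<alpha>) f) x = conv (marchaud_kernel \<alpha> \<delta>) f x"
proof -
  have T: "abs_conv (frac_kernel \<alpha>) f = (\<lambda>x. \<integral>\<^sup>+s. ennreal (frac_kernel \<alpha> s * \<bar>f (x + s)\<bar>) \<partial>lborel)"
    by (simp add: abs_conv_def fun_eq_iff frac_kernel_nonneg)
  show A: "AE x in lborel. abs_conv (frac_kernel \<alpha>) f x < \<infinity>"
    unfolding T by (rule frac_integral_Lq(1)) (use fin in \<open>auto simp: wnorm_def\<close>)
  have G: "wnorm q w (\<lambda>x. enn2real (abs_conv (frac_kernel \<alpha>) f x)) < \<infinity>"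
    using frac_integral_Lq(2)[of f] fin unfolding T wnorm_def by simp
  show "wnorm q w (conv (frac_kernel \<alpha>) f) < \<infinity>"
  proof (rule le_less_trans[OF wnorm_mono_AE G])
    show "AE x in lborel. \<bar>conv (frac_kernel \<alpha>) f x\<bar> \<le> \<bar>enn2real (abs_conv (frac_kernel \<alpha>) f x)\<bar>"
      using A
    proof eventually_elim
      case (elim x)
      have "ennreal \<bar>conv (frac_kernel \<alpha>) f x\<bar> \<le> ennreal (enn2real (abs_conv (frac_kernel \<alpha>) f x))"
        using abs_conv_le[of "frac_kernel \<alpha>" f x] elim by simp
      then show ?case by simp
    qed
  qed (use q1 in simp)
  assume \<delta>: "0 < \<delta>"
  have "AE x in lborel. abs_conv (trunc_kernel \<alpha> \<delta>) (\<lambda>x. enn2real (abs_conv (frac_kernel \<alpha>) f x)) x < \<infinity>"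
    by (rule Wq.abs_conv_AE_finite[OF _ _ Wq.abs_conv_trunc_finite[OF _ G \<alpha> \<delta>]]) auto
  then have B: "AE x in lborel. (\<integral>\<^sup>+t. ennreal \<bar>trunc_kernel \<alpha> \<delta> t\<bar> * abs_conv (frac_kernel \<alpha>) f (x + t) \<partial>lborel) < \<infinity>"
    by (subst nn_integral_abs_conv_enn2real[OF _ A]) auto
  show "AE x in lborel. marchaud_diff \<alpha> \<delta> (conv (frac_kernel \<alpha>) f) x = conv (marchaud_kernel \<alpha> \<delta>) f x"
    using A B
  proof eventually_elim
    case (elim x)
    have Q: "(\<lambda>s. LINT t|lborel. trunc_kernel \<alpha> \<delta> t * frac_kernel \<alpha> (s - t)) = frac_trunc_kernel \<alpha> \<delta>"
      using trunc_frac_kernel_integral(2)[OF \<alpha> \<delta>] by (simp add: fun_eq_iff)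
    have "abs_conv (frac_trunc_kernel \<alpha> \<delta>) f x < \<infinity>"
      unfolding Q[symmetric] by (rule le_less_trans[OF abs_conv_conv_le elim(2)]) auto
    then have i1: "integrable lborel (\<lambda>s. frac_trunc_kernel \<alpha> \<delta> s * f (x + s))" by (intro abs_conv_integrable) auto
    have i2: "integrable lborel (\<lambda>s. frac_kernel \<alpha> s * f (x + s))" by (rule abs_conv_integrable[OF _ _ elim(1)]) auto
    have "conv (trunc_kernel \<alpha> \<delta>) (conv (frac_kernel \<alpha>) f) x = conv (frac_trunc_kernel \<alpha> \<delta>) f x"
      unfolding Q[symmetric] by (rule conv_conv[OF _ _ _ elim(2)]) auto
    moreover have "conv (marchaud_kernel \<alpha> \<delta>) f x = \<delta> powr (- \<alpha>) / \<alpha> * conv (frac_kernel \<alpha>) f x - conv (frac_trunc_kernel \<alpha> \<delta>) f x"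
    proof -
      have "conv (marchaud_kernel \<alpha> \<delta>) f x = (LINT s|lborel. \<delta> powr (- \<alpha>) / \<alpha> * (frac_kernel \<alpha> s * f (x + s)) - frac_trunc_kernel \<alpha> \<delta> s * f (x + s))"
        unfolding conv_def marchaud_kernel_def by (rule Bochner_Integration.integral_cong) (auto simp: algebra_simps)
      then show ?thesis using i1 i2 by (simp add: conv_def)
    qed
    ultimately show ?case by (simp add: marchaud_diff_def)
  qed
qed

text \<open>Doubling [x, x + 2^k) adds an adjacent interval of equal length on the right, which by
  \<open>\<nu>_growth\<close> carries at least the fraction C^(-q) of the mass so far.\<close>

lemma \<nu>_doubling_growth:
  "(1 + C powr (- q)) ^ k * measure \<nu> {x..<x + 1} \<le> measure \<nu> {x..<x + 2 ^ k}"
proof (induction k)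
  case (Suc k)
  have "measure \<nu> {x..<x + 2 ^ Suc k} = measure \<nu> {x..<x + 2 ^ k} + measure \<nu> {x + 2 ^ k..<x + 2 ^ k + 2 ^ k}"
  proof -
    have fin: "emeasure \<nu> {a..<b} \<noteq> \<infinity>" for a b
      using finite_\<nu>[of "{a..<b}" a b] by (auto simp: subset_eq)
    have "measure \<nu> ({x..<x + 2 ^ k} \<union> {x + 2 ^ k..<x + 2 ^ k + 2 ^ k}) = measure \<nu> {x..<x + 2 ^ k} + measure \<nu> {x + 2 ^ k..<x + 2 ^ k + 2 ^ k}"
      by (rule measure_Union) (use fin in auto)
    moreover have "{x..<x + 2 ^ k} \<union> {x + 2 ^ k..<x + 2 ^ k + 2 ^ k} = {x..<x + 2 ^ Suc k}" by auto
    ultimately show ?thesis by simp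
  qed
  moreover have "C powr (- q) * measure \<nu> {x..<x + 2 ^ k} \<le> measure \<nu> {x + 2 ^ k..<x + 2 ^ k + 2 ^ k}"
    using \<nu>_growth[of "2 ^ k" "x + 2 ^ k"] by simp
  moreover have "(1 + C powr (- q)) ^ Suc k * measure \<nu> {x..<x + 1} \<le> (1 + C powr (- q)) * measure \<nu> {x..<x + 2 ^ k}"
    using mult_left_mono[OF Suc.IH, of "1 + C powr (- q)"] by (simp add: mult.assoc)
  ultimately show ?case by (simp add: distrib_right)
qed simp

lemma \<nu>_unbounded: "\<exists>k. K \<le> measure \<nu> {x..<x + 2 ^ k}"
proof -
  have m: "measure \<nu> {x..<x + 1} > 0" by (rule measure_pos) simp
  obtain k where "K / measure \<nu> {x..<x + 1} < (1 + C powr (- q)) ^ k"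
    using real_arch_pow[of "1 + C powr (- q)"] C_pos by auto
  then have "K < (1 + C powr (- q)) ^ k * measure \<nu> {x..<x + 1}" using m by (simp add: field_simps)
  then show ?thesis using \<nu>_doubling_growth[of k x] by (intro exI[of _ k]) linarith
qed

text \<open>At scale 2d the hypothesis says that (2d)^(-\<alpha>)/\<alpha> times u(x) is the tail
  integral beyond x + 2d. That tail is dominated by averages over [x + t, x + 2t] with t > d, each
  at most a constant times the \<open>\<nu>\<close> mass of [x, x + d) to the power -1/q. The powers
  of d cancel, and this mass is unbounded in d.\<close>

lemma marchaud_diff_eq_0_imp:
  assumes [measurable]: "u \<in> borel_measurable borel" and fin: "wnorm q w u < \<infinity>"
    and zero: "\<And>n. AE x in lborel. marchaud_diff \<alpha> (2 * 2 ^ n) u x = 0"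
  shows "AE x in lborel. u x = 0"
proof -
  obtain B where B: "wnorm q w u = ennreal B" "0 \<le> B" using fin by (cases "wnorm q w u") auto
  have gap: "Wq.gap_average d u x \<le> ennreal (C * B powr (1 / q) * measure \<nu> {x..<x + d} powr (- (1 / q)))" if d: "0 < d" for d x
  proof -
    have "(\<integral>\<^sup>+t. ennreal (\<bar>u t\<bar> powr q * w t powr q) * indicator {x + d..<x + d + d} t \<partial>lborel) \<le> ennreal B"
      unfolding B(1)[symmetric] wnorm_def by (intro nn_integral_mono) (auto simp: indicator_def)
    then obtain X where X: "X \<ge> 0" "(\<integral>\<^sup>+t. ennreal \<bar>u t\<bar> * indicator {x + d..<x + d + d} t \<partial>lborel) \<le> ennreal X"
      "(\<integral>\<^sup>+t. ennreal (w t powr q) * indicator {x + d - d..<x + d} t \<partial>lborel) * ennreal (X powr q) \<le> ennreal ((C * d) powr q * B)"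
      using Wq.average[OF d _ B(2), of u "x + d"] by auto
    define N where "N = measure \<nu> {x..<x + d}"
    have N0: "0 < N" unfolding N_def using d by (intro measure_pos) simp
    have "{x..<x + d} \<subseteq> {x..x + d}" by auto
    then have "(\<integral>\<^sup>+t. ennreal (w t powr q) * indicator {x + d - d..<x + d} t \<partial>lborel) = ennreal N"
      using emeasure_eq_\<nu>[of "{x..<x + d}" x "x + d"] by (simp add: emeasure_\<nu> N_def)
    then have "N * X powr q \<le> (C * d) powr q * B"
      using X(3) N0 B by (simp flip: ennreal_mult'')
    then have "X powr q \<le> (C * d) powr q * B / N" using N0 by (simp add: field_simps)
    then have "(X powr q) powr (1 / q) \<le> ((C * d) powr q * B / N) powr (1 / q)" using q1 by (intro powr_mono2) auto
    then have "X \<le> ((C * d) powr q * B / N) powr (1 / q)" using q1 X by (simp add: powr_powr)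
    also have "\<dots> = C * d * B powr (1 / q) * N powr (- (1 / q))"
      using N0 B C_pos d q1 by (simp add: powr_mult powr_divide powr_powr powr_minus_divide)
    finally have Xd: "X / d \<le> C * B powr (1 / q) * N powr (- (1 / q))" using d by (simp add: field_simps)
    have "(\<integral>\<^sup>+s. ennreal \<bar>u (x + s)\<bar> * indicator {d<..2 * d} s \<partial>lborel) = (\<integral>\<^sup>+t. ennreal \<bar>u t\<bar> * indicator {x + d<..x + 2 * d} t \<partial>lborel)"
      by (subst nn_integral_real_affine[where c=1 and t=x and f="\<lambda>t. ennreal \<bar>u t\<bar> * indicator {x + d<..x + 2 * d} t"]) (auto simp: indicator_def intro!: nn_integral_cong)
    also have "\<dots> = (\<integral>\<^sup>+t. ennreal \<bar>u t\<bar> * indicator {x + d..<x + d + d} t \<partial>lborel)"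
    proof (rule nn_integral_cong_AE)
      show "AE t in lborel. ennreal \<bar>u t\<bar> * indicator {x + d<..x + 2 * d} t = ennreal \<bar>u t\<bar> * indicator {x + d..<x + d + d} t"
        using AE_lborel_singleton[of "x + d"] AE_lborel_singleton[of "x + 2 * d"]
        by eventually_elim (auto simp: indicator_def)
    qed
    also have "\<dots> \<le> ennreal X" by (rule X(2))
    finally have "Wq.gap_average d u x \<le> ennreal (1 / d) * ennreal X"
      unfolding Wq.gap_average_def by (intro mult_left_mono) auto
    also have "\<dots> = ennreal (X / d)" using X d by (simp flip: ennreal_mult)
    also have "\<dots> \<le> ennreal (C * B powr (1 / q) * N powr (- (1 / q)))" by (intro ennreal_leI Xd)
    finally show ?thesis by (simp add: N_def)
  qed
  have bound: "abs_conv (trunc_kernel \<alpha> (2 * d)) u x \<le> ennreal (2 * d powr (- \<alpha>) / \<alpha> * (C * B powr (1 / q) * measure \<nu> {x..<x + d} powr (- (1 / q))))" if d: "0 < d" for d x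
  proof -
    \<comment> \<open>The density lives on t > d: a point s > 2d is covered by the t in [s/2, s),
      all of which exceed d.\<close>
    define m where "m t = 2 * trunc_kernel \<alpha> d t" for t
    have [measurable]: "m \<in> borel_measurable borel" unfolding m_def[abs_def] by measurable
    have mint: "(\<integral>\<^sup>+t. ennreal (m t) \<partial>lborel) = ennreal (2 * d powr (- \<alpha>) / \<alpha>)"
    proof -
      have "(\<integral>\<^sup>+t. ennreal (m t) \<partial>lborel) = 2 * (\<integral>\<^sup>+t. ennreal (trunc_kernel \<alpha> d t) \<partial>lborel)"
        by (simp add: m_def ennreal_mult trunc_kernel_nonneg nn_integral_cmult)
      also have "\<dots> = ennreal 2 * ennreal (d powr (- \<alpha>) / \<alpha>)" by (simp add: nn_integral_trunc_kernel[OF \<alpha> d])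
      also have "\<dots> = ennreal (2 * (d powr (- \<alpha>) / \<alpha>))" using \<alpha> by (intro ennreal_mult[symmetric]) auto
      finally show ?thesis by simp
    qed
    have "abs_conv (trunc_kernel \<alpha> (2 * d)) u x \<le> (\<integral>\<^sup>+t. ennreal (m t) * Wq.gap_average t u x \<partial>lborel)"
    proof (rule Wq.conv_bound(1)[OF _ _ _ fin])
      show "(\<integral>\<^sup>+t. ennreal (m t) \<partial>lborel) \<le> ennreal (2 * d powr (- \<alpha>) / \<alpha>)" using mint by simp
      fix s
      show "ennreal \<bar>trunc_kernel \<alpha> (2 * d) s\<bar> \<le> (\<integral>\<^sup>+t. ennreal (m t / t) * indicator {t<..2 * t} s \<partial>lborel)"
      proof (cases "2 * d < s")
        case False
        then show ?thesis by (simp add: trunc_kernel_def)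
      next
        case True
        have "ennreal \<bar>trunc_kernel \<alpha> (2 * d) s\<bar> = ennreal (2 * s powr (- 1 - \<alpha>) / s) * ennreal (s - s / 2)"
          using True d by (simp add: trunc_kernel_def flip: ennreal_mult)
        also have "\<dots> = (\<integral>\<^sup>+t. ennreal (2 * s powr (- 1 - \<alpha>) / s) * indicator {s / 2..<s} t \<partial>lborel)"
          using True d by (subst nn_integral_cmult) auto
        also have "\<dots> \<le> (\<integral>\<^sup>+t. ennreal (m t / t) * indicator {t<..2 * t} s \<partial>lborel)"
        proof (rule nn_integral_mono)
          fix t
          have "2 * s powr (- 1 - \<alpha>) / s \<le> m t / t" if "s / 2 \<le> t" "t < s"
          proof -
            have "m t = 2 * t powr (- 1 - \<alpha>)" using that True by (simp add: m_def trunc_kernel_def)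
            moreover have "s powr (- 1 - \<alpha>) \<le> t powr (- 1 - \<alpha>)" using that True d \<alpha> by (intro powr_mono2') auto
            ultimately show ?thesis using that True d by (intro frac_le) auto
          qed
          then show "ennreal (2 * s powr (- 1 - \<alpha>) / s) * indicator {s / 2..<s} t \<le> ennreal (m t / t) * indicator {t<..2 * t} s"
            by (auto simp: indicator_def ennreal_leI)
        qed
        finally show ?thesis .
      qed
    qed (use d \<alpha> in \<open>auto simp: m_def trunc_kernel_def\<close>)
    also have "\<dots> \<le> (\<integral>\<^sup>+t. ennreal (m t) * ennreal (C * B powr (1 / q) * measure \<nu> {x..<x + d} powr (- (1 / q))) \<partial>lborel)"
    proof (rule nn_integral_mono)
      fix t
      show "ennreal (m t) * Wq.gap_average t u x \<le> ennreal (m t) * ennreal (C * B powr (1 / q) * measure \<nu> {x..<x + d} powr (- (1 / q)))"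
      proof (cases "d < t")
        case True
        have "measure \<nu> {x..<x + t} powr (- (1 / q)) \<le> measure \<nu> {x..<x + d} powr (- (1 / q))"
          using measure_pos(1)[of x "x + d"] d True q1 by (intro powr_mono2' measure_\<nu>_mono[of _ _ x "x + t"]) auto
        then have "C * B powr (1 / q) * measure \<nu> {x..<x + t} powr (- (1 / q)) \<le> C * B powr (1 / q) * measure \<nu> {x..<x + d} powr (- (1 / q))"
          using C_pos by (intro mult_left_mono) auto
        then have "Wq.gap_average t u x \<le> ennreal (C * B powr (1 / q) * measure \<nu> {x..<x + d} powr (- (1 / q)))"
          using gap[of t x] True d by (meson ennreal_leI order_trans less_trans)
        then show ?thesis by (intro mult_left_mono) auto
      qed (simp add: m_def trunc_kernel_def)
    qed
    also have "\<dots> = ennreal (2 * d powr (- \<alpha>) / \<alpha>) * ennreal (C * B powr (1 / q) * measure \<nu> {x..<x + d} powr (- (1 / q)))"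
      by (subst nn_integral_multc) (auto simp: mint)
    also have "\<dots> = ennreal (2 * d powr (- \<alpha>) / \<alpha> * (C * B powr (1 / q) * measure \<nu> {x..<x + d} powr (- (1 / q))))"
      using \<alpha> C_pos by (simp flip: ennreal_mult)
    finally show ?thesis .
  qed
  \<comment> \<open>Working with countably many scales yields one common exceptional set.\<close>
  have "AE x in lborel. \<forall>n. marchaud_diff \<alpha> (2 * 2 ^ n) u x = 0" using zero by (simp add: AE_all_countable)
  then show ?thesis
  proof eventually_elim
    case (elim x)
    have le: "\<bar>u x\<bar> \<le> 4 * (C * B powr (1 / q) * measure \<nu> {x..<x + 2 ^ n} powr (- (1 / q)))" for n
    proof -
      define d where "d = (2::real) ^ n"
      have d: "d > 0" by (simp add: d_def)
      have "(2 * d) powr (- \<alpha>) / \<alpha> * u x = conv (trunc_kernel \<alpha> (2 * d)) u x"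
        using elim by (auto simp: marchaud_diff_def d_def)
      then have "\<bar>(2 * d) powr (- \<alpha>) / \<alpha> * u x\<bar> = \<bar>conv (trunc_kernel \<alpha> (2 * d)) u x\<bar>" by simp
      then have "ennreal \<bar>(2 * d) powr (- \<alpha>) / \<alpha> * u x\<bar> \<le> ennreal (2 * d powr (- \<alpha>) / \<alpha> * (C * B powr (1 / q) * measure \<nu> {x..<x + d} powr (- (1 / q))))"
        using abs_conv_le[of "trunc_kernel \<alpha> (2 * d)" u x] bound[OF d, of x] by (simp del: abs_mult) 
      then have "\<bar>(2 * d) powr (- \<alpha>) / \<alpha> * u x\<bar> \<le> 2 * d powr (- \<alpha>) / \<alpha> * (C * B powr (1 / q) * measure \<nu> {x..<x + d} powr (- (1 / q)))"
        using \<alpha> C_pos by (subst (asm) ennreal_le_iff) auto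
      moreover have "\<bar>(2 * d) powr (- \<alpha>) / \<alpha> * u x\<bar> = d powr (- \<alpha>) / \<alpha> * (2 powr (- \<alpha>) * \<bar>u x\<bar>)"
        using \<alpha> d by (simp add: abs_mult powr_mult)
      ultimately have "d powr (- \<alpha>) / \<alpha> * (2 powr (- \<alpha>) * \<bar>u x\<bar>) \<le> d powr (- \<alpha>) / \<alpha> * (2 * (C * B powr (1 / q) * measure \<nu> {x..<x + d} powr (- (1 / q))))"
        by (simp add: mult.assoc mult.left_commute)
      then have "2 powr (- \<alpha>) * \<bar>u x\<bar> \<le> 2 * (C * B powr (1 / q) * measure \<nu> {x..<x + d} powr (- (1 / q)))"
        using \<alpha> d by (subst (asm) mult_le_cancel_left_pos) auto
      moreover have "1 / 2 * \<bar>u x\<bar> \<le> 2 powr (- \<alpha>) * \<bar>u x\<bar>"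
      proof (intro mult_right_mono)
        have "(2::real) powr (- 1) \<le> 2 powr (- \<alpha>)" using \<alpha> by (intro powr_mono) auto
        then show "1 / 2 \<le> (2::real) powr (- \<alpha>)" by (simp add: powr_minus_divide)
      qed auto
      ultimately show ?thesis by (simp add: d_def)
    qed
    show "u x = 0"
    proof (rule ccontr)
      assume ux: "u x \<noteq> 0"
      define E where "E = 4 * (C * B powr (1 / q))"
      have E0: "0 \<le> E" using C_pos by (simp add: E_def)
      \<comment> \<open>The added 1 turns |u x| <= E N^(-1/q) into the contradiction E + |u x| <=
        N^(1/q) |u x| <= E.\<close>
      obtain k where k: "(E / \<bar>u x\<bar> + 1) powr q \<le> measure \<nu> {x..<x + 2 ^ k}" using \<nu>_unbounded by blast
      define N where "N = measure \<nu> {x..<x + 2 ^ k}"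
      have N0: "0 < N" unfolding N_def by (intro measure_pos) simp
      have pos: "E / \<bar>u x\<bar> + 1 > 0" using E0 by (simp add: add_nonneg_pos)
      have "((E / \<bar>u x\<bar> + 1) powr q) powr (1 / q) \<le> N powr (1 / q)"
        using k q1 unfolding N_def by (intro powr_mono2) auto
      then have "E / \<bar>u x\<bar> + 1 \<le> N powr (1 / q)" using pos q1 by (simp add: powr_powr)
      then have "E + \<bar>u x\<bar> \<le> N powr (1 / q) * \<bar>u x\<bar>" using ux by (simp add: field_simps)
      moreover have "\<bar>u x\<bar> \<le> E * N powr (- (1 / q))" using le[of k] by (simp add: E_def N_def mult.assoc)
      then have "N powr (1 / q) * \<bar>u x\<bar> \<le> N powr (1 / q) * (E * N powr (- (1 / q)))" by (intro mult_left_mono) auto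
      moreover have "N powr (1 / q) * (E * N powr (- (1 / q))) = E" using N0 by (simp add: powr_minus_divide)
      ultimately show False using ux by simp
    qed
  qed
qed

end

section \<open>The Marchaud kernels as an approximate identity\<close>

lemma wnorm_LIMSEQ_0:
  assumes [measurable]: "\<And>n. s n \<in> borel_measurable borel" "W \<in> borel_measurable borel" "v \<in> borel_measurable borel"
    and W: "wnorm r v W < \<infinity>" and r: "0 < r"
    and bound: "\<And>n. AE x in lborel. \<bar>s n x\<bar> \<le> W x" and lim: "AE x in lborel. (\<lambda>n. s n x) \<longlonglongrightarrow> 0"
  shows "(\<lambda>n. wnorm r v (s n)) \<longlonglongrightarrow> 0"
proof -
  have "(\<lambda>n. \<integral>\<^sup>+x. ennreal (\<bar>s n x\<bar> powr r * v x powr r) \<partial>lborel) \<longlonglongrightarrow> (\<integral>\<^sup>+x. 0 \<partial>(lborel :: real measure))"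
  proof (rule nn_integral_dominated_convergence[where w="\<lambda>x. ennreal (\<bar>W x\<bar> powr r * v x powr r)"])
    show "(\<integral>\<^sup>+x. ennreal (\<bar>W x\<bar> powr r * v x powr r) \<partial>lborel) < \<infinity>" using W by (simp add: wnorm_def)
    show "AE x in lborel. ennreal (\<bar>s n x\<bar> powr r * v x powr r) \<le> ennreal (\<bar>W x\<bar> powr r * v x powr r)" for n
      using bound[of n] by eventually_elim (use r in \<open>auto intro!: ennreal_leI mult_right_mono powr_mono2\<close>)
    show "AE x in lborel. (\<lambda>n. ennreal (\<bar>s n x\<bar> powr r * v x powr r)) \<longlonglongrightarrow> 0"
      using lim
    proof eventually_elim
      case (elim x)
      have "(\<lambda>n. \<bar>s n x\<bar>) \<longlonglongrightarrow> 0" using tendsto_rabs_zero[OF elim] .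
      then have "(\<lambda>n. \<bar>s n x\<bar> powr r) \<longlonglongrightarrow> 0"
        using r by (intro tendsto_zero_powrI[where b=r]) auto
      then have "(\<lambda>n. \<bar>s n x\<bar> powr r * v x powr r) \<longlonglongrightarrow> 0" by (rule tendsto_mult_left_zero)
      then show ?case by (metis ennreal_0 tendsto_ennrealI)
    qed
  qed measurable
  then show ?thesis by (simp add: wnorm_def)
qed

context average_weight
begin

lemma wnorm_indicator_finite: "wnorm r v (\<lambda>x. c * indicator {a..<b} x) < \<infinity>"
proof -
  have "wnorm r v (\<lambda>x. c * indicator {a..<b} x) = (\<integral>\<^sup>+x. ennreal (\<bar>c\<bar> powr r) * (ennreal (v x powr r) * indicator {a..<b} x) \<partial>lborel)"
    unfolding wnorm_def using r by (intro nn_integral_cong) (auto simp: indicator_def ennreal_mult)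
  also have "\<dots> = ennreal (\<bar>c\<bar> powr r) * (\<integral>\<^sup>+x. ennreal (v x powr r) * indicator {a..<b} x \<partial>lborel)"
    by (rule nn_integral_cmult) measurable
  also have "\<dots> < \<infinity>" using v_fin[of a b] by (simp add: ennreal_mult_less_top)
  finally show ?thesis .
qed

text \<open>Dilation turns the convolution into an integral of M s times g(x + \<epsilon> s), so
  pointwise convergence is dominated convergence. Norm convergence requires a majorant in the
  weighted space: a constant for x in [-N - 1, N), while for x < -N - 1 only s > 1 meets the support
  of g, and there the kernel majorant for \<epsilon> <= 1 is below the one for 1. For x >= N
  everything vanishes.\<close>

lemma marchaud_approx_continuous:
  assumes \<alpha>: "0 < \<alpha>" "\<alpha> < 1" and X: "\<And>n. 0 < X n" "X \<longlonglongrightarrow> 0"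
    and cont: "continuous_on UNIV g" and K: "\<And>x. \<bar>g x\<bar> \<le> K" and N: "0 < N" "\<And>x. x \<notin> {- N..<N} \<Longrightarrow> g x = 0"
  shows "(\<lambda>n. wnorm r v (\<lambda>x. conv (marchaud_kernel \<alpha> (X n)) g x - marchaud_const \<alpha> * g x)) \<longlonglongrightarrow> 0"
proof -
  have [measurable]: "g \<in> borel_measurable borel" using cont by (rule borel_measurable_continuous_onI)
  have K0: "0 \<le> K" using K[of 0] by linarith
  define M where "M = marchaud_kernel \<alpha> 1"
  have [measurable]: "M \<in> borel_measurable borel" by (simp add: M_def)
  define c where "c = marchaud_const \<alpha>"
  have c0: "0 < c" using marchaud_const_pos[OF \<alpha>] by (simp add: c_def)
  have M0: "0 \<le> M s" for s unfolding M_def by (rule marchaud_kernel_bounds(1)[OF \<alpha>]) simp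
  have Mint: "integrable lborel M" unfolding M_def by (rule marchaud_kernel_integrable[OF \<alpha>]) simp
  have Mc: "(LINT s|lborel. M s) = c" by (simp add: M_def c_def marchaud_const_def[OF \<alpha>])
  have scale: "conv (marchaud_kernel \<alpha> \<epsilon>) g x = (LINT s|lborel. M s * g (x + \<epsilon> * s))" if "0 < \<epsilon>" for \<epsilon> x
  proof -
    have "conv (marchaud_kernel \<alpha> \<epsilon>) g x = \<bar>\<epsilon>\<bar> *\<^sub>R (LINT s|lborel. marchaud_kernel \<alpha> \<epsilon> (0 + \<epsilon> * s) * g (x + (0 + \<epsilon> * s)))"
      unfolding conv_def by (rule lborel_integral_real_affine) (use that in simp)
    then show ?thesis using that marchaud_kernel_scaling[OF \<alpha> that] by (simp add: M_def)
  qed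
  have dom: "integrable lborel (\<lambda>s. K * M s)" using Mint by simp
  have bM: "\<bar>M s * g y\<bar> \<le> K * M s" for s y using mult_left_mono[OF K[of y] M0[of s]] M0[of s] by (simp add: abs_mult mult.commute)
  have ptbound: "\<bar>conv (marchaud_kernel \<alpha> \<epsilon>) g x\<bar> \<le> K * c" if "0 < \<epsilon>" for \<epsilon> x
  proof -
    have KM: "0 \<le> K * M s" for s using K0 M0 by simp
    have "integrable lborel (\<lambda>s. M s * g (x + \<epsilon> * s))"
      by (rule Bochner_Integration.integrable_bound[OF dom]) (use bM KM in \<open>auto intro!: AE_I2\<close>)
    then have "(LINT s|lborel. \<bar>M s * g (x + \<epsilon> * s)\<bar>) \<le> (LINT s|lborel. K * M s)"
      using bM by (intro integral_mono dom) auto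
    then have "\<bar>LINT s|lborel. M s * g (x + \<epsilon> * s)\<bar> \<le> (LINT s|lborel. K * M s)"
      by (rule order_trans[OF integral_abs_bound])
    then show ?thesis using scale[OF that] Mc by simp
  qed
  have lim: "(\<lambda>n. conv (marchaud_kernel \<alpha> (X n)) g x - c * g x) \<longlonglongrightarrow> 0" for x
  proof -
    have "(\<lambda>n. LINT s|lborel. M s * g (x + X n * s)) \<longlonglongrightarrow> (LINT s|lborel. M s * g x)"
    proof (rule integral_dominated_convergence[OF _ _ dom])
      show "AE s in lborel. (\<lambda>n. M s * g (x + X n * s)) \<longlonglongrightarrow> M s * g x"
      proof (rule AE_I2)
        fix s
        have "(\<lambda>n. x + X n * s) \<longlonglongrightarrow> x + 0 * s" by (intro tendsto_intros X)
        then have "(\<lambda>n. x + X n * s) \<longlonglongrightarrow> x" by simp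
        then have "(\<lambda>n. g (x + X n * s)) \<longlonglongrightarrow> g x"
          using cont by (intro continuous_on_tendsto_compose[of UNIV g]) auto
        then show "(\<lambda>n. M s * g (x + X n * s)) \<longlonglongrightarrow> M s * g x" by (rule tendsto_mult_left)
      qed
    qed (use bM in auto)
    then have "(\<lambda>n. conv (marchaud_kernel \<alpha> (X n)) g x) \<longlonglongrightarrow> c * g x" using scale[OF X(1)] Mc by simp
    then show ?thesis by (simp add: LIM_zero)
  qed
  define H where "H x = enn2real (abs_conv (marchaud_majorant \<alpha> 1) g x)" for x
  have Mm[measurable]: "marchaud_majorant \<alpha> \<epsilon> \<in> borel_measurable borel" for \<epsilon> by (rule marchaud_majorant_measurable[OF \<alpha>])
  have [measurable]: "H \<in> borel_measurable borel" unfolding H_def[abs_def] by measurable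
  have gfin: "wnorm r v g < \<infinity>"
  proof (rule le_less_trans[OF wnorm_mono_AE wnorm_indicator_finite[of K "- N" N]])
    show "AE x in lborel. \<bar>g x\<bar> \<le> \<bar>K * indicator {- N..<N} x\<bar>"
      using K N(2) K0 by (intro AE_I2) (auto simp: indicator_def abs_mult)
  qed (use r in simp)
  have Hfin: "wnorm r v H < \<infinity>"
  proof -
    have "(\<integral>\<^sup>+x. ennpowr (abs_conv (marchaud_majorant \<alpha> 1) g x) r * ennreal (v x powr r) \<partial>lborel)
      \<le> ennreal (2 * (4 * D * marchaud_mass \<alpha>) powr r) * wnorm r v g"
      by (rule conv_bound_decreasing[of _ _ "marchaud_majorant \<alpha> 1", OF _ _ _ gfin _ _ _ _ nn_integral_marchaud_majorant[OF \<alpha>]])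
        (auto simp: marchaud_majorant_props[OF \<alpha>] marchaud_mass_pos[OF \<alpha>])
    also have "\<dots> < \<infinity>" using gfin by (simp add: ennreal_mult_less_top)
    finally show ?thesis unfolding H_def[abs_def] by (rule le_less_trans[OF wnorm_enn2real_le])
  qed
  have Hreal: "abs_conv (marchaud_majorant \<alpha> 1) g x = ennreal (H x)" for x
  proof -
    have "abs_conv (marchaud_majorant \<alpha> 1) g x \<le> (\<integral>\<^sup>+s. ennreal (marchaud_majorant \<alpha> 1 s) * ennreal K \<partial>lborel)"
      unfolding abs_conv_def using K marchaud_majorant_props(1)[OF \<alpha>, of 1]
      by (intro nn_integral_mono) (auto simp: ennreal_mult intro!: mult_left_mono ennreal_leI)
    also have "\<dots> = (\<integral>\<^sup>+s. ennreal (marchaud_majorant \<alpha> 1 s) \<partial>lborel) * ennreal K" by (rule nn_integral_multc) measurable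
    also have "\<dots> \<le> ennreal (marchaud_mass \<alpha>) * ennreal K"
      by (intro mult_right_mono nn_integral_marchaud_majorant[OF \<alpha>]) auto
    also have "\<dots> < \<infinity>" by (simp add: ennreal_mult_less_top)
    finally show ?thesis by (simp add: H_def)
  qed
  define W where "W x = 2 * (K * c) * indicator {- N - 1..<N} x + H x" for x
  have [measurable]: "W \<in> borel_measurable borel" unfolding W_def[abs_def] by measurable
  have Wfin: "wnorm r v W < \<infinity>" unfolding W_def[abs_def]
    by (rule wnorm_add_finite[OF _ _ _ _ wnorm_indicator_finite Hfin]) (use r in auto)
  have dominated: "\<bar>conv (marchaud_kernel \<alpha> \<epsilon>) g x - c * g x\<bar> \<le> W x" if \<epsilon>: "0 < \<epsilon>" "\<epsilon> \<le> 1" for \<epsilon> x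
  proof (cases "x \<in> {- N - 1..<N}")
    case True
    have "\<bar>c * g x\<bar> \<le> K * c" using K[of x] c0 by (simp add: abs_mult mult.commute mult_left_mono)
    moreover have "0 \<le> H x" by (simp add: H_def)
    ultimately show ?thesis using ptbound[OF \<epsilon>(1), of x] True by (simp add: W_def)
  next
    case False
    then have gx: "g x = 0" using N by auto
    have "abs_conv (marchaud_kernel \<alpha> \<epsilon>) g x \<le> abs_conv (marchaud_majorant \<alpha> 1) g x"
      unfolding abs_conv_def
    proof (intro nn_integral_mono ennreal_leI)
      fix s
      show "\<bar>marchaud_kernel \<alpha> \<epsilon> s\<bar> * \<bar>g (x + s)\<bar> \<le> \<bar>marchaud_majorant \<alpha> 1 s\<bar> * \<bar>g (x + s)\<bar>"
      proof (cases "g (x + s) = 0")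
        case False
        then have xs: "x + s \<in> {- N..<N}" using N(2) by blast
        have "\<bar>marchaud_kernel \<alpha> \<epsilon> s\<bar> \<le> \<bar>marchaud_majorant \<alpha> 1 s\<bar>"
        proof (cases "s \<le> 0")
          case True
          then show ?thesis using \<epsilon> by (simp add: marchaud_kernel_def frac_kernel_def frac_trunc_kernel_def)
        next
          case s0: False
          then have s1: "1 < s" using xs \<open>x \<notin> {- N - 1..<N}\<close> by auto
          have "\<bar>marchaud_kernel \<alpha> \<epsilon> s\<bar> \<le> marchaud_majorant \<alpha> \<epsilon> s"
            using marchaud_kernel_bounds[OF \<alpha> \<epsilon>(1), of s] by simp
          also have "\<dots> = \<epsilon> powr (1 - \<alpha>) / \<alpha> * s powr (\<alpha> - 2)" using s1 \<epsilon> by (simp add: marchaud_majorant_def[OF \<alpha>])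
          also have "\<dots> \<le> 1 / \<alpha> * s powr (\<alpha> - 2)"
            using \<epsilon> \<alpha> by (intro mult_right_mono divide_right_mono powr_le1) auto
          also have "\<dots> = marchaud_majorant \<alpha> 1 s" using s1 by (simp add: marchaud_majorant_def[OF \<alpha>])
          finally show ?thesis by simp
        qed
        then show ?thesis by (intro mult_right_mono) auto
      qed simp
    qed
    then have "ennreal \<bar>conv (marchaud_kernel \<alpha> \<epsilon>) g x\<bar> \<le> ennreal (H x)"
      unfolding Hreal[symmetric] using abs_conv_le order_trans by blast
    then have "\<bar>conv (marchaud_kernel \<alpha> \<epsilon>) g x\<bar> \<le> H x" by (subst (asm) ennreal_le_iff) (auto simp: H_def)
    then show ?thesis using gx False by (simp add: W_def)
  qed
  \<comment> \<open>The majorant W requires \<epsilon> <= 1, which holds from some index on; the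
    sequence is shifted accordingly.\<close>
  from order_tendstoD(2)[OF X(2), of 1] obtain n0 where n0: "\<And>n. n \<ge> n0 \<Longrightarrow> X n < 1"
    by (auto simp: eventually_sequentially)
  have "(\<lambda>n. wnorm r v (\<lambda>x. conv (marchaud_kernel \<alpha> (X (n + n0))) g x - c * g x)) \<longlonglongrightarrow> 0"
  proof (rule wnorm_LIMSEQ_0[OF _ _ _ Wfin])
    show "AE x in lborel. \<bar>conv (marchaud_kernel \<alpha> (X (n + n0))) g x - c * g x\<bar> \<le> W x" for n
      using dominated[OF X(1), of "n + n0"] n0[of "n + n0"] by (intro AE_I2) simp
    show "AE x in lborel. (\<lambda>n. conv (marchaud_kernel \<alpha> (X (n + n0))) g x - c * g x) \<longlonglongrightarrow> 0"
      using LIMSEQ_ignore_initial_segment[OF lim] by (intro AE_I2) auto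
  qed (use r in auto)
  then show ?thesis unfolding c_def by (rule LIMSEQ_offset)
qed

text \<open>Values and domain are cut off at n; the bounded function is an almost everywhere limit
  of continuous functions, and clipping together with the factor \<open>cut\<close> gives these a
  common bound and support. Both approximations converge in norm by domination.\<close>

lemma continuous_dense:
  assumes [measurable]: "f \<in> borel_measurable borel" and fin: "wnorm r v f < \<infinity>" and \<eta>: "0 < \<eta>"
  obtains g K N where "continuous_on UNIV g" "\<And>x. \<bar>g x\<bar> \<le> K" "0 < N" "\<And>x. x \<notin> {- N..<N} \<Longrightarrow> g x = 0"
    "wnorm r v (\<lambda>x. f x - g x) < \<eta>"
proof -
  \<comment> \<open>\<eta> may be infinite; the minimum with 1 has a real value.\<close>
  define \<theta> where "\<theta> = min \<eta> 1"
  have "\<theta> \<le> 1" by (simp add: \<theta>_def)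
  then have \<theta>: "0 < \<theta>" "\<theta> < \<infinity>" "\<theta> \<le> \<eta>" using \<eta> by (auto simp: \<theta>_def intro: le_less_trans[OF _ ennreal_one_less_top])
  obtain e where e: "\<theta> = ennreal e" "0 < e" using \<theta> by (cases \<theta>) auto
  \<comment> \<open>Chosen so that \<open>wnorm_add\<close> gives 2^r (e' + e') = e/2 < e.\<close>
  define e' where "e' = e / (4 * 2 powr r)"
  have e': "0 < e'" using e by (simp add: e'_def)
  define F where "F n x = f x * indicator {- real n..<real n} x * indicator {x. \<bar>f x\<bar> \<le> real n} x" for n x
  have [measurable]: "F n \<in> borel_measurable borel" for n unfolding F_def[abs_def] by measurable
  have "(\<lambda>n. wnorm r v (\<lambda>x. f x - F n x)) \<longlonglongrightarrow> 0"
  proof (rule wnorm_LIMSEQ_0[of _ "\<lambda>x. \<bar>f x\<bar>"])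
    show "wnorm r v (\<lambda>x. \<bar>f x\<bar>) < \<infinity>" using fin by (simp add: wnorm_def)
    show "AE x in lborel. \<bar>f x - F n x\<bar> \<le> \<bar>f x\<bar>" for n by (auto simp: F_def indicator_def)
    show "AE x in lborel. (\<lambda>n. f x - F n x) \<longlonglongrightarrow> 0"
    proof (rule AE_I2)
      fix x
      obtain m :: nat where m: "\<bar>x\<bar> + \<bar>f x\<bar> + 1 < real m" using reals_Archimedean2 by blast
      have "f x - F n x = 0" if "n \<ge> m" for n
      proof -
        have "real m \<le> real n" using that by simp
        then have "\<bar>x\<bar> < real n" "\<bar>f x\<bar> \<le> real n" using m by linarith+
        then show ?thesis by (auto simp: F_def indicator_def)
      qed
      then have "\<forall>\<^sub>F n in sequentially. f x - F n x = 0" by (auto simp: eventually_sequentially)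
      then show "(\<lambda>n. f x - F n x) \<longlonglongrightarrow> 0" by (rule tendsto_eventually)
    qed
  qed (use r in auto)
  then have "\<forall>\<^sub>F n in sequentially. wnorm r v (\<lambda>x. f x - F n x) < ennreal e'"
    using e' by (intro order_tendstoD(2)) auto
  then obtain n where n: "wnorm r v (\<lambda>x. f x - F n x) < ennreal e'" by (auto simp: eventually_sequentially)
  define K where "K = real n"
  define N where "N = real n + 2"
  have "F n measurable_on UNIV" by (rule lebesgue_measurable_imp_measurable_on_real) (auto intro: measurable_completion)
  then obtain Z G where Z: "negligible Z" "\<And>j. continuous_on UNIV (G j)" "\<And>x. x \<notin> Z \<Longrightarrow> (\<lambda>j. G j x) \<longlonglongrightarrow> F n x"
    unfolding measurable_on_def by auto
  \<comment> \<open>Equal to 1 on [-n, n], outside of which F n vanishes, and equal to 0 off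
    [-n - 1, n + 1], which lies inside [-N, N) for N = n + 2.\<close>
  define cut where "cut x = max 0 (min 1 (real n + 1 - \<bar>x\<bar>))" for x :: real
  define g where "g j x = max (- K) (min K (G j x)) * cut x" for j x
  have gcont: "continuous_on UNIV (g j)" for j
    unfolding g_def cut_def by (intro continuous_intros Z(2))
  have [measurable]: "g j \<in> borel_measurable borel" for j using gcont by (rule borel_measurable_continuous_onI)
  have cut: "0 \<le> cut x" "cut x \<le> 1" for x by (auto simp: cut_def)
  have gK: "\<bar>g j x\<bar> \<le> K" for j x
  proof -
    have "\<bar>max (- K) (min K (G j x))\<bar> \<le> K" by (auto simp: K_def max_def min_def)
    then have "\<bar>max (- K) (min K (G j x))\<bar> * cut x \<le> K * 1" using cut[of x] by (intro mult_mono) (auto simp: K_def)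
    then show ?thesis using cut[of x] by (simp add: g_def abs_mult)
  qed
  have gN: "g j x = 0" if "x \<notin> {- N..<N}" for j x
    using that by (auto simp: g_def cut_def N_def)
  have FK: "\<bar>F n x\<bar> \<le> K" for x by (auto simp: F_def K_def indicator_def)
  have FN: "F n x = 0" if "x \<notin> {- N..<N}" for x using that by (auto simp: F_def N_def indicator_def)
  have "(\<lambda>j. wnorm r v (\<lambda>x. F n x - g j x)) \<longlonglongrightarrow> 0"
  proof (rule wnorm_LIMSEQ_0[OF _ _ _ wnorm_indicator_finite[of "2 * K" "- N" N]])
    show "AE x in lborel. \<bar>F n x - g j x\<bar> \<le> 2 * K * indicator {- N..<N} x" for j
    proof (rule AE_I2)
      fix x
      show "\<bar>F n x - g j x\<bar> \<le> 2 * K * indicator {- N..<N} x"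
      proof (cases "x \<in> {- N..<N}")
        case True
        then show ?thesis using FK[of x] gK[of j x] by simp
      qed (use gN FN in auto)
    qed
    have "AE x in lebesgue. x \<notin> Z"
      using Z(1) by (intro AE_not_in) (simp add: negligible_iff_null_sets)
    then have "AE x in lborel. x \<notin> Z" by (simp add: AE_completion_iff)
    then show "AE x in lborel. (\<lambda>j. F n x - g j x) \<longlonglongrightarrow> 0"
    proof eventually_elim
      case (elim x)
      have "(\<lambda>j. g j x) \<longlonglongrightarrow> max (- K) (min K (F n x)) * cut x"
        unfolding g_def by (intro tendsto_intros tendsto_max tendsto_min Z(3) elim)
      moreover have "max (- K) (min K (F n x)) * cut x = F n x"
      proof (cases "F n x = 0")
        case False
        then have "\<bar>x\<bar> \<le> real n" by (auto simp: F_def indicator_def split: if_splits)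
        then show ?thesis using FK[of x] by (auto simp: cut_def)
      qed (auto simp: K_def max_def min_def)
      ultimately show ?case using tendsto_diff[OF tendsto_const[of "F n x"]] by fastforce
    qed
  qed (use r in auto)
  then have "\<forall>\<^sub>F j in sequentially. wnorm r v (\<lambda>x. F n x - g j x) < ennreal e'"
    using e' by (intro order_tendstoD(2)) auto
  then obtain j where j: "wnorm r v (\<lambda>x. F n x - g j x) < ennreal e'" by (auto simp: eventually_sequentially)
  have "wnorm r v (\<lambda>x. f x - g j x) = wnorm r v (\<lambda>x. (f x - F n x) + (F n x - g j x))" by simp
  also have "\<dots> \<le> ennreal (2 powr r) * (wnorm r v (\<lambda>x. f x - F n x) + wnorm r v (\<lambda>x. F n x - g j x))"
    by (rule wnorm_add) (use r in auto)
  also have "\<dots> \<le> ennreal (2 powr r) * (ennreal e' + ennreal e')"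
    using n j by (intro mult_left_mono add_mono) auto
  also have "\<dots> = ennreal (2 powr r * (e' + e'))" using e' by (simp add: ennreal_mult flip: ennreal_plus)
  also have "2 powr r * (e' + e') = e / 2" by (simp add: e'_def)
  also have "ennreal (e / 2) < \<theta>" using e by (simp add: ennreal_less_iff)
  finally have "wnorm r v (\<lambda>x. f x - g j x) < \<eta>" using \<theta>(3) by (rule less_le_trans)
  moreover have "0 < N" by (simp add: N_def)
  ultimately show ?thesis using that[of "g j" K N] gcont gK gN by blast
qed

lemma conv_marchaud_diff:
  assumes [measurable]: "f \<in> borel_measurable borel" "g \<in> borel_measurable borel"
    and f: "wnorm r v f < \<infinity>" and g: "wnorm r v g < \<infinity>" and \<alpha>: "0 < \<alpha>" "\<alpha> < 1" and \<epsilon>: "0 < \<epsilon>"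
  shows "AE x in lborel. conv (marchaud_kernel \<alpha> \<epsilon>) (\<lambda>x. f x - g x) x = conv (marchaud_kernel \<alpha> \<epsilon>) f x - conv (marchaud_kernel \<alpha> \<epsilon>) g x"
proof -
  have "AE x in lborel. abs_conv (marchaud_kernel \<alpha> \<epsilon>) f x < \<infinity>"
    by (rule abs_conv_AE_finite[OF _ _ abs_conv_marchaud_finite[OF _ f \<alpha> \<epsilon>]]) auto
  moreover have "AE x in lborel. abs_conv (marchaud_kernel \<alpha> \<epsilon>) g x < \<infinity>"
    by (rule abs_conv_AE_finite[OF _ _ abs_conv_marchaud_finite[OF _ g \<alpha> \<epsilon>]]) auto
  ultimately show ?thesis
proof eventually_elim
  case (elim x)
  have "integrable lborel (\<lambda>s. marchaud_kernel \<alpha> \<epsilon> s * f (x + s))" "integrable lborel (\<lambda>s. marchaud_kernel \<alpha> \<epsilon> s * g (x + s))"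
    using elim by (auto intro: abs_conv_integrable)
  then show ?case by (simp add: conv_def right_diff_distrib)
qed
qed

text \<open>The density argument: f = h + g with g continuous of bounded support and h small. The
  uniform bound \<open>wnorm_conv_marchaud\<close> keeps the contribution of h small for all indices
  at once.\<close>

lemma marchaud_approx_seq:
  assumes [measurable]: "f \<in> borel_measurable borel" and fin: "wnorm r v f < \<infinity>"
    and \<alpha>: "0 < \<alpha>" "\<alpha> < 1" and X: "\<And>n. 0 < X n" "X \<longlonglongrightarrow> 0"
  shows "(\<lambda>n. wnorm r v (\<lambda>x. conv (marchaud_kernel \<alpha> (X n)) f x - marchaud_const \<alpha> * f x)) \<longlonglongrightarrow> 0"
proof (rule order_tendstoI)
  fix a :: ennreal assume a: "0 < a"
  define \<theta> where "\<theta> = min a 1"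
  have "\<theta> \<le> 1" by (simp add: \<theta>_def)
  then have \<theta>: "0 < \<theta>" "\<theta> < \<infinity>" "\<theta> \<le> a" using a by (auto simp: \<theta>_def intro: le_less_trans[OF _ ennreal_one_less_top])
  obtain e where e: "\<theta> = ennreal e" "0 < e" using \<theta> by (cases \<theta>) auto
  define c where "c = marchaud_const \<alpha>"
  define K where "K = 2 * (4 * D * marchaud_mass \<alpha>) powr r"
  \<comment> \<open>L collects the constants of two uses of \<open>wnorm_add\<close>, the uniform
    bound K and the multiple c; \<eta> is chosen to make the share of h at most e/4, and the share
    of g becomes e/4 too.\<close>
  define L where "L = 2 powr r * (2 powr r * (K + \<bar>- c\<bar> powr r))"
  have K0: "0 \<le> K" by (simp add: K_def)
  have L0: "0 \<le> L" using K0 by (simp add: L_def)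
  define \<eta> where "\<eta> = e / (4 * (L + 1))"
  have \<eta>: "0 < \<eta>" using e L0 by (simp add: \<eta>_def)
  obtain g B N where g: "continuous_on UNIV g" "\<And>x. \<bar>g x\<bar> \<le> B" "0 < N" "\<And>x. x \<notin> {- N..<N} \<Longrightarrow> g x = 0"
    "wnorm r v (\<lambda>x. f x - g x) < ennreal \<eta>"
    using continuous_dense[OF _ fin, of "ennreal \<eta>"] \<eta> by auto
  have [measurable]: "g \<in> borel_measurable borel" using g(1) by (rule borel_measurable_continuous_onI)
  have gfin: "wnorm r v g < \<infinity>"
  proof -
    have "wnorm r v (\<lambda>x. f x - g x) < \<infinity>" using g(5) less_trans ennreal_less_top infinity_ennreal_def by metis
    from wnorm_diff_finite[OF _ _ _ _ fin this] r show ?thesis by simp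
  qed
  have hfin: "wnorm r v (\<lambda>x. f x - g x) < \<infinity>" by (rule wnorm_diff_finite) (use r fin gfin in auto)
  have "(\<lambda>n. wnorm r v (\<lambda>x. conv (marchaud_kernel \<alpha> (X n)) g x - c * g x)) \<longlonglongrightarrow> 0"
    unfolding c_def by (rule marchaud_approx_continuous[OF \<alpha> X g(1-4)])
  then have "\<forall>\<^sub>F n in sequentially. wnorm r v (\<lambda>x. conv (marchaud_kernel \<alpha> (X n)) g x - c * g x) < ennreal (e / (4 * 2 powr r))"
    using e by (intro order_tendstoD(2)) auto
  then show "\<forall>\<^sub>F n in sequentially. wnorm r v (\<lambda>x. conv (marchaud_kernel \<alpha> (X n)) f x - marchaud_const \<alpha> * f x) < a"
  proof eventually_elim
    case (elim n)
    define h where "h = (\<lambda>x. f x - g x)"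
    have [measurable]: "h \<in> borel_measurable borel" by (simp add: h_def)
    have hw: "wnorm r v h \<le> ennreal \<eta>" using g(5) by (simp add: h_def)
    have "wnorm r v (\<lambda>x. conv (marchaud_kernel \<alpha> (X n)) f x - c * f x) =
      wnorm r v (\<lambda>x. (conv (marchaud_kernel \<alpha> (X n)) h x + (- c) * h x) + (conv (marchaud_kernel \<alpha> (X n)) g x - c * g x))"
    proof (rule wnorm_cong_AE)
      show "AE x in lborel. conv (marchaud_kernel \<alpha> (X n)) f x - c * f x =
        (conv (marchaud_kernel \<alpha> (X n)) h x + (- c) * h x) + (conv (marchaud_kernel \<alpha> (X n)) g x - c * g x)"
        using conv_marchaud_diff[OF assms(1) \<open>g \<in> borel_measurable borel\<close> fin gfin \<alpha> X(1)[of n]] unfolding h_def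
        by eventually_elim (auto simp: algebra_simps)
    qed
    also have "\<dots> \<le> ennreal (2 powr r) * (wnorm r v (\<lambda>x. conv (marchaud_kernel \<alpha> (X n)) h x + (- c) * h x) + wnorm r v (\<lambda>x. conv (marchaud_kernel \<alpha> (X n)) g x - c * g x))"
      by (rule wnorm_add) (use r in auto)
    also have "\<dots> \<le> ennreal (2 powr r) * (ennreal (2 powr r) * (ennreal K * ennreal \<eta> + ennreal (\<bar>- c\<bar> powr r) * ennreal \<eta>) + ennreal (e / (4 * 2 powr r)))"
    proof (intro mult_left_mono add_mono)
      have "wnorm r v (\<lambda>x. conv (marchaud_kernel \<alpha> (X n)) h x + (- c) * h x) \<le> ennreal (2 powr r) * (wnorm r v (conv (marchaud_kernel \<alpha> (X n)) h) + wnorm r v (\<lambda>x. (- c) * h x))"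
        by (rule wnorm_add) (use r in auto)
      also have "\<dots> \<le> ennreal (2 powr r) * (ennreal K * ennreal \<eta> + ennreal (\<bar>- c\<bar> powr r) * ennreal \<eta>)"
      proof (intro mult_left_mono add_mono)
        have "wnorm r v (conv (marchaud_kernel \<alpha> (X n)) h) \<le> ennreal K * wnorm r v h"
          unfolding K_def by (rule wnorm_conv_marchaud) (use hfin \<alpha> X in \<open>auto simp: h_def\<close>)
        also have "\<dots> \<le> ennreal K * ennreal \<eta>" by (intro mult_left_mono hw) auto
        finally show "wnorm r v (conv (marchaud_kernel \<alpha> (X n)) h) \<le> ennreal K * ennreal \<eta>" .
        have "wnorm r v (\<lambda>x. (- c) * h x) = ennreal (\<bar>- c\<bar> powr r) * wnorm r v h" by (rule wnorm_cmult) auto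
        also have "\<dots> \<le> ennreal (\<bar>- c\<bar> powr r) * ennreal \<eta>" by (intro mult_left_mono hw) auto
        finally show "wnorm r v (\<lambda>x. (- c) * h x) \<le> ennreal (\<bar>- c\<bar> powr r) * ennreal \<eta>" .
      qed auto
      finally show "wnorm r v (\<lambda>x. conv (marchaud_kernel \<alpha> (X n)) h x + (- c) * h x) \<le> ennreal (2 powr r) * (ennreal K * ennreal \<eta> + ennreal (\<bar>- c\<bar> powr r) * ennreal \<eta>)" .
    qed (use elim in auto)
    also have "\<dots> = ennreal (2 powr r * (2 powr r * (K * \<eta> + \<bar>- c\<bar> powr r * \<eta>) + e / (4 * 2 powr r)))"
      using \<eta> e K0 by (simp add: ennreal_mult)
    also have "2 powr r * (2 powr r * (K * \<eta> + \<bar>- c\<bar> powr r * \<eta>) + e / (4 * 2 powr r)) = L * \<eta> + e / 4"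
      by (simp add: L_def field_simps)
    also have "ennreal (L * \<eta> + e / 4) \<le> ennreal (e / 4 + e / 4)"
    proof (rule ennreal_leI)
      have "L * \<eta> \<le> (L + 1) * \<eta>" using \<eta> by simp
      also have "\<dots> = e / 4"
      proof -
        have "t * (e / (4 * t)) = e / 4" if "0 < t" for t using that by simp
        from this[of "L + 1"] show ?thesis using L0 by (simp only: \<eta>_def)
      qed
      finally show "L * \<eta> + e / 4 \<le> e / 4 + e / 4" by simp
    qed
    also have "\<dots> < \<theta>" using e by (simp add: ennreal_less_iff)
    finally show ?case using \<theta>(3) by (auto simp: c_def)
  qed
qed auto

lemma marchaud_approx:
  assumes "f \<in> borel_measurable borel" and "wnorm r v f < \<infinity>" and "0 < \<alpha>" "\<alpha> < 1"
  shows "((\<lambda>\<epsilon>. wnorm r v (\<lambda>x. conv (marchaud_kernel \<alpha> \<epsilon>) f x - marchaud_const \<alpha> * f x)) \<longlongrightarrow> 0) (at_right 0)"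
  unfolding tendsto_at_iff_sequentially
proof (intro allI impI)
  fix X :: "nat \<Rightarrow> real" assume "\<forall>i. X i \<in> {0<..} - {0}" "X \<longlonglongrightarrow> 0"
  then show "((\<lambda>\<epsilon>. wnorm r v (\<lambda>x. conv (marchaud_kernel \<alpha> \<epsilon>) f x - marchaud_const \<alpha> * f x)) \<circ> X) \<longlonglongrightarrow> 0"
    using marchaud_approx_seq[OF assms, of X] by (auto simp: o_def)
qed

end

section \<open>Uniform convexity and completeness\<close>

text \<open>Strict convexity, by comparing the mean slopes on the two halves of [x, y]. The case x =
  0 is separate because the derivative formula is applied at positive points only.\<close>

lemma powr_midpoint_less:
  fixes x y :: real
  assumes p: "1 < p" and xy: "0 \<le> x" "x < y"
  shows "((x + y) / 2) powr p < (x powr p + y powr p) / 2"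
proof (cases "x = 0")
  case True
  have "(1 / 2) powr p < (1 / 2 :: real) powr 1" using p by (intro powr_less_mono') auto
  then have "y powr p * (1 / 2) powr p < y powr p * (1 / 2)" using xy by (intro mult_strict_left_mono) auto
  moreover have "(y / 2) powr p = y powr p * (1 / 2) powr p" using xy by (simp flip: powr_mult)
  ultimately show ?thesis using True p by simp
next
  case False
  then have x: "0 < x" using xy by simp
  define m where "m = (x + y) / 2"
  have m: "x < m" "m < y" "y - m = m - x" using xy by (auto simp: m_def field_simps)
  have der: "((\<lambda>t. t powr p) has_real_derivative p * t powr (p - 1)) (at t)" if "x \<le> t" for t
    using that x by (intro has_real_derivative_powr) auto
  obtain z1 where z1: "x < z1" "z1 < m" "m powr p - x powr p = (m - x) * (p * z1 powr (p - 1))"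
    using MVT2[OF m(1), of "\<lambda>t. t powr p" "\<lambda>t. p * t powr (p - 1)"] der by auto
  obtain z2 where z2: "m < z2" "z2 < y" "y powr p - m powr p = (y - m) * (p * z2 powr (p - 1))"
    using MVT2[OF m(2), of "\<lambda>t. t powr p" "\<lambda>t. p * t powr (p - 1)"] der m by auto
  have "z1 powr (p - 1) < z2 powr (p - 1)" using z1 z2 x p by (intro powr_less_mono2) auto
  then have "(m - x) * (p * z1 powr (p - 1)) < (m - x) * (p * z2 powr (p - 1))"
    using m p by (intro mult_strict_left_mono) auto
  then have "m powr p - x powr p < y powr p - m powr p" unfolding z1(3) z2(3) m(3) .
  then show ?thesis unfolding m_def[symmetric] by argo
qed

lemma abs_powr_midpoint_less:
  fixes a b :: real
  assumes p: "1 < p" and ab: "a \<noteq> b"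
  shows "\<bar>(a + b) / 2\<bar> powr p < (\<bar>a\<bar> powr p + \<bar>b\<bar> powr p) / 2"
proof (cases "\<bar>a\<bar> = \<bar>b\<bar>")
  case True
  then have "a = - b" "b \<noteq> 0" using ab by auto
  then show ?thesis by simp
next
  case False
  have "\<bar>(a + b) / 2\<bar> powr p \<le> ((\<bar>a\<bar> + \<bar>b\<bar>) / 2) powr p" using p by (intro powr_mono2) auto
  also have "\<dots> < (\<bar>a\<bar> powr p + \<bar>b\<bar> powr p) / 2"
    using powr_midpoint_less[OF p, of "\<bar>a\<bar>" "\<bar>b\<bar>"] powr_midpoint_less[OF p, of "\<bar>b\<bar>" "\<bar>a\<bar>"] False
    by (cases "\<bar>a\<bar> < \<bar>b\<bar>") (auto simp: add.commute)
  finally show ?thesis .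
qed

lemma abs_powr_midpoint_le:
  fixes a b :: real
  assumes p: "1 < p"
  shows "\<bar>(a + b) / 2\<bar> powr p \<le> (\<bar>a\<bar> powr p + \<bar>b\<bar> powr p) / 2"
  using abs_powr_midpoint_less[OF p, of a b] by (cases "a = b") auto

text \<open>Both sides are homogeneous of degree \<open>p\<close>, so it suffices to consider the compact set
  \<open>max \<bar>a\<bar> \<bar>b\<bar> = 1\<close>, where the midpoint defect is bounded below as soon as \<open>\<bar>a - b\<bar>\<close> is.\<close>

lemma uniform_convexity_powr:
  assumes p: "1 < p" and \<eta>: "0 < \<eta>"
  obtains C where "0 \<le> C"
    "\<And>a b :: real. \<bar>a - b\<bar> powr p \<le> \<eta> * (\<bar>a\<bar> powr p + \<bar>b\<bar> powr p) + C * ((\<bar>a\<bar> powr p + \<bar>b\<bar> powr p) / 2 - \<bar>(a + b) / 2\<bar> powr p)"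
proof -
  define \<phi> where "\<phi> z = \<bar>fst z - snd z\<bar> powr p - \<eta> * (\<bar>fst z\<bar> powr p + \<bar>snd z\<bar> powr p)" for z :: "real \<times> real"
  define \<psi> where "\<psi> z = (\<bar>fst z\<bar> powr p + \<bar>snd z\<bar> powr p) / 2 - \<bar>(fst z + snd z) / 2\<bar> powr p" for z :: "real \<times> real"
  \<comment> \<open>On the rest of the unit sphere of the maximum norm the claim is trivial, since
    there \<phi> < 0 <= C \<psi>. On S the two coordinates differ, which makes the defect \<psi>
    positive.\<close>
  define S where "S = {z. max \<bar>fst z\<bar> \<bar>snd z\<bar> = 1} \<inter> {z. 0 \<le> \<phi> z}"
  have c\<phi>: "continuous_on UNIV \<phi>" unfolding \<phi>_def using p by (intro continuous_intros continuous_on_powr') auto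
  have c\<psi>: "continuous_on UNIV \<psi>" unfolding \<psi>_def using p by (intro continuous_intros continuous_on_powr') auto
  have "closed {z :: real \<times> real. max \<bar>fst z\<bar> \<bar>snd z\<bar> = 1}"
    by (intro closed_Collect_eq continuous_intros continuous_on_max)
  moreover have "closed {z. 0 \<le> \<phi> z}" using c\<phi> by (intro closed_Collect_le continuous_intros)
  ultimately have "closed S" unfolding S_def by (rule closed_Int)
  moreover have "S \<subseteq> {-1..1} \<times> {-1..1}" by (auto simp: S_def max_def split: if_splits)
  then have "bounded S" by (rule bounded_subset[rotated]) (intro bounded_Times bounded_closed_interval)
  ultimately have comp: "compact S" by (simp add: compact_eq_bounded_closed)
  have \<psi>pos: "0 < \<psi> z" if "z \<in> S" for z
  proof -
    have "fst z \<noteq> snd z"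
    proof
      assume eq: "fst z = snd z"
      then have "\<bar>snd z\<bar> = 1" using that by (simp add: S_def)
      then have "\<phi> z = - 2 * \<eta>" using eq p by (simp add: \<phi>_def)
      then show False using that \<eta> by (simp add: S_def)
    qed
    then show ?thesis using abs_powr_midpoint_less[OF p, of "fst z" "snd z"] by (simp add: \<psi>_def)
  qed
  obtain d where d: "0 < d" "\<And>z. z \<in> S \<Longrightarrow> d \<le> \<psi> z"
  proof (cases "S = {}")
    case True
    then show ?thesis using that[of 1] by auto
  next
    case False
    obtain z0 where "z0 \<in> S" "\<And>z. z \<in> S \<Longrightarrow> \<psi> z0 \<le> \<psi> z"
      using continuous_attains_inf[OF comp False continuous_on_subset[OF c\<psi>]] by auto
    then show ?thesis using that[of "\<psi> z0"] \<psi>pos by auto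
  qed
  \<comment> \<open>On S this choice gives \<phi> <= 2^p = C d <= C \<psi>.\<close>
  define C where "C = 2 powr p / d"
  have C0: "0 \<le> C" using d by (simp add: C_def)
  have \<psi>0: "0 \<le> \<psi> z" for z using abs_powr_midpoint_le[OF p, of "fst z" "snd z"] by (simp add: \<psi>_def)
  have unit: "\<phi> z \<le> C * \<psi> z" if "max \<bar>fst z\<bar> \<bar>snd z\<bar> = 1" for z
  proof (cases "0 \<le> \<phi> z")
    case True
    then have zS: "z \<in> S" using that by (simp add: S_def)
    have "\<bar>fst z\<bar> \<le> 1" "\<bar>snd z\<bar> \<le> 1" using that by (auto simp: max_def split: if_splits)
    then have "\<bar>fst z - snd z\<bar> powr p \<le> 2 powr p" using p by (intro powr_mono2) auto
    moreover have "0 \<le> \<eta> * (\<bar>fst z\<bar> powr p + \<bar>snd z\<bar> powr p)" using \<eta> by simp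
    ultimately have "\<phi> z \<le> 2 powr p" by (simp add: \<phi>_def)
    also have "\<dots> = C * d" using d by (simp add: C_def)
    also have "\<dots> \<le> C * \<psi> z" using d(2)[OF zS] C0 by (rule mult_left_mono)
    finally show ?thesis .
  next
    case False
    moreover have "0 \<le> C * \<psi> z" using C0 \<psi>0 by simp
    ultimately show ?thesis by linarith
  qed
  have "\<phi> (a, b) \<le> C * \<psi> (a, b)" for a b
  proof (cases "max \<bar>a\<bar> \<bar>b\<bar> = 0")
    case True
    then have "a = 0" "b = 0" by (auto simp: max_def split: if_splits)
    then show ?thesis by (simp add: \<phi>_def \<psi>_def)
  next
    case False
    define t where "t = max \<bar>a\<bar> \<bar>b\<bar>"
    have t: "0 < t" using False by (auto simp: t_def max_def)
    define a' where "a' = a / t"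
    define b' where "b' = b / t"
    have ab: "a = t * a'" "b = t * b'" using t by (auto simp: a'_def b'_def)
    have "max \<bar>a'\<bar> \<bar>b'\<bar> = t / t" using t by (simp add: a'_def b'_def t_def abs_divide max_def)
    then have u: "\<phi> (a', b') \<le> C * \<psi> (a', b')" using t by (intro unit) simp
    have *: "\<bar>t * x\<bar> powr p = t powr p * \<bar>x\<bar> powr p" for x using t by (simp add: abs_mult powr_mult)
    have d1: "t * a' - t * b' = t * (a' - b')" "(t * a' + t * b') / 2 = t * ((a' + b') / 2)" by (simp_all add: algebra_simps)
    have "\<phi> (a, b) = t powr p * \<phi> (a', b')"
      unfolding \<phi>_def ab fst_conv snd_conv d1 * by (simp add: algebra_simps)
    moreover have "\<psi> (a, b) = t powr p * \<psi> (a', b')"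
      unfolding \<psi>_def ab fst_conv snd_conv d1 * by (simp add: algebra_simps add_divide_distrib)
    ultimately show ?thesis using mult_left_mono[OF u, of "t powr p"] by (simp add: algebra_simps)
  qed
  then have "\<bar>a - b\<bar> powr p \<le> \<eta> * (\<bar>a\<bar> powr p + \<bar>b\<bar> powr p) + C * ((\<bar>a\<bar> powr p + \<bar>b\<bar> powr p) / 2 - \<bar>(a + b) / 2\<bar> powr p)" for a b
    by (simp add: \<phi>_def \<psi>_def) (smt (verit))
  then show ?thesis using that C0 by blast
qed

text \<open>The geometric bounds make the sum of the integrands integrable, hence finite almost
  everywhere. Working with r-th powers avoids Minkowski's inequality.\<close>

lemma wnorm_geometric_AE:
  assumes [measurable]: "\<And>k. s k \<in> borel_measurable borel" "v \<in> borel_measurable borel"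
    and v: "\<And>x. 0 < v x" and r: "0 < r" and le: "\<And>k. wnorm r v (s k) \<le> ennreal ((1 / 2) ^ k)"
  shows "AE x in lborel. summable (\<lambda>k. \<bar>s k x\<bar> powr r)"
proof -
  have "(\<integral>\<^sup>+x. (\<Sum>k. ennreal (\<bar>s k x\<bar> powr r * v x powr r)) \<partial>lborel) = (\<Sum>k. wnorm r v (s k))"
    unfolding wnorm_def by (rule nn_integral_suminf) measurable
  also have "\<dots> \<le> (\<Sum>k. ennreal ((1 / 2) ^ k))" by (intro suminf_le le) auto
  also have "\<dots> = ennreal (\<Sum>k. (1 / 2) ^ k)" by (rule suminf_ennreal2) (auto intro: summable_geometric)
  also have "\<dots> < \<infinity>" by simp
  finally have "(\<integral>\<^sup>+x. (\<Sum>k. ennreal (\<bar>s k x\<bar> powr r * v x powr r)) \<partial>lborel) \<noteq> \<infinity>" by simp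
  then have "AE x in lborel. (\<Sum>k. ennreal (\<bar>s k x\<bar> powr r * v x powr r)) \<noteq> \<infinity>"
    by (intro nn_integral_noteq_infinite) measurable
  then show ?thesis
  proof eventually_elim
    case (elim x)
    then have "summable (\<lambda>k. \<bar>s k x\<bar> powr r * v x powr r)"
      by (intro summable_suminf_not_top) auto
    then have "summable (\<lambda>k. \<bar>s k x\<bar> powr r * v x powr r / v x powr r)" by (rule summable_divide)
    moreover have "v x powr r \<noteq> 0" using v[of x] by simp
    ultimately show ?case by simp
  qed
qed

lemma powr_LIMSEQ_0D:
  fixes y :: "nat \<Rightarrow> real"
  assumes "(\<lambda>k. \<bar>y k\<bar> powr r) \<longlonglongrightarrow> 0" "0 < r"
  shows "y \<longlonglongrightarrow> 0"
proof -
  have "(\<lambda>k. (\<bar>y k\<bar> powr r) powr (1 / r)) \<longlonglongrightarrow> 0"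
    using assms(2) by (intro tendsto_zero_powrI[OF assms(1) tendsto_const]) auto
  then have "(\<lambda>k. \<bar>y k\<bar>) \<longlonglongrightarrow> 0" using assms(2) by (simp add: powr_powr)
  then show ?thesis by (rule tendsto_rabs_zero_cancel)
qed

lemma ennreal_LIMSEQ_0_subseq:
  fixes a :: "nat \<Rightarrow> ennreal"
  assumes "a \<longlonglongrightarrow> 0" and \<epsilon>: "0 < \<epsilon>"
  shows "\<forall>\<^sub>F n in sequentially. a n \<le> \<epsilon>"
  using order_tendstoD(2)[OF assms(1) \<epsilon>] by (auto elim: eventually_mono)

lemma ennreal_between_0:
  assumes "(0::ennreal) < a"
  obtains e where "0 < e" "ennreal e < a"
proof -
  obtain b where b: "0 < b" "b < a" using dense[OF assms] by blast
  then show ?thesis using that by (cases b) auto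
qed

text \<open>The limits may be taken in two different weighted spaces: a common subsequence with
  geometric errors in both converges almost everywhere to a and to b. It serves for convolutions
  that converge in L^p(w^p) and in L^q(w^q).\<close>

lemma wnorm_limit_unique:
  assumes [measurable]: "\<And>n. s n \<in> borel_measurable borel" "a \<in> borel_measurable borel" "b \<in> borel_measurable borel"
      "v \<in> borel_measurable borel" "v' \<in> borel_measurable borel"
    and v: "\<And>x. 0 < v x" "\<And>x. 0 < v' x" and r: "0 < r" "0 < r'"
    and lim: "(\<lambda>n. wnorm r v (\<lambda>x. s n x - a x)) \<longlonglongrightarrow> 0" "(\<lambda>n. wnorm r' v' (\<lambda>x. s n x - b x)) \<longlonglongrightarrow> 0"
  shows "AE x in lborel. a x = b x"
proof -
  have ev: "\<forall>\<^sub>F n in sequentially. wnorm r v (\<lambda>x. s n x - a x) \<le> ennreal ((1 / 2) ^ k) \<and> wnorm r' v' (\<lambda>x. s n x - b x) \<le> ennreal ((1 / 2) ^ k)" for k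
    by (intro eventually_conj ennreal_LIMSEQ_0_subseq[OF lim(1)] ennreal_LIMSEQ_0_subseq[OF lim(2)]) auto
  have "\<exists>n. wnorm r v (\<lambda>x. s n x - a x) \<le> ennreal ((1 / 2) ^ k) \<and> wnorm r' v' (\<lambda>x. s n x - b x) \<le> ennreal ((1 / 2) ^ k)" for k
    using eventually_happens[OF ev[of k]] by auto
  then obtain n where n: "\<And>k. wnorm r v (\<lambda>x. s (n k) x - a x) \<le> ennreal ((1 / 2) ^ k)" "\<And>k. wnorm r' v' (\<lambda>x. s (n k) x - b x) \<le> ennreal ((1 / 2) ^ k)"
    by metis
  have "AE x in lborel. summable (\<lambda>k. \<bar>s (n k) x - a x\<bar> powr r)"
    by (rule wnorm_geometric_AE[OF _ _ v(1) r(1) n(1)]) measurable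
  moreover have "AE x in lborel. summable (\<lambda>k. \<bar>s (n k) x - b x\<bar> powr r')"
    by (rule wnorm_geometric_AE[OF _ _ v(2) r(2) n(2)]) measurable
  ultimately show ?thesis
  proof eventually_elim
    case (elim x)
    have "(\<lambda>k. s (n k) x - a x) \<longlonglongrightarrow> 0" by (rule powr_LIMSEQ_0D[OF summable_LIMSEQ_zero[OF elim(1)] r(1)])
    moreover have "(\<lambda>k. s (n k) x - b x) \<longlonglongrightarrow> 0" by (rule powr_LIMSEQ_0D[OF summable_LIMSEQ_zero[OF elim(2)] r(2)])
    ultimately have "(\<lambda>k. (s (n k) x - b x) - (s (n k) x - a x)) \<longlonglongrightarrow> 0 - 0" by (intro tendsto_diff)
    then have "(\<lambda>k::nat. a x - b x) \<longlonglongrightarrow> 0" by simp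
    then show ?case by (simp add: LIMSEQ_const_iff)
  qed
qed

text \<open>Riesz-Fischer: an almost everywhere convergent subsequence yields G, and Fatou's lemma
  turns the Cauchy condition into convergence in norm.\<close>

lemma wnorm_complete:
  assumes [measurable]: "\<And>n. g n \<in> borel_measurable borel" "v \<in> borel_measurable borel"
    and v: "\<And>x. 0 < v x" and r: "0 < r"
    and cauchy: "\<And>\<eta>. 0 < \<eta> \<Longrightarrow> \<exists>N. \<forall>m\<ge>N. \<forall>n\<ge>N. wnorm r v (\<lambda>x. g m x - g n x) \<le> ennreal \<eta>"
  obtains G where "G \<in> borel_measurable borel" "(\<lambda>n. wnorm r v (\<lambda>x. g n x - G x)) \<longlonglongrightarrow> 0"
proof -
  \<comment> \<open>Besides the geometric factor, (2^k)^r allows the differences to be multiplied by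
    2^k, so that pointwise they are bounded by a multiple of 2^(-k) and sum up.\<close>
  define \<theta> where "\<theta> k = (1 / 2) ^ k / (2 ^ k) powr r" for k :: nat
  have \<theta>: "0 < \<theta> k" for k by (simp add: \<theta>_def)
  obtain N where N: "\<And>k m n. m \<ge> N k \<Longrightarrow> n \<ge> N k \<Longrightarrow> wnorm r v (\<lambda>x. g m x - g n x) \<le> ennreal (\<theta> k)"
    using cauchy[OF \<theta>] by metis
  \<comment> \<open>Partial sums make the indices increasing and at least \<open>N k\<close>; the
    added k sends them to infinity.\<close>
  define I where "I k = (\<Sum>j\<le>k. N j) + k" for k
  have I: "N k \<le> I k" "I k \<le> I (Suc k)" "k \<le> I k" for k
    by (auto simp: I_def intro: member_le_sum order_trans[OF member_le_sum[of k "{..k}" N]])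
  define \<Delta> where "\<Delta> k x = g (I (Suc k)) x - g (I k) x" for k x
  have [measurable]: "\<Delta> k \<in> borel_measurable borel" for k unfolding \<Delta>_def[abs_def] by measurable
  have "AE x in lborel. summable (\<lambda>k. \<bar>2 ^ k * \<Delta> k x\<bar> powr r)"
  proof (rule wnorm_geometric_AE[OF _ _ v r])
    fix k :: nat
    have "wnorm r v (\<lambda>x. 2 ^ k * \<Delta> k x) = ennreal (\<bar>2 ^ k\<bar> powr r) * wnorm r v (\<Delta> k)"
      by (rule wnorm_cmult) measurable
    also have "\<dots> \<le> ennreal (\<bar>2 ^ k\<bar> powr r) * ennreal (\<theta> k)"
      unfolding \<Delta>_def using I[of k] by (intro mult_left_mono N) auto
    also have "\<dots> = ennreal ((1 / 2) ^ k)" by (simp add: \<theta>_def flip: ennreal_mult')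
    finally show "wnorm r v (\<lambda>x. 2 ^ k * \<Delta> k x) \<le> ennreal ((1 / 2) ^ k)" .
  qed measurable
  then have conv: "AE x in lborel. convergent (\<lambda>k. g (I k) x)"
  proof eventually_elim
    case (elim x)
    have "(\<lambda>k. 2 ^ k * \<Delta> k x) \<longlonglongrightarrow> 0" by (rule powr_LIMSEQ_0D[OF summable_LIMSEQ_zero[OF elim] r])
    then have "Bseq (\<lambda>k. 2 ^ k * \<Delta> k x)" by (intro convergent_imp_Bseq convergentI)
    then obtain K where K: "\<And>k. \<bar>2 ^ k * \<Delta> k x\<bar> \<le> K" by (auto simp: Bseq_def)
    have "summable (\<lambda>k. \<Delta> k x)"
    proof (rule summable_comparison_test'[where g="\<lambda>k. K * (1 / 2) ^ k" and N=0])
      show "summable (\<lambda>k. K * (1 / 2) ^ k)" by (intro summable_mult summable_geometric) auto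
      show "norm (\<Delta> k x) \<le> K * (1 / 2) ^ k" for k
        using K[of k] by (simp add: abs_mult power_one_over field_simps)
    qed
    then have "(\<lambda>n. \<Sum>k<n. \<Delta> k x) \<longlonglongrightarrow> (\<Sum>k. \<Delta> k x)" by (rule summable_LIMSEQ)
    moreover have "(\<Sum>k<n. \<Delta> k x) = g (I n) x - g (I 0) x" for n
      unfolding \<Delta>_def by (rule sum_lessThan_telescope)
    ultimately have "(\<lambda>n. g (I n) x - g (I 0) x) \<longlonglongrightarrow> (\<Sum>k. \<Delta> k x)" by simp
    from tendsto_add[OF this tendsto_const[of "g (I 0) x"]] show ?case by (auto intro: convergentI)
  qed
  define G where "G x = lim (\<lambda>k. g (I k) x)" for x
  have [measurable]: "G \<in> borel_measurable borel" unfolding G_def[abs_def] by measurable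
  have "\<exists>N. \<forall>n\<ge>N. wnorm r v (\<lambda>x. g n x - G x) \<le> ennreal \<eta>" if \<eta>: "0 < \<eta>" for \<eta>
  proof -
    obtain M where M: "\<And>m n. m \<ge> M \<Longrightarrow> n \<ge> M \<Longrightarrow> wnorm r v (\<lambda>x. g m x - g n x) \<le> ennreal \<eta>" using cauchy[OF \<eta>] by auto
    have "wnorm r v (\<lambda>x. g n x - G x) \<le> ennreal \<eta>" if n: "n \<ge> M" for n
    proof -
      have "wnorm r v (\<lambda>x. g n x - G x) = (\<integral>\<^sup>+x. liminf (\<lambda>k. ennreal (\<bar>g n x - g (I k) x\<bar> powr r * v x powr r)) \<partial>lborel)"
        unfolding wnorm_def
      proof (rule nn_integral_cong_AE)
        show "AE x in lborel. ennreal (\<bar>g n x - G x\<bar> powr r * v x powr r) = liminf (\<lambda>k. ennreal (\<bar>g n x - g (I k) x\<bar> powr r * v x powr r))"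
          using conv
        proof eventually_elim
          case (elim x)
          then have "(\<lambda>k. g (I k) x) \<longlonglongrightarrow> G x" by (simp add: G_def convergent_LIMSEQ_iff)
          then have "(\<lambda>k. \<bar>g n x - g (I k) x\<bar> powr r * v x powr r) \<longlonglongrightarrow> \<bar>g n x - G x\<bar> powr r * v x powr r"
            using r by (intro tendsto_intros tendsto_powr') auto
          then have "(\<lambda>k. ennreal (\<bar>g n x - g (I k) x\<bar> powr r * v x powr r)) \<longlonglongrightarrow> ennreal (\<bar>g n x - G x\<bar> powr r * v x powr r)"
            by (rule tendsto_ennrealI)
          then show ?case by (intro lim_imp_Liminf[symmetric]) auto
        qed
      qed
      also have "\<dots> \<le> liminf (\<lambda>k. wnorm r v (\<lambda>x. g n x - g (I k) x))"
        unfolding wnorm_def by (rule nn_integral_liminf) measurable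
      also have "\<dots> \<le> ennreal \<eta>"
      proof -
        have "\<forall>\<^sub>F k in sequentially. wnorm r v (\<lambda>x. g n x - g (I k) x) \<le> ennreal \<eta>"
          using eventually_ge_at_top[of M] by eventually_elim (use M n I(3) order_trans in blast)
        then have "liminf (\<lambda>k. wnorm r v (\<lambda>x. g n x - g (I k) x)) \<le> liminf (\<lambda>k. ennreal \<eta>)" by (rule Liminf_mono)
        then show ?thesis by (simp add: Liminf_const)
      qed
      finally show ?thesis .
    qed
    then show ?thesis by blast
  qed
  then have "(\<lambda>n. wnorm r v (\<lambda>x. g n x - G x)) \<longlonglongrightarrow> 0"
  proof (intro order_tendstoI, goal_cases)
    case (2 a)
    obtain e where e: "0 < e" "ennreal e < a" using ennreal_between_0[OF 2(2)] by blast
    then obtain N where "\<forall>n\<ge>N. wnorm r v (\<lambda>x. g n x - G x) \<le> ennreal e" using 2(1) by blast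
    then show ?case unfolding eventually_sequentially using le_less_trans[OF _ e(2)] by blast
  qed auto
  then show ?thesis using that[of G] by simp
qed

lemma ennreal_LIMSEQ_0_le:
  fixes a b :: "nat \<Rightarrow> ennreal"
  assumes "\<And>n. a n \<le> b n" "b \<longlonglongrightarrow> 0"
  shows "a \<longlonglongrightarrow> 0"
  by (rule tendsto_sandwich[OF always_eventually always_eventually tendsto_const assms(2)]) (use assms(1) in auto)

text \<open>The pointwise inequality integrated against v^p. The midpoint term stands on the left so
  that extended-valued integrals are added and never subtracted; finiteness allows the return to
  real numbers.\<close>

lemma wnorm_uniform_convexity:
  assumes [measurable]: "f \<in> borel_measurable borel" "h \<in> borel_measurable borel" "v \<in> borel_measurable borel"
    and fin: "wnorm p v f < \<infinity>" "wnorm p v h < \<infinity>" and C: "0 \<le> C" "0 < \<eta>" and p: "1 < p"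
    and conv: "\<And>a b :: real. \<bar>a - b\<bar> powr p \<le> \<eta> * (\<bar>a\<bar> powr p + \<bar>b\<bar> powr p) + C * ((\<bar>a\<bar> powr p + \<bar>b\<bar> powr p) / 2 - \<bar>(a + b) / 2\<bar> powr p)"
  shows "enn2real (wnorm p v (\<lambda>x. f x - h x)) + C * enn2real (wnorm p v (\<lambda>x. (f x + h x) / 2)) \<le>
    (\<eta> + C / 2) * (enn2real (wnorm p v f) + enn2real (wnorm p v h))"
proof -
  have dfin: "wnorm p v (\<lambda>x. f x - h x) < \<infinity>" by (rule wnorm_diff_finite) (use fin p in auto)
  have mfin: "wnorm p v (\<lambda>x. (f x + h x) / 2) < \<infinity>"
  proof -
    have "wnorm p v (\<lambda>x. f x + h x) < \<infinity>" by (rule wnorm_add_finite) (use fin p in auto)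
    then have "wnorm p v (\<lambda>x. (1 / 2) * (f x + h x)) < \<infinity>" by (intro wnorm_cmult_finite) auto
    then show ?thesis by simp
  qed
  have "wnorm p v (\<lambda>x. f x - h x) + ennreal C * wnorm p v (\<lambda>x. (f x + h x) / 2)
    = (\<integral>\<^sup>+x. ennreal (\<bar>f x - h x\<bar> powr p * v x powr p) + ennreal C * ennreal (\<bar>(f x + h x) / 2\<bar> powr p * v x powr p) \<partial>lborel)"
    unfolding wnorm_def by (subst nn_integral_add) (auto simp: nn_integral_cmult)
  also have "\<dots> \<le> (\<integral>\<^sup>+x. ennreal (\<eta> + C / 2) * (ennreal (\<bar>f x\<bar> powr p * v x powr p) + ennreal (\<bar>h x\<bar> powr p * v x powr p)) \<partial>lborel)"
  proof (rule nn_integral_mono)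
    fix x
    have "\<bar>f x - h x\<bar> powr p + C * \<bar>(f x + h x) / 2\<bar> powr p \<le> (\<eta> + C / 2) * (\<bar>f x\<bar> powr p + \<bar>h x\<bar> powr p)"
    proof -
      have "(\<eta> + C / 2) * A = \<eta> * A + C * (A / 2 - m) + C * m" for A m by (simp add: algebra_simps)
      from this[of "\<bar>f x\<bar> powr p + \<bar>h x\<bar> powr p" "\<bar>(f x + h x) / 2\<bar> powr p"] conv[of "f x" "h x"]
      show ?thesis by linarith
    qed
    then have "(\<bar>f x - h x\<bar> powr p + C * \<bar>(f x + h x) / 2\<bar> powr p) * v x powr p \<le> (\<eta> + C / 2) * (\<bar>f x\<bar> powr p + \<bar>h x\<bar> powr p) * v x powr p"
      by (rule mult_right_mono) simp
    then have le: "\<bar>f x - h x\<bar> powr p * v x powr p + C * (\<bar>(f x + h x) / 2\<bar> powr p * v x powr p) \<le> (\<eta> + C / 2) * (\<bar>f x\<bar> powr p * v x powr p + \<bar>h x\<bar> powr p * v x powr p)"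
      by (simp add: algebra_simps)
    have "ennreal (\<bar>f x - h x\<bar> powr p * v x powr p) + ennreal C * ennreal (\<bar>(f x + h x) / 2\<bar> powr p * v x powr p)
      = ennreal (\<bar>f x - h x\<bar> powr p * v x powr p + C * (\<bar>(f x + h x) / 2\<bar> powr p * v x powr p))"
      using C by (simp add: ennreal_mult)
    also have "\<dots> \<le> ennreal ((\<eta> + C / 2) * (\<bar>f x\<bar> powr p * v x powr p + \<bar>h x\<bar> powr p * v x powr p))" by (rule ennreal_leI[OF le])
    also have "\<dots> = ennreal (\<eta> + C / 2) * (ennreal (\<bar>f x\<bar> powr p * v x powr p) + ennreal (\<bar>h x\<bar> powr p * v x powr p))"
      using C by (subst ennreal_mult) auto
    finally show "ennreal (\<bar>f x - h x\<bar> powr p * v x powr p) + ennreal C * ennreal (\<bar>(f x + h x) / 2\<bar> powr p * v x powr p)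
      \<le> ennreal (\<eta> + C / 2) * (ennreal (\<bar>f x\<bar> powr p * v x powr p) + ennreal (\<bar>h x\<bar> powr p * v x powr p))" .
  qed
  also have "\<dots> = ennreal (\<eta> + C / 2) * (wnorm p v f + wnorm p v h)"
    unfolding wnorm_def by (simp add: nn_integral_cmult nn_integral_add)
  finally have le: "wnorm p v (\<lambda>x. f x - h x) + ennreal C * wnorm p v (\<lambda>x. (f x + h x) / 2) \<le> ennreal (\<eta> + C / 2) * (wnorm p v f + wnorm p v h)" .
  define a b c d where "a = enn2real (wnorm p v (\<lambda>x. f x - h x))" and "b = enn2real (wnorm p v (\<lambda>x. (f x + h x) / 2))"
    and "c = enn2real (wnorm p v f)" and "d = enn2real (wnorm p v h)"
  then have r: "wnorm p v (\<lambda>x. f x - h x) = ennreal a" "wnorm p v (\<lambda>x. (f x + h x) / 2) = ennreal b"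
    "wnorm p v f = ennreal c" "wnorm p v h = ennreal d" and n: "0 \<le> a" "0 \<le> b" "0 \<le> c" "0 \<le> d"
    using fin dfin mfin by simp_all
  have "ennreal (a + C * b) \<le> ennreal ((\<eta> + C / 2) * (c + d))"
    using le n C unfolding r by (simp add: ennreal_mult)
  then have "a + C * b \<le> (\<eta> + C / 2) * (c + d)" using n C by (subst (asm) ennreal_le_iff) auto
  then show ?thesis unfolding r using n by simp
qed

text \<open>This replaces weak compactness: elements of almost minimal norm in a decreasing sequence of
  midpoint convex sets form a Cauchy sequence by uniform convexity.\<close>

lemma near_minimal_convergent:
  fixes \<C> :: "nat \<Rightarrow> (real \<Rightarrow> real) set"
  assumes [measurable]: "v \<in> borel_measurable borel" and v: "\<And>x. 0 < v x" and p: "1 < p"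
    and meas: "\<And>n f. f \<in> \<C> n \<Longrightarrow> f \<in> borel_measurable borel" and fin: "\<And>n f. f \<in> \<C> n \<Longrightarrow> wnorm p v f < \<infinity>"
    and mono: "\<And>m n. n \<le> m \<Longrightarrow> \<C> m \<subseteq> \<C> n"
    and mid: "\<And>n f h. f \<in> \<C> n \<Longrightarrow> h \<in> \<C> n \<Longrightarrow> (\<lambda>x. (f x + h x) / 2) \<in> \<C> n"
    and bound: "\<And>n. \<exists>f\<in>\<C> n. wnorm p v f \<le> ennreal M" and M: "0 \<le> M"
  obtains g G where "\<And>n. g n \<in> \<C> n" "G \<in> borel_measurable borel" "wnorm p v G < \<infinity>"
    "(\<lambda>n. wnorm p v (\<lambda>x. g n x - G x)) \<longlonglongrightarrow> 0"
proof -
  define N where "N f = enn2real (wnorm p v f)" for f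
  have N: "wnorm p v f = ennreal (N f)" if "f \<in> \<C> n" for f n using fin[OF that] by (simp add: N_def)
  have N0: "0 \<le> N f" for f by (simp add: N_def)
  define d where "d n = Inf (N ` \<C> n)" for n
  have ne: "\<C> n \<noteq> {}" for n using bound[of n] by auto
  have bb: "bdd_below (N ` \<C> n)" for n using N0 by (auto intro: bdd_belowI[of _ 0])
  have dle: "d n \<le> N f" if "f \<in> \<C> n" for n f unfolding d_def by (rule cInf_lower[OF _ bb]) (use that in auto)
  have dM: "d n \<le> M" for n
  proof -
    obtain f where f: "f \<in> \<C> n" "wnorm p v f \<le> ennreal M" using bound by blast
    then have "N f \<le> M" using M N by simp
    then show ?thesis using dle[OF f(1)] by simp
  qed
  have dmono: "d n \<le> d m" if "n \<le> m" for m n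
    unfolding d_def by (rule cInf_superset_mono) (use ne bb mono[OF that] in auto)
  have d0: "0 \<le> d n" for n unfolding d_def by (rule cInf_greatest) (use ne N0 in auto)
  \<comment> \<open>The infima increase as the sets shrink and stay below M; near-minimal elements
    of late sets therefore all have norm powers close to L.\<close>
  define L where "L = (SUP n. d n)"
  have bdd: "bdd_above (range d)" using dM by (auto intro: bdd_aboveI[of _ M])
  have dL: "d n \<le> L" for n unfolding L_def by (rule cSUP_upper[OF _ bdd]) simp
  have L0: "0 \<le> L" using d0[of 0] dL[of 0] by simp
  have "\<exists>f\<in>\<C> n. N f < d n + 1 / real (Suc n)" for n
  proof -
    have "Inf (N ` \<C> n) < d n + 1 / real (Suc n)" by (simp add: d_def)
    then show ?thesis using cInf_less_iff[OF _ bb] ne by auto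
  qed
  then obtain g where g: "\<And>n. g n \<in> \<C> n" "\<And>n. N (g n) < d n + 1 / real (Suc n)" by metis
  have [measurable]: "g n \<in> borel_measurable borel" for n using meas[OF g(1)] .
  have cauchy: "\<exists>K. \<forall>m\<ge>K. \<forall>n\<ge>K. wnorm p v (\<lambda>x. g m x - g n x) \<le> ennreal \<theta>" if \<theta>: "0 < \<theta>" for \<theta>
  proof -
    \<comment> \<open>\<eta> and, below, \<kappa> are chosen so that the contributions sum to at
      most \<theta>: 2 \<eta> (L + 1) = \<theta>/2 and 2 C \<kappa> <= \<theta>/2.\<close>
    define \<eta> where "\<eta> = \<theta> / (4 * (L + 1))"
    have \<eta>: "0 < \<eta>" using \<theta> L0 by (simp add: \<eta>_def)
    obtain C where C: "0 \<le> C" "\<And>a b :: real. \<bar>a - b\<bar> powr p \<le> \<eta> * (\<bar>a\<bar> powr p + \<bar>b\<bar> powr p) + C * ((\<bar>a\<bar> powr p + \<bar>b\<bar> powr p) / 2 - \<bar>(a + b) / 2\<bar> powr p)"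
      using uniform_convexity_powr[OF p \<eta>] by blast
    define \<kappa> where "\<kappa> = \<theta> / (4 * (C + 1))"
    have \<kappa>: "0 < \<kappa>" using \<theta> C by (simp add: \<kappa>_def)
    obtain K1 where K1: "L - \<kappa> < d K1"
      using less_cSUP_iff[OF _ bdd, of "L - \<kappa>"] \<kappa> by (auto simp: L_def)
    obtain K2 where K2: "1 / real (Suc K2) < \<kappa>" using nat_approx_posE[OF \<kappa>] by blast
    define K where "K = max K1 K2"
    have dK: "L - \<kappa> < d K" using K1 dmono[of K1 K] by (simp add: K_def)
    have "wnorm p v (\<lambda>x. g m x - g n x) \<le> ennreal \<theta>" if mn: "m \<ge> K" "n \<ge> K" for m n
    proof -
      \<comment> \<open>Both elements lie in the larger set \<open>\<C> K\<close>, hence so does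
        their midpoint, whose norm power is therefore at least d K > L - \<kappa>; this caps the
        convexity defect.\<close>
      have gK: "g m \<in> \<C> K" "g n \<in> \<C> K" using g(1) mono mn by blast+
      have small: "N (g j) \<le> L + min 1 \<kappa>" if "j \<ge> K" for j
      proof -
        have "1 / real (Suc j) \<le> 1 / real (Suc K2)" using that by (intro divide_left_mono) (auto simp: K_def)
        then have "1 / real (Suc j) \<le> \<kappa>" using K2 by linarith
        moreover have "1 / real (Suc j) \<le> 1" by simp
        ultimately have "1 / real (Suc j) \<le> min 1 \<kappa>" by (intro min.boundedI)
        then show ?thesis using g(2)[of j] dL[of j] by linarith
      qed
      have "N (\<lambda>x. g m x - g n x) + C * N (\<lambda>x. (g m x + g n x) / 2) \<le> (\<eta> + C / 2) * (N (g m) + N (g n))"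
        unfolding N_def by (rule wnorm_uniform_convexity) (use fin[OF g(1)] C \<eta> p in auto)
      also have "\<dots> \<le> \<eta> * (2 * (L + 1)) + C / 2 * (2 * (L + \<kappa>))"
      proof -
        have "\<eta> * (N (g m) + N (g n)) \<le> \<eta> * (2 * (L + 1))"
          using small[OF mn(1)] small[OF mn(2)] \<eta> by (intro mult_left_mono) auto
        moreover have "C / 2 * (N (g m) + N (g n)) \<le> C / 2 * (2 * (L + \<kappa>))"
          using small[OF mn(1)] small[OF mn(2)] C by (intro mult_left_mono) auto
        ultimately show ?thesis by (simp add: distrib_right)
      qed
      also have "\<eta> * (2 * (L + 1)) = \<theta> / 2"
      proof -
        have "\<theta> / (4 * t) * (2 * t) = \<theta> / 2" if "0 < t" for t using that by simp
        from this[of "L + 1"] show ?thesis using L0 by (simp only: \<eta>_def)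
      qed
      finally have 1: "N (\<lambda>x. g m x - g n x) + C * N (\<lambda>x. (g m x + g n x) / 2) \<le> \<theta> / 2 + C / 2 * (2 * (L + \<kappa>))" .
      have half: "C / 2 * (2 * t) = C * t" for t by simp
      have "C * (L - \<kappa>) \<le> C * N (\<lambda>x. (g m x + g n x) / 2)"
        using dle[OF mid[OF gK]] dK C by (intro mult_left_mono) auto
      then have "N (\<lambda>x. g m x - g n x) \<le> \<theta> / 2 + 2 * (C * \<kappa>)" using 1 unfolding half by (simp add: algebra_simps)
      also have "C * \<kappa> \<le> (C + 1) * \<kappa>" using \<kappa> by simp
      also have "(C + 1) * \<kappa> = \<theta> / 4"
      proof -
        have "t * (\<theta> / (4 * t)) = \<theta> / 4" if "0 < t" for t using that by simp
        from this[of "C + 1"] show ?thesis using C by (simp only: \<kappa>_def)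
      qed
      finally have "N (\<lambda>x. g m x - g n x) \<le> \<theta>" by simp
      moreover have "wnorm p v (\<lambda>x. g m x - g n x) < \<infinity>"
        by (rule wnorm_diff_finite) (use fin[OF g(1)] p in auto)
      ultimately show ?thesis by (cases "wnorm p v (\<lambda>x. g m x - g n x)") (auto simp: N_def ennreal_leI)
    qed
    then show ?thesis by blast
  qed
  obtain G where G[measurable]: "G \<in> borel_measurable borel" and lim: "(\<lambda>n. wnorm p v (\<lambda>x. g n x - G x)) \<longlonglongrightarrow> 0"
    using wnorm_complete[OF _ _ v _ cauchy] p by auto
  have "\<forall>\<^sub>F n in sequentially. wnorm p v (\<lambda>x. g n x - G x) < 1" using lim by (rule order_tendstoD) simp
  then obtain n where n: "wnorm p v (\<lambda>x. g n x - G x) < 1" by (auto simp: eventually_sequentially)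
  have "wnorm p v (\<lambda>x. g n x - G x) < \<infinity>" using n by (rule less_trans) simp
  then have "wnorm p v (\<lambda>x. g n x - (g n x - G x)) < \<infinity>"
    using wnorm_diff_finite[of "g n" "\<lambda>x. g n x - G x" v p] fin[OF g(1)[of n]] p by auto
  then show ?thesis using that[of g G] g(1) G lim by simp
qed

section \<open>Inversion of fractional integrals\<close>

lemma conv_cmult: "conv k (\<lambda>x. c * f x) x = c * conv k f x"
  unfolding conv_def by (subst integral_mult_right_zero[symmetric]) (simp add: ac_simps)

lemma abs_conv_cmult:
  assumes [measurable]: "k \<in> borel_measurable borel" "f \<in> borel_measurable borel"
  shows "abs_conv k (\<lambda>x. c * f x) x = ennreal \<bar>c\<bar> * abs_conv k f x"
  unfolding abs_conv_def by (subst nn_integral_cmult[symmetric]) (auto simp: abs_mult ac_simps simp flip: ennreal_mult)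

context one_sided_weight
begin

abbreviation c\<^sub>\<alpha> :: real where "c\<^sub>\<alpha> \<equiv> marchaud_const \<alpha>"

text \<open>The common end of the cases of convergence and of boundedness. Convolution with the
  kernel for \<delta> is continuous in L^p(w^p), so the two limits agree. With f = G divided by
  \<open>c\<^sub>\<alpha>\<close>, the truncated derivatives of u and of the potential of f
  coincide, and \<open>marchaud_diff_eq_0_imp\<close> applies to the difference.\<close>

lemma marchaud_diff_limit_imp_frac_integral:
  assumes [measurable]: "u \<in> borel_measurable borel" "\<And>n. s n \<in> borel_measurable borel" "G \<in> borel_measurable borel"
    and u: "wnorm q w u < \<infinity>" and s: "\<And>n. wnorm p w (s n) < \<infinity>" and G: "wnorm p w G < \<infinity>"
    and lim: "(\<lambda>n. wnorm p w (\<lambda>x. s n x - G x)) \<longlonglongrightarrow> 0"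
    and lim': "\<And>\<delta>. 0 < \<delta> \<Longrightarrow> (\<lambda>n. wnorm q w (\<lambda>x. conv (marchaud_kernel \<alpha> \<delta>) (s n) x - c\<^sub>\<alpha> * marchaud_diff \<alpha> \<delta> u x)) \<longlonglongrightarrow> 0"
  shows "\<exists>f\<in>borel_measurable borel. wnorm p w f < \<infinity> \<and> (AE x in lborel. abs_conv (frac_kernel \<alpha>) f x < \<infinity> \<and> u x = conv (frac_kernel \<alpha>) f x)"
proof -
  have c: "0 < c\<^sub>\<alpha>" by (rule marchaud_const_pos[OF \<alpha>])
  have eq: "AE x in lborel. conv (marchaud_kernel \<alpha> \<delta>) G x = c\<^sub>\<alpha> * marchaud_diff \<alpha> \<delta> u x" if \<delta>: "0 < \<delta>" for \<delta>
  proof (rule wnorm_limit_unique[OF _ _ _ _ _ w_pos w_pos _ _ _ lim'[OF \<delta>]])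
    define K where "K = ennreal (2 * (4 * C * marchaud_mass \<alpha>) powr p)"
    have "wnorm p w (\<lambda>x. conv (marchaud_kernel \<alpha> \<delta>) (s n) x - conv (marchaud_kernel \<alpha> \<delta>) G x) \<le> K * wnorm p w (\<lambda>x. s n x - G x)" for n
    proof -
      have "wnorm p w (\<lambda>x. conv (marchaud_kernel \<alpha> \<delta>) (s n) x - conv (marchaud_kernel \<alpha> \<delta>) G x) = wnorm p w (conv (marchaud_kernel \<alpha> \<delta>) (\<lambda>x. s n x - G x))"
        by (rule wnorm_cong_AE, rule AE_symmetric) (rule Wp.conv_marchaud_diff[OF assms(2,3) s G \<alpha> \<delta>])
      also have "\<dots> \<le> K * wnorm p w (\<lambda>x. s n x - G x)"
        unfolding K_def using s G p by (intro Wp.wnorm_conv_marchaud[OF _ _ \<alpha> \<delta>] wnorm_diff_finite) auto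
      finally show ?thesis .
    qed
    moreover have "(\<lambda>n. K * wnorm p w (\<lambda>x. s n x - G x)) \<longlonglongrightarrow> 0"
      using tendsto_mult_ennreal[OF tendsto_const[of K] lim] by (simp add: K_def)
    ultimately show "(\<lambda>n. wnorm p w (\<lambda>x. conv (marchaud_kernel \<alpha> \<delta>) (s n) x - conv (marchaud_kernel \<alpha> \<delta>) G x)) \<longlonglongrightarrow> 0"
      by (rule ennreal_LIMSEQ_0_le)
  qed (use p q1 in auto)
  define f where "f = (\<lambda>x. (1 / c\<^sub>\<alpha>) * G x)"
  have f[measurable]: "f \<in> borel_measurable borel" by (simp add: f_def)
  have ffin: "wnorm p w f < \<infinity>" unfolding f_def by (rule wnorm_cmult_finite) (use G in auto)
  define U where "U = conv (frac_kernel \<alpha>) f"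
  have U[measurable]: "U \<in> borel_measurable borel" by (simp add: U_def)
  have Ufin: "wnorm q w U < \<infinity>" unfolding U_def by (rule frac_integral_props(2)[OF f ffin])
  define z where "z x = U x - u x" for x
  have [measurable]: "z \<in> borel_measurable borel" unfolding z_def[abs_def] by measurable
  have "AE x in lborel. z x = 0"
  proof (rule marchaud_diff_eq_0_imp)
    show "wnorm q w z < \<infinity>" unfolding z_def[abs_def] by (rule wnorm_diff_finite) (use Ufin u q1 in auto)
    fix n
    define \<delta> where "\<delta> = (2::real) * 2 ^ n"
    have \<delta>: "0 < \<delta>" by (simp add: \<delta>_def)
    have t: "AE x in lborel. abs_conv (trunc_kernel \<alpha> \<delta>) h x < \<infinity>" if "h \<in> borel_measurable borel" "wnorm q w h < \<infinity>" for h
      by (rule Wq.abs_conv_AE_finite[OF _ _ Wq.abs_conv_trunc_finite[OF _ that(2) \<alpha> \<delta>]]) (use that in auto)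
    show "AE x in lborel. marchaud_diff \<alpha> (2 * 2 ^ n) z x = 0"
      unfolding \<delta>_def[symmetric] using frac_integral_props(3)[OF f ffin \<delta>] eq[OF \<delta>] t[OF U Ufin] t[OF assms(1) u]
    proof eventually_elim
      case (elim x)
      have i: "integrable lborel (\<lambda>s. trunc_kernel \<alpha> \<delta> s * U (x + s))" "integrable lborel (\<lambda>s. trunc_kernel \<alpha> \<delta> s * u (x + s))"
        using elim(3,4) by (auto intro: abs_conv_integrable)
      have "conv (trunc_kernel \<alpha> \<delta>) z x = conv (trunc_kernel \<alpha> \<delta>) U x - conv (trunc_kernel \<alpha> \<delta>) u x"
        using i by (simp add: conv_def z_def right_diff_distrib)
      then have "marchaud_diff \<alpha> \<delta> z x = marchaud_diff \<alpha> \<delta> U x - marchaud_diff \<alpha> \<delta> u x"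
        by (simp add: marchaud_diff_def z_def right_diff_distrib)
      also have "marchaud_diff \<alpha> \<delta> U x = conv (marchaud_kernel \<alpha> \<delta>) f x" unfolding U_def by (rule elim(1))
      also have "\<dots> = (1 / c\<^sub>\<alpha>) * conv (marchaud_kernel \<alpha> \<delta>) G x" unfolding f_def by (rule conv_cmult)
      also have "\<dots> = marchaud_diff \<alpha> \<delta> u x" using elim(2) c by simp
      finally show ?case by simp
    qed
  qed measurable
  then have "AE x in lborel. abs_conv (frac_kernel \<alpha>) f x < \<infinity> \<and> u x = conv (frac_kernel \<alpha>) f x"
    using frac_integral_props(1)[OF f ffin] by eventually_elim (auto simp: z_def U_def)
  then show ?thesis using f ffin by blast
qed

text \<open>After the exchange of \<epsilon> and \<delta> this is an approximate identity acting on
  the fixed function \<open>marchaud_diff \<alpha> \<delta> u\<close>, which lies in L^q(w^q) by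
  \<open>wnorm_marchaud_diff_finite\<close>.\<close>

lemma conv_marchaud_marchaud_diff_limit:
  assumes [measurable]: "u \<in> borel_measurable borel" and u: "wnorm q w u < \<infinity>" and \<delta>: "0 < \<delta>"
  shows "((\<lambda>\<epsilon>. wnorm q w (\<lambda>x. conv (marchaud_kernel \<alpha> \<delta>) (marchaud_diff \<alpha> \<epsilon> u) x - c\<^sub>\<alpha> * marchaud_diff \<alpha> \<delta> u x)) \<longlongrightarrow> 0) (at_right 0)"
proof -
  have "((\<lambda>\<epsilon>. wnorm q w (\<lambda>x. conv (marchaud_kernel \<alpha> \<epsilon>) (marchaud_diff \<alpha> \<delta> u) x - c\<^sub>\<alpha> * marchaud_diff \<alpha> \<delta> u x)) \<longlongrightarrow> 0) (at_right 0)"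
    by (rule Wq.marchaud_approx[OF _ Wq.wnorm_marchaud_diff_finite[OF _ u \<alpha> \<delta>] \<alpha>]) measurable
  moreover have "\<forall>\<^sub>F \<epsilon> in at_right 0. wnorm q w (\<lambda>x. conv (marchaud_kernel \<alpha> \<epsilon>) (marchaud_diff \<alpha> \<delta> u) x - c\<^sub>\<alpha> * marchaud_diff \<alpha> \<delta> u x)
     = wnorm q w (\<lambda>x. conv (marchaud_kernel \<alpha> \<delta>) (marchaud_diff \<alpha> \<epsilon> u) x - c\<^sub>\<alpha> * marchaud_diff \<alpha> \<delta> u x)"
    using eventually_at_right_less[of 0]
  proof eventually_elim
    case (elim \<epsilon>)
    show ?case
      by (rule wnorm_cong_AE) (use Wq.marchaud_diff_commute[OF _ u \<alpha> \<delta> elim] in \<open>auto elim!: eventually_mono\<close>)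
  qed
  ultimately show ?thesis by (rule Lim_transform_eventually)
qed

lemma convergent_marchaud_diff_imp_frac_integral:
  assumes [measurable]: "u \<in> borel_measurable borel" "G \<in> borel_measurable borel"
    and u: "wnorm q w u < \<infinity>" and G: "wnorm p w G < \<infinity>"
    and ev: "\<forall>\<^sub>F \<epsilon> in at_right 0. wnorm p w (marchaud_diff \<alpha> \<epsilon> u) < \<infinity>"
    and lim: "((\<lambda>\<epsilon>. wnorm p w (\<lambda>x. marchaud_diff \<alpha> \<epsilon> u x - G x)) \<longlongrightarrow> 0) (at_right 0)"
  shows "\<exists>f\<in>borel_measurable borel. wnorm p w f < \<infinity> \<and> (AE x in lborel. abs_conv (frac_kernel \<alpha>) f x < \<infinity> \<and> u x = conv (frac_kernel \<alpha>) f x)"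
proof -
  obtain b where b: "0 < b" "\<And>\<epsilon>. 0 < \<epsilon> \<Longrightarrow> \<epsilon> < b \<Longrightarrow> wnorm p w (marchaud_diff \<alpha> \<epsilon> u) < \<infinity>"
    using ev by (auto simp: eventually_at_right_field)
  \<comment> \<open>n + 2 rather than n + 1 keeps \<open>X 0\<close> strictly below b.\<close>
  define X where "X n = b / real (n + 2)" for n
  have X: "0 < X n" "X n < b" for n using b(1) by (auto simp: X_def field_simps intro!: add_pos_nonneg)
  have "X \<longlonglongrightarrow> 0" unfolding X_def[abs_def] by (rule LIMSEQ_ignore_initial_segment[OF lim_const_over_n])
  then have X0: "filterlim X (at_right 0) sequentially"
    unfolding filterlim_at using less_imp_neq[OF X(1), symmetric] X(1) by (auto intro!: always_eventually)
  show ?thesis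
  proof (rule marchaud_diff_limit_imp_frac_integral[where s="\<lambda>n. marchaud_diff \<alpha> (X n) u", OF _ _ _ u _ G])
    show "wnorm p w (marchaud_diff \<alpha> (X n) u) < \<infinity>" for n using b(2) X by blast
    show "(\<lambda>n. wnorm p w (\<lambda>x. marchaud_diff \<alpha> (X n) u x - G x)) \<longlonglongrightarrow> 0" by (rule filterlim_compose[OF lim X0])
    show "(\<lambda>n. wnorm q w (\<lambda>x. conv (marchaud_kernel \<alpha> \<delta>) (marchaud_diff \<alpha> (X n) u) x - c\<^sub>\<alpha> * marchaud_diff \<alpha> \<delta> u x)) \<longlonglongrightarrow> 0" if "0 < \<delta>" for \<delta>
      by (rule filterlim_compose[OF conv_marchaud_marchaud_diff_limit[OF _ u that] X0]) measurable
  qed measurable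
qed

text \<open>The sets \<open>\<C> n\<close> consist of functions satisfying the limit identity up to
  the tolerance \<open>\<Omega> n \<delta>\<close>, for all \<delta> simultaneously. They contain
  the derivative for 1/(n + 1), of norm power at most M, and are midpoint convex because |y|^q is
  convex in y. Near-minimal elements, which do converge, take the place of the derivatives.\<close>

lemma bounded_marchaud_diff_imp_frac_integral:
  assumes [measurable]: "u \<in> borel_measurable borel"
    and u: "wnorm q w u < \<infinity>" and M: "0 \<le> M" "\<And>\<epsilon>. 0 < \<epsilon> \<Longrightarrow> wnorm p w (marchaud_diff \<alpha> \<epsilon> u) \<le> ennreal M"
  shows "\<exists>f\<in>borel_measurable borel. wnorm p w f < \<infinity> \<and> (AE x in lborel. abs_conv (frac_kernel \<alpha>) f x < \<infinity> \<and> u x = conv (frac_kernel \<alpha>) f x)"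
proof -
  define E where "E \<delta> f = wnorm q w (\<lambda>x. conv (marchaud_kernel \<alpha> \<delta>) f x - c\<^sub>\<alpha> * marchaud_diff \<alpha> \<delta> u x)" for \<delta> f
  \<comment> \<open>The supremum over all \<epsilon> <= 1/(n + 1) makes the tolerances, and with
    them the sets \<open>\<C> n\<close>, decrease in n; they tend to 0 by
    \<open>conv_marchaud_marchaud_diff_limit\<close>.\<close>
  define \<Omega> where "\<Omega> n \<delta> = (SUP \<epsilon>\<in>{0<..1 / real (Suc n)}. E \<delta> (marchaud_diff \<alpha> \<epsilon> u))" for n \<delta>
  define \<C> where "\<C> n = {f \<in> borel_measurable borel. wnorm p w f < \<infinity> \<and> (\<forall>\<delta>>0. E \<delta> f \<le> \<Omega> n \<delta>)}" for n
  have \<Omega>mono: "\<Omega> m \<delta> \<le> \<Omega> n \<delta>" if "n \<le> m" for m n \<delta>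
  proof -
    have "1 / real (Suc m) \<le> 1 / real (Suc n)" using that by (intro divide_left_mono) auto
    then show ?thesis unfolding \<Omega>_def by (intro SUP_subset_mono) auto
  qed
  have mid: "(\<lambda>x. (f x + h x) / 2) \<in> \<C> n" if f: "f \<in> \<C> n" and h: "h \<in> \<C> n" for f h n
  proof -
    have [measurable]: "f \<in> borel_measurable borel" "h \<in> borel_measurable borel" using f h by (auto simp: \<C>_def)
    have ff: "wnorm p w f < \<infinity>" "wnorm p w h < \<infinity>" using f h by (auto simp: \<C>_def)
    have "wnorm p w (\<lambda>x. f x + h x) < \<infinity>" by (rule wnorm_add_finite) (use ff p in auto)
    then have mfin: "wnorm p w (\<lambda>x. (1 / 2) * (f x + h x)) < \<infinity>" by (intro wnorm_cmult_finite) auto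
    have "E \<delta> (\<lambda>x. (f x + h x) / 2) \<le> \<Omega> n \<delta>" if \<delta>: "0 < \<delta>" for \<delta>
    proof -
      define k where "k = marchaud_kernel \<alpha> \<delta>"
      define y where "y x = c\<^sub>\<alpha> * marchaud_diff \<alpha> \<delta> u x" for x
      have [measurable]: "k \<in> borel_measurable borel" "y \<in> borel_measurable borel"
        unfolding k_def y_def[abs_def] by measurable
      have fi: "AE x in lborel. abs_conv k f x < \<infinity>" "AE x in lborel. abs_conv k h x < \<infinity>"
        unfolding k_def by (rule Wp.abs_conv_AE_finite[OF _ _ Wp.abs_conv_marchaud_finite[OF _ _ \<alpha> \<delta>]]; use ff in auto)+
      have "E \<delta> (\<lambda>x. (f x + h x) / 2) = wnorm q w (\<lambda>x. ((conv k f x - y x) + (conv k h x - y x)) / 2)"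
        unfolding E_def k_def[symmetric] y_def[symmetric]
      proof (rule wnorm_cong_AE)
        show "AE x in lborel. conv k (\<lambda>x. (f x + h x) / 2) x - y x = ((conv k f x - y x) + (conv k h x - y x)) / 2"
          using fi
        proof eventually_elim
          case (elim x)
          have i: "integrable lborel (\<lambda>s. k s * f (x + s))" "integrable lborel (\<lambda>s. k s * h (x + s))"
            using elim by (auto intro: abs_conv_integrable)
          have "conv k (\<lambda>x. (f x + h x) / 2) x = (LINT s|lborel. (k s * f (x + s) + k s * h (x + s)) / 2)"
            unfolding conv_def by (simp add: distrib_left)
          also have "\<dots> = (conv k f x + conv k h x) / 2" using i by (simp add: conv_def)
          finally show ?case by (simp add: field_simps)
        qed
      qed
      also have "\<dots> \<le> (\<integral>\<^sup>+x. ennreal (1 / 2) * (ennreal (\<bar>conv k f x - y x\<bar> powr q * w x powr q) + ennreal (\<bar>conv k h x - y x\<bar> powr q * w x powr q)) \<partial>lborel)"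
        unfolding wnorm_def
      proof (rule nn_integral_mono)
        fix x
        define a b where "a = conv k f x - y x" and "b = conv k h x - y x"
        have "\<bar>(a + b) / 2\<bar> powr q * w x powr q \<le> (\<bar>a\<bar> powr q + \<bar>b\<bar> powr q) / 2 * w x powr q"
          by (intro mult_right_mono abs_powr_midpoint_le q1) auto
        also have "\<dots> = 1 / 2 * (\<bar>a\<bar> powr q * w x powr q + \<bar>b\<bar> powr q * w x powr q)" by (simp add: field_simps)
        finally have "ennreal (\<bar>(a + b) / 2\<bar> powr q * w x powr q) \<le> ennreal (1 / 2 * (\<bar>a\<bar> powr q * w x powr q + \<bar>b\<bar> powr q * w x powr q))"
          by (rule ennreal_leI)
        also have "\<dots> = ennreal (1 / 2) * ennreal (\<bar>a\<bar> powr q * w x powr q + \<bar>b\<bar> powr q * w x powr q)"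
          by (rule ennreal_mult) auto
        finally show "ennreal (\<bar>(a + b) / 2\<bar> powr q * w x powr q) \<le> ennreal (1 / 2) * (ennreal (\<bar>a\<bar> powr q * w x powr q) + ennreal (\<bar>b\<bar> powr q * w x powr q))"
          by simp
      qed
      also have "\<dots> = ennreal (1 / 2) * (E \<delta> f + E \<delta> h)"
        unfolding E_def wnorm_def k_def[symmetric] y_def[symmetric] by (subst nn_integral_cmult) (auto simp: nn_integral_add)
      also have "\<dots> \<le> ennreal (1 / 2) * (\<Omega> n \<delta> + \<Omega> n \<delta>)"
        using f h \<delta> by (intro mult_left_mono add_mono) (auto simp: \<C>_def)
      also have "\<dots> = \<Omega> n \<delta>"
      proof -
        have "ennreal (1 / 2) * (x + x) = x" for x
        proof (cases x)
          case (real r)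
          have "x + x = ennreal (r + r)" using real by (simp only: ennreal_plus)
          moreover have "ennreal (1 / 2 * (r + r)) = ennreal (1 / 2) * ennreal (r + r)"
            by (rule ennreal_mult) (use real in auto)
          moreover have "1 / 2 * (r + r) = r" by simp
          ultimately show ?thesis using real by (simp only:)
        next
          case top
          then show ?thesis by (simp add: ennreal_mult_eq_top_iff)
        qed
        then show ?thesis .
      qed
      finally show ?thesis .
    qed
    then show ?thesis using mfin by (auto simp: \<C>_def)
  qed
  have in\<C>: "marchaud_diff \<alpha> (1 / real (Suc n)) u \<in> \<C> n" for n
  proof -
    have "wnorm p w (marchaud_diff \<alpha> (1 / real (Suc n)) u) < \<infinity>"
      by (rule le_less_trans[OF M(2)]) simp_all
    moreover have "E \<delta> (marchaud_diff \<alpha> (1 / real (Suc n)) u) \<le> \<Omega> n \<delta>" for \<delta>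
      unfolding \<Omega>_def by (rule SUP_upper) simp
    ultimately show ?thesis by (simp add: \<C>_def)
  qed
  obtain g G where g: "\<And>n. g n \<in> \<C> n" and G[measurable]: "G \<in> borel_measurable borel" and Gfin: "wnorm p w G < \<infinity>"
    and lim: "(\<lambda>n. wnorm p w (\<lambda>x. g n x - G x)) \<longlonglongrightarrow> 0"
  proof (rule near_minimal_convergent[of w p \<C> M])
    show "\<C> m \<subseteq> \<C> n" if "n \<le> m" for m n using \<Omega>mono[OF that] by (auto simp: \<C>_def intro: order_trans)
    show "\<exists>f\<in>\<C> n. wnorm p w f \<le> ennreal M" for n using in\<C> M(2)[of "1 / real (Suc n)"] by (intro bexI) auto
  qed (use w_pos p mid M in \<open>auto simp: \<C>_def\<close>)
  have \<Omega>0: "(\<lambda>n. \<Omega> n \<delta>) \<longlonglongrightarrow> 0" if \<delta>: "0 < \<delta>" for \<delta>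
  proof (rule order_tendstoI)
    fix a :: ennreal assume "0 < a"
    then obtain e where e: "0 < e" "ennreal e < a" by (rule ennreal_between_0)
    have "\<forall>\<^sub>F \<epsilon> in at_right 0. E \<delta> (marchaud_diff \<alpha> \<epsilon> u) < ennreal e"
      using conv_marchaud_marchaud_diff_limit[OF _ u \<delta>] e unfolding E_def by (intro order_tendstoD(2)) auto
    then obtain b where b: "0 < b" "\<And>\<epsilon>. 0 < \<epsilon> \<Longrightarrow> \<epsilon> < b \<Longrightarrow> E \<delta> (marchaud_diff \<alpha> \<epsilon> u) < ennreal e"
      by (auto simp: eventually_at_right_field)
    obtain n0 where n0: "1 / real (Suc n0) < b" using nat_approx_posE[OF b(1)] by blast
    have "\<Omega> n0 \<delta> \<le> ennreal e" unfolding \<Omega>_def using n0 b(2) by (intro SUP_least less_imp_le) auto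
    then have "\<Omega> n \<delta> < a" if "n \<ge> n0" for n using \<Omega>mono[OF that, of \<delta>] e(2) by auto
    then show "\<forall>\<^sub>F n in sequentially. \<Omega> n \<delta> < a" by (auto simp: eventually_sequentially)
  qed auto
  show ?thesis
  proof (rule marchaud_diff_limit_imp_frac_integral[where s=g, OF _ _ G u _ Gfin lim])
    fix \<delta> :: real assume \<delta>: "0 < \<delta>"
    have "E \<delta> (g n) \<le> \<Omega> n \<delta>" for n using g[of n] \<delta> by (auto simp: \<C>_def)
    then have "(\<lambda>n. E \<delta> (g n)) \<longlonglongrightarrow> 0" using \<Omega>0[OF \<delta>] by (rule ennreal_LIMSEQ_0_le)
    then show "(\<lambda>n. wnorm q w (\<lambda>x. conv (marchaud_kernel \<alpha> \<delta>) (g n) x - c\<^sub>\<alpha> * marchaud_diff \<alpha> \<delta> u x)) \<longlonglongrightarrow> 0"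
      by (simp add: E_def)
  qed (use g in \<open>auto simp: \<C>_def\<close>)
qed

end

section \<open>Borel representatives\<close>

lemma borel_representative:
  fixes f :: "real \<Rightarrow> real"
  assumes "f \<in> borel_measurable lebesgue"
  obtains f' where "f' \<in> borel_measurable borel" "AE x in lborel. f x = f' x"
  using completion_ex_borel_measurable_real[OF assms] by auto

lemma lebesgue_measurable_AE_borel:
  fixes f :: "real \<Rightarrow> real"
  assumes "f' \<in> borel_measurable borel" "AE x in lborel. f x = f' x"
  shows "f \<in> borel_measurable lebesgue"
proof (rule borel_measurable_AE)
  show "f' \<in> borel_measurable lebesgue" using assms(1) by (intro measurable_completion) simp
  show "AE x in lebesgue. f' x = f x" using assms(2) by (intro AE_completion) (auto elim: eventually_mono)
qed

lemma nn_integral_wmeasure: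
  assumes [measurable]: "w \<in> borel_measurable lebesgue" "f \<in> borel_measurable lebesgue"
    and w': "AE x in lborel. w x = w' x" and f': "AE x in lborel. f x = f' x"
  shows "(\<integral>\<^sup>+x. ennreal (\<bar>f x\<bar> powr r) \<partial>wmeasure r w) = wnorm r w' f'"
proof -
  have "(\<integral>\<^sup>+x. ennreal (\<bar>f x\<bar> powr r) \<partial>wmeasure r w) = (\<integral>\<^sup>+x. ennreal (w x powr r) * ennreal (\<bar>f x\<bar> powr r) \<partial>lebesgue)"
    unfolding wmeasure_def by (rule nn_integral_density) measurable
  also have "\<dots> = (\<integral>\<^sup>+x. ennreal (w x powr r) * ennreal (\<bar>f x\<bar> powr r) \<partial>lborel)" by (rule nn_integral_completion)
  also have "\<dots> = wnorm r w' f'"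
    unfolding wnorm_def
  proof (rule nn_integral_cong_AE)
    show "AE x in lborel. ennreal (w x powr r) * ennreal (\<bar>f x\<bar> powr r) = ennreal (\<bar>f' x\<bar> powr r * w' x powr r)"
      using w' f' by eventually_elim (simp add: ennreal_mult mult.commute)
  qed
  finally show ?thesis .
qed

lemma wLp_transfer:
  assumes w: "w \<in> borel_measurable lebesgue" and f: "f \<in> borel_measurable lebesgue"
    and w': "AE x in lborel. w x = w' x" and f': "AE x in lborel. f x = f' x"
  shows "f \<in> wLp r w \<longleftrightarrow> wnorm r w' f' < \<infinity>"
    and "wLp_norm r w f = enn2real (wnorm r w' f') powr (1 / r)"
proof -
  have m: "(\<lambda>x. \<bar>f x\<bar> powr r) \<in> borel_measurable (wmeasure r w)"
    using f unfolding wmeasure_def by simp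
  show "f \<in> wLp r w \<longleftrightarrow> wnorm r w' f' < \<infinity>"
    using f m nn_integral_wmeasure[OF w f w' f', of r] by (simp add: wLp_def integrable_iff_bounded)
  have "(LINT x|wmeasure r w. \<bar>f x\<bar> powr r) = enn2real (\<integral>\<^sup>+x. ennreal (\<bar>f x\<bar> powr r) \<partial>wmeasure r w)"
    using m by (intro integral_eq_nn_integral) auto
  then show "wLp_norm r w f = enn2real (wnorm r w' f') powr (1 / r)"
    using nn_integral_wmeasure[OF w f w' f', of r] by (simp add: wLp_norm_def)
qed

lemma emeasure_density_transfer:
  fixes w w' :: "real \<Rightarrow> real"
  assumes "w' \<in> borel_measurable borel" and w': "AE x in lborel. w x = w' x"
    and int: "set_integrable lebesgue {a..b} (\<lambda>x. w x powr e)"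
  shows "emeasure (density lborel (\<lambda>x. ennreal (w' x powr e))) {a..b} = ennreal (LINT x:{a..b}|lebesgue. w x powr e)"
proof -
  have [measurable]: "w' \<in> borel_measurable borel" by fact
  have "emeasure (density lborel (\<lambda>x. ennreal (w' x powr e))) {a..b} = (\<integral>\<^sup>+x. ennreal (w' x powr e) * indicator {a..b} x \<partial>lborel)"
    by (rule emeasure_density) simp_all
  also have "\<dots> = (\<integral>\<^sup>+x. ennreal (indicator {a..b} x *\<^sub>R w x powr e) \<partial>lborel)"
  proof (rule nn_integral_cong_AE)
    show "AE x in lborel. ennreal (w' x powr e) * indicator {a..b} x = ennreal (indicator {a..b} x *\<^sub>R w x powr e)"
      using w' by eventually_elim (auto simp: indicator_def)
  qed
  also have "\<dots> = (\<integral>\<^sup>+x. ennreal (indicator {a..b} x *\<^sub>R w x powr e) \<partial>lebesgue)" by (rule nn_integral_completion[symmetric])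
  also have "\<dots> = ennreal (LINT x:{a..b}|lebesgue. w x powr e)"
    unfolding set_lebesgue_integral_def using int
    by (intro nn_integral_eq_integral) (auto simp: set_integrable_def)
  finally show ?thesis .
qed

text \<open>The factors 1/h of the averages, raised to 1/q and 1/p', combine to h^(\<alpha> - 1) and
  move to the right side. The bound p < 1/\<alpha> enters through q > 0.\<close>

lemma A_plus_imp_one_sided_weight:
  assumes \<alpha>: "0 < \<alpha>" "\<alpha> < 1" and p: "1 < p" "p < 1 / \<alpha>" and pq: "1 / q = 1 / p - \<alpha>"
    and A: "A_plus p q w" and w': "w' \<in> borel_measurable borel" "\<And>x. 0 < w' x" "AE x in lborel. w x = w' x"
  obtains C where "one_sided_weight \<alpha> p q (conj_exp p) w' C"
proof -
  define p' where "p' = conj_exp p"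
  have p'1: "1 / p + 1 / p' = 1" using p by (auto simp: p'_def conj_exp_def field_simps)
  have "\<alpha> < 1 / p" using p \<alpha> by (simp add: field_simps)
  then have "0 < 1 / q" using pq by simp
  then have q: "0 < q" by (simp add: zero_less_divide_iff)
  obtain C where C: "C > 0" and I1: "\<And>a h. 0 < h \<Longrightarrow> set_integrable lebesgue {a - h..a} (\<lambda>x. w x powr q)"
    and I2: "\<And>a h. 0 < h \<Longrightarrow> set_integrable lebesgue {a..a + h} (\<lambda>x. w x powr (- p'))"
    and le: "\<And>a h. 0 < h \<Longrightarrow> (1 / h * (LINT x:{a - h..a}|lebesgue. w x powr q)) powr (1 / q) *
        (1 / h * (LINT x:{a..a + h}|lebesgue. w x powr (- p'))) powr (1 / p') \<le> C"
    using A unfolding A_plus_def p'_def by blast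
  let ?\<nu> = "density lborel (\<lambda>x. ennreal (w' x powr q))" and ?\<sigma> = "density lborel (\<lambda>x. ennreal (w' x powr (- p')))"
  note E1 = emeasure_density_transfer[OF w'(1,3) I1] and E2 = emeasure_density_transfer[OF w'(1,3) I2]
  have nn: "0 \<le> (LINT x:S|lebesgue. w x powr e)" for S e
    unfolding set_lebesgue_integral_def by (intro integral_nonneg_AE) auto
  have "one_sided_weight \<alpha> p q p' w' C"
  proof
    fix a b :: real
    \<comment> \<open>Integrability is available for positive lengths; max 1 (b - a) also covers b
      <= a.\<close>
    have "emeasure ?\<nu> {a..b} \<le> emeasure ?\<nu> {b - max 1 (b - a)..b}" by (rule emeasure_mono) auto
    also have "\<dots> < \<infinity>" by (subst E1) auto
    finally show "emeasure ?\<nu> {a..b} < \<infinity>" .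
    have "emeasure ?\<sigma> {a..b} \<le> emeasure ?\<sigma> {a..a + max 1 (b - a)}" by (rule emeasure_mono) auto
    also have "\<dots> < \<infinity>" by (subst E2) auto
    finally show "emeasure ?\<sigma> {a..b} < \<infinity>" .
  next
    fix a h :: real assume h: "0 < h"
    define U where "U = (LINT x:{a - h..a}|lebesgue. w x powr q)"
    define V where "V = (LINT x:{a..a + h}|lebesgue. w x powr (- p'))"
    have UV: "0 \<le> U" "0 \<le> V" using nn by (auto simp: U_def V_def)
    have m: "measure ?\<nu> {a - h..a} = U" "measure ?\<sigma> {a..a + h} = V"
      using E1[OF h, of a] E2[OF h, of a] UV by (simp_all add: measure_def U_def V_def)
    have "h powr (1 - \<alpha>) * ((1 / h * U) powr (1 / q) * (1 / h * V) powr (1 / p')) \<le> h powr (1 - \<alpha>) * C"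
      using le[OF h, of a] by (intro mult_left_mono) (auto simp: U_def V_def)
    moreover have "h powr (1 - \<alpha>) * ((1 / h * U) powr (1 / q) * (1 / h * V) powr (1 / p')) = U powr (1 / q) * V powr (1 / p')"
    proof -
      have e: "1 - \<alpha> = 1 / q + 1 / p'" using pq p'1 by simp
      have "(1 / h * U) powr (1 / q) = U powr (1 / q) / h powr (1 / q)" "(1 / h * V) powr (1 / p') = V powr (1 / p') / h powr (1 / p')"
        using h UV by (simp_all add: powr_divide)
      then show ?thesis unfolding e powr_add using h by simp
    qed
    ultimately show "measure ?\<nu> {a - h..a} powr (1 / q) * measure ?\<sigma> {a..a + h} powr (1 / p') \<le> C * h powr (1 - \<alpha>)"
      unfolding m by (simp add: mult.commute)
  qed (use \<alpha> p q pq p'1 w' C in auto)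
  then show ?thesis using that by (simp add: p'_def)
qed

text \<open>Translation preserves null sets, so equality holds at every x and not merely almost
  everywhere.\<close>

lemma conv_cong_AE:
  assumes "AE x in lborel. f x = g x" and [measurable]: "k \<in> borel_measurable borel" "f \<in> borel_measurable borel" "g \<in> borel_measurable borel"
  shows "conv k f x = conv k g x"
proof -
  have "AE s in lborel. f (x + 1 * s) = g (x + 1 * s)"
    by (rule AE_borel_affine) (use assms(1) in auto)
  then show ?thesis unfolding conv_def
    by (intro integral_cong_AE) (auto elim!: eventually_mono)
qed

lemma lebesgue_conv:
  assumes f: "f \<in> borel_measurable lebesgue" and [measurable]: "k \<in> borel_measurable borel" "f' \<in> borel_measurable borel"
    and f': "AE x in lborel. f x = f' x"
  shows "(LINT t|lebesgue. k (t - x) * f t) = conv k f' x"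
    and "integrable lebesgue (\<lambda>t. k (t - x) * f t) \<longleftrightarrow> abs_conv k f' x < \<infinity>"
proof -
  have km: "(\<lambda>t. k (t - x)) \<in> borel_measurable lebesgue" by (intro measurable_completion) measurable
  have m: "(\<lambda>t. k (t - x) * f t) \<in> borel_measurable lebesgue" using km f by simp
  have m': "(\<lambda>t. k (t - x) * f' t) \<in> borel_measurable lebesgue" by (intro measurable_completion) measurable
  have ae: "AE t in lebesgue. k (t - x) * f t = k (t - x) * f' t"
    using f' by (intro AE_completion) (auto elim: eventually_mono)
  have "(LINT t|lebesgue. k (t - x) * f t) = (LINT t|lebesgue. k (t - x) * f' t)" by (rule integral_cong_AE[OF m m' ae])
  also have "\<dots> = (LINT t|lborel. k (t - x) * f' t)" by (rule integral_completion) measurable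
  also have "\<dots> = conv k f' x"
    unfolding conv_def by (subst lborel_integral_real_affine[where c=1 and t=x]) auto
  finally show "(LINT t|lebesgue. k (t - x) * f t) = conv k f' x" .
  have "integrable lebesgue (\<lambda>t. k (t - x) * f t) \<longleftrightarrow> integrable lebesgue (\<lambda>t. k (t - x) * f' t)"
    by (rule integrable_cong_AE[OF m m' ae])
  also have "\<dots> \<longleftrightarrow> integrable lborel (\<lambda>t. k (t - x) * f' t)" by (rule integrable_completion) measurable
  also have "\<dots> \<longleftrightarrow> (\<integral>\<^sup>+t. ennreal \<bar>k (t - x) * f' t\<bar> \<partial>lborel) < \<infinity>" by (simp add: integrable_iff_bounded)
  also have "(\<integral>\<^sup>+t. ennreal \<bar>k (t - x) * f' t\<bar> \<partial>lborel) = abs_conv k f' x"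
    unfolding abs_conv_def by (subst nn_integral_real_affine[where c=1 and t=x]) (auto simp: abs_mult)
  finally show "integrable lebesgue (\<lambda>t. k (t - x) * f t) \<longleftrightarrow> abs_conv k f' x < \<infinity>" .
qed

lemma frac_integral_transfer:
  assumes f: "f \<in> borel_measurable lebesgue" "f' \<in> borel_measurable borel" "AE x in lborel. f x = f' x"
  shows "frac_integral \<alpha> f x = 1 / Gamma \<alpha> * conv (frac_kernel \<alpha>) f' x"
    and "frac_integral_exists \<alpha> f x \<longleftrightarrow> abs_conv (frac_kernel \<alpha>) f' x < \<infinity>"
proof -
  have k: "indicator {x<..} t *\<^sub>R (f t / (t - x) powr (1 - \<alpha>)) = frac_kernel \<alpha> (t - x) * f t" for t
  proof -
    have "1 / (t - x) powr (1 - \<alpha>) = (t - x) powr (\<alpha> - 1)" using powr_minus_divide[of "t - x" "1 - \<alpha>"] by simp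
    then have "f t / (t - x) powr (1 - \<alpha>) = (t - x) powr (\<alpha> - 1) * f t" by (metis times_divide_eq_left mult_1)
    then show ?thesis by (simp add: frac_kernel_def indicator_def)
  qed
  show "frac_integral \<alpha> f x = 1 / Gamma \<alpha> * conv (frac_kernel \<alpha>) f' x"
    unfolding frac_integral_def set_lebesgue_integral_def k using lebesgue_conv(1)[OF f(1) _ f(2,3)] by simp
  show "frac_integral_exists \<alpha> f x \<longleftrightarrow> abs_conv (frac_kernel \<alpha>) f' x < \<infinity>"
    unfolding frac_integral_exists_def set_integrable_def k by (rule lebesgue_conv(2)[OF f(1) _ f(2,3)]) simp
qed

text \<open>The value u(x) enters pointwise, so the representative must agree with u at this very x.
  Convergence of the tail integral lets the constant u(x) be split off and integrated in closed
  form.\<close>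

lemma trunc_frac_deriv_transfer:
  assumes u: "u \<in> borel_measurable lebesgue" "u' \<in> borel_measurable borel" "AE x in lborel. u x = u' x"
    and x: "u x = u' x" and fin: "abs_conv (trunc_kernel \<alpha> \<epsilon>) u' x < \<infinity>" and \<alpha>: "0 < \<alpha>" "\<alpha> < 1" and \<epsilon>: "0 < \<epsilon>"
  shows "trunc_frac_deriv \<alpha> \<epsilon> u x = - 1 / Gamma (- \<alpha>) * marchaud_diff \<alpha> \<epsilon> u' x"
proof -
  have [measurable]: "u' \<in> borel_measurable borel" by fact
  have k: "indicator {x + \<epsilon><..} t *\<^sub>R ((u t - u x) / (t - x) powr (1 + \<alpha>)) = trunc_kernel \<alpha> \<epsilon> (t - x) * (u t - u x)" for t
  proof -
    have "1 / (t - x) powr (1 + \<alpha>) = (t - x) powr (- 1 - \<alpha>)" using powr_minus_divide[of "t - x" "1 + \<alpha>"] by simp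
    then have "(u t - u x) / (t - x) powr (1 + \<alpha>) = (t - x) powr (- 1 - \<alpha>) * (u t - u x)" by (metis times_divide_eq_left mult_1)
    then show ?thesis by (auto simp: trunc_kernel_def indicator_def)
  qed
  have "(LINT t|lebesgue. trunc_kernel \<alpha> \<epsilon> (t - x) * (u t - u x)) = conv (trunc_kernel \<alpha> \<epsilon>) (\<lambda>t. u' t - u x) x"
    by (rule lebesgue_conv(1)) (use u in \<open>auto elim: eventually_mono\<close>)
  also have "\<dots> = conv (trunc_kernel \<alpha> \<epsilon>) u' x - \<epsilon> powr (- \<alpha>) / \<alpha> * u x"
  proof -
    have i: "integrable lborel (\<lambda>s. trunc_kernel \<alpha> \<epsilon> s * u' (x + s))" by (rule abs_conv_integrable[OF _ _ fin]) auto
    have "conv (trunc_kernel \<alpha> \<epsilon>) (\<lambda>t. u' t - u x) x = (LINT s|lborel. trunc_kernel \<alpha> \<epsilon> s * u' (x + s) - trunc_kernel \<alpha> \<epsilon> s * u x)"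
      unfolding conv_def by (simp add: right_diff_distrib)
    then show ?thesis using i trunc_kernel_integrable[OF \<alpha> \<epsilon>] by (simp add: conv_def)
  qed
  also have "\<dots> = - marchaud_diff \<alpha> \<epsilon> u' x" by (simp add: marchaud_diff_def x)
  finally show ?thesis
    unfolding trunc_frac_deriv_def set_lebesgue_integral_def k by simp
qed

section \<open>The equivalence for Lebesgue measurable weights and functions\<close>

theorem theorem6p5:
  fixes \<alpha> p q :: real and w u :: "real \<Rightarrow> real"
  assumes "0 < \<alpha>" and "\<alpha> < 1"
    and "1 < p" and "p < 1 / \<alpha>"
    and "1 / q = 1 / p - \<alpha>"
    and "weight w" and "A_plus p q w"
    and "u \<in> borel_measurable lebesgue"
  defines "cond_a \<equiv> (\<exists>f \<in> wLp p w.
      AE x in lebesgue. frac_integral_exists \<alpha> f x \<and> u x = frac_integral \<alpha> f x)"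
    and "cond_b \<equiv> u \<in> wLp q w \<and>
      (\<exists>g. wLp_tendsto p w (\<lambda>\<epsilon>. trunc_frac_deriv \<alpha> \<epsilon> u) g)"
    and "cond_c \<equiv> u \<in> wLp q w \<and>
      (\<forall>\<epsilon>>0. trunc_frac_deriv \<alpha> \<epsilon> u \<in> wLp p w) \<and>
      bdd_above ((\<lambda>\<epsilon>. wLp_norm p w (trunc_frac_deriv \<alpha> \<epsilon> u)) ` {0<..})"
  shows "(cond_a \<longleftrightarrow> cond_b) \<and> (cond_b \<longleftrightarrow> cond_c)"
proof -
  note \<alpha> = assms(1,2) and u = assms(8)
  have w: "w \<in> borel_measurable lebesgue" and wpos: "\<And>x. 0 < w x" using assms(6) by (auto simp: weight_def)
  obtain w0 where w0[measurable]: "w0 \<in> borel_measurable borel" and w0_eq: "AE x in lborel. w x = w0 x"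
    by (rule borel_representative[OF w])
  \<comment> \<open>Redefinition on the null set where the representative is not positive makes the
    weight positive everywhere.\<close>
  define w' where "w' x = (if 0 < w0 x then w0 x else 1)" for x
  have w'[measurable]: "w' \<in> borel_measurable borel" unfolding w'_def[abs_def] by measurable
  have w'pos: "0 < w' x" for x by (simp add: w'_def)
  have ww': "AE x in lborel. w x = w' x"
    using w0_eq
  proof eventually_elim
    case (elim x)
    then show ?case using wpos[of x] by (simp add: w'_def)
  qed
  obtain u' where u'[measurable]: "u' \<in> borel_measurable borel" and uu': "AE x in lborel. u x = u' x"
    by (rule borel_representative[OF u])
  obtain C where "one_sided_weight \<alpha> p q (conj_exp p) w' C"
    using A_plus_imp_one_sided_weight[OF assms(1-5,7) w' w'pos ww'] by blast
  then interpret one_sided_weight \<alpha> p q "conj_exp p" w' C .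
  have p0: "0 < p" using p by simp
  \<comment> \<open>The ratio of the truncated derivative to \<open>marchaud_diff\<close>; it is
    nonzero because -\<alpha> is not a pole of Gamma.\<close>
  define \<kappa> where "\<kappa> = - 1 / Gamma (- \<alpha>)"
  have "Gamma (- \<alpha>) \<noteq> 0"
  proof -
    have "- \<alpha> \<notin> \<int>\<^sub>\<le>\<^sub>0"
    proof
      assume "- \<alpha> \<in> \<int>\<^sub>\<le>\<^sub>0"
      then obtain n where "- \<alpha> = - of_nat n" by (elim nonpos_Ints_cases')
      then have "0 < real n" "real n < 1" using \<alpha> by auto
      then show False by simp
    qed
    then show ?thesis by (simp add: Gamma_eq_zero_iff)
  qed
  then have \<kappa>: "\<kappa> \<noteq> 0" by (simp add: \<kappa>_def)
  have Gp: "0 < Gamma \<alpha>" using \<alpha> by (simp add: Gamma_real_pos)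
  define T where "T \<epsilon> = trunc_frac_deriv \<alpha> \<epsilon> u" for \<epsilon>
  define h where "h \<epsilon> = marchaud_diff \<alpha> \<epsilon> u'" for \<epsilon>
  have h[measurable]: "h \<epsilon> \<in> borel_measurable borel" for \<epsilon> by (simp add: h_def)
  have u_iff: "u \<in> wLp q w \<longleftrightarrow> wnorm q w' u' < \<infinity>" by (rule wLp_transfer(1)[OF w u ww' uu'])
  \<comment> \<open>Condition (a) for Borel representatives, with the factor 1/Gamma(\<alpha>)
    absorbed into f; all three conditions are compared with it.\<close>
  define A' where "A' \<longleftrightarrow> (\<exists>f\<in>borel_measurable borel. wnorm p w' f < \<infinity> \<and>
    (AE x in lborel. abs_conv (frac_kernel \<alpha>) f x < \<infinity> \<and> u' x = conv (frac_kernel \<alpha>) f x))"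
  have T_eq: "AE x in lborel. T \<epsilon> x = \<kappa> * h \<epsilon> x" if fin: "wnorm q w' u' < \<infinity>" and \<epsilon>: "0 < \<epsilon>" for \<epsilon>
  proof -
    have "AE x in lborel. abs_conv (trunc_kernel \<alpha> \<epsilon>) u' x < \<infinity>"
      by (rule Wq.abs_conv_AE_finite[OF _ _ Wq.abs_conv_trunc_finite[OF _ fin \<alpha> \<epsilon>]]) auto
    then show ?thesis using uu'
    proof eventually_elim
      case (elim x)
      show ?case unfolding T_def \<kappa>_def h_def
        by (rule trunc_frac_deriv_transfer[OF u u' uu' elim(2,1) \<alpha> \<epsilon>])
    qed
  qed
  have Tm: "T \<epsilon> \<in> borel_measurable lebesgue" if "wnorm q w' u' < \<infinity>" "0 < \<epsilon>" for \<epsilon>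
    by (rule lebesgue_measurable_AE_borel[OF _ T_eq[OF that]]) measurable
  have h_fin: "wnorm p w' (h \<epsilon>) < \<infinity> \<longleftrightarrow> wnorm p w' (\<lambda>x. \<kappa> * h \<epsilon> x) < \<infinity>" for \<epsilon>
    using \<kappa> by (auto simp: wnorm_cmult ennreal_mult_less_top)
  have T_mem: "T \<epsilon> \<in> wLp p w \<longleftrightarrow> wnorm p w' (h \<epsilon>) < \<infinity>" and T_norm: "wLp_norm p w (T \<epsilon>) = enn2real (wnorm p w' (\<lambda>x. \<kappa> * h \<epsilon> x)) powr (1 / p)"
    if "wnorm q w' u' < \<infinity>" "0 < \<epsilon>" for \<epsilon>
    using wLp_transfer[OF w Tm[OF that] ww' T_eq[OF that]] h_fin by auto
  have "cond_a \<longleftrightarrow> A'"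
  proof
    assume cond_a
    then obtain f where f: "f \<in> wLp p w" and ae: "AE x in lebesgue. frac_integral_exists \<alpha> f x \<and> u x = frac_integral \<alpha> f x"
      by (auto simp: cond_a_def)
    have fm: "f \<in> borel_measurable lebesgue" using f by (simp add: wLp_def)
    obtain f1 where f1[measurable]: "f1 \<in> borel_measurable borel" and ff1: "AE x in lborel. f x = f1 x"
      by (rule borel_representative[OF fm])
    have "wnorm p w' f1 < \<infinity>" using f wLp_transfer(1)[OF w fm ww' ff1] by blast
    then have "wnorm p w' (\<lambda>x. 1 / Gamma \<alpha> * f1 x) < \<infinity>" by (intro wnorm_cmult_finite) auto
    moreover have "AE x in lborel. abs_conv (frac_kernel \<alpha>) (\<lambda>x. 1 / Gamma \<alpha> * f1 x) x < \<infinity> \<and> u' x = conv (frac_kernel \<alpha>) (\<lambda>x. 1 / Gamma \<alpha> * f1 x) x"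
      using ae[unfolded AE_completion_iff] uu'
    proof eventually_elim
      case (elim x)
      have "abs_conv (frac_kernel \<alpha>) (\<lambda>x. 1 / Gamma \<alpha> * f1 x) x < \<infinity>"
        using elim(1) frac_integral_transfer(2)[OF fm f1 ff1]
        by (subst abs_conv_cmult) (auto simp: ennreal_mult_less_top)
      moreover have "conv (frac_kernel \<alpha>) (\<lambda>x. 1 / Gamma \<alpha> * f1 x) x = frac_integral \<alpha> f x"
        unfolding conv_cmult frac_integral_transfer(1)[OF fm f1 ff1] ..
      ultimately show ?case using elim by simp
    qed
    ultimately show A' unfolding A'_def by (intro bexI[of _ "\<lambda>x. 1 / Gamma \<alpha> * f1 x"]) auto
  next
    assume A'
    then obtain f where f[measurable]: "f \<in> borel_measurable borel" and fin: "wnorm p w' f < \<infinity>"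
      and ae: "AE x in lborel. abs_conv (frac_kernel \<alpha>) f x < \<infinity> \<and> u' x = conv (frac_kernel \<alpha>) f x" by (auto simp: A'_def)
    define F where "F x = Gamma \<alpha> * f x" for x
    have F[measurable]: "F \<in> borel_measurable borel" unfolding F_def[abs_def] by measurable
    have Fm: "F \<in> borel_measurable lebesgue" and FF: "AE x in lborel. F x = F x" by (auto intro: measurable_completion)
    have "wnorm p w' F < \<infinity>" unfolding F_def[abs_def] by (rule wnorm_cmult_finite) (use fin in auto)
    then have "F \<in> wLp p w" using wLp_transfer(1)[OF w Fm ww' FF] by blast
    moreover have "AE x in lborel. frac_integral_exists \<alpha> F x \<and> u x = frac_integral \<alpha> F x"
      using ae uu'
    proof eventually_elim
      case (elim x)
      have "abs_conv (frac_kernel \<alpha>) F x < \<infinity>"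
        unfolding F_def[abs_def] using elim by (subst abs_conv_cmult) (auto simp: ennreal_mult_less_top)
      moreover have "1 / Gamma \<alpha> * conv (frac_kernel \<alpha>) F x = conv (frac_kernel \<alpha>) f x"
        unfolding F_def[abs_def] conv_cmult using Gp by simp
      ultimately show ?case
        using elim unfolding frac_integral_transfer[OF Fm F FF] by simp
    qed
    ultimately show cond_a unfolding cond_a_def AE_completion_iff by blast
  qed
  moreover have "A' \<Longrightarrow> cond_b \<and> cond_c"
  proof -
    assume A'
    then obtain f where f[measurable]: "f \<in> borel_measurable borel" and fin: "wnorm p w' f < \<infinity>"
      and ae: "AE x in lborel. abs_conv (frac_kernel \<alpha>) f x < \<infinity> \<and> u' x = conv (frac_kernel \<alpha>) f x" by (auto simp: A'_def)
    have ae': "AE x in lborel. u' x = conv (frac_kernel \<alpha>) f x" using ae by (auto elim: eventually_mono)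
    have ufin: "wnorm q w' u' < \<infinity>"
      using frac_integral_props(2)[OF f fin] wnorm_cong_AE[OF ae'] by simp
    have h_eq: "AE x in lborel. h \<epsilon> x = conv (marchaud_kernel \<alpha> \<epsilon>) f x" if "0 < \<epsilon>" for \<epsilon>
      using frac_integral_props(3)[OF f fin that] ae'
    proof eventually_elim
      case (elim x)
      have "conv (trunc_kernel \<alpha> \<epsilon>) u' x = conv (trunc_kernel \<alpha> \<epsilon>) (conv (frac_kernel \<alpha>) f) x"
        by (rule conv_cong_AE[OF ae']) auto
      then show ?case using elim by (simp add: h_def marchaud_diff_def)
    qed
    define K where "K = ennreal (\<bar>\<kappa>\<bar> powr p) * (ennreal (2 * (4 * C * marchaud_mass \<alpha>) powr p) * wnorm p w' f)"
    have K: "K < \<infinity>" using fin by (simp add: K_def ennreal_mult_less_top)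
    have bound: "wnorm p w' (\<lambda>x. \<kappa> * h \<epsilon> x) \<le> K" if \<epsilon>: "0 < \<epsilon>" for \<epsilon>
    proof -
      have "wnorm p w' (\<lambda>x. \<kappa> * h \<epsilon> x) = ennreal (\<bar>\<kappa>\<bar> powr p) * wnorm p w' (conv (marchaud_kernel \<alpha> \<epsilon>) f)"
        using wnorm_cong_AE[OF h_eq[OF \<epsilon>], of p w'] by (simp add: wnorm_cmult)
      also have "\<dots> \<le> K" unfolding K_def by (intro mult_left_mono Wp.wnorm_conv_marchaud[OF f fin \<alpha> \<epsilon>]) auto
      finally show ?thesis .
    qed
    have mem: "T \<epsilon> \<in> wLp p w" if "0 < \<epsilon>" for \<epsilon>
      using T_mem[OF ufin that] h_fin le_less_trans[OF bound[OF that] K] by blast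
    have "wLp_norm p w (T \<epsilon>) \<le> enn2real K powr (1 / p)" if "0 < \<epsilon>" for \<epsilon>
      unfolding T_norm[OF ufin that] using bound[OF that] K p0 by (intro powr_mono2 enn2real_mono) auto
    then have c: cond_c unfolding cond_c_def T_def[symmetric] using u_iff ufin mem by (auto intro!: bdd_aboveI)
    \<comment> \<open>The convolutions of f with the Marchaud kernels tend to
      \<open>c\<^sub>\<alpha>\<close> times f, and \<kappa> converts \<open>marchaud_diff\<close>
      back to the truncated derivative.\<close>
    define g where "g x = \<kappa> * (c\<^sub>\<alpha> * f x)" for x
    have g[measurable]: "g \<in> borel_measurable borel" unfolding g_def[abs_def] by measurable
    have gm: "g \<in> borel_measurable lebesgue" and gg: "AE x in lborel. g x = g x" by (auto intro: measurable_completion)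
    have "wnorm p w' (\<lambda>x. (\<kappa> * c\<^sub>\<alpha>) * f x) < \<infinity>" by (rule wnorm_cmult_finite) (use fin in auto)
    then have gw: "g \<in> wLp p w" using wLp_transfer(1)[OF w gm ww' gg] by (simp add: g_def[abs_def] mult.assoc)
    have norm: "wLp_norm p w (\<lambda>x. T \<epsilon> x - g x) = enn2real (ennreal (\<bar>\<kappa>\<bar> powr p) * wnorm p w' (\<lambda>x. conv (marchaud_kernel \<alpha> \<epsilon>) f x - c\<^sub>\<alpha> * f x)) powr (1 / p)"
      if \<epsilon>: "0 < \<epsilon>" for \<epsilon>
    proof -
      have m: "(\<lambda>x. T \<epsilon> x - g x) \<in> borel_measurable lebesgue" using Tm[OF ufin \<epsilon>] gm by simp
      have "AE x in lborel. T \<epsilon> x - g x = \<kappa> * (conv (marchaud_kernel \<alpha> \<epsilon>) f x - c\<^sub>\<alpha> * f x)"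
        using T_eq[OF ufin \<epsilon>] h_eq[OF \<epsilon>] by eventually_elim (simp add: g_def right_diff_distrib)
      from wLp_transfer(2)[OF w m ww' this, of p] show ?thesis by (simp add: wnorm_cmult)
    qed
    have "((\<lambda>\<epsilon>. ennreal (\<bar>\<kappa>\<bar> powr p) * wnorm p w' (\<lambda>x. conv (marchaud_kernel \<alpha> \<epsilon>) f x - c\<^sub>\<alpha> * f x)) \<longlongrightarrow> ennreal (\<bar>\<kappa>\<bar> powr p) * 0) (at_right 0)"
      by (intro tendsto_mult_ennreal tendsto_const Wp.marchaud_approx[OF f fin \<alpha>]) auto
    then have "((\<lambda>\<epsilon>. enn2real (ennreal (\<bar>\<kappa>\<bar> powr p) * wnorm p w' (\<lambda>x. conv (marchaud_kernel \<alpha> \<epsilon>) f x - c\<^sub>\<alpha> * f x))) \<longlongrightarrow> 0) (at_right 0)"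
      by (intro tendsto_enn2real) auto
    then have "((\<lambda>\<epsilon>. enn2real (ennreal (\<bar>\<kappa>\<bar> powr p) * wnorm p w' (\<lambda>x. conv (marchaud_kernel \<alpha> \<epsilon>) f x - c\<^sub>\<alpha> * f x)) powr (1 / p)) \<longlongrightarrow> 0) (at_right 0)"
      by (rule tendsto_zero_powrI[OF _ tendsto_const]) (use p0 in auto)
    moreover have "\<forall>\<^sub>F \<epsilon> in at_right 0. enn2real (ennreal (\<bar>\<kappa>\<bar> powr p) * wnorm p w' (\<lambda>x. conv (marchaud_kernel \<alpha> \<epsilon>) f x - c\<^sub>\<alpha> * f x)) powr (1 / p) = wLp_norm p w (\<lambda>x. T \<epsilon> x - g x)"
      using eventually_at_right_less[of 0] by eventually_elim (rule norm[symmetric])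
    ultimately have "((\<lambda>\<epsilon>. wLp_norm p w (\<lambda>x. T \<epsilon> x - g x)) \<longlongrightarrow> 0) (at_right 0)" by (rule Lim_transform_eventually)
    moreover have "\<forall>\<^sub>F \<epsilon> in at_right 0. T \<epsilon> \<in> wLp p w"
      using eventually_at_right_less[of 0] by eventually_elim (rule mem)
    ultimately have "wLp_tendsto p w T g" using gw by (simp add: wLp_tendsto_def)
    then have cond_b unfolding cond_b_def T_def[symmetric] using u_iff ufin by (auto simp: T_def[abs_def])
    with c show "cond_b \<and> cond_c" by simp
  qed
  moreover have "cond_b \<Longrightarrow> A'"
  proof -
    assume cond_b
    then obtain g where ufin: "wnorm q w' u' < \<infinity>" and g: "wLp_tendsto p w T g"
      unfolding cond_b_def u_iff by (auto simp: T_def[abs_def])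
    have gw: "g \<in> wLp p w" and ev: "\<forall>\<^sub>F \<epsilon> in at_right 0. T \<epsilon> \<in> wLp p w"
      and lim: "((\<lambda>\<epsilon>. wLp_norm p w (\<lambda>x. T \<epsilon> x - g x)) \<longlongrightarrow> 0) (at_right 0)" using g by (auto simp: wLp_tendsto_def)
    have gm: "g \<in> borel_measurable lebesgue" using gw by (simp add: wLp_def)
    obtain g' where g'[measurable]: "g' \<in> borel_measurable borel" and gg': "AE x in lborel. g x = g' x"
      by (rule borel_representative[OF gm])
    have g'fin: "wnorm p w' g' < \<infinity>" using gw wLp_transfer(1)[OF w gm ww' gg'] by blast
    define G where "G x = (1 / \<kappa>) * g' x" for x
    have G[measurable]: "G \<in> borel_measurable borel" unfolding G_def[abs_def] by measurable
    have Gfin: "wnorm p w' G < \<infinity>" unfolding G_def[abs_def] by (rule wnorm_cmult_finite) (use g'fin in auto)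
    \<comment> \<open>The real norm determines \<open>wnorm\<close> only where the latter is finite,
      since \<open>enn2real\<close> of \<infinity> is 0; membership for small \<epsilon> secures
      this.\<close>
    have ev': "\<forall>\<^sub>F \<epsilon> in at_right 0. wnorm p w' (h \<epsilon>) < \<infinity>"
      using ev eventually_at_right_less[of 0] by eventually_elim (use T_mem[OF ufin] in blast)
    have "\<forall>\<^sub>F \<epsilon> in at_right 0. ennreal (\<bar>1 / \<kappa>\<bar> powr p * wLp_norm p w (\<lambda>x. T \<epsilon> x - g x) powr p) = wnorm p w' (\<lambda>x. h \<epsilon> x - G x)"
      using ev' eventually_at_right_less[of 0]
    proof eventually_elim
      case (elim \<epsilon>)
      define d where "d x = \<kappa> * h \<epsilon> x - g' x" for x
      have [measurable]: "d \<in> borel_measurable borel" unfolding d_def[abs_def] by measurable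
      have m: "(\<lambda>x. T \<epsilon> x - g x) \<in> borel_measurable lebesgue" using Tm[OF ufin elim(2)] gm by simp
      have ae: "AE x in lborel. T \<epsilon> x - g x = d x"
        using T_eq[OF ufin elim(2)] gg' by eventually_elim (simp add: d_def)
      have dfin: "wnorm p w' d < \<infinity>" unfolding d_def[abs_def]
        by (rule wnorm_diff_finite) (use elim(1) h_fin g'fin p0 in auto)
      have "wLp_norm p w (\<lambda>x. T \<epsilon> x - g x) powr p = enn2real (wnorm p w' d)"
        using wLp_transfer(2)[OF w m ww' ae, of p] p0 by (simp add: powr_powr)
      then have "ennreal (wLp_norm p w (\<lambda>x. T \<epsilon> x - g x) powr p) = wnorm p w' d" using dfin by simp
      moreover have "(\<lambda>x. h \<epsilon> x - G x) = (\<lambda>x. (1 / \<kappa>) * d x)"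
        using \<kappa> by (simp add: d_def G_def fun_eq_iff field_simps)
      moreover have "wnorm p w' (\<lambda>x. (1 / \<kappa>) * d x) = ennreal (\<bar>1 / \<kappa>\<bar> powr p) * wnorm p w' d"
        by (rule wnorm_cmult) auto
      ultimately show ?case by (simp only: ennreal_mult powr_ge_zero)
    qed
    moreover have "((\<lambda>\<epsilon>. ennreal (\<bar>1 / \<kappa>\<bar> powr p * wLp_norm p w (\<lambda>x. T \<epsilon> x - g x) powr p)) \<longlongrightarrow> 0) (at_right 0)"
    proof -
      have "((\<lambda>\<epsilon>. wLp_norm p w (\<lambda>x. T \<epsilon> x - g x) powr p) \<longlongrightarrow> 0) (at_right 0)"
        by (rule tendsto_zero_powrI[OF lim tendsto_const]) (use p0 in \<open>auto simp: wLp_norm_def\<close>)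
      then have "((\<lambda>\<epsilon>. \<bar>1 / \<kappa>\<bar> powr p * wLp_norm p w (\<lambda>x. T \<epsilon> x - g x) powr p) \<longlongrightarrow> 0) (at_right 0)"
        by (rule tendsto_mult_right_zero)
      from tendsto_ennrealI[OF this] show ?thesis by simp
    qed
    ultimately have "((\<lambda>\<epsilon>. wnorm p w' (\<lambda>x. h \<epsilon> x - G x)) \<longlongrightarrow> 0) (at_right 0)" by (rule Lim_transform_eventually[rotated])
    then show A' unfolding A'_def
      using convergent_marchaud_diff_imp_frac_integral[OF u' G ufin Gfin] ev' unfolding h_def by blast
  qed
  moreover have "cond_c \<Longrightarrow> A'"
  proof -
    assume cond_c
    then have ufin: "wnorm q w' u' < \<infinity>" and mem: "\<And>\<epsilon>. 0 < \<epsilon> \<Longrightarrow> T \<epsilon> \<in> wLp p w"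
      and bdd: "bdd_above ((\<lambda>\<epsilon>. wLp_norm p w (T \<epsilon>)) ` {0<..})"
      unfolding cond_c_def u_iff T_def by auto
    obtain B where B: "\<And>\<epsilon>. 0 < \<epsilon> \<Longrightarrow> wLp_norm p w (T \<epsilon>) \<le> B" using bdd by (auto simp: bdd_above_def)
    have "wnorm p w' (h \<epsilon>) \<le> ennreal (\<bar>1 / \<kappa>\<bar> powr p * \<bar>B\<bar> powr p)" if \<epsilon>: "0 < \<epsilon>" for \<epsilon>
    proof -
      \<comment> \<open>Finiteness is what lets the bound on the real norm pass to
        \<open>wnorm\<close>: an infinite value would appear as norm 0.\<close>
      have fin: "wnorm p w' (\<lambda>x. \<kappa> * h \<epsilon> x) < \<infinity>" using mem[OF \<epsilon>] T_mem[OF ufin \<epsilon>] h_fin by blast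
      have "enn2real (wnorm p w' (\<lambda>x. \<kappa> * h \<epsilon> x)) = wLp_norm p w (T \<epsilon>) powr p"
        unfolding T_norm[OF ufin \<epsilon>] using p0 by (simp add: powr_powr)
      also have "\<dots> \<le> \<bar>B\<bar> powr p" using B[OF \<epsilon>] p0 by (intro powr_mono2) (auto simp: wLp_norm_def)
      finally have "wnorm p w' (\<lambda>x. \<kappa> * h \<epsilon> x) \<le> ennreal (\<bar>B\<bar> powr p)"
        using fin by (metis ennreal_enn2real ennreal_leI infinity_ennreal_def)
      moreover have "wnorm p w' (h \<epsilon>) = ennreal (\<bar>1 / \<kappa>\<bar> powr p) * wnorm p w' (\<lambda>x. \<kappa> * h \<epsilon> x)"
      proof -
        have "wnorm p w' (\<lambda>x. (1 / \<kappa>) * (\<kappa> * h \<epsilon> x)) = ennreal (\<bar>1 / \<kappa>\<bar> powr p) * wnorm p w' (\<lambda>x. \<kappa> * h \<epsilon> x)"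
          by (rule wnorm_cmult) auto
        then show ?thesis using \<kappa> by simp
      qed
      ultimately show ?thesis by (simp add: ennreal_mult mult_left_mono)
    qed
    then show A' unfolding A'_def h_def
      by (intro bounded_marchaud_diff_imp_frac_integral[OF u' ufin, of "\<bar>1 / \<kappa>\<bar> powr p * \<bar>B\<bar> powr p"]) auto
  qed
  ultimately show ?thesis by blast
qed

end
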